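(* Let $d\ge 2$ and $T>0$. There exists a divergence-free vector field $u:[0,T]\times\mathbb{T}^d\to\mathbb{R}^d$ with $u\in L^1(0,T;W^{1,p}(\mathbb{T}^d))$ for all $p<\infty$, such that uniqueness of weak solutions to the transport equation $$\partial_t\rho+u\cdot\nabla\rho=0,\qquad \rho|_{t=0}=\rho_0$$ fails in the class $$\rho\in\bigcap_{p<\infty,\;k\in\mathbb{N}}L^p(0,T;C^k(\mathbb{T}^d)),$$ i.e. there are an initial datum $\rho_0$ and two distinct weak solutions, both belonging to this class, with the same vector field $u$ and the same initial datum $\rho_0$.
   Context: $\mathbb{T}^d=\mathbb{R}^d/\mathbb{Z}^d$; $\nabla$ and $\operatorname{div}$ act in the space variable only. The divergence-free condition $\operatorname{div}u=0$ is understood in the sense of distributions. For a divergence-free $u$, a (scalar) function $\rho:[0,T]\times\mathbb{T}^d\to\mathbb{R}$ is a weak solution with initial datum $\rho_0$ if $\rho,\ \rho u\in L^1([0,T]\times\mathbb{T}^d)$ and $$-\int_{\mathbb{T}^d}\rho_0\,\varphi(0,\cdot)\,dx=\int_0^T\int_{\mathbb{T}^d}\rho\,(\partial_t\varphi+u\cdot\nabla\varphi)\,dx\,dt\qquad\text{for all }\varphi\in C_c^\infty([0,T)\times\mathbb{T}^d).$$ Functions equal a.e. are identified. *)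

theory Defs
  imports "HOL-Analysis.Analysis"
begin

text \<open>
  A function on the torus (the quotient of \<open>real ^ 'n\<close> by its integer lattice) is a lattice-periodic
  function on \<open>real ^ 'n\<close>; integrals over the torus are Lebesgue integrals over the unit cube.
\<close>

definition periodic :: "(real ^ 'n \<Rightarrow> 'b) \<Rightarrow> bool" where
  "periodic f \<longleftrightarrow> (\<forall>x m. (\<forall>i. m $ i \<in> \<int>) \<longrightarrow> f (x + m) = f x)"

definition cube :: "(real ^ 'n) set" where
  "cube = cbox 0 1"

text \<open>
  A function on \<open>[0,T] \<times> torus\<close> is given in curried form; its values at times outside \<open>[0,T]\<close>
  play no role.
\<close>

definition spacetime :: "real \<Rightarrow> (real \<times> (real ^ 'n)) set" where
  "spacetime T = {0..T} \<times> cube"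

definition spacetime_function ::
    "real \<Rightarrow> (real \<Rightarrow> real ^ 'n \<Rightarrow> 'b::euclidean_space) \<Rightarrow> bool" where
  "spacetime_function T f \<longleftrightarrow>
     (\<forall>t\<in>{0..T}. periodic (f t)) \<and>
     (\<lambda>(t, x). f t x) \<in> borel_measurable (lebesgue_on (spacetime T))"

definition spacetime_L1 ::
    "real \<Rightarrow> (real \<Rightarrow> real ^ 'n \<Rightarrow> 'b::euclidean_space) \<Rightarrow> bool" where
  "spacetime_L1 T f \<longleftrightarrow>
     spacetime_function T f \<and> set_integrable lebesgue (spacetime T) (\<lambda>(t, x). f t x)"

definition partial :: "'a \<Rightarrow> ('a::euclidean_space \<Rightarrow> 'b::real_normed_vector) \<Rightarrow> 'a \<Rightarrow> 'b" where
  "partial b f x = frechet_derivative f (at x) b"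

primrec C_k :: "nat \<Rightarrow> ('a::euclidean_space \<Rightarrow> 'b::real_normed_vector) \<Rightarrow> bool" where
  "C_k 0 f \<longleftrightarrow> continuous_on UNIV f"
| "C_k (Suc k) f \<longleftrightarrow> (\<forall>x. f differentiable (at x)) \<and> (\<forall>b\<in>Basis. C_k k (partial b f))"

definition smooth :: "('a::euclidean_space \<Rightarrow> 'b::real_normed_vector) \<Rightarrow> bool" where
  "smooth f \<longleftrightarrow> (\<forall>k. C_k k f)"

definition grad :: "(real ^ 'n \<Rightarrow> real) \<Rightarrow> real ^ 'n \<Rightarrow> real ^ 'n" where
  "grad f x = (\<chi> i. partial (axis i 1) f x)"

definition torus_Ck :: "nat \<Rightarrow> (real ^ 'n \<Rightarrow> 'b::real_normed_vector) set" where
  "torus_Ck k = {f. periodic f \<and> C_k k f}"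

text \<open>
  The largest sup norm of an iterated partial derivative of order at most \<open>k\<close>. A list of basis
  vectors stands for a multi-index, with the order of differentiation recorded. For members of
  \<open>torus_Ck k\<close> the set is bounded, so the real supremum is the true one.
\<close>

definition Ck_norm :: "nat \<Rightarrow> (real ^ 'n \<Rightarrow> 'b::real_normed_vector) \<Rightarrow> real" where
  "Ck_norm k f = Sup {norm (foldr partial bs f x) | bs x. set bs \<subseteq> Basis \<and> length bs \<le> k}"

definition torus_Lp :: "real \<Rightarrow> (real ^ 'n \<Rightarrow> 'b::euclidean_space) set" where
  "torus_Lp p = {f. periodic f \<and> f \<in> borel_measurable (lebesgue_on cube) \<and>
     set_integrable lebesgue cube (\<lambda>x. norm (f x) powr p)}"

definition Lp_norm :: "real \<Rightarrow> (real ^ 'n \<Rightarrow> 'b::euclidean_space) \<Rightarrow> real" where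
  "Lp_norm p f = (LINT x:cube|lebesgue. norm (f x) powr p) powr (1 / p)"

definition has_weak_partial ::
    "'n \<Rightarrow> (real ^ 'n \<Rightarrow> 'b::euclidean_space) \<Rightarrow> (real ^ 'n \<Rightarrow> 'b) \<Rightarrow> bool" where
  "has_weak_partial i f v \<longleftrightarrow> f \<in> torus_Lp 1 \<and> v \<in> torus_Lp 1 \<and>
     (\<forall>\<phi> :: real ^ 'n \<Rightarrow> real. smooth \<phi> \<and> periodic \<phi> \<longrightarrow>
        (LINT x:cube|lebesgue. partial (axis i 1) \<phi> x *\<^sub>R f x) =
        - (LINT x:cube|lebesgue. \<phi> x *\<^sub>R v x))"

text \<open>A weak derivative is unique almost everywhere, so the choice does not affect norms.\<close>

definition weak_partial ::
    "'n \<Rightarrow> (real ^ 'n \<Rightarrow> 'b::euclidean_space) \<Rightarrow> real ^ 'n \<Rightarrow> 'b" where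
  "weak_partial i f = (SOME v. has_weak_partial i f v)"

definition torus_W1p :: "real \<Rightarrow> (real ^ 'n \<Rightarrow> 'b::euclidean_space) set" where
  "torus_W1p p = {f \<in> torus_Lp p. \<forall>i. \<exists>v \<in> torus_Lp p. has_weak_partial i f v}"

definition W1p_norm :: "real \<Rightarrow> (real ^ 'n \<Rightarrow> 'b::euclidean_space) \<Rightarrow> real" where
  "W1p_norm p f = Lp_norm p f + (\<Sum>i\<in>UNIV. Lp_norm p (weak_partial i f))"

text \<open>
  \<open>bochner_Lp T p X N\<close> is \<open>L\<^sup>p(0,T;X)\<close> for a space \<open>X\<close> of functions on the torus with norm \<open>N\<close>, where
  \<open>1 \<le> p < \<infinity>\<close>. The function \<open>f\<close> has to agree almost everywhere with some \<open>g\<close> that is strongly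
  measurable into \<open>X\<close> (an almost everywhere limit in \<open>N\<close> of simple functions \<open>s n\<close>) and whose
  norm is \<open>p\<close>-integrable in time.
\<close>

definition bochner_Lp ::
    "real \<Rightarrow> real \<Rightarrow> (real ^ 'n \<Rightarrow> 'b::euclidean_space) set \<Rightarrow> ((real ^ 'n \<Rightarrow> 'b) \<Rightarrow> real) \<Rightarrow>
     (real \<Rightarrow> real ^ 'n \<Rightarrow> 'b) set" where
  "bochner_Lp T p X N = {f. \<exists>g s.
     (AE t in lebesgue_on {0..T}. AE x in lebesgue_on cube. f t x = g t x) \<and>
     (\<forall>n. finite (s n ` {0..T}) \<and> s n ` {0..T} \<subseteq> X \<and>
          (\<forall>h. {t \<in> {0..T}. s n t = h} \<in> sets lebesgue)) \<and>
     (AE t in lebesgue_on {0..T}. g t \<in> X \<and> (\<lambda>n::nat. N (\<lambda>x. s n t x - g t x)) \<longlonglongrightarrow> 0) \<and>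
     set_integrable lebesgue {0..T} (\<lambda>t. N (g t) powr p)}"

text \<open>
  Distributions on \<open>(0,T) \<times> torus\<close>: the test functions have compact support in the open time
  interval.
\<close>

definition divergence_free :: "real \<Rightarrow> (real \<Rightarrow> real ^ 'n \<Rightarrow> real ^ 'n) \<Rightarrow> bool" where
  "divergence_free T u \<longleftrightarrow> spacetime_L1 T u \<and>
     (\<forall>\<phi> :: real \<times> (real ^ 'n) \<Rightarrow> real.
        smooth \<phi> \<and> (\<forall>t. periodic (\<lambda>x. \<phi> (t, x))) \<and>
        (\<exists>a b. 0 < a \<and> b < T \<and> (\<forall>t x. t < a \<or> b < t \<longrightarrow> \<phi> (t, x) = 0)) \<longrightarrow>
        (LINT t:{0..T}|lebesgue. LINT x:cube|lebesgue. u t x \<bullet> grad (\<lambda>y. \<phi> (t, y)) x) = 0)"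

text \<open>
  A smooth function on \<open>[0,T) \<times> torus\<close> (smooth up to \<open>t = 0\<close>) with compact support there is the
  restriction of a smooth function on \<open>\<real> \<times> torus\<close> that vanishes from some time before \<open>T\<close> on.
\<close>

definition test_function :: "real \<Rightarrow> (real \<times> (real ^ 'n) \<Rightarrow> real) \<Rightarrow> bool" where
  "test_function T \<phi> \<longleftrightarrow> smooth \<phi> \<and> (\<forall>t. periodic (\<lambda>x. \<phi> (t, x))) \<and>
     (\<exists>b<T. \<forall>t x. b < t \<longrightarrow> \<phi> (t, x) = 0)"

definition weak_solution ::
    "real \<Rightarrow> (real \<Rightarrow> real ^ 'n \<Rightarrow> real ^ 'n) \<Rightarrow> (real ^ 'n \<Rightarrow> real) \<Rightarrow>
     (real \<Rightarrow> real ^ 'n \<Rightarrow> real) \<Rightarrow> bool" where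
  "weak_solution T u \<rho>0 \<rho> \<longleftrightarrow>
     \<rho>0 \<in> torus_Lp 1 \<and> spacetime_L1 T \<rho> \<and> spacetime_L1 T (\<lambda>t x. \<rho> t x *\<^sub>R u t x) \<and>
     (\<forall>\<phi>. test_function T \<phi> \<longrightarrow>
        - (LINT x:cube|lebesgue. \<rho>0 x * \<phi> (0, x)) =
        (LINT t:{0..T}|lebesgue. LINT x:cube|lebesgue.
           \<rho> t x * (deriv (\<lambda>s. \<phi> (s, x)) t + u t x \<bullet> grad (\<lambda>y. \<phi> (t, y)) x)))"

end

(*
  The datum is 0 and one of the two solutions is 0. The other one, rho, comes from convex
  integration with shear flows in two coordinates i and j. A stage consists of a density r with
  r = 0 at time 0, a field u = U e_i + V e_j with d_i U = d_j V = 0, and an error (A, B) with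
  d_t r + u . grad r = d_i A + d_j B.

  To cancel A, let P = Phi(s x_j) / s and Q = psi(s x_j) with Phi' psi of mean 1, and let Gamma, g
  be functions of time with Gamma g of mean 1, all of them oscillating fast. Adding
  -Gamma d_j(A P) to r and g Q to U produces a product of mean -A, so that only small errors and
  rapidly oscillating terms remain, and the latter are absorbed by primitives. The factor Gamma is
  bounded but concentrated in short time intervals, so the change of r is small in L^p(0,T; C^k)
  for any prescribed finite p and k. The factor g is large only in L^infinity and bounded in L^1, while
  Phi is concentrated so strongly that psi and psi' can be small in L^p; hence the change of U is
  small in L^1(0,T; W^{1,p}). The change of r U in L^1 is of the size of A, which is summable over
  the stages. All functions stay in an algebra generated by trigonometric polynomials and time.
*)
theory Submission
  imports Defs
begin

subsection \<open>Trigonometric polynomials\<close>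

text \<open>For densities bounded in time, renormalisation gives uniqueness for fields of this
  class, so the construction has to live on the missing endpoint \<open>p = \<infinity>\<close> in
  time. This dictates the roles of the factors: \<open>\<Gamma>\<close> stays below 1 and tends to 0
  in every \<open>L^p\<close> in time with \<open>p\<close> finite, while \<open>g\<close> pays for
  it with its supremum only, and the mean of their product remains 1. In space all largeness is put
  on the density; its \<open>C^k\<close> size is then beaten by concentration in time.

  Hence the order of the parameters: the frequency first, the concentration in space next (it beats
  powers of the frequency), the concentration in time last (it beats every norm of the space
  profile). The order is consistent because the means of the products and their primitives are
  bounded independently of the concentration.

  The principal density increment is a full derivative \<open>d_j (A P)\<close>, so that its time
  derivative is again of divergence form, with \<open>P\<close> small in \<open>L^1\<close>. The
  part of the product oscillating in time only is not small as a divergence; it is moved into the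
  density instead.\<close>

inductive_set trig :: "(real \<Rightarrow> real) set" where
  trig_cos: "(\<lambda>y. cos (2 * pi * of_int m * y)) \<in> trig"
| trig_sin: "(\<lambda>y. sin (2 * pi * of_int m * y)) \<in> trig"
| trig_scale: "f \<in> trig \<Longrightarrow> (\<lambda>y. c * f y) \<in> trig"
| trig_add: "f \<in> trig \<Longrightarrow> g \<in> trig \<Longrightarrow> (\<lambda>y. f y + g y) \<in> trig"

lemma trig_const: "(\<lambda>y. c) \<in> trig"
  using trig_scale[OF trig_cos[of 0], of c] by simp

lemma trig_uminus: "f \<in> trig \<Longrightarrow> (\<lambda>y. - f y) \<in> trig"
  using trig_scale[of f "-1"] by simp

lemma trig_diff: "f \<in> trig \<Longrightarrow> g \<in> trig \<Longrightarrow> (\<lambda>y. f y - g y) \<in> trig"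
  using trig_add[OF _ trig_uminus, of f g] by simp

text \<open>Kept as rewrite rules for \<open>simp only\<close>, so that the addition theorems see
  split arguments before arithmetic recombines them.\<close>

lemma trig_freq:
  "2 * pi * of_int (m - k) * y = 2 * pi * of_int m * y - 2 * pi * of_int k * y"
  "2 * pi * of_int (m + k) * y = 2 * pi * of_int m * y + 2 * pi * of_int k * y"
  by (simp_all add: algebra_simps)

text \<open>The product-to-sum formulas return to integer frequencies. Closure under products is
  what keeps the concentrated profiles, high powers of the sine, inside \<open>trig\<close>.\<close>

lemma trig_mult_cos: "f \<in> trig \<Longrightarrow> (\<lambda>y. cos (2 * pi * of_int m * y) * f y) \<in> trig"
proof (induction rule: trig.induct)
  case (trig_cos k)
  have "(\<lambda>y. cos (2 * pi * of_int m * y) * cos (2 * pi * of_int k * y)) =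
    (\<lambda>y. (1/2) * (cos (2 * pi * of_int (m - k) * y) + cos (2 * pi * of_int (m + k) * y)))"
    by (rule ext, simp only: trig_freq cos_add cos_diff, simp)
  then show ?case by (simp only:) (intro trig.intros)
next
  case (trig_sin k)
  have "(\<lambda>y. cos (2 * pi * of_int m * y) * sin (2 * pi * of_int k * y)) =
    (\<lambda>y. (1/2) * (sin (2 * pi * of_int (m + k) * y) + (-1) * sin (2 * pi * of_int (m - k) * y)))"
    by (rule ext, simp only: trig_freq sin_add sin_diff, simp)
  then show ?case by (simp only:) (intro trig.intros)
next
  case (trig_scale f c)
  then show ?case using trig.trig_scale[of "\<lambda>y. cos (2 * pi * of_int m * y) * f y" c]
    by (simp add: algebra_simps)
next
  case (trig_add f g)
  then show ?case using trig.trig_add by (auto simp: algebra_simps)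
qed

lemma trig_mult_sin: "f \<in> trig \<Longrightarrow> (\<lambda>y. sin (2 * pi * of_int m * y) * f y) \<in> trig"
proof (induction rule: trig.induct)
  case (trig_cos k)
  show ?case using trig_mult_cos[OF trig.trig_sin] by (simp add: mult.commute)
next
  case (trig_sin k)
  have "(\<lambda>y. sin (2 * pi * of_int m * y) * sin (2 * pi * of_int k * y)) =
    (\<lambda>y. (1/2) * (cos (2 * pi * of_int (m - k) * y) + (-1) * cos (2 * pi * of_int (m + k) * y)))"
    by (rule ext, simp only: trig_freq cos_add cos_diff, simp)
  then show ?case by (simp only:) (intro trig.intros)
next
  case (trig_scale f c)
  then show ?case using trig.trig_scale[of "\<lambda>y. sin (2 * pi * of_int m * y) * f y" c]
    by (simp add: algebra_simps)
next
  case (trig_add f g)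
  then show ?case using trig.trig_add by (auto simp: algebra_simps)
qed

lemma trig_mult: "f \<in> trig \<Longrightarrow> g \<in> trig \<Longrightarrow> (\<lambda>y. f y * g y) \<in> trig"
proof (induction rule: trig.induct)
  case (trig_cos m) then show ?case by (rule trig_mult_cos)
next
  case (trig_sin m) then show ?case by (rule trig_mult_sin)
next
  case (trig_scale f c)
  then show ?case using trig.trig_scale[of "\<lambda>y. f y * g y" c] by (simp add: algebra_simps)
next
  case (trig_add f f')
  then show ?case using trig.trig_add[of "\<lambda>y. f y * g y" "\<lambda>y. f' y * g y"] by (simp add: algebra_simps)
qed

lemma trig_power: "f \<in> trig \<Longrightarrow> (\<lambda>y. f y ^ n) \<in> trig"
  by (induction n) (auto intro: trig_const trig_mult)

lemma trig_deriv: "f \<in> trig \<Longrightarrow> \<exists>f'\<in>trig. \<forall>y. (f has_real_derivative f' y) (at y)"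
proof (induction rule: trig.induct)
  case (trig_cos m)
  show ?case
    by (rule bexI[OF _ trig_scale[OF trig.trig_sin[of m], of "- (2 * pi * of_int m)"]])
       (auto intro!: derivative_eq_intros)
next
  case (trig_sin m)
  show ?case
    by (rule bexI[OF _ trig_scale[OF trig.trig_cos[of m], of "2 * pi * of_int m"]])
       (auto intro!: derivative_eq_intros)
next
  case (trig_scale f c)
  then obtain f' where "f' \<in> trig" "\<forall>y. (f has_real_derivative f' y) (at y)" by blast
  then show ?case
    by (intro bexI[OF _ trig.trig_scale[of f' c]]) (auto intro!: DERIV_cmult)
next
  case (trig_add f g)
  then obtain f' g' where "f' \<in> trig" "\<forall>y. (f has_real_derivative f' y) (at y)"
    "g' \<in> trig" "\<forall>y. (g has_real_derivative g' y) (at y)" by blast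
  then show ?case
    by (intro bexI[OF _ trig.trig_add[of f' g']]) (auto intro!: DERIV_add)
qed

text \<open>Frequency zero is the only one without a trigonometric primitive. The constant
  \<open>c\<close> collects these terms along the induction; periodicity of \<open>H\<close> later
  identifies it as the mean.\<close>

lemma trig_antideriv:
  "f \<in> trig \<Longrightarrow> \<exists>H\<in>trig. \<exists>c. \<forall>y. (H has_real_derivative f y - c) (at y)"
proof (induction rule: trig.induct)
  case (trig_cos m)
  show ?case
  proof (cases "m = 0")
    case True
    then show ?thesis by (intro bexI[OF _ trig_const[of 0]] exI[of _ 1]) auto
  next
    case False
    then show ?thesis
      by (intro bexI[OF _ trig_scale[OF trig.trig_sin[of m], of "1 / (2 * pi * of_int m)"]] exI[of _ 0])
         (auto intro!: derivative_eq_intros)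
  qed
next
  case (trig_sin m)
  show ?case
  proof (cases "m = 0")
    case True
    then show ?thesis by (intro bexI[OF _ trig_const[of 0]] exI[of _ 0]) auto
  next
    case False
    then show ?thesis
      by (intro bexI[OF _ trig_scale[OF trig.trig_cos[of m], of "- 1 / (2 * pi * of_int m)"]] exI[of _ 0])
         (auto intro!: derivative_eq_intros)
  qed
next
  case (trig_scale f c)
  then obtain H d where "H \<in> trig" "\<forall>y. (H has_real_derivative f y - d) (at y)" by blast
  then show ?case
    by (intro bexI[OF _ trig.trig_scale[of H c]] exI[of _ "c * d"])
       (auto intro!: derivative_eq_intros simp: algebra_simps)
next
  case (trig_add f g)
  then obtain H d K e where "H \<in> trig" "\<forall>y. (H has_real_derivative f y - d) (at y)"
    "K \<in> trig" "\<forall>y. (K has_real_derivative g y - e) (at y)" by blast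
  then show ?case
    by (intro bexI[OF _ trig.trig_add[of H K]] exI[of _ "d + e"])
       (auto intro!: derivative_eq_intros simp: algebra_simps)
qed

lemma cos_sin_shift:
  "cos (a + of_int n * (2 * pi)) = cos (a::real)" "sin (a + of_int n * (2 * pi)) = sin (a::real)"
  using cos.plus_of_int[of a n] sin.plus_of_int[of a n] by simp_all

lemma trig_periodic: "f \<in> trig \<Longrightarrow> f (y + of_int k) = f y"
proof (induction rule: trig.induct)
  case (trig_cos m)
  have "2 * pi * of_int m * (y + of_int k) = 2 * pi * of_int m * y + of_int (m * k) * (2 * pi)"
    by (simp add: algebra_simps)
  then show ?case by (simp only: cos_sin_shift)
next
  case (trig_sin m)
  have "2 * pi * of_int m * (y + of_int k) = 2 * pi * of_int m * y + of_int (m * k) * (2 * pi)"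
    by (simp add: algebra_simps)
  then show ?case by (simp only: cos_sin_shift)
qed auto

lemma trig_continuous: "f \<in> trig \<Longrightarrow> continuous_on S f"
  by (metis DERIV_isCont continuous_at_imp_continuous_on trig_deriv)

lemma trig_continuous2:
  "f \<in> trig \<Longrightarrow> continuous_on S g \<Longrightarrow> continuous_on S (\<lambda>x. f (g x))"
  by (metis trig_continuous continuous_on_compose2 subset_UNIV)

lemma trig_bounded: assumes "f \<in> trig" shows "\<exists>M\<ge>0. \<forall>y. \<bar>f y\<bar> \<le> M"
  using assms
proof (induction rule: trig.induct)
  case (trig_scale f c)
  then obtain M where "M \<ge> 0" "\<forall>y. \<bar>f y\<bar> \<le> M" by blast
  then show ?case by (intro exI[of _ "\<bar>c\<bar> * M"]) (auto simp: abs_mult intro: mult_left_mono)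
next
  case (trig_add f g)
  then obtain M N where "M \<ge> 0" "\<forall>y. \<bar>f y\<bar> \<le> M" "N \<ge> 0" "\<forall>y. \<bar>g y\<bar> \<le> N" by blast
  then show ?case by (intro exI[of _ "M + N"]) (auto intro!: order_trans[OF abs_triangle_ineq] add_mono)
qed (auto intro!: exI[of _ 1])

subsection \<open>A differential algebra of functions on space-time\<close>

text \<open>Frequencies in time are arbitrary reals because \<open>T\<close> is; those in space are integers.\<close>

inductive_set alg :: "(real \<Rightarrow> real ^ 'n \<Rightarrow> real) set" where
  alg_const: "(\<lambda>t x. c) \<in> alg"
| alg_id: "(\<lambda>t x. t) \<in> alg"
| alg_time: "f \<in> trig \<Longrightarrow> (\<lambda>t x. f (\<tau> * t)) \<in> alg"
| alg_space: "f \<in> trig \<Longrightarrow> (\<lambda>t x. f (of_int m * x $ k)) \<in> alg"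
| alg_add: "F \<in> alg \<Longrightarrow> G \<in> alg \<Longrightarrow> (\<lambda>t x. F t x + G t x) \<in> alg"
| alg_mult: "F \<in> alg \<Longrightarrow> G \<in> alg \<Longrightarrow> (\<lambda>t x. F t x * G t x) \<in> alg"

lemma alg_uminus: "F \<in> alg \<Longrightarrow> (\<lambda>t x. - F t x) \<in> alg"
  using alg_mult[OF alg_const[of "-1"], of F] by simp

lemma alg_diff: "F \<in> alg \<Longrightarrow> G \<in> alg \<Longrightarrow> (\<lambda>t x. F t x - G t x) \<in> alg"
  using alg_add[OF _ alg_uminus, of F G] by simp

lemma alg_power: "F \<in> alg \<Longrightarrow> (\<lambda>t x. F t x ^ n) \<in> alg"
  by (induction n) (auto intro: alg_const alg_mult)

lemma alg_sum: "(\<And>i. i \<in> I \<Longrightarrow> F i \<in> alg) \<Longrightarrow> (\<lambda>t x. \<Sum>i\<in>I. F i t x) \<in> alg"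
  by (induction I rule: infinite_finite_induct) (auto intro: alg_const alg_add)

lemma alg_prod: "(\<And>i. i \<in> I \<Longrightarrow> F i \<in> alg) \<Longrightarrow> (\<lambda>t x. \<Prod>i\<in>I. F i t x) \<in> alg"
  by (induction I rule: infinite_finite_induct) (auto intro: alg_const alg_mult)

lemma alg_divide: "F \<in> alg \<Longrightarrow> (\<lambda>t x. F t x / c) \<in> alg"
  using alg_mult[OF alg_const[of "1/c"], of F] by simp

lemmas alg_intros = alg_const alg_id alg_add alg_mult alg_uminus alg_diff
  alg_power alg_sum alg_divide

lemma alg_periodic: "F \<in> alg \<Longrightarrow> periodic (F t)"
  unfolding periodic_def
proof (induction rule: alg.induct)
  case (alg_space f m k)
  show ?case
  proof (intro allI impI)
    fix x v :: "real ^ 'a" assume "\<forall>i. v $ i \<in> \<int>"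
    then obtain j where j: "v $ k = of_int j" by (metis Ints_cases)
    show "f (of_int m * (x + v) $ k) = f (of_int m * x $ k)"
      using trig_periodic[OF alg_space, of "of_int m * x $ k" "m * j"] j by (simp add: algebra_simps)
  qed
qed (auto)

lemma alg_continuous: "F \<in> alg \<Longrightarrow> continuous_on UNIV (\<lambda>(t, x). F t x)"
proof (induction rule: alg.induct)
  case (alg_time f \<tau>)
  show ?case unfolding split_beta by (rule trig_continuous2[OF alg_time]) (intro continuous_intros)
next
  case (alg_space f m k)
  show ?case unfolding split_beta by (rule trig_continuous2[OF alg_space]) (intro continuous_intros)
qed (auto simp: split_beta intro!: continuous_intros)

lemma alg_continuous2:
  assumes "F \<in> alg" "continuous_on S a" "continuous_on S b"
  shows "continuous_on S (\<lambda>z. F (a z) (b z))"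
  using continuous_on_compose2[OF alg_continuous[OF assms(1)] continuous_on_Pair[OF assms(2,3)]]
  by simp

text \<open>Global in \<open>x\<close>, since space enters through trigonometric polynomials, but
  local in time: the generator \<open>t\<close>, which the initial density uses, is
  unbounded.\<close>

lemma alg_bounded: "F \<in> alg \<Longrightarrow> \<exists>M\<ge>0. \<forall>t\<in>{0..T}. \<forall>x. \<bar>F t x\<bar> \<le> M"
proof (induction rule: alg.induct)
  case (alg_const c) then show ?case by (intro exI[of _ "\<bar>c\<bar>"]) auto
next
  case alg_id then show ?case by (intro exI[of _ "\<bar>T\<bar>"]) auto
next
  case (alg_time f) then show ?case using trig_bounded[of f] by blast
next
  case (alg_space f) then show ?case using trig_bounded[of f] by blast
next
  case (alg_add F G)
  then obtain M N where "M \<ge> 0" "\<forall>t\<in>{0..T}. \<forall>x. \<bar>F t x\<bar> \<le> M" "N \<ge> 0" "\<forall>t\<in>{0..T}. \<forall>x. \<bar>G t x\<bar> \<le> N"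
    by blast
  then show ?case by (intro exI[of _ "M + N"]) (auto intro!: order_trans[OF abs_triangle_ineq] add_mono)
next
  case (alg_mult F G)
  then obtain M N where "M \<ge> 0" "\<forall>t\<in>{0..T}. \<forall>x. \<bar>F t x\<bar> \<le> M" "N \<ge> 0" "\<forall>t\<in>{0..T}. \<forall>x. \<bar>G t x\<bar> \<le> N"
    by blast
  then show ?case by (intro exI[of _ "M * N"]) (auto simp: abs_mult intro!: mult_mono)
qed

section \<open>Time and space derivatives inside the algebra\<close>

definition Dt :: "(real \<Rightarrow> real ^ 'n \<Rightarrow> real) \<Rightarrow> real \<Rightarrow> real ^ 'n \<Rightarrow> real" where
  "Dt F t x = deriv (\<lambda>s. F s x) t"

definition Dx :: "'n \<Rightarrow> (real \<Rightarrow> real ^ 'n \<Rightarrow> real) \<Rightarrow> real \<Rightarrow> real ^ 'n \<Rightarrow> real" where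
  "Dx k F t x = partial (axis k 1) (F t) x"

text \<open>The induction builds a derivative inside the algebra; uniqueness of derivatives then
  identifies it with \<open>Dt\<close>, which is defined for arbitrary functions through
  \<open>deriv\<close>.\<close>

lemma alg_Dt_ex: "F \<in> alg \<Longrightarrow> \<exists>F'\<in>alg. \<forall>t x. ((\<lambda>s. F s x) has_real_derivative F' t x) (at t)"
proof (induction rule: alg.induct)
  case (alg_const c) show ?case by (rule bexI[OF _ alg.alg_const[of 0]]) auto
next
  case alg_id show ?case by (rule bexI[OF _ alg.alg_const[of 1]]) auto
next
  case (alg_time f \<tau>)
  then obtain f' where f': "f' \<in> trig" "\<forall>y. (f has_real_derivative f' y) (at y)" using trig_deriv by blast
  show ?case
    by (rule bexI[OF _ alg_mult[OF alg.alg_time[OF f'(1), of \<tau>] alg.alg_const[of \<tau>]]])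
       (auto intro!: DERIV_chain2[of f] f'(2)[rule_format] derivative_eq_intros)
next
  case (alg_space f m k) show ?case by (rule bexI[OF _ alg.alg_const[of 0]]) auto
next
  case (alg_add F G)
  then obtain F' G' where "F' \<in> alg" "\<forall>t x. ((\<lambda>s. F s x) has_real_derivative F' t x) (at t)"
   "G' \<in> alg" "\<forall>t x. ((\<lambda>s. G s x) has_real_derivative G' t x) (at t)" by blast
  then show ?case
    by (intro bexI[OF _ alg.alg_add[of F' G']]) (auto intro!: DERIV_add)
next
  case (alg_mult F G)
  then obtain F' G' where *: "F' \<in> alg" "\<forall>t x. ((\<lambda>s. F s x) has_real_derivative F' t x) (at t)"
   "G' \<in> alg" "\<forall>t x. ((\<lambda>s. G s x) has_real_derivative G' t x) (at t)" by blast
  show ?case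
    by (rule bexI[OF _ alg.alg_add[OF alg.alg_mult[OF *(1) alg_mult.hyps(2)] alg.alg_mult[OF *(3) alg_mult.hyps(1)]]])
       (use * in \<open>auto intro!: DERIV_mult\<close>)
qed

lemma alg_Dt: assumes "F \<in> alg"
  shows "Dt F \<in> alg" "((\<lambda>s. F s x) has_real_derivative Dt F t x) (at t)"
proof -
  obtain F' where F': "F' \<in> alg" "\<forall>t x. ((\<lambda>s. F s x) has_real_derivative F' t x) (at t)"
    using alg_Dt_ex[OF assms] by blast
  then have "Dt F = F'" by (auto simp: Dt_def fun_eq_iff intro!: DERIV_imp_deriv)
  with F' show "Dt F \<in> alg" "((\<lambda>s. F s x) has_real_derivative Dt F t x) (at t)" by auto
qed

text \<open>The total derivative is carried through the induction, and not only its coordinates,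
  because \<open>partial\<close> is read off from \<open>frechet_derivative\<close>.\<close>

lemma alg_Dx_ex: "F \<in> alg \<Longrightarrow> \<exists>D. (\<forall>k. D k \<in> alg) \<and>
    (\<forall>t x. (F t has_derivative (\<lambda>h. \<Sum>k\<in>UNIV. h $ k * D k t x)) (at x))"
proof (induction rule: alg.induct)
  case (alg_const c) show ?case by (rule exI[of _ "\<lambda>k t x. 0"]) (auto intro: alg_intros)
next
  case alg_id show ?case by (rule exI[of _ "\<lambda>k t x. 0"]) (auto intro: alg_intros)
next
  case (alg_time f \<tau>) show ?case by (rule exI[of _ "\<lambda>k t x. 0"]) (auto intro: alg_intros)
next
  case (alg_space f m k)
  then obtain f' where f': "f' \<in> trig" "\<forall>y. (f has_real_derivative f' y) (at y)" using trig_deriv by blast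
  let ?D = "\<lambda>l (t::real) (x::real^'a). (if l = k then of_int m * f' (of_int m * x $ k) else 0)"
  have "?D l \<in> alg" for l
    by (cases "l = k") (auto intro!: alg_const alg_mult[OF alg_const alg.alg_space] f')
  moreover have "((\<lambda>x. f (of_int m * x $ k)) has_derivative (\<lambda>h. \<Sum>l\<in>UNIV. h $ l * ?D l t x)) (at x)"
    for t and x :: "real^'a"
  proof -
    have "((\<lambda>x. f (of_int m * x $ k)) has_derivative (\<lambda>h. (of_int m * h $ k) * f' (of_int m * x $ k))) (at x)"
    proof (rule has_derivative_compose[where f="\<lambda>x. of_int m * x $ k" and g=f
        and f'="\<lambda>h. of_int m * h $ k" and g'="\<lambda>h. h * f' (of_int m * x $ k)"])
      show "((\<lambda>x. of_int m * x $ k) has_derivative (\<lambda>h. of_int m * h $ k)) (at x)"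
        by (auto intro!: derivative_eq_intros bounded_linear.has_derivative[OF bounded_linear_vec_nth] has_derivative_ident)
      have "(*) (f' (of_int m * x $ k)) = (\<lambda>h. h * f' (of_int m * x $ k))" by (auto simp: mult.commute)
      then show "(f has_derivative (\<lambda>h. h * f' (of_int m * x $ k))) (at (of_int m * x $ k))"
        using f'(2)[rule_format, of "of_int m * x $ k"] by (simp add: has_field_derivative_def)
    qed
    then show ?thesis by (simp add: if_distrib algebra_simps cong: if_cong)
  qed
  ultimately show ?case by (intro exI[of _ ?D] conjI allI)
next
  case (alg_add F G)
  then obtain D E where D: "\<forall>k. D k \<in> alg" "\<forall>t x. (F t has_derivative (\<lambda>h. \<Sum>k\<in>UNIV. h $ k * D k t x)) (at x)"
    and E: "\<forall>k. E k \<in> alg" "\<forall>t x. (G t has_derivative (\<lambda>h. \<Sum>k\<in>UNIV. h $ k * E k t x)) (at x)" by blast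
  show ?case
  proof (intro exI[of _ "\<lambda>k t x. D k t x + E k t x"] conjI allI)
    fix k show "(\<lambda>t x. D k t x + E k t x) \<in> alg" using D E by (auto intro: alg_intros)
  next
    fix t x
    show "((\<lambda>x. F t x + G t x) has_derivative (\<lambda>h. \<Sum>k\<in>UNIV. h $ k * (D k t x + E k t x))) (at x)"
      using has_derivative_add[OF D(2)[rule_format] E(2)[rule_format]]
      by (simp add: algebra_simps sum.distrib)
  qed
next
  case (alg_mult F G)
  then obtain D E where D: "\<forall>k. D k \<in> alg" "\<forall>t x. (F t has_derivative (\<lambda>h. \<Sum>k\<in>UNIV. h $ k * D k t x)) (at x)"
    and E: "\<forall>k. E k \<in> alg" "\<forall>t x. (G t has_derivative (\<lambda>h. \<Sum>k\<in>UNIV. h $ k * E k t x)) (at x)" by blast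
  show ?case
  proof (intro exI[of _ "\<lambda>k t x. F t x * E k t x + D k t x * G t x"] conjI allI)
    fix k show "(\<lambda>t x. F t x * E k t x + D k t x * G t x) \<in> alg"
      by (intro alg.alg_add alg.alg_mult D(1)[rule_format] E(1)[rule_format] alg_mult.hyps)
  next
    fix t x
    show "((\<lambda>x. F t x * G t x) has_derivative (\<lambda>h. \<Sum>k\<in>UNIV. h $ k * (F t x * E k t x + D k t x * G t x))) (at x)"
      using has_derivative_mult[OF D(2)[rule_format, of t x] E(2)[rule_format, of t x]]
      by (simp add: algebra_simps sum.distrib sum_distrib_left sum_distrib_right)
  qed
qed

lemma partial_eqI: "(f has_derivative f') (at x) \<Longrightarrow> partial b f x = f' b"
  unfolding partial_def using frechet_derivative_at by metis

lemma alg_Dx: assumes "F \<in> alg"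
  shows "Dx k F \<in> alg" "(F t has_derivative (\<lambda>h. \<Sum>k\<in>UNIV. h $ k * Dx k F t x)) (at x)"
proof -
  obtain D where D: "\<forall>k. D k \<in> alg" "\<forall>t x. (F t has_derivative (\<lambda>h. \<Sum>k\<in>UNIV. h $ k * D k t x)) (at x)"
    using alg_Dx_ex[OF assms] by blast
  have "Dx k F = D k" for k
    using D(2) by (auto simp: Dx_def fun_eq_iff partial_eqI[OF D(2)[rule_format]] axis_def if_distrib
      if_distribR cong: if_cong)
  with D show "Dx k F \<in> alg" "(F t has_derivative (\<lambda>h. \<Sum>k\<in>UNIV. h $ k * Dx k F t x)) (at x)" by auto
qed

text \<open>On coordinate lines \<open>Dx\<close> becomes a derivative in one real variable, so that
  the \<open>DERIV\<close> calculus and the fundamental theorem of calculus apply.\<close>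

lemma alg_Dx_line: assumes "F \<in> alg"
  shows "((\<lambda>s. F t (x + s *\<^sub>R axis k 1)) has_real_derivative Dx k F t (x + s *\<^sub>R axis k 1)) (at s)"
proof -
  have "((\<lambda>s. x + s *\<^sub>R axis k 1) has_derivative (\<lambda>h. h *\<^sub>R axis k 1)) (at s)"
    by (auto intro!: derivative_eq_intros)
  from has_derivative_compose[OF this alg_Dx(2)[OF assms]]
  have "((\<lambda>s. F t (x + s *\<^sub>R axis k 1)) has_derivative
     (\<lambda>h. \<Sum>l\<in>UNIV. (h *\<^sub>R axis k 1 :: real^'a) $ l * Dx l F t (x + s *\<^sub>R axis k 1))) (at s)" .
  moreover have "(\<lambda>h. \<Sum>l\<in>UNIV. (h *\<^sub>R axis k 1 :: real^'a) $ l * Dx l F t (x + s *\<^sub>R axis k 1)) =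
     (*) (Dx k F t (x + s *\<^sub>R axis k 1))"
  proof (rule ext)
    fix h :: real
    have "(\<Sum>l\<in>UNIV. (h *\<^sub>R axis k 1 :: real^'a) $ l * Dx l F t (x + s *\<^sub>R axis k 1)) =
      (\<Sum>l\<in>UNIV. if l = k then h * Dx l F t (x + s *\<^sub>R axis k 1) else 0)"
      by (rule sum.cong) (auto simp: axis_def)
    then show "(\<Sum>l\<in>UNIV. (h *\<^sub>R axis k 1 :: real^'a) $ l * Dx l F t (x + s *\<^sub>R axis k 1)) =
      Dx k F t (x + s *\<^sub>R axis k 1) * h" by simp
  qed
  ultimately show ?thesis by (simp add: has_field_derivative_def)
qed

lemma Dx_eqI: assumes "F \<in> alg" "\<And>t x. ((\<lambda>s. F t (x + s *\<^sub>R axis k 1)) has_real_derivative G t x) (at 0)"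
  shows "Dx k F = G"
proof (intro ext)
  fix t x
  show "Dx k F t x = G t x"
    using DERIV_unique[OF alg_Dx_line[OF assms(1), of t x k 0] assms(2)[of t x]] by simp
qed

lemma Dt_eqI: "(\<And>t x. ((\<lambda>s. F s x) has_real_derivative G t x) (at t)) \<Longrightarrow> Dt F = G"
  by (auto simp: Dt_def fun_eq_iff intro!: DERIV_imp_deriv)

lemma Dx_simps:
  assumes "F \<in> alg"
  shows "G \<in> alg \<Longrightarrow> Dx k (\<lambda>t x. F t x + G t x) = (\<lambda>t x. Dx k F t x + Dx k G t x)"
    "G \<in> alg \<Longrightarrow> Dx k (\<lambda>t x. F t x - G t x) = (\<lambda>t x. Dx k F t x - Dx k G t x)"
    "Dx k (\<lambda>t x. - F t x) = (\<lambda>t x. - Dx k F t x)"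
    "Dx k (\<lambda>t x. F t x / c) = (\<lambda>t x. Dx k F t x / c)"
    "G \<in> alg \<Longrightarrow> Dx k (\<lambda>t x. F t x * G t x) = (\<lambda>t x. Dx k F t x * G t x + F t x * Dx k G t x)"
proof -
  note d = alg_Dx_line[where s=0, simplified]
  show "G \<in> alg \<Longrightarrow> Dx k (\<lambda>t x. F t x + G t x) = (\<lambda>t x. Dx k F t x + Dx k G t x)"
    by (rule Dx_eqI) (auto intro!: derivative_eq_intros alg_intros d assms)
  show "G \<in> alg \<Longrightarrow> Dx k (\<lambda>t x. F t x - G t x) = (\<lambda>t x. Dx k F t x - Dx k G t x)"
    by (rule Dx_eqI) (auto intro!: derivative_eq_intros alg_intros d assms)
  show "Dx k (\<lambda>t x. - F t x) = (\<lambda>t x. - Dx k F t x)"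
    by (rule Dx_eqI) (auto intro!: derivative_eq_intros alg_intros d assms)
  show "Dx k (\<lambda>t x. F t x / c) = (\<lambda>t x. Dx k F t x / c)"
    by (rule Dx_eqI) (auto intro!: DERIV_cdivide alg_intros d assms)
  show "G \<in> alg \<Longrightarrow> Dx k (\<lambda>t x. F t x * G t x) = (\<lambda>t x. Dx k F t x * G t x + F t x * Dx k G t x)"
    by (rule Dx_eqI) (auto intro!: derivative_eq_intros alg_intros d assms)
qed

lemma Dx_const [simp]: "Dx k (\<lambda>t x. c t) = (\<lambda>t x. 0)"
  by (auto simp: Dx_def fun_eq_iff partial_def)

lemma Dx_space:
  assumes "f \<in> trig" "\<And>y. (f has_real_derivative f' y) (at y)"
  shows "Dx k (\<lambda>t x. f (of_int m * x $ l)) = (\<lambda>t x. if k = l then of_int m * f' (of_int m * x $ l) else 0)"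
proof (rule Dx_eqI)
  fix t :: real and x :: "real ^ 'a"
  show "((\<lambda>s. f (of_int m * (x + s *\<^sub>R axis k 1) $ l)) has_real_derivative
     (if k = l then of_int m * f' (of_int m * x $ l) else 0)) (at 0)"
  proof (cases "k = l")
    case True
    have "((\<lambda>s. f (of_int m * (x $ l + s))) has_real_derivative f' (of_int m * (x $ l + 0)) * of_int m) (at 0)"
      by (rule DERIV_chain2[of f]) (auto intro!: assms derivative_eq_intros)
    then show ?thesis using True by (simp add: mult.commute)
  qed (simp add: axis_def)
qed (intro alg_space assms)

lemma Dt_simps:
  assumes "F \<in> alg"
  shows "G \<in> alg \<Longrightarrow> Dt (\<lambda>t x. F t x + G t x) = (\<lambda>t x. Dt F t x + Dt G t x)"
    "G \<in> alg \<Longrightarrow> Dt (\<lambda>t x. F t x - G t x) = (\<lambda>t x. Dt F t x - Dt G t x)"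
    "Dt (\<lambda>t x. - F t x) = (\<lambda>t x. - Dt F t x)"
    "Dt (\<lambda>t x. F t x / c) = (\<lambda>t x. Dt F t x / c)"
    "G \<in> alg \<Longrightarrow> Dt (\<lambda>t x. F t x * G t x) = (\<lambda>t x. Dt F t x * G t x + F t x * Dt G t x)"
  by (rule Dt_eqI; auto intro!: derivative_eq_intros DERIV_cdivide alg_Dt assms)+

lemma Dt_const [simp]: "Dt (\<lambda>t x. c x) = (\<lambda>t x. 0)"
  by (rule Dt_eqI) auto

lemma Dt_id [simp]: "Dt (\<lambda>t x. t) = (\<lambda>t x. 1)"
  by (rule Dt_eqI) auto

lemma Dt_time:
  assumes "\<And>y. (f has_real_derivative f' y) (at y)"
  shows "Dt (\<lambda>t x. f (\<tau> * t)) = (\<lambda>t x. \<tau> * f' (\<tau> * t))"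
proof (rule Dt_eqI)
  fix t x
  have "((\<lambda>s. f (\<tau> * s)) has_real_derivative f' (\<tau> * t) * \<tau>) (at t)"
    by (rule DERIV_chain2[of f]) (auto intro!: assms derivative_eq_intros)
  then show "((\<lambda>s. f (\<tau> * s)) has_real_derivative \<tau> * f' (\<tau> * t)) (at t)" by (simp add: mult.commute)
qed

text \<open>A generator depends on a single variable, so the mixed derivative vanishes there; the
  Leibniz rule carries the symmetry to sums and products.\<close>

lemma Dt_Dx_commute: assumes "F \<in> alg" shows "Dt (Dx k F) = Dx k (Dt F)"
  using assms
proof (induction rule: alg.induct)
  case (alg_time f \<tau>)
  then obtain f' where f': "f' \<in> trig" "\<And>y. (f has_real_derivative f' y) (at y)" using trig_deriv by blast
  show ?case by (simp add: Dt_time[OF f'(2)])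
next
  case (alg_space f m l)
  then obtain f' where f': "f' \<in> trig" "\<And>y. (f has_real_derivative f' y) (at y)" using trig_deriv by blast
  show ?case by (simp add: Dx_space[OF alg_space f'(2)])
qed (simp_all add: Dx_simps Dt_simps alg_Dx alg_Dt alg_mult alg_add algebra_simps)

lemma Dx_Dx_commute: assumes "F \<in> alg" shows "Dx l (Dx k F) = Dx k (Dx l F)"
  using assms
proof (induction rule: alg.induct)
  case (alg_space f m j)
  then obtain f' where f': "f' \<in> trig" "\<And>y. (f has_real_derivative f' y) (at y)" using trig_deriv by blast
  then obtain f'' where f'': "\<And>y. (f' has_real_derivative f'' y) (at y)" using trig_deriv by blast
  have s: "(\<lambda>t x. f' (of_int m * x $ j)) \<in> alg" by (intro alg.alg_space f')
  show ?case
    by (cases "k = j"; cases "l = j")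
       (simp_all add: Dx_space[OF alg_space f'(2)] Dx_simps(5)[OF alg_const s] Dx_space[OF f'(1) f''])
qed (simp_all add: Dx_simps Dt_simps alg_Dx alg_Dt alg_mult alg_add algebra_simps)

section \<open>Iterated space derivatives\<close>

lemma Basis_axis: "b \<in> (Basis :: (real^'n) set) \<longleftrightarrow> (\<exists>k. b = axis k 1)"
  by (auto simp: Basis_vec_def)

lemma alg_partial: assumes "F \<in> alg" "b \<in> Basis" shows "(\<lambda>t. partial b (F t)) \<in> alg"
proof -
  obtain k where "b = axis k 1" using assms Basis_axis by auto
  then have "(\<lambda>t. partial b (F t)) = Dx k F" by (auto simp: Dx_def fun_eq_iff)
  with assms alg_Dx show ?thesis by auto
qed

lemma alg_partials: assumes "F \<in> alg" shows "set bs \<subseteq> Basis \<Longrightarrow> (\<lambda>t. foldr partial bs (F t)) \<in> alg"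
proof (induction bs)
  case (Cons b bs)
  then show ?case using alg_partial[of "\<lambda>t. foldr partial bs (F t)" b] by auto
qed (use assms in auto)

lemma alg_Ck: "F \<in> alg \<Longrightarrow> C_k k (F t)"
proof (induction k arbitrary: F)
  case 0
  then show ?case using alg_continuous2[OF 0, of UNIV "\<lambda>x. t" "\<lambda>x. x"] by simp
next
  case (Suc k)
  have "C_k k (partial b (F t))" if "b \<in> Basis" for b
    using Suc.IH[OF alg_partial[OF Suc.prems that]] .
  then show ?case using alg_Dx(2)[OF Suc.prems] by (auto simp: differentiable_def)
qed

lemma alg_smooth: "F \<in> alg \<Longrightarrow> smooth (F t)"
  by (auto simp: smooth_def alg_Ck)

lemma foldr_partial_diff_alg: assumes "F \<in> alg" "G \<in> alg" "set bs \<subseteq> Basis"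
  shows "foldr partial bs (\<lambda>x. F t x - G s x) = (\<lambda>x. foldr partial bs (F t) x - foldr partial bs (G s) x)"
  using assms(3)
proof (induction bs)
  case (Cons b bs)
  have "set bs \<subseteq> Basis" using Cons by auto
  note a = alg_partials[OF assms(1) this] alg_partials[OF assms(2) this]
  have "partial b (\<lambda>x. foldr partial bs (F t) x - foldr partial bs (G s) x) x =
     partial b (foldr partial bs (F t)) x - partial b (foldr partial bs (G s)) x" for x
    by (simp add: partial_eqI[OF has_derivative_diff[OF alg_Dx(2)[OF a(1)] alg_Dx(2)[OF a(2)]]]
      partial_eqI[OF alg_Dx(2)[OF a(1)]] partial_eqI[OF alg_Dx(2)[OF a(2)]])
  then show ?case using Cons by auto
qed simp

lemma finite_partial_lists: "finite {bs. set bs \<subseteq> (Basis :: 'a::euclidean_space set) \<and> length bs \<le> q}"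
  by (rule finite_lists_length_le) simp

text \<open>Only finitely many lists of basis vectors have length at most \<open>q\<close>, so the
  sum of the individual bounds serves all of them at once.\<close>

lemma alg_partials_bounded: assumes "F \<in> alg"
  shows "\<exists>M\<ge>0. \<forall>bs. set bs \<subseteq> Basis \<and> length bs \<le> q \<longrightarrow>
     (\<forall>t\<in>{0..T}. \<forall>x. \<bar>foldr partial bs (F t) x\<bar> \<le> M)"
proof -
  let ?B = "{bs. set bs \<subseteq> (Basis :: (real^'a) set) \<and> length bs \<le> q}"
  have "\<forall>bs\<in>?B. \<exists>M\<ge>0. \<forall>t\<in>{0..T}. \<forall>x. \<bar>foldr partial bs (F t) x\<bar> \<le> M"
    using alg_bounded[OF alg_partials[OF assms]] by auto
  from bchoice[OF this] obtain M
    where M: "\<forall>bs\<in>?B. M bs \<ge> 0 \<and> (\<forall>t\<in>{0..T}. \<forall>x. \<bar>foldr partial bs (F t) x\<bar> \<le> M bs)"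
    by blast
  have f: "finite ?B" by (rule finite_partial_lists)
  have "M bs \<le> sum M ?B" if "bs \<in> ?B" for bs
    using member_le_sum[OF that, of M] M f by auto
  then have "\<bar>foldr partial bs (F t) x\<bar> \<le> sum M ?B" if "bs \<in> ?B" "t \<in> {0..T}" for bs t x
    using M that by (meson order_trans)
  moreover have "sum M ?B \<ge> 0" using M by (intro sum_nonneg) auto
  ultimately show ?thesis by blast
qed

subsection \<open>Concentrated profiles\<close>

lemma has_integral_deriv:
  fixes F :: "real \<Rightarrow> real"
  assumes "a \<le> b" "\<And>y. (F has_real_derivative f y) (at y)"
  shows "(f has_integral F b - F a) {a..b}"
  using assms by (intro fundamental_theorem_of_calculus)
    (auto simp: has_real_derivative_iff_has_vector_derivative[symmetric] intro: has_field_derivative_at_within)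

text \<open>
  High powers of the sine are concentrated trigonometric polynomials. Their means are controlled by
  Wallis' product.
\<close>

definition sinint :: "nat \<Rightarrow> real" where
  "sinint n = integral {0..1} (\<lambda>y. sin (pi * y) ^ (2 * n))"

lemma sin_power_trig: "(\<lambda>y. sin (pi * y) ^ (2 * n)) \<in> trig"
proof -
  have "sin (pi * y) ^ (2 * n) = ((1/2) * (1 - cos (2 * pi * of_int 1 * y))) ^ n" for y
    using cos_double_sin[of "pi * y"] by (simp add: power_mult power2_eq_square mult.assoc)
  moreover have "(\<lambda>y. ((1/2) * (1 - cos (2 * pi * of_int 1 * y))) ^ n) \<in> trig"
    by (intro trig_power trig_scale trig_diff trig_const trig_cos)
  ultimately show ?thesis by presburger
qed

lemma sinint_has_integral: "((\<lambda>y. sin (pi * y) ^ (2 * n)) has_integral sinint n) {0..1}"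
  unfolding sinint_def
  by (intro integrable_integral integrable_continuous_real trig_continuous sin_power_trig)

lemma sinint_0: "sinint 0 = 1"
  by (simp add: sinint_def)

lemma sin_pi_power_deriv:
  "((\<lambda>y. sin (pi * y) ^ Suc n) has_real_derivative
     real (Suc n) * (sin (pi * y) ^ n * (cos (pi * y) * pi))) (at y)"
proof -
  have "((\<lambda>y. sin (pi * y)) has_real_derivative cos (pi * y) * pi) (at y)"
    by (auto intro!: derivative_eq_intros)
  from DERIV_power[OF this, of "Suc n"] show ?thesis by (simp add: mult_ac del: power_Suc)
qed

lemma cos_pi_deriv:
  "((\<lambda>y. cos (pi * y)) has_real_derivative - (sin (pi * y) * pi)) (at y)"
  by (auto intro!: derivative_eq_intros)

text \<open>Integration by parts in the form of an explicit primitive: \<open>F\<close> vanishes at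
  both ends of the period, so its derivative integrates to 0, and \<open>cos_squared_eq\<close>
  turns this into Wallis' recursion.\<close>

lemma sinint_Suc: "(2 * real n + 2) * sinint (Suc n) = (2 * real n + 1) * sinint n"
proof -
  define F where "F y = sin (pi * y) ^ (2 * n + 1) * cos (pi * y) / pi" for y
  have "(F has_real_derivative ((2 * real n + 1) * sin (pi * y) ^ (2 * n) -
      (2 * real n + 2) * sin (pi * y) ^ (2 * Suc n))) (at y)" for y
  proof -
    have "(F has_real_derivative (real (Suc (2 * n)) * (sin (pi * y) ^ (2 * n) * (cos (pi * y) * pi)) * cos (pi * y)
       + (- (sin (pi * y) * pi)) * sin (pi * y) ^ Suc (2 * n)) / pi) (at y)"
      unfolding F_def Suc_eq_plus1[symmetric] by (intro DERIV_cdivide DERIV_mult sin_pi_power_deriv cos_pi_deriv)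
    moreover have "(real (Suc (2 * n)) * (sin (pi * y) ^ (2 * n) * (cos (pi * y) * pi)) * cos (pi * y)
       + (- (sin (pi * y) * pi)) * sin (pi * y) ^ Suc (2 * n)) / pi =
       (2 * real n + 1) * sin (pi * y) ^ (2 * n) * (cos (pi * y))\<^sup>2 - sin (pi * y) ^ (2 * Suc n)"
      by (simp add: field_simps power2_eq_square)
    moreover have "(2 * real n + 1) * sin (pi * y) ^ (2 * n) * (cos (pi * y))\<^sup>2 - sin (pi * y) ^ (2 * Suc n) =
       (2 * real n + 1) * sin (pi * y) ^ (2 * n) - (2 * real n + 2) * sin (pi * y) ^ (2 * Suc n)"
      by (simp only: cos_squared_eq) (simp add: algebra_simps power2_eq_square)
    ultimately show ?thesis by (simp only:)
  qed
  from has_integral_deriv[OF _ this, of 0 1]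
  have "((\<lambda>y. (2 * real n + 1) * sin (pi * y) ^ (2 * n) -
      (2 * real n + 2) * sin (pi * y) ^ (2 * Suc n)) has_integral 0) {0..1}"
    by (simp add: F_def)
  moreover have "((\<lambda>y. (2 * real n + 1) * sin (pi * y) ^ (2 * n) -
      (2 * real n + 2) * sin (pi * y) ^ (2 * Suc n)) has_integral
      ((2 * real n + 1) * sinint n - (2 * real n + 2) * sinint (Suc n))) {0..1}"
    by (intro has_integral_diff has_integral_mult_right sinint_has_integral)
  ultimately have "0 = (2 * real n + 1) * sinint n - (2 * real n + 2) * sinint (Suc n)"
    by (rule has_integral_unique)
  then show ?thesis by simp
qed

lemma sinint_Suc': "sinint (Suc n) = (2 * real n + 1) / (2 * real n + 2) * sinint n"
  using sinint_Suc[of n] by (simp add: field_simps)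

lemma sinint_pos: "sinint n > 0"
  by (induction n) (auto simp: sinint_0 sinint_Suc')

lemma sinint_decreasing: "sinint (Suc n) \<le> sinint n"
  unfolding sinint_Suc' using sinint_pos[of n] by (simp add: field_simps)

text \<open>The left side is nonincreasing in \<open>n\<close> and starts at 1: by the recursion,
  consecutive values have the ratio \<open>(2 * n + 1) * (2 * n + 3) / (2 * n + 2) ^ 2\<close>,
  which is at most 1.\<close>

lemma sinint_upper: "(sinint n)\<^sup>2 * (2 * real n + 1) \<le> 1"
proof (induction n)
  case (Suc n)
  define x where "x = real n"
  have "(2 * x + 1)\<^sup>2 * (2 * x + 3) \<le> (2 * x + 1) * (2 * x + 2)\<^sup>2"
    unfolding x_def by (simp add: power2_eq_square algebra_simps)
  then have r: "((2 * x + 1) / (2 * x + 2))\<^sup>2 * (2 * x + 3) \<le> 2 * x + 1"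
    unfolding x_def by (simp add: power_divide pos_divide_le_eq)
  have "(sinint (Suc n))\<^sup>2 * (2 * real (Suc n) + 1) =
    (sinint n)\<^sup>2 * (((2 * x + 1) / (2 * x + 2))\<^sup>2 * (2 * x + 3))"
    unfolding sinint_Suc' x_def by (simp only: power_mult_distrib of_nat_Suc) (simp add: algebra_simps)
  also have "\<dots> \<le> (sinint n)\<^sup>2 * (2 * x + 1)" by (intro mult_left_mono r) simp
  finally show ?case using Suc.IH unfolding x_def by linarith
qed (simp add: sinint_0)

text \<open>Here the left side is nondecreasing, with ratio
  \<open>(2 * n + 3) ^ 2 / (4 * (n + 1) * (n + 2))\<close>, and starts at 1 because
  \<open>sinint 1 = 1 / 2\<close>. Together with the upper bound this fixes the decay as the inverse
  square root of \<open>n\<close>.\<close>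

lemma sinint_lower: "(sinint (Suc n))\<^sup>2 * (4 * real (Suc n)) \<ge> 1"
proof (induction n)
  case (Suc n)
  define x where "x = real n"
  have "(x + 1) * (2 * x + 4)\<^sup>2 \<le> (2 * x + 3)\<^sup>2 * (x + 2)"
    unfolding x_def by (simp add: power2_eq_square algebra_simps)
  then have r: "x + 1 \<le> ((2 * x + 3) / (2 * x + 4))\<^sup>2 * (x + 2)"
    unfolding x_def by (simp add: power_divide pos_le_divide_eq)
  have "(sinint (Suc n))\<^sup>2 * (4 * (x + 1)) \<le> (sinint (Suc n))\<^sup>2 * (4 * (((2 * x + 3) / (2 * x + 4))\<^sup>2 * (x + 2)))"
    by (intro mult_left_mono r) auto
  also have "\<dots> = (sinint (Suc (Suc n)))\<^sup>2 * (4 * real (Suc (Suc n)))"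
    unfolding sinint_Suc'[of "Suc n"] x_def by (simp only: power_mult_distrib of_nat_Suc) (simp add: algebra_simps)
  finally show ?case using Suc.IH unfolding x_def by (simp add: add.commute)
qed (simp add: sinint_0 sinint_Suc' power2_eq_square)

text \<open>Both integrals tend to 0, but at comparable rates. Squaring a sine power doubles its
  exponent, so the mean of a concentrated profile and the mean of its square differ by at most a
  factor 2; this is why the product of two concentrated factors can be normalised while one of them
  keeps a bounded mean.\<close>

lemma sinint_ratio: "sinint (Suc n) \<le> 2 * sinint (2 * Suc n)"
proof -
  define X where "X = 2 * real (Suc n) + 1"
  have X: "X > 0" unfolding X_def by simp
  have "(sinint (Suc n))\<^sup>2 * X \<le> (sinint (2 * Suc n))\<^sup>2 * (4 * real (2 * Suc n))"
    using sinint_upper[of "Suc n"] sinint_lower[of "2 * n + 1"] unfolding X_def by simp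
  also have "\<dots> \<le> (sinint (2 * Suc n))\<^sup>2 * (4 * X)"
    unfolding X_def by (intro mult_left_mono) auto
  also have "\<dots> = (2 * sinint (2 * Suc n))\<^sup>2 * X"
    by (simp add: power2_eq_square)
  finally have "(sinint (Suc n))\<^sup>2 \<le> (2 * sinint (2 * Suc n))\<^sup>2"
    using X by (rule mult_right_le_imp_le)
  then show ?thesis using sinint_pos by (intro power2_le_imp_le[of "sinint (Suc n)"]) (auto simp: less_imp_le)
qed

lemma sinint_small: assumes "e > 0" shows "\<exists>n. sinint (Suc n) \<le> e"
proof -
  obtain n where n: "1 / e\<^sup>2 < real n" using reals_Archimedean2 by blast
  have "(sinint (Suc n))\<^sup>2 * (2 * real (Suc n) + 1) \<le> 1" by (rule sinint_upper)
  moreover have "e\<^sup>2 * (2 * real (Suc n) + 1) \<ge> 1"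
  proof -
    have "e\<^sup>2 * real n \<ge> 1" using n assms by (simp add: field_simps)
    moreover have "e\<^sup>2 * (2 * real (Suc n) + 1) \<ge> e\<^sup>2 * real n" by (intro mult_left_mono) auto
    ultimately show ?thesis by simp
  qed
  ultimately have "(sinint (Suc n))\<^sup>2 * (2 * real (Suc n) + 1) \<le> e\<^sup>2 * (2 * real (Suc n) + 1)" by linarith
  then have "(sinint (Suc n))\<^sup>2 \<le> e\<^sup>2" by (rule mult_right_le_imp_le) simp
  from power2_le_imp_le[OF this less_imp_le[OF assms]] show ?thesis by blast
qed

lemma sinint_le_1: "sinint n \<le> 1"
  by (induction n) (auto simp: sinint_0 intro: order_trans[OF sinint_decreasing])

text \<open>The bound 1 is blind to concentration: \<open>H y + y\<close> is nondecreasing since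
  \<open>f\<close> is nonnegative, and climbs from 0 to 1 over a period, hence \<open>H y\<close>
  lies between \<open>- y\<close> and \<open>1 - y\<close>.\<close>

lemma trig_mean_primitive:
  assumes f: "f \<in> trig" "\<And>y. f y \<ge> 0" "(f has_integral 1) {0..1}"
  shows "\<exists>H\<in>trig. (\<forall>y. (H has_real_derivative f y - 1) (at y)) \<and> H 0 = 0 \<and> (\<forall>y. \<bar>H y\<bar> \<le> 1)"
proof -
  obtain K c where K: "K \<in> trig" "\<And>y. (K has_real_derivative f y - c) (at y)"
    using trig_antideriv[OF f(1)] by blast
  have "((\<lambda>y. f y - c) has_integral K 1 - K 0) {0..1}" by (intro has_integral_deriv K) auto
  moreover have "((\<lambda>y. f y - c) has_integral 1 - c) {0..1}"
    using has_integral_diff[OF f(3) has_integral_const_real[of c 0 1]] by simp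
  ultimately have "K 1 - K 0 = 1 - c" by (rule has_integral_unique)
  then have c: "c = 1" using trig_periodic[OF K(1), of 0 1] by simp
  define H where "H y = K y - K 0" for y
  have H: "H \<in> trig" "(H has_real_derivative f y - 1) (at y)" "H 0 = 0" for y
    using K c unfolding H_def by (auto intro!: trig_diff trig_const derivative_eq_intros)
  have H1: "H 1 = 0" using trig_periodic[OF H(1), of 0 1] H(3) by simp
  have mono: "H a + a \<le> H b + b" if "a \<le> b" for a b
    using that
  proof (rule DERIV_nonneg_imp_nondecreasing)
    fix x show "\<exists>y. ((\<lambda>x. H x + x) has_real_derivative y) (at x) \<and> 0 \<le> y"
      by (rule exI[of _ "f x"]) (auto intro!: derivative_eq_intros H f(2))
  qed
  have b: "\<bar>H y\<bar> \<le> 1" if "0 \<le> y" "y \<le> 1" for y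
    using mono[of 0 y] mono[of y 1] that H(3) H1 by auto
  have "\<bar>H y\<bar> \<le> 1" for y
    using b[of "frac y"] trig_periodic[OF H(1), of "frac y" "\<lfloor>y\<rfloor>"] frac_lt_1[of y]
    by (simp add: frac_def less_imp_le)
  then show ?thesis using H by blast
qed

section \<open>Profiles built from powers of the sine\<close>

lemma sin_power_deriv:
  "((\<lambda>y. sin (pi * y) ^ (2 * Suc k)) has_real_derivative
     2 * (real k + 1) * pi * (sin (pi * y) ^ (2 * k + 1) * cos (pi * y))) (at y)"
  using sin_pi_power_deriv[of "2 * k + 1" y] by (simp add: algebra_simps)

lemma sin_power_deriv2:
  "((\<lambda>y. sin (pi * y) ^ (2 * k + 1) * cos (pi * y)) has_real_derivative
     pi * ((2 * real k + 1) * (sin (pi * y) ^ (2 * k) * (cos (pi * y))\<^sup>2) - sin (pi * y) ^ (2 * Suc k))) (at y)"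
  using DERIV_mult[OF sin_pi_power_deriv[of "2 * k" y] cos_pi_deriv[of y]]
  by (simp add: algebra_simps power2_eq_square)

lemma deriv_in_trig:
  assumes "f \<in> trig" "\<And>y. (f has_real_derivative f' y) (at y)" shows "f' \<in> trig"
proof -
  obtain g where g: "g \<in> trig" "\<And>y. (f has_real_derivative g y) (at y)" using trig_deriv[OF assms(1)] by blast
  then have "f' = g" using DERIV_unique[OF assms(2) g(2)] by auto
  with g show ?thesis by simp
qed

text \<open>
  \<open>\<gamma>\<close> multiplies the density perturbation and \<open>G\<close> the velocity perturbation; \<open>H\<close> is a primitive
  of the oscillating part of their product.
\<close>

definition time_profile :: "real \<Rightarrow> (real \<Rightarrow> real) \<Rightarrow> (real \<Rightarrow> real) \<Rightarrow> (real \<Rightarrow> real) \<Rightarrow> (real \<Rightarrow> real) \<Rightarrow> bool" where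
  "time_profile \<delta> \<gamma> \<gamma>' G H \<longleftrightarrow> \<gamma> \<in> trig \<and> \<gamma>' \<in> trig \<and> G \<in> trig \<and> H \<in> trig \<and>
    (\<forall>y. 0 \<le> \<gamma> y) \<and> (\<forall>y. \<gamma> y \<le> 1) \<and> \<gamma> 0 = 0 \<and> (\<forall>y. (\<gamma> has_real_derivative \<gamma>' y) (at y)) \<and>
    integral {0..1} \<gamma> \<le> \<delta> \<and> integral {0..1} (\<lambda>y. \<bar>\<gamma>' y\<bar>) \<le> 2 \<and>
    (\<forall>y. \<gamma> y * G y \<ge> 0) \<and> (\<forall>y. (H has_real_derivative \<gamma> y * G y - 1) (at y)) \<and>
    H 0 = 0 \<and> (\<forall>y. \<bar>H y\<bar> \<le> 1) \<and> integral {0..1} (\<lambda>y. \<bar>G y\<bar>) \<le> 2"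

text \<open>\<open>\<gamma>\<close> is a high power of the sine, and \<open>G\<close> is the same
  function divided by the mean of \<open>\<gamma> ^ 2\<close>. The mean of \<open>\<gamma>\<close>
  is then as small as desired, whereas that of \<open>G\<close> is a quotient controlled by
  \<open>sinint_ratio\<close>. Over one period \<open>\<gamma>\<close> rises once from 0 to 1 and
  falls back once, so its total variation is 2 for every exponent.\<close>

lemma time_profile_exists:
  assumes "\<delta> > 0" shows "\<exists>\<gamma> \<gamma>' G H. time_profile \<delta> \<gamma> \<gamma>' G H"
proof -
  obtain k where k: "sinint (Suc k) \<le> \<delta>" using sinint_small[OF assms] by blast
  define \<gamma> where "\<gamma> y = sin (pi * y) ^ (2 * Suc k)" for y
  define \<gamma>' where "\<gamma>' y = 2 * (real k + 1) * pi * (sin (pi * y) ^ (2 * k + 1) * cos (pi * y))" for y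
  define J where "J = sinint (2 * Suc k)"
  define G where "G y = (1 / J) * \<gamma> y" for y
  have J: "J > 0" unfolding J_def by (rule sinint_pos)
  have \<gamma>: "\<gamma> \<in> trig" unfolding \<gamma>_def by (rule sin_power_trig)
  have \<gamma>': "\<And>y. (\<gamma> has_real_derivative \<gamma>' y) (at y)" unfolding \<gamma>_def \<gamma>'_def by (rule sin_power_deriv)
  have G: "G \<in> trig" unfolding G_def by (intro trig_scale \<gamma>)
  have nn: "0 \<le> \<gamma> y" "\<gamma> y \<le> 1" for y
  proof -
    have "(sin (pi * y))\<^sup>2 \<le> 1" by (simp add: abs_square_le_1)
    then show "0 \<le> \<gamma> y" "\<gamma> y \<le> 1" unfolding \<gamma>_def power_mult by (auto intro!: power_le_one simp del: power_Suc)
  qed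
  have GG: "\<gamma> y * G y = (1 / J) * sin (pi * y) ^ (2 * (2 * Suc k))" for y
    unfolding G_def \<gamma>_def by (simp only: mult_2 power_add) simp
  have "((\<lambda>y. \<gamma> y * G y) has_integral (1 / J) * J) {0..1}"
    unfolding GG J_def by (intro has_integral_mult_right sinint_has_integral)
  then have "((\<lambda>y. \<gamma> y * G y) has_integral 1) {0..1}" using J by simp
  moreover have p: "\<And>y. \<gamma> y * G y \<ge> 0" using nn J by (simp add: G_def)
  ultimately obtain H where H: "H \<in> trig" "\<And>y. (H has_real_derivative \<gamma> y * G y - 1) (at y)"
    "H 0 = 0" "\<And>y. \<bar>H y\<bar> \<le> 1"
    using trig_mean_primitive[OF trig_mult[OF \<gamma> G]] by blast
  have "((\<lambda>y. \<bar>\<gamma>' y\<bar>) has_integral 1 + 1) {0..1}"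
  proof (rule has_integral_combine)
    show "((\<lambda>y. \<bar>\<gamma>' y\<bar>) has_integral 1) {0..1/2}"
    proof (rule has_integral_eq)
      show "(\<gamma>' has_integral 1) {0..1/2}" using has_integral_deriv[of 0 "1/2" \<gamma> \<gamma>'] \<gamma>' by (simp add: \<gamma>_def)
      show "\<gamma>' y = \<bar>\<gamma>' y\<bar>" if "y \<in> {0..1/2}" for y
      proof -
        have "0 \<le> pi * y" "pi * y \<le> pi / 2" "- (pi / 2) \<le> 0"
          using that by (auto simp: field_simps)
        then have "sin (pi * y) \<ge> 0" "cos (pi * y) \<ge> 0"
          by (intro sin_ge_zero cos_ge_zero; linarith)+
        then show ?thesis unfolding \<gamma>'_def by simp
      qed
    qed
    show "((\<lambda>y. \<bar>\<gamma>' y\<bar>) has_integral 1) {1/2..1}"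
    proof (rule has_integral_eq)
      show "((\<lambda>y. - \<gamma>' y) has_integral 1) {1/2..1}"
        using has_integral_neg[OF has_integral_deriv[of "1/2" 1 \<gamma> \<gamma>']] \<gamma>' by (simp add: \<gamma>_def)
      show "- \<gamma>' y = \<bar>\<gamma>' y\<bar>" if "y \<in> {1/2..1}" for y
      proof -
        have "sin (pi * y) \<ge> 0"
          using that by (auto intro!: sin_ge_zero simp: field_simps)
        moreover have "cos (pi * y) \<le> 0"
        proof -
          have "sin (pi * (y - 1/2)) \<ge> 0"
          proof (rule sin_ge_zero)
            show "0 \<le> pi * (y - 1/2)" using that by (intro mult_nonneg_nonneg) auto
            have "pi * (y - 1/2) \<le> pi * 1" using that by (intro mult_left_mono) auto
            then show "pi * (y - 1/2) \<le> pi" by simp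
          qed
          moreover have "sin (pi * (y - 1/2)) = - cos (pi * y)"
            by (simp add: right_diff_distrib sin_diff)
          ultimately show ?thesis by simp
        qed
        ultimately show ?thesis unfolding \<gamma>'_def
          by (simp add: abs_mult abs_of_nonpos zero_le_mult_iff mult_nonneg_nonpos)
      qed
    qed
  qed auto
  then have v: "integral {0..1} (\<lambda>y. \<bar>\<gamma>' y\<bar>) \<le> 2" by (simp add: integral_unique)
  have i: "(\<gamma> has_integral sinint (Suc k)) {0..1}" unfolding \<gamma>_def by (rule sinint_has_integral)
  have "((\<lambda>y. \<bar>G y\<bar>) has_integral (1 / J) * sinint (Suc k)) {0..1}"
  proof -
    have "\<bar>G y\<bar> = (1/J) * \<gamma> y" for y using J nn[of y] by (simp add: G_def)
    then show ?thesis by (simp only:) (intro has_integral_mult_right i)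
  qed
  then have "integral {0..1} (\<lambda>y. \<bar>G y\<bar>) \<le> 2"
    using sinint_ratio[of k] J unfolding J_def by (simp add: integral_unique field_simps)
  moreover have "\<gamma> 0 = 0" by (simp add: \<gamma>_def)
  ultimately have "time_profile \<delta> \<gamma> \<gamma>' G H"
    unfolding time_profile_def
    using \<gamma> \<gamma>' G H nn p v k deriv_in_trig[OF \<gamma> \<gamma>'] by (auto simp: integral_unique[OF i])
  then show ?thesis by blast
qed

text \<open>Each of the \<open>k + 1\<close> copies of \<open>z ^ k\<close> is at most one of the
  powers \<open>z ^ 0\<close> to \<open>z ^ k\<close>, and the resulting geometric sum telescopes.
  This keeps the second derivative of a sine power of the order of the exponent rather than of its
  square.\<close>

lemma power_one_minus_le:
  fixes z :: real assumes "0 \<le> z" "z \<le> 1" shows "(real k + 1) * (z ^ k * (1 - z)) \<le> 1"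
proof -
  have "(real k + 1) * (z ^ k * (1 - z)) = (\<Sum>l\<le>k. z ^ k) * (1 - z)" by simp
  also have "\<dots> \<le> (\<Sum>l\<le>k. z ^ l) * (1 - z)"
    using assms by (intro mult_right_mono sum_mono power_decreasing) auto
  also have "\<dots> = 1 - z ^ Suc k"
    using one_diff_power_eq[of z "Suc k"] by (simp add: lessThan_Suc_atMost mult.commute)
  also have "\<dots> \<le> 1" using assms by simp
  finally show ?thesis .
qed

text \<open>
  \<open>\<Phi>'\<close> is the leading density profile and \<open>\<psi>\<close> the velocity profile; both are multiples of the
  same derivative, which makes their product nonnegative.
\<close>

definition space_profile :: "nat \<Rightarrow> real \<Rightarrow> (real \<Rightarrow> real) \<Rightarrow> (real \<Rightarrow> real) \<Rightarrow> (real \<Rightarrow> real) \<Rightarrow> (real \<Rightarrow> real) \<Rightarrow>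
    (real \<Rightarrow> real) \<Rightarrow> bool" where
  "space_profile q \<delta> \<Phi> \<Phi>' \<psi> \<psi>' H \<longleftrightarrow> \<Phi> \<in> trig \<and> \<Phi>' \<in> trig \<and> \<psi> \<in> trig \<and> \<psi>' \<in> trig \<and> H \<in> trig \<and>
    (\<forall>y. (\<Phi> has_real_derivative \<Phi>' y) (at y)) \<and> (\<forall>y. (\<psi> has_real_derivative \<psi>' y) (at y)) \<and>
    integral {0..1} (\<lambda>y. \<bar>\<Phi> y\<bar>) \<le> \<delta> \<and> (\<forall>y. \<bar>\<psi> y\<bar> \<le> \<delta>) \<and>
    (\<forall>p. 1 \<le> p \<longrightarrow> p \<le> real q \<longrightarrow> integral {0..1} (\<lambda>y. \<bar>\<psi>' y\<bar> powr p) \<le> \<delta> powr p) \<and>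
    (\<forall>y. \<Phi>' y * \<psi> y \<ge> 0) \<and> (\<forall>y. (H has_real_derivative \<Phi>' y * \<psi> y - 1) (at y)) \<and>
    (\<forall>y. \<bar>H y\<bar> \<le> 1) \<and> (\<forall>y. \<bar>\<Phi> y * \<psi> y\<bar> \<le> 8)"

text \<open>With exponent \<open>2 * Suc k\<close> the function \<open>s\<close> has width of order
  \<open>k ^ (-1/2)\<close>: its integral \<open>I\<close> shrinks like the width, \<open>s'\<close>
  and the mean \<open>m\<close> of \<open>s' ^ 2\<close> grow like \<open>k ^ (1/2)\<close>, and
  \<open>s''\<close> grows like \<open>k\<close>. Dividing \<open>s'\<close> by \<open>m\<close>
  leaves a function of order 1, and \<open>\<nu> = \<delta> / I\<close> makes it small. The
  derivative \<open>\<psi>'\<close> is not small in the supremum norm, but its \<open>L^1\<close>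
  norm is of order \<open>I\<close>, which gives smallness in \<open>L^p\<close> for bounded
  \<open>p\<close>.\<close>

lemma space_profile_exists:
  assumes "0 < \<delta>" "\<delta> \<le> 1" shows "\<exists>\<Phi> \<Phi>' \<psi> \<psi>' H. space_profile q \<delta> \<Phi> \<Phi>' \<psi> \<psi>' H"
proof -
  have d: "0 < \<delta>\<^sup>2 / 12" "\<delta>\<^sup>2 / 12 \<le> 1"
    using assms power_le_one[of \<delta> 2] by auto
  \<comment> \<open>The exponent \<open>Suc q\<close> serves the \<open>L^p\<close> bound of
    \<open>\<psi>'\<close> for all \<open>p\<close> up to \<open>q\<close>. The base is chosen so
    that its product with the bound \<open>12 / \<delta>\<close> of \<open>\<psi>'\<close> is
    exactly \<open>\<delta>\<close>.\<close>
  obtain k where k: "sinint (Suc k) \<le> (\<delta>\<^sup>2 / 12) ^ Suc q"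
    using sinint_small[of "(\<delta>\<^sup>2 / 12) ^ Suc q"] d by auto
  define s where "s y = sin (pi * y) ^ (2 * Suc k)" for y
  define s' where "s' y = 2 * (real k + 1) * pi * (sin (pi * y) ^ (2 * k + 1) * cos (pi * y))" for y
  define s'' where "s'' y = 2 * (real k + 1) * pi\<^sup>2 *
    ((2 * real k + 1) * (sin (pi * y) ^ (2 * k) * (cos (pi * y))\<^sup>2) - sin (pi * y) ^ (2 * Suc k))" for y
  define I where "I = sinint (Suc k)"
  define J where "J = sinint (2 * k + 1)"
  define m where "m = (real k + 1) * pi\<^sup>2 * J"
  have I: "0 < I" "I \<le> 1" "I \<le> 2 * J" and J: "J > 0"
    unfolding I_def J_def using sinint_pos sinint_le_1 sinint_ratio[of k] sinint_decreasing[of "2 * k + 1"]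
    by (auto intro: order_trans)
  have m: "m > 0" unfolding m_def using J by (auto intro!: mult_pos_pos)
  have s: "s \<in> trig" unfolding s_def by (rule sin_power_trig)
  have s': "(s has_real_derivative s' y) (at y)" for y unfolding s_def s'_def by (rule sin_power_deriv)
  have s'': "(s' has_real_derivative s'' y) (at y)" for y
    unfolding s'_def s''_def
    using DERIV_cmult[OF sin_power_deriv2[of k y], of "2 * (real k + 1) * pi"]
    by (simp add: power2_eq_square mult.assoc)
  have t': "s' \<in> trig" by (rule deriv_in_trig[OF s s'])
  have t'': "s'' \<in> trig" by (rule deriv_in_trig[OF t' s''])
  have sq: "s' y * s' y = 4 * (real k + 1)\<^sup>2 * pi\<^sup>2 *
     (sin (pi * y) ^ (2 * (2 * k + 1)) - sin (pi * y) ^ (2 * Suc (2 * k + 1)))" for y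
  proof -
    have "s' y * s' y = 4 * (real k + 1)\<^sup>2 * pi\<^sup>2 * (sin (pi * y) ^ (2 * (2 * k + 1)) * (cos (pi * y))\<^sup>2)"
      unfolding s'_def by (simp only: mult_2 power_add power2_eq_square) (simp add: algebra_simps)
    also have "sin (pi * y) ^ (2 * (2 * k + 1)) * (cos (pi * y))\<^sup>2 =
      sin (pi * y) ^ (2 * (2 * k + 1)) - sin (pi * y) ^ (2 * Suc (2 * k + 1))"
      by (simp only: cos_squared_eq) (simp add: algebra_simps power2_eq_square)
    finally show ?thesis .
  qed
  \<comment> \<open>Written as a difference of two consecutive Wallis integrals, the mean of
    \<open>s' ^ 2\<close> is evaluated exactly by the recursion.\<close>
  have im: "((\<lambda>y. s' y * s' y) has_integral m) {0..1}"
  proof -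
    have "((\<lambda>y. s' y * s' y) has_integral 4 * (real k + 1)\<^sup>2 * pi\<^sup>2 * (J - sinint (Suc (2 * k + 1)))) {0..1}"
      unfolding sq J_def by (intro has_integral_mult_right has_integral_diff sinint_has_integral)
    moreover have "4 * (real k + 1)\<^sup>2 * pi\<^sup>2 * (J - sinint (Suc (2 * k + 1))) = m"
    proof -
      have "(4 * (real k + 1)) * (J - sinint (Suc (2 * k + 1))) = J"
        using sinint_Suc[of "2 * k + 1"] unfolding J_def by (simp add: algebra_simps)
      then have "(4 * (real k + 1)) * (J - sinint (Suc (2 * k + 1))) * ((real k + 1) * pi\<^sup>2) = J * ((real k + 1) * pi\<^sup>2)"
        by simp
      then show ?thesis unfolding m_def by (simp add: power2_eq_square algebra_simps)
    qed
    ultimately show ?thesis by simp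
  qed
  \<comment> \<open>\<open>M\<close> is the integral of a positive majorant of \<open>|s''|\<close>,
    in which the two terms of \<open>s''\<close> are added instead of subtracted; the recursion
    collapses it to a multiple of \<open>I\<close>.\<close>
  define M where "M = 4 * (real k + 1) * pi\<^sup>2 * I"
  have i2: "((\<lambda>y. 2 * (real k + 1) * pi\<^sup>2 *
    ((2 * real k + 1) * (sin (pi * y) ^ (2 * k) - sin (pi * y) ^ (2 * Suc k)) + sin (pi * y) ^ (2 * Suc k))) has_integral M) {0..1}"
  proof -
    have "((\<lambda>y. 2 * (real k + 1) * pi\<^sup>2 *
    ((2 * real k + 1) * (sin (pi * y) ^ (2 * k) - sin (pi * y) ^ (2 * Suc k)) + sin (pi * y) ^ (2 * Suc k)))
     has_integral 2 * (real k + 1) * pi\<^sup>2 * ((2 * real k + 1) * (sinint k - I) + I)) {0..1}"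
      unfolding I_def
      by (intro has_integral_mult_right has_integral_diff has_integral_add sinint_has_integral)
    moreover have "(2 * real k + 1) * (sinint k - I) + I = 2 * I"
      using sinint_Suc[of k] unfolding I_def by (simp add: algebra_simps)
    then have "2 * (real k + 1) * pi\<^sup>2 * ((2 * real k + 1) * (sinint k - I) + I) = M"
      unfolding M_def by (simp only:)
    ultimately show ?thesis by (simp only:)
  qed
  have s2: "\<bar>s'' y\<bar> \<le> 2 * (real k + 1) * pi\<^sup>2 *
    ((2 * real k + 1) * (sin (pi * y) ^ (2 * k) - sin (pi * y) ^ (2 * Suc k)) + sin (pi * y) ^ (2 * Suc k))"
    "\<bar>s'' y\<bar> \<le> 6 * (real k + 1) * pi\<^sup>2" for y
  proof -
    define z where "z = (sin (pi * y))\<^sup>2"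
    have z: "0 \<le> z" "z \<le> 1" unfolding z_def by (auto simp: abs_square_le_1)
    have e: "sin (pi * y) ^ (2 * k) = z ^ k" "sin (pi * y) ^ (2 * Suc k) = z ^ Suc k" "(cos (pi * y))\<^sup>2 = 1 - z"
      unfolding z_def by (simp_all only: power_mult cos_squared_eq)
    have A: "0 \<le> (2 * real k + 1) * (z ^ k * (1 - z))" and B: "0 \<le> z ^ Suc k" "z ^ Suc k \<le> 1"
      using z by (auto intro: power_le_one mult_le_one)
    have "\<bar>(2 * real k + 1) * (z ^ k * (1 - z)) - z ^ Suc k\<bar> \<le> (2 * real k + 1) * (z ^ k * (1 - z)) + z ^ Suc k"
      using A B by linarith
    then have "2 * (real k + 1) * pi\<^sup>2 * \<bar>(2 * real k + 1) * (z ^ k * (1 - z)) - z ^ Suc k\<bar>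
       \<le> 2 * (real k + 1) * pi\<^sup>2 * ((2 * real k + 1) * (z ^ k * (1 - z)) + z ^ Suc k)"
      by (intro mult_left_mono) auto
    then have 1: "\<bar>s'' y\<bar> \<le> 2 * (real k + 1) * pi\<^sup>2 * ((2 * real k + 1) * (z ^ k * (1 - z)) + z ^ Suc k)"
      unfolding s''_def e by (simp add: abs_mult)
    then show "\<bar>s'' y\<bar> \<le> 2 * (real k + 1) * pi\<^sup>2 *
    ((2 * real k + 1) * (sin (pi * y) ^ (2 * k) - sin (pi * y) ^ (2 * Suc k)) + sin (pi * y) ^ (2 * Suc k))"
      unfolding e by (simp add: algebra_simps)
    have "(2 * real k + 1) * (z ^ k * (1 - z)) \<le> 2 * ((real k + 1) * (z ^ k * (1 - z)))"
      using mult_nonneg_nonneg[of "z ^ k" "1 - z"] z by (simp add: algebra_simps)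
    also have "\<dots> \<le> 2" using power_one_minus_le[OF z, of k] by simp
    finally have "(2 * real k + 1) * (z ^ k * (1 - z)) + z ^ Suc k \<le> 3" using B by linarith
    then have "2 * (real k + 1) * pi\<^sup>2 * ((2 * real k + 1) * (z ^ k * (1 - z)) + z ^ Suc k) \<le> 2 * (real k + 1) * pi\<^sup>2 * 3"
      by (intro mult_left_mono) auto
    with 1 show "\<bar>s'' y\<bar> \<le> 6 * (real k + 1) * pi\<^sup>2" by (simp add: algebra_simps)
  qed
  have c2: "continuous_on S (\<lambda>y. \<bar>s'' y\<bar>)" for S by (intro continuous_intros trig_continuous t'')
  have ia: "integral {0..1} (\<lambda>y. \<bar>s'' y\<bar>) \<le> M"
    using integral_le[OF integrable_continuous_real[OF c2] has_integral_integrable[OF i2] s2(1)] integral_unique[OF i2]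
    by simp
  \<comment> \<open>Since \<open>s'\<close> vanishes at 0, its supremum is at most the integral of
    \<open>|s''|\<close> over one period.\<close>
  have s1: "\<bar>s' y\<bar> \<le> M" for y
  proof -
    have *: "\<bar>s' y\<bar> \<le> M" if "0 \<le> y" "y \<le> 1" for y
    proof -
      have "(s'' has_integral s' y - s' 0) {0..y}" by (intro has_integral_deriv s'' that)
      then have "\<bar>s' y\<bar> = \<bar>integral {0..y} s''\<bar>" by (simp add: integral_unique s'_def)
      also have "\<dots> \<le> integral {0..y} (\<lambda>y. \<bar>s'' y\<bar>)"
        using integral_norm_bound_integral[of s'' "{0..y}" "\<lambda>y. \<bar>s'' y\<bar>"]
        by (auto intro!: integrable_continuous_real c2 trig_continuous t'')
      also have "\<dots> \<le> integral {0..1} (\<lambda>y. \<bar>s'' y\<bar>)"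
        using that by (intro integral_subset_le integrable_continuous_real c2) auto
      finally show ?thesis using ia by simp
    qed
    show ?thesis using *[of "frac y"] trig_periodic[OF t', of "frac y" "\<lfloor>y\<rfloor>"] frac_lt_1[of y]
      by (simp add: frac_def less_imp_le)
  qed
  \<comment> \<open>The factor \<open>\<nu>\<close> shifts size from one profile to the other
    without changing their product; with this value the mean of \<open>\<Phi>\<close> is
    \<open>\<delta>\<close>.\<close>
  define \<nu> where "\<nu> = \<delta> / I"
  have \<nu>: "\<nu> > 0" unfolding \<nu>_def using assms I by simp
  define \<Phi> where "\<Phi> y = \<nu> * s y" for y
  define \<Phi>' where "\<Phi>' y = \<nu> * s' y" for y
  define \<psi> where "\<psi> y = (1 / (m * \<nu>)) * s' y" for y
  define \<psi>' where "\<psi>' y = (1 / (m * \<nu>)) * s'' y" for y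
  have mem: "\<Phi> \<in> trig" "\<Phi>' \<in> trig" "\<psi> \<in> trig" "\<psi>' \<in> trig"
    unfolding \<Phi>_def \<Phi>'_def \<psi>_def \<psi>'_def by (intro trig_scale s t' t'')+
  have der: "(\<Phi> has_real_derivative \<Phi>' y) (at y)" "(\<psi> has_real_derivative \<psi>' y) (at y)" for y
    unfolding \<Phi>_def \<Phi>'_def \<psi>_def \<psi>'_def by (intro DERIV_cmult s' s'')+
  have s01: "0 \<le> s y" "s y \<le> 1" for y
  proof -
    have "(sin (pi * y))\<^sup>2 \<le> 1" by (simp add: abs_square_le_1)
    then show "0 \<le> s y" "s y \<le> 1" unfolding s_def power_mult by (auto intro!: power_le_one simp del: power_Suc)
  qed
  have "((\<lambda>y. \<bar>\<Phi> y\<bar>) has_integral \<nu> * I) {0..1}"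
  proof -
    have "\<bar>\<Phi> y\<bar> = \<nu> * s y" for y using \<nu> s01 by (simp add: \<Phi>_def)
    moreover have "((\<lambda>y. \<nu> * s y) has_integral \<nu> * I) {0..1}" unfolding s_def I_def
      by (intro has_integral_mult_right sinint_has_integral)
    ultimately show ?thesis by simp
  qed
  then have r1: "integral {0..1} (\<lambda>y. \<bar>\<Phi> y\<bar>) \<le> \<delta>" using I by (simp add: integral_unique \<nu>_def)
  have "M \<le> 4 * (real k + 1) * pi\<^sup>2 * (2 * J)"
    unfolding M_def using I by (intro mult_left_mono) auto
  also have "\<dots> = 8 * m" by (simp add: m_def)
  finally have Mm: "M / m \<le> 8" using m by (simp add: pos_divide_le_eq)
  have k1: "(\<delta>\<^sup>2 / 12) ^ Suc q \<le> \<delta>\<^sup>2 / 12"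
    using d power_decreasing[of 1 "Suc q" "\<delta>\<^sup>2 / 12"] by simp
  have I1: "I \<le> \<delta>\<^sup>2 / 12" using k k1 unfolding I_def by linarith
  have r2: "\<bar>\<psi> y\<bar> \<le> \<delta>" for y
  proof -
    have "\<bar>\<psi> y\<bar> = \<bar>s' y\<bar> / m / \<nu>" using m \<nu> by (simp add: \<psi>_def abs_mult)
    also have "\<dots> \<le> M / m / \<nu>" using s1[of y] m \<nu> by (intro divide_right_mono) auto
    also have "\<dots> \<le> 8 / \<nu>" using Mm \<nu> by (intro divide_right_mono) auto
    also have "\<dots> = 8 * I / \<delta>" by (simp add: \<nu>_def)
    also have "\<dots> \<le> \<delta>" using I1 I(1) assms by (simp add: field_simps power2_eq_square) 
    finally show ?thesis .
  qed
  have r3: "integral {0..1} (\<lambda>y. \<bar>\<psi>' y\<bar> powr p) \<le> \<delta> powr p" if p: "1 \<le> p" "p \<le> real q" for p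
  proof -
    have b1: "\<bar>\<psi>' y\<bar> \<le> 12 / \<delta>" for y
    proof -
      have "\<bar>\<psi>' y\<bar> = \<bar>s'' y\<bar> / m / \<nu>" using m \<nu> by (simp add: \<psi>'_def abs_mult)
      also have "\<dots> \<le> 6 * (real k + 1) * pi\<^sup>2 / m / \<nu>"
        using s2(2)[of y] m \<nu> by (intro divide_right_mono) auto
      also have "\<dots> = 6 * I / (J * \<delta>)" unfolding m_def \<nu>_def by (simp add: divide_simps)
      also have "\<dots> \<le> 12 / \<delta>" using I J assms by (simp add: field_simps)
      finally show ?thesis .
    qed
    have cont: "continuous_on {0..1} (\<lambda>y. \<bar>\<psi>' y\<bar>)" by (intro continuous_intros trig_continuous mem)
    \<comment> \<open>Interpolation between \<open>L^1\<close> and the supremum norm: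
      \<open>p - 1\<close> powers are estimated by the large bound \<open>12 / \<delta>\<close>, and
      the remaining one contributes the factor \<open>I\<close>, which is tiny by the choice of
      \<open>k\<close>.\<close>
    have "integral {0..1} (\<lambda>y. \<bar>\<psi>' y\<bar> powr p) \<le> integral {0..1} (\<lambda>y. (12 / \<delta>) powr (p - 1) * \<bar>\<psi>' y\<bar>)"
    proof (rule integral_le)
      show "(\<lambda>y. \<bar>\<psi>' y\<bar> powr p) integrable_on {0..1}"
        using p by (intro integrable_continuous_real continuous_on_powr' cont continuous_on_const) auto
      show "(\<lambda>y. (12 / \<delta>) powr (p - 1) * \<bar>\<psi>' y\<bar>) integrable_on {0..1}"
        by (intro integrable_continuous_real continuous_on_mult cont continuous_on_const)
      fix y :: real
      have "\<bar>\<psi>' y\<bar> powr p = \<bar>\<psi>' y\<bar> powr (p - 1) * \<bar>\<psi>' y\<bar>"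
        by (cases "\<psi>' y = 0") (auto simp: powr_diff)
      also have "\<dots> \<le> (12 / \<delta>) powr (p - 1) * \<bar>\<psi>' y\<bar>"
        using p b1 by (intro mult_right_mono powr_mono2) auto
      finally show "\<bar>\<psi>' y\<bar> powr p \<le> (12 / \<delta>) powr (p - 1) * \<bar>\<psi>' y\<bar>" .
    qed
    also have "\<dots> = (12 / \<delta>) powr (p - 1) * integral {0..1} (\<lambda>y. \<bar>\<psi>' y\<bar>)" by simp
    also have "integral {0..1} (\<lambda>y. \<bar>\<psi>' y\<bar>) = integral {0..1} (\<lambda>y. \<bar>s'' y\<bar>) / (m * \<nu>)"
      using m \<nu> by (simp add: \<psi>'_def abs_mult)
    also have "\<dots> \<le> M / (m * \<nu>)" using ia m \<nu> by (intro divide_right_mono) auto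
    also have "\<dots> = (M / m) / \<nu>" by simp
    also have "\<dots> \<le> 8 / \<nu>" using Mm \<nu> by (intro divide_right_mono) auto
    also have "\<dots> \<le> (12 / \<delta>) * I" using I assms by (simp add: \<nu>_def field_simps)
    finally have "integral {0..1} (\<lambda>y. \<bar>\<psi>' y\<bar> powr p) \<le> (12 / \<delta>) powr (p - 1) * ((12 / \<delta>) * I)"
      by (simp add: mult_left_mono)
    also have "\<dots> = (12 / \<delta>) powr p * I" using assms by (simp add: powr_diff)
    also have "\<dots> \<le> (12 / \<delta>) powr p * (\<delta>\<^sup>2 / 12) powr p"
    proof (rule mult_left_mono)
      have "(\<delta>\<^sup>2 / 12) powr (real (Suc q)) = (\<delta>\<^sup>2 / 12) ^ Suc q" by (rule powr_realpow[OF d(1)])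
      then have "I \<le> (\<delta>\<^sup>2 / 12) powr (real (Suc q))" using k unfolding I_def by (simp only:)
      also have "\<dots> \<le> (\<delta>\<^sup>2 / 12) powr p" using d p by (intro powr_mono') auto
      finally show "I \<le> (\<delta>\<^sup>2 / 12) powr p" .
    qed simp
    also have "\<dots> = \<delta> powr p"
      using assms by (subst powr_mult[symmetric]) (auto simp: power2_eq_square)
    finally show ?thesis .
  qed
  have pp: "\<Phi>' y * \<psi> y = (1 / m) * (s' y * s' y)" for y
    using \<nu> by (simp add: \<Phi>'_def \<psi>_def)
  have r4: "\<Phi>' y * \<psi> y \<ge> 0" for y unfolding pp using m by simp
  have "((\<lambda>y. \<Phi>' y * \<psi> y) has_integral (1 / m) * m) {0..1}"
    unfolding pp by (intro has_integral_mult_right im)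
  then have "((\<lambda>y. \<Phi>' y * \<psi> y) has_integral 1) {0..1}" using m by simp
  then obtain H where H: "H \<in> trig" "\<And>y. (H has_real_derivative \<Phi>' y * \<psi> y - 1) (at y)" "\<And>y. \<bar>H y\<bar> \<le> 1"
    using trig_mean_primitive[OF trig_mult[OF mem(2,3)]] r4 by blast
  have r5: "\<bar>\<Phi> y * \<psi> y\<bar> \<le> 8" for y
  proof -
    have "\<bar>\<Phi> y * \<psi> y\<bar> = s y * (\<bar>s' y\<bar> / m)" using \<nu> m s01 by (simp add: \<Phi>_def \<psi>_def abs_mult)
    also have "\<dots> \<le> 1 * (M / m)" using s01 s1 m by (intro mult_mono divide_right_mono) auto
    finally show ?thesis using Mm by simp
  qed
  have "space_profile q \<delta> \<Phi> \<Phi>' \<psi> \<psi>' H"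
    unfolding space_profile_def by (intro conjI allI impI mem der r1 r2 r3 r4 r5 H)
  then show ?thesis by blast
qed

subsection \<open>Integration over the torus\<close>

text \<open>The shifted cube is cut along the hyperplane where coordinate \<open>k\<close> equals 1;
  the protruding slice is moved back by one period and fills exactly the gap that the shift has
  left.\<close>

lemma integral_cube_translate:
  fixes F :: "real ^ 'n \<Rightarrow> real"
  assumes F: "continuous_on UNIV F" "periodic F" and s: "0 \<le> s" "s \<le> 1"
  shows "integral cube (\<lambda>x. F (x + s *\<^sub>R axis k 1)) = integral cube F"
proof -
  define e :: "real ^ 'n" where "e = axis k 1"
  define v where "v = s *\<^sub>R e"
  have e: "e \<in> Basis" "x \<bullet> e = x $ k" for x unfolding e_def by (auto simp: inner_axis)
  have per: "F (x + e) = F x" for x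
    using F(2) unfolding periodic_def e_def by (simp add: axis_def)
  have int: "F integrable_on cbox a b" for a b
    by (rule integrable_continuous) (rule continuous_on_subset[OF F(1)], simp)
  have mem: "x \<in> cbox a b \<longleftrightarrow> (a $ k \<le> x $ k \<and> x $ k \<le> b $ k) \<and> (\<forall>i. i \<noteq> k \<longrightarrow> a $ i \<le> x $ i \<and> x $ i \<le> b $ i)"
    for x a b :: "real ^ 'n" by (auto simp: mem_box_cart)
  have vk: "v $ k = s" "e $ k = 1" "\<And>i. i \<noteq> k \<Longrightarrow> v $ i = 0" "\<And>i. i \<noteq> k \<Longrightarrow> e $ i = 0"
    by (auto simp: v_def e_def axis_def)
  have s1: "cbox v (1 + v) \<inter> {x. x \<bullet> e \<le> 1} = cbox 0 1 \<inter> {x. s \<le> x \<bullet> e}"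
    using s by (auto simp: mem vk e(2))
  have s2: "cbox v (1 + v) \<inter> {x. 1 \<le> x \<bullet> e} = cbox e (1 + v)"
    using s by (auto simp: mem vk e(2))
  have s3: "cbox 0 1 \<inter> {x. x \<bullet> e \<le> s} = cbox 0 (1 + v - e)"
    using s by (auto simp: mem vk e(2))
  have "integral cube (\<lambda>x. F (x + v)) = integral (cbox v (1 + v)) F"
    using integral_shift_cbox[of v v "1 + v" F] by (simp add: cube_def)
  also have "\<dots> = integral (cbox 0 1 \<inter> {x. s \<le> x \<bullet> e}) F + integral (cbox e (1 + v)) F"
    using integral_split[OF int e(1), of v "1 + v" 1] by (simp add: s1 s2)
  also have "integral (cbox e (1 + v)) F = integral (cbox 0 (1 + v - e)) F"
    using integral_shift_cbox[of e e "1 + v" F] by (simp add: per)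
  also have "\<dots> = integral (cbox 0 1 \<inter> {x. x \<bullet> e \<le> s}) F" by (simp add: s3)
  also have "integral (cbox 0 1 \<inter> {x. s \<le> x \<bullet> e}) F + \<dots> = integral cube F"
    using integral_split[OF int e(1), of 0 1 s] by (simp add: cube_def)
  finally show ?thesis by (simp add: v_def e_def)
qed

lemma integral_cube_const [simp]: "integral cube (\<lambda>x::real^'n. c::real) = c"
proof -
  have "measure lborel (cube :: (real^'n) set) = 1"
    unfolding cube_def using content_cbox_cart[of "0::real^'n" 1] by (simp add: interval_eq_empty_cart)
  then show ?thesis by (simp add: cube_def)
qed

text \<open>Averaging the translation invariance over a full period and exchanging the integrals
  reduces integrals over the cube to integrals over closed coordinate lines. Vanishing of integrated
  derivatives and evaluation of functions of one coordinate both follow from it.\<close>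

lemma integral_cube_average:
  fixes G :: "real ^ 'n \<Rightarrow> real"
  assumes G: "continuous_on UNIV G" "periodic G"
  shows "integral cube G = integral cube (\<lambda>x. integral {0..1} (\<lambda>s. G (x + s *\<^sub>R axis k 1)))"
proof -
  have "integral cube (\<lambda>x. integral {0..1} (\<lambda>s. G (x + s *\<^sub>R axis k 1))) =
        integral {0..1} (\<lambda>s. integral cube (\<lambda>x. G (x + s *\<^sub>R axis k 1)))"
    unfolding cube_def cbox_interval[symmetric]
  proof (rule integral_swap_continuous)
    show "continuous_on (cbox (0, 0) (1, 1)) (\<lambda>(x, s::real). G (x + s *\<^sub>R axis k 1))"
      unfolding split_beta
      by (rule continuous_on_compose2[OF G(1)]) (auto intro!: continuous_intros)
  qed
  also have "\<dots> = integral {0..1::real} (\<lambda>s. integral cube G)"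
    by (rule integral_cong) (auto intro!: integral_cube_translate G)
  finally show ?thesis by simp
qed

lemma integral_cube_derivative:
  fixes F G :: "real ^ 'n \<Rightarrow> real"
  assumes F: "periodic F" and G: "continuous_on UNIV G" "periodic G"
    and d: "\<And>x s. ((\<lambda>s. F (x + s *\<^sub>R axis k 1)) has_real_derivative G (x + s *\<^sub>R axis k 1)) (at s)"
  shows "integral cube G = 0"
proof -
  have "integral {0..1} (\<lambda>s. G (x + s *\<^sub>R axis k 1)) = 0" for x
  proof -
    have "((\<lambda>s. G (x + s *\<^sub>R axis k 1)) has_integral F (x + 1 *\<^sub>R axis k 1) - F (x + 0 *\<^sub>R axis k 1)) {0..1}"
      by (intro fundamental_theorem_of_calculus)
        (auto simp: has_real_derivative_iff_has_vector_derivative[symmetric]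
          intro!: has_field_derivative_at_within d)
    moreover have "F (x + axis k 1) = F x" using F unfolding periodic_def by (simp add: axis_def)
    ultimately show ?thesis by (simp add: integral_unique)
  qed
  then show ?thesis using integral_cube_average[OF G, of k] by simp
qed

text \<open>The increment of a primitive over a unit interval does not depend on where the interval
  starts, because its derivative in the starting point vanishes by periodicity. An integer frequency
  therefore leaves the mean unchanged.\<close>

lemma periodic_scaled_integral:
  fixes f :: "real \<Rightarrow> real"
  assumes f: "continuous_on UNIV f" "\<And>y. f (y + 1) = f y" and m: "m > 0"
  shows "((\<lambda>s. f (real m * (c + s))) has_integral integral {0..1} f) {0..1}"
    "(f has_integral real m * integral {0..1} f) {0..real m}"
proof -
  have "\<exists>F. \<forall>x::real. -\<infinity> < ereal x \<longrightarrow> ereal x < \<infinity> \<longrightarrow> (F has_vector_derivative f x) (at x)"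
    by (rule einterval_antiderivative) (use f in \<open>simp_all add: continuous_on_eq_continuous_at\<close>)
  then obtain F where F: "(F has_real_derivative f x) (at x)" for x
    by (auto simp: has_real_derivative_iff_has_vector_derivative)
  have ftc: "(f has_integral F b - F a) {a..b}" if "a \<le> b" for a b
    using that by (intro fundamental_theorem_of_calculus)
      (auto simp: has_real_derivative_iff_has_vector_derivative[symmetric] intro!: has_field_derivative_at_within F)
  define J where "J = integral {0..1} f"
  have J: "J = F 1 - F 0" unfolding J_def using ftc[of 0 1] by (simp add: integral_unique)
  have "((\<lambda>y. F (y + 1) - F y) has_real_derivative 0) (at x)" for x
  proof -
    have "((\<lambda>y. F (y + 1)) has_real_derivative f (x + 1) * 1) (at x)"
      by (rule DERIV_chain2[OF F]) (auto intro!: derivative_eq_intros)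
    from DERIV_diff[OF this F[of x]] show ?thesis by (simp add: f)
  qed
  then have "\<forall>x y. F (x + 1) - F x = F (y + 1) - F y" using DERIV_isconst_all by blast
  then have step: "F (x + 1) = F x + J" for x unfolding J by (metis add_0 add.commute diff_add_cancel)
  have Fm: "F (x + real m) = F x + real m * J" for x m
  proof (induction m)
    case (Suc m)
    show ?case using step[of "x + real m"] Suc by (simp add: algebra_simps)
  qed simp
  show "(f has_integral real m * integral {0..1} f) {0..real m}"
    using ftc[of 0 "real m"] Fm[of 0 m] by (simp add: J_def)
  have "((\<lambda>s. f (real m * (c + s))) has_integral F (real m * (c + 1)) / real m - F (real m * (c + 0)) / real m) {0..1}"
  proof (rule fundamental_theorem_of_calculus)
    fix s :: real
    have "((\<lambda>s. F (real m * (c + s)) / real m) has_real_derivative (f (real m * (c + s)) * real m) / real m) (at s)"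
      by (intro DERIV_cdivide DERIV_chain2[OF F]) (auto intro!: derivative_eq_intros)
    then have "((\<lambda>s. F (real m * (c + s)) / real m) has_real_derivative f (real m * (c + s))) (at s)"
      using m by simp
    then show "((\<lambda>s. F (real m * (c + s)) / real m) has_vector_derivative f (real m * (c + s))) (at s within {0..1})"
      by (simp add: has_real_derivative_iff_has_vector_derivative[symmetric] has_field_derivative_at_within)
  qed simp
  moreover have "F (real m * (c + 1)) / real m - F (real m * (c + 0)) / real m = J"
    using Fm[of "real m * c" m] m by (simp add: algebra_simps add_divide_distrib)
  ultimately show "((\<lambda>s. f (real m * (c + s))) has_integral integral {0..1} f) {0..1}"
    by (simp only: J_def)
qed

lemma integral_cube_coordinate:
  fixes f :: "real \<Rightarrow> real"
  assumes f: "continuous_on UNIV f" "\<And>y. f (y + 1) = f y" and m: "m > 0"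
  shows "integral cube (\<lambda>x::real^'n. f (real m * x $ k)) = integral {0..1} f"
proof -
  have fp: "f (y + of_int j) = f y" for y j
  proof (induction j rule: int_induct[where k=0])
    case (step1 i) then show ?case using f(2)[of "y + of_int i"] by (simp add: algebra_simps)
  next
    case (step2 i) then show ?case using f(2)[of "y + of_int i - 1"] by (simp add: algebra_simps)
  qed simp
  have "periodic (\<lambda>x::real^'n. f (real m * x $ k))"
    unfolding periodic_def
  proof (intro allI impI)
    fix x v :: "real ^ 'n" assume "\<forall>i. v $ i \<in> \<int>"
    then obtain j where j: "v $ k = of_int j" by (metis Ints_cases)
    show "f (real m * (x + v) $ k) = f (real m * x $ k)"
      using fp[of "real m * x $ k" "int m * j"] j by (simp add: algebra_simps)
  qed
  moreover have "continuous_on UNIV (\<lambda>x::real^'n. f (real m * x $ k))"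
    by (rule continuous_on_compose2[OF f(1)]) (auto intro!: continuous_intros)
  ultimately have "integral cube (\<lambda>x::real^'n. f (real m * x $ k)) =
     integral cube (\<lambda>x::real^'n. integral {0..1} (\<lambda>s. f (real m * (x + s *\<^sub>R axis k 1) $ k)))"
    by (rule integral_cube_average[rotated])
  also have "\<dots> = integral cube (\<lambda>x::real^'n. integral {0..1} f)"
    by (rule integral_cong)
      (use integral_unique[OF periodic_scaled_integral(1)[OF f m]] in \<open>simp add: axis_def\<close>)
  finally show ?thesis by simp
qed

text \<open>The frequency \<open>real m / T\<close> fits exactly \<open>m\<close> periods into
  \<open>[0,T]\<close>, so no incomplete period is left over; this is why the algebra admits real
  frequencies in time.\<close>

lemma integral_time_scaled:
  fixes f :: "real \<Rightarrow> real"
  assumes f: "continuous_on UNIV f" "\<And>y. f (y + 1) = f y" and m: "m > 0" and T: "T > 0"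
  shows "integral {0..T} (\<lambda>t. f (real m / T * t)) = T * integral {0..1} f"
proof -
  have "((\<lambda>t. f (real m / T * t + 0)) has_integral (1 / \<bar>real m / T\<bar>) *\<^sub>R (real m * integral {0..1} f))
     ((\<lambda>x. (1 / (real m / T)) *\<^sub>R x + - ((1 / (real m / T)) *\<^sub>R 0)) ` cbox 0 (real m))"
    using has_integral_affinity[of f "real m * integral {0..1} f" 0 "real m" "real m / T" 0]
      periodic_scaled_integral(2)[OF f m] m T by simp
  moreover have "(\<lambda>x. (1 / (real m / T)) *\<^sub>R x + - ((1 / (real m / T)) *\<^sub>R 0)) ` cbox 0 (real m) = {0..T}"
    using m T by (auto simp: image_iff field_simps intro!: bexI[where x="real m / T * _"])
  ultimately show ?thesis using m T by (simp add: integral_unique)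
qed

subsection \<open>Space-time integrals of continuous functions\<close>

definition jcont :: "(real \<Rightarrow> real ^ 'n \<Rightarrow> real) \<Rightarrow> bool" where
  "jcont f \<longleftrightarrow> continuous_on UNIV (\<lambda>(t, x). f t x)"

text \<open>A gauge integral over a box in space-time: for continuous integrands it can be iterated
  in either order by the continuous Fubini theorem. The connection with Lebesgue integrals is made
  when limits are taken.\<close>

definition stint :: "real \<Rightarrow> (real \<Rightarrow> real ^ 'n \<Rightarrow> real) \<Rightarrow> real" where
  "stint T f = integral (cbox (0, 0) (T, 1)) (\<lambda>(t, x). f t x)"

lemma jcont_alg: "F \<in> alg \<Longrightarrow> jcont F"
  unfolding jcont_def by (rule alg_continuous)

lemma jcont_intros:
  "jcont f \<Longrightarrow> jcont g \<Longrightarrow> jcont (\<lambda>t x. f t x + g t x)"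
  "jcont f \<Longrightarrow> jcont g \<Longrightarrow> jcont (\<lambda>t x. f t x - g t x)"
  "jcont f \<Longrightarrow> jcont g \<Longrightarrow> jcont (\<lambda>t x. f t x * g t x)"
  "jcont f \<Longrightarrow> jcont (\<lambda>t x. - f t x)"
  "jcont f \<Longrightarrow> jcont (\<lambda>t x. \<bar>f t x\<bar>)"
  "jcont (\<lambda>t x. c)"
  "continuous_on UNIV a \<Longrightarrow> jcont (\<lambda>t x. a t)"
  "continuous_on UNIV b \<Longrightarrow> jcont (\<lambda>t x. b x)"
  unfolding jcont_def split_beta
  by (auto intro!: continuous_intros elim!: continuous_on_compose2)

lemma jcont_section: assumes "jcont f" shows "continuous_on S (f t)" "continuous_on R (\<lambda>t. f t x)"
proof -
  have c: "continuous_on UNIV (\<lambda>z. f (fst z) (snd z))" using assms unfolding jcont_def split_beta .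
  show "continuous_on S (f t)"
    using continuous_on_compose2[OF c continuous_on_Pair[OF continuous_on_const continuous_on_id]] by simp
  show "continuous_on R (\<lambda>t. f t x)"
    using continuous_on_compose2[OF c continuous_on_Pair[OF continuous_on_id continuous_on_const]] by simp
qed

lemma jcont_integrable: "jcont f \<Longrightarrow> (\<lambda>(t, x). f t x) integrable_on cbox a b"
  unfolding jcont_def by (rule integrable_continuous) (erule continuous_on_subset, simp)

lemmas jcont_integrable' = jcont_integrable[unfolded split_beta]

lemma jcont_integral_cube: "jcont f \<Longrightarrow> continuous_on S (\<lambda>t. integral cube (f t))"
  unfolding cube_def jcont_def
  by (rule integral_continuous_on_param) (erule continuous_on_subset, simp)

lemma stint_add: "jcont f \<Longrightarrow> jcont g \<Longrightarrow> stint T (\<lambda>t x. f t x + g t x) = stint T f + stint T g"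
  unfolding stint_def split_beta
  by (rule integral_add) (auto intro: jcont_integrable')

lemma stint_diff: "jcont f \<Longrightarrow> jcont g \<Longrightarrow> stint T (\<lambda>t x. f t x - g t x) = stint T f - stint T g"
  unfolding stint_def split_beta
  by (rule integral_diff) (auto intro: jcont_integrable')

lemma stint_cmult: "stint T (\<lambda>t x. c * f t x) = c * stint T f"
  unfolding stint_def split_beta by simp

lemma stint_mono:
  assumes "jcont f" "jcont g" "\<And>t x. t \<in> {0..T} \<Longrightarrow> f t x \<le> g t x"
  shows "stint T f \<le> stint T g"
  unfolding stint_def split_beta
proof (rule integral_le)
  show "f (fst z) (snd z) \<le> g (fst z) (snd z)" if "z \<in> cbox (0, 0) (T, 1)" for z
    using that assms(3) by (cases z) (auto simp: cbox_Pair_eq)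
qed (intro jcont_integrable' assms)+

lemma stint_iter: "jcont f \<Longrightarrow> stint T f = integral {0..T} (\<lambda>t. integral cube (f t))"
  unfolding stint_def cube_def jcont_def cbox_interval[symmetric]
  by (subst integral_prod_continuous) (auto elim: continuous_on_subset)

lemma stint_swap: "jcont f \<Longrightarrow> stint T f = integral cube (\<lambda>x. integral {0..T} (\<lambda>t. f t x))"
  unfolding stint_iter unfolding cube_def jcont_def cbox_interval[symmetric]
  by (rule integral_swap_continuous) (auto elim: continuous_on_subset)

lemma stint_abs_add:
  assumes "jcont f" "jcont g"
  shows "stint T (\<lambda>t x. \<bar>f t x + g t x\<bar>) \<le> stint T (\<lambda>t x. \<bar>f t x\<bar>) + stint T (\<lambda>t x. \<bar>g t x\<bar>)"
  by (subst stint_add[symmetric]) (auto intro!: stint_mono jcont_intros assms)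

lemma stint_abs_diff:
  assumes "jcont f" "jcont g"
  shows "stint T (\<lambda>t x. \<bar>f t x - g t x\<bar>) \<le> stint T (\<lambda>t x. \<bar>f t x\<bar>) + stint T (\<lambda>t x. \<bar>g t x\<bar>)"
  by (subst stint_add[symmetric]) (auto intro!: stint_mono jcont_intros assms)

lemma stint_prod:
  assumes "continuous_on UNIV a" "continuous_on UNIV b"
  shows "stint T (\<lambda>t x. a t * b x) = integral {0..T} a * integral cube b"
  by (subst stint_iter) (auto intro!: jcont_intros assms)

lemma stint_prod_bound:
  assumes "jcont f" "continuous_on UNIV a" "continuous_on UNIV b"
    "\<And>t x. t \<in> {0..T} \<Longrightarrow> \<bar>f t x\<bar> \<le> a t * b x"
  shows "stint T (\<lambda>t x. \<bar>f t x\<bar>) \<le> integral {0..T} a * integral cube b"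
  unfolding stint_prod[OF assms(2,3), symmetric]
  by (intro stint_mono jcont_intros assms)

lemma stint_time_bound:
  assumes "jcont f" "continuous_on UNIV a" "\<And>t x. t \<in> {0..T} \<Longrightarrow> \<bar>f t x\<bar> \<le> a t"
  shows "stint T (\<lambda>t x. \<bar>f t x\<bar>) \<le> integral {0..T} a"
  using stint_prod_bound[OF assms(1,2) continuous_on_const[of _ 1], of T] assms(3) by simp

lemma stint_Dx: assumes "F \<in> alg" shows "stint T (Dx k F) = 0"
proof -
  have "integral cube (Dx k F t) = 0" for t
    by (rule integral_cube_derivative[of "F t" _ k])
      (auto intro!: alg_periodic assms alg_Dx jcont_section jcont_alg alg_Dx_line)
  then show ?thesis by (simp add: stint_iter jcont_alg alg_Dx assms)
qed

text \<open>In contrast to space, the time interval is not a closed circle for elements of the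
  algebra, so the two end values survive and have to be estimated.\<close>

lemma stint_Dt: assumes "F \<in> alg" "T \<ge> 0" shows "stint T (Dt F) = integral cube (\<lambda>x. F T x - F 0 x)"
proof -
  have "integral {0..T} (\<lambda>t. Dt F t x) = F T x - F 0 x" for x
    using assms by (intro integral_unique fundamental_theorem_of_calculus)
      (auto simp: has_real_derivative_iff_has_vector_derivative[symmetric]
          intro!: has_field_derivative_at_within alg_Dt)
  then show ?thesis by (simp add: stint_swap jcont_alg alg_Dt assms)
qed

lemma trig_periodic1: "f \<in> trig \<Longrightarrow> f (y + 1) = f y"
  using trig_periodic[of f y 1] by simp

lemma alg_space_nat: "f \<in> trig \<Longrightarrow> (\<lambda>t x. f (real m * x $ k)) \<in> alg"
  using alg_space[of f "int m" k] by simp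

lemma Dx_space_nat:
  assumes "f \<in> trig" "\<And>y. (f has_real_derivative f' y) (at y)"
  shows "Dx k (\<lambda>t x. f (real m * x $ l)) = (\<lambda>t x. if k = l then real m * f' (real m * x $ l) else 0)"
  using Dx_space[OF assms, of k "int m" l] by (simp only: of_int_of_nat_eq)

subsection \<open>The perturbation step\<close>

text \<open>A nonnegative profile of mean 1 whose oscillating part has a bounded primitive. Both the
  time weight \<open>\<Gamma> g\<close> and the space weight \<open>P' Q\<close> are of this kind,
  however concentrated they are.\<close>

definition osc :: "(real \<Rightarrow> real) \<Rightarrow> (real \<Rightarrow> real) \<Rightarrow> bool" where
  "osc F H \<longleftrightarrow> F \<in> trig \<and> H \<in> trig \<and> (\<forall>y. F y \<ge> 0) \<and>
     (\<forall>y. (H has_real_derivative F y - 1) (at y)) \<and> (\<forall>y. \<bar>H y\<bar> \<le> 1)"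

lemma osc_mean: assumes "osc F H" shows "integral {0..1} F = 1"
proof -
  have "((\<lambda>y. F y - 1) has_integral H 1 - H 0) {0..1}"
    using assms by (intro has_integral_deriv) (auto simp: osc_def)
  moreover have "H 1 = H 0" using assms trig_periodic1[of H 0] by (auto simp: osc_def)
  ultimately have "((\<lambda>y. F y - 1) has_integral 0) {0..1}" by simp
  from has_integral_add[OF this has_integral_const_real[of 1 0 1]] show ?thesis
    by (simp add: integral_unique)
qed

lemma integral_trig_time:
  assumes "f \<in> trig" "m > 0" "T > 0"
  shows "integral {0..T} (\<lambda>t. f (real m / T * t)) = T * integral {0..1} f"
    "integral {0..T} (\<lambda>t. \<bar>f (real m / T * t)\<bar>) = T * integral {0..1} (\<lambda>y. \<bar>f y\<bar>)"
  using assms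
  by (intro integral_time_scaled integral_time_scaled[of "\<lambda>y. \<bar>f y\<bar>" m T];
      auto simp: trig_periodic1 trig_continuous intro!: continuous_on_rabs)+

lemma alg_polynomial:
  assumes "real_polynomial_function p" "F \<in> alg" shows "(\<lambda>t x. p (F t x)) \<in> alg"
  using assms(1)
proof (induction rule: real_polynomial_function.induct)
  case (linear f)
  have "f y = f 1 * y" for y using bounded_linear.linear[OF linear] linear_cmul[of f y 1] by simp
  then have "(\<lambda>t x. f (F t x)) = (\<lambda>t x. f 1 * F t x)" by (intro ext)
  then show ?case using alg_mult[OF alg_const[of "f 1"] assms(2)] by (simp only:)
qed (auto intro: alg_intros)

text \<open>
  Since \<open>\<bar>A\<bar>\<close> is not in the algebra, it is replaced by a polynomial in \<open>A\<close> that majorises it; the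
  oscillating parts of the weights are then integrated by parts.
\<close>

lemma oscillation_bound:
  fixes A :: "real \<Rightarrow> real ^ 'n \<Rightarrow> real"
  assumes A: "A \<in> alg" and T: "T > 0" and \<eta>: "\<eta> > 0"
  shows "\<exists>K\<ge>0. \<forall>m F1 H1 F2 H2. m > 0 \<longrightarrow> osc F1 H1 \<longrightarrow> osc F2 H2 \<longrightarrow>
    stint T (\<lambda>t x. \<bar>A t x * (F1 (real m / T * t) * F2 (real m * x $ j))\<bar>) \<le>
    stint T (\<lambda>t x. \<bar>A t x\<bar>) + \<eta> + K / real m"
proof -
  obtain M where M: "M \<ge> 0" "\<And>t x. t \<in> {0..T} \<Longrightarrow> \<bar>A t x\<bar> \<le> M" using alg_bounded[OF A, of T] by blast
  \<comment> \<open>Raising the approximating polynomial by \<open>e\<close> makes it a majorant of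
    \<open>|A|\<close>; it exceeds \<open>|A|\<close> by at most \<open>2 * e\<close>, which
    integrates to \<open>\<eta>\<close> over a slab of volume \<open>T\<close>.\<close>
  define e where "e = \<eta> / (2 * T)"
  have e: "e > 0" unfolding e_def using T \<eta> by simp
  have "continuous_on {-M..M} (\<lambda>z. \<bar>z\<bar>)" by (intro continuous_intros)
  from Stone_Weierstrass_real_polynomial_function[OF compact_Icc this e]
  obtain p where p: "real_polynomial_function p" "\<And>z. z \<in> {-M..M} \<Longrightarrow> \<bar>\<bar>z\<bar> - p z\<bar> < e"
    by blast
  define S where "S t x = p (A t x) + e" for t x
  have S: "S \<in> alg" unfolding S_def by (rule alg_add[OF alg_polynomial[OF p(1) A] alg_const])
  have SA: "\<bar>A t x\<bar> \<le> S t x" "S t x \<le> \<bar>A t x\<bar> + 2 * e" if "t \<in> {0..T}" for t x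
    using p(2)[of "A t x"] M(2)[OF that, of x] unfolding S_def by (auto simp: abs_le_iff) 
  obtain M0 where M0: "M0 \<ge> 0" "\<And>t x. t \<in> {0..T} \<Longrightarrow> \<bar>S t x\<bar> \<le> M0" using alg_bounded[OF S, of T] by blast
  obtain M1 where M1: "M1 \<ge> 0" "\<And>t x. t \<in> {0..T} \<Longrightarrow> \<bar>Dt S t x\<bar> \<le> M1"
    using alg_bounded[OF alg_Dt(1)[OF S], of T] by blast
  obtain M2 where M2: "M2 \<ge> 0" "\<And>t x. t \<in> {0..T} \<Longrightarrow> \<bar>Dx j S t x\<bar> \<le> M2"
    using alg_bounded[OF alg_Dx(1)[OF S], of T] by blast
  \<comment> \<open>The summands come from the two end values in time, from \<open>Dt S\<close> and
    from \<open>Dx j S\<close>. None of them involves the profiles: \<open>K\<close> has to be known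
    before the concentration is chosen.\<close>
  define K where "K = 2 * M0 * T + M1 * T * T + M2 * T"
  show ?thesis
  proof (intro exI[of _ K] conjI allI impI)
    show "K \<ge> 0" unfolding K_def using M0 M1 M2 T by auto
    fix m :: nat and F1 H1 F2 H2
    assume m: "m > 0" and o1: "osc F1 H1" and o2: "osc F2 H2"
    define \<tau> where "\<tau> = real m / T"
    have \<tau>: "\<tau> > 0" unfolding \<tau>_def using m T by simp
    define f where "f t x = F1 (\<tau> * t)" for t and x :: "real ^ 'n"
    define h where "h t x = H1 (\<tau> * t) / \<tau>" for t and x :: "real ^ 'n"
    define g where "g t x = F2 (real m * x $ j)" for t :: real and x :: "real ^ 'n"
    define k where "k t x = H2 (real m * x $ j) / real m" for t :: real and x :: "real ^ 'n"
    have tr: "F1 \<in> trig" "H1 \<in> trig" "F2 \<in> trig" "H2 \<in> trig" using o1 o2 by (auto simp: osc_def)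
    have alg: "f \<in> alg" "h \<in> alg" "g \<in> alg" "k \<in> alg"
      unfolding f_def h_def g_def k_def
      using alg_time[OF tr(1)] alg_divide[OF alg_time[OF tr(2)]] alg_space_nat[OF tr(3)]
        alg_divide[OF alg_space_nat[OF tr(4)]] by this+
    have fpos: "f t x \<ge> 0" "g t x \<ge> 0" for t x unfolding f_def g_def using o1 o2 by (auto simp: osc_def)
    have hb: "\<bar>h t x\<bar> \<le> T / real m" for t x
    proof -
      have "\<bar>h t x\<bar> = \<bar>H1 (\<tau> * t)\<bar> / \<tau>" using \<tau> by (simp add: h_def)
      also have "\<dots> \<le> 1 / \<tau>" using o1 \<tau> by (intro divide_right_mono) (auto simp: osc_def)
      finally show ?thesis by (simp add: \<tau>_def)
    qed
    have kb: "\<bar>k t x\<bar> \<le> 1 / real m" for t x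
      using o2 m by (auto simp: osc_def k_def divide_right_mono abs_divide)
    have Dh: "Dt h = (\<lambda>t x. f t x - 1)"
    proof -
      have "Dt h = (\<lambda>t x. (\<tau> * (F1 (\<tau> * t) - 1)) / \<tau>)"
        unfolding h_def Dt_simps(4)[OF alg_time[OF tr(2)]] using o1
        by (subst Dt_time[of H1]) (auto simp: osc_def)
      then show ?thesis using \<tau> by (simp add: f_def)
    qed
    have Dk: "Dx j k = (\<lambda>t x. g t x - 1)"
    proof -
      have "Dx j k = (\<lambda>t x. (real m * (F2 (real m * x $ j) - 1)) / real m)"
        unfolding k_def Dx_simps(4)[OF alg_space_nat[OF tr(4)]] using o2
        by (subst Dx_space_nat[OF tr(4)]) (auto simp: osc_def)
      then show ?thesis using m by (simp add: g_def)
    qed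
    have Df: "Dx j f = (\<lambda>t x. 0)" unfolding f_def by simp
    have intf: "integral {0..T} (\<lambda>t. F1 (\<tau> * t)) = T"
      using integral_trig_time(1)[of F1 m T] o1 m T osc_mean[OF o1] by (simp add: osc_def \<tau>_def)
    have cf: "continuous_on UNIV (\<lambda>t. F1 (\<tau> * t))"
      by (rule trig_continuous2[OF tr(1)]) (intro continuous_intros)
    have c1: "stint T (\<lambda>t x. S t x * (f t x - 1)) \<le> (2 * M0 * T + M1 * T * T) / real m"
    proof -
      have "(\<lambda>t x. S t x * (f t x - 1)) = (\<lambda>t x. Dt (\<lambda>t x. S t x * h t x) t x - Dt S t x * h t x)"
        using S alg by (simp add: Dt_simps Dh)
      then have e1: "stint T (\<lambda>t x. S t x * (f t x - 1)) =
         stint T (Dt (\<lambda>t x. S t x * h t x)) - stint T (\<lambda>t x. Dt S t x * h t x)"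
        by (simp only:) (intro stint_diff jcont_alg alg_mult alg_Dt S alg)
      have "stint T (Dt (\<lambda>t x. S t x * h t x)) = integral cube (\<lambda>x. S T x * h T x - S 0 x * h 0 x)"
        using T by (intro stint_Dt alg_mult S alg) auto
      also have "\<dots> \<le> integral cube (\<lambda>x::real^'n. 2 * M0 * (T / real m))"
      proof (rule integral_le)
        show "(\<lambda>x. S T x * h T x - S 0 x * h 0 x) integrable_on cube" unfolding cube_def
          by (intro integrable_continuous continuous_intros jcont_section(1) jcont_alg S alg)
        show "(\<lambda>x. 2 * M0 * (T / real m)) integrable_on (cube::(real^'n) set)" unfolding cube_def
          by (intro integrable_continuous continuous_intros)
        fix x
        have "\<bar>S s x * h s x\<bar> \<le> M0 * (T / real m)" if "s \<in> {0..T}" for s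
          unfolding abs_mult using M0 hb that by (intro mult_mono) auto
        from this[of T] this[of 0] T show "S T x * h T x - S 0 x * h 0 x \<le> 2 * M0 * (T / real m)" by auto
      qed
      finally have e2: "stint T (Dt (\<lambda>t x. S t x * h t x)) \<le> 2 * M0 * (T / real m)" by simp
      have "- stint T (\<lambda>t x. Dt S t x * h t x) \<le> M1 * (T / real m) * T"
      proof -
        have "- stint T (\<lambda>t x. Dt S t x * h t x) = stint T (\<lambda>t x. (-1) * (Dt S t x * h t x))"
          by (subst stint_cmult) simp
        also have "\<dots> \<le> stint T (\<lambda>t x. \<bar>Dt S t x * h t x\<bar>)"
          by (intro stint_mono jcont_intros jcont_alg alg_Dt S alg) auto
        also have "\<dots> \<le> integral {0..T} (\<lambda>t. M1 * (T / real m))"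
        proof (rule stint_time_bound)
          show "\<bar>Dt S t x * h t x\<bar> \<le> M1 * (T / real m)" if "t \<in> {0..T}" for t x
            unfolding abs_mult using M1 hb that by (intro mult_mono) auto
        qed (intro jcont_alg alg_mult alg_Dt S alg continuous_on_const)+
        finally show ?thesis using T by (simp add: algebra_simps)
      qed
      with e1 e2 have "stint T (\<lambda>t x. S t x * (f t x - 1)) \<le> 2 * M0 * (T / real m) + M1 * (T / real m) * T" by linarith
      also have "\<dots> = (2 * M0 * T + M1 * T * T) / real m" by (simp add: add_divide_distrib)
      finally show ?thesis .
    qed
    have c2: "stint T (\<lambda>t x. S t x * f t x * (g t x - 1)) \<le> (M2 * T) / real m"
    proof -
      have "(\<lambda>t x. S t x * f t x * (g t x - 1)) =
         (\<lambda>t x. Dx j (\<lambda>t x. S t x * f t x * k t x) t x - Dx j S t x * f t x * k t x)"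
        using S alg by (simp add: Dx_simps Dk Df alg_intros)
      then have "stint T (\<lambda>t x. S t x * f t x * (g t x - 1)) =
         stint T (Dx j (\<lambda>t x. S t x * f t x * k t x)) - stint T (\<lambda>t x. Dx j S t x * f t x * k t x)"
        by (simp only:) (intro stint_diff jcont_alg alg_mult alg_Dx S alg)
      also have "stint T (Dx j (\<lambda>t x. S t x * f t x * k t x)) = 0"
        by (intro stint_Dx alg_mult S alg)
      also have "0 - stint T (\<lambda>t x. Dx j S t x * f t x * k t x) \<le> M2 * T / real m"
      proof -
        have "0 - stint T (\<lambda>t x. Dx j S t x * f t x * k t x) = stint T (\<lambda>t x. (-1) * (Dx j S t x * f t x * k t x))"
          by (subst stint_cmult) simp
        also have "\<dots> \<le> stint T (\<lambda>t x. \<bar>Dx j S t x * f t x * k t x\<bar>)"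
          by (intro stint_mono jcont_intros jcont_alg alg_Dx S alg) auto
        also have "\<dots> \<le> integral {0..T} (\<lambda>t. M2 / real m * F1 (\<tau> * t))"
        proof (rule stint_time_bound)
          show "continuous_on UNIV (\<lambda>t. M2 / real m * F1 (\<tau> * t))" by (intro continuous_on_mult cf continuous_on_const)
          fix t x assume t: "t \<in> {0..T}"
          have "\<bar>Dx j S t x * f t x * k t x\<bar> \<le> M2 * f t x * (1 / real m)"
            unfolding abs_mult using M2(2)[OF t, of x] kb[of t x] fpos(1)[of t x] M2(1)
            by (intro mult_mono) auto
          then show "\<bar>Dx j S t x * f t x * k t x\<bar> \<le> M2 / real m * F1 (\<tau> * t)" by (simp add: f_def)
        qed (intro jcont_alg alg_mult alg_Dx S alg)
        also have "\<dots> = M2 / real m * T" using intf by simp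
        finally show ?thesis by simp
      qed
      finally show ?thesis .
    qed
    have c0: "stint T S \<le> stint T (\<lambda>t x. \<bar>A t x\<bar>) + \<eta>"
    proof -
      have "stint T S \<le> stint T (\<lambda>t x. \<bar>A t x\<bar> + 2 * e)"
        using SA by (intro stint_mono jcont_intros jcont_alg S A) auto
      also have "\<dots> = stint T (\<lambda>t x. \<bar>A t x\<bar>) + stint T (\<lambda>(t::real) (x::real^'n). 2 * e)"
        by (intro stint_add jcont_intros jcont_alg A)
      also have "stint T (\<lambda>(t::real) (x::real^'n). 2 * e) = \<eta>"
        using T by (subst stint_iter) (auto intro!: jcont_intros simp: e_def)
      finally show ?thesis .
    qed
    have "stint T (\<lambda>t x. \<bar>A t x * (f t x * g t x)\<bar>) \<le> stint T (\<lambda>t x. S t x * (f t x * g t x))"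
    proof (rule stint_mono)
      fix t x assume "t \<in> {0..T}"
      then show "\<bar>A t x * (f t x * g t x)\<bar> \<le> S t x * (f t x * g t x)"
        using SA(1)[of t x] fpos[of t x] by (simp add: abs_mult mult_right_mono)
    qed (intro jcont_intros jcont_alg S A alg)+
    \<comment> \<open>Passing from \<open>f * g\<close> to 1 through \<open>f\<close> separates the
      two oscillations. In the last term \<open>f\<close> may be arbitrarily high, but it is
      independent of \<open>x\<close> and has mean 1, so the integration by parts in space does not
      see its height.\<close>
    also have "(\<lambda>t x. S t x * (f t x * g t x)) = (\<lambda>t x. (S t x + S t x * (f t x - 1)) + S t x * f t x * (g t x - 1))"
      by (simp add: algebra_simps)
    also have "stint T \<dots> = stint T S + stint T (\<lambda>t x. S t x * (f t x - 1)) + stint T (\<lambda>t x. S t x * f t x * (g t x - 1))"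
      by (subst stint_add, (intro jcont_alg alg_intros S alg)+)
         (subst stint_add, (intro jcont_alg alg_intros S alg)+, simp)
    also have "\<dots> \<le> stint T (\<lambda>t x. \<bar>A t x\<bar>) + \<eta> + K / real m"
      using c0 c1 c2 by (simp add: K_def add_divide_distrib)
    finally show "stint T (\<lambda>t x. \<bar>A t x * (F1 (real m / T * t) * F2 (real m * x $ j))\<bar>) \<le>
      stint T (\<lambda>t x. \<bar>A t x\<bar>) + \<eta> + K / real m"
      by (simp add: f_def g_def \<tau>_def)
  qed
qed

text \<open>The field is \<open>U e\<^sub>i + V e\<^sub>j\<close>, and \<open>(A, B)\<close> is the error in the transport equation.\<close>

definition Sys :: "'n \<Rightarrow> 'n \<Rightarrow> (real \<Rightarrow> real ^ 'n \<Rightarrow> real) \<Rightarrow> (real \<Rightarrow> real ^ 'n \<Rightarrow> real) \<Rightarrow>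
    (real \<Rightarrow> real ^ 'n \<Rightarrow> real) \<Rightarrow> (real \<Rightarrow> real ^ 'n \<Rightarrow> real) \<Rightarrow> (real \<Rightarrow> real ^ 'n \<Rightarrow> real) \<Rightarrow> bool" where
  "Sys i j r U V A B \<longleftrightarrow> r \<in> alg \<and> U \<in> alg \<and> V \<in> alg \<and> A \<in> alg \<and> B \<in> alg \<and>
     (\<forall>x. r 0 x = 0) \<and> Dx i U = (\<lambda>t x. 0) \<and> Dx j V = (\<lambda>t x. 0) \<and>
     (\<forall>t x. Dt r t x + U t x * Dx i r t x + V t x * Dx j r t x = Dx i A t x + Dx j B t x)"

lemma Sys_swap: "Sys i j r U V A B \<longleftrightarrow> Sys j i r V U B A"
  unfolding Sys_def by (auto simp: algebra_simps)

text \<open>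
  \<open>\<theta>p\<close> is the principal perturbation of the density; \<open>\<theta>c\<close> removes the part of the product that
  oscillates in time only, with \<open>h\<close> a primitive of \<open>\<Gamma> g - 1\<close>, and \<open>Hs\<close> is a primitive of \<open>P' Q - 1\<close>.
\<close>

lemma perturbed_system:
  assumes sys: "Sys i j r U V A B" and ij: "i \<noteq> j"
    and alg: "\<Gamma> \<in> alg" "\<Gamma>' \<in> alg" "g \<in> alg" "h \<in> alg" "P \<in> alg" "P' \<in> alg" "Q \<in> alg" "Q' \<in> alg" "Hs \<in> alg"
    and D: "Dt \<Gamma> = \<Gamma>'" "\<And>k. Dx k \<Gamma> = (\<lambda>t x. 0)" "\<And>k. Dx k \<Gamma>' = (\<lambda>t x. 0)" "\<And>k. Dx k g = (\<lambda>t x. 0)"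
      "\<And>k. Dx k h = (\<lambda>t x. 0)" "Dt h = (\<lambda>t x. \<Gamma> t x * g t x - 1)"
      "Dt P = (\<lambda>t x. 0)" "Dt P' = (\<lambda>t x. 0)"
      "Dx j P = P'" "Dx i P = (\<lambda>t x. 0)" "Dx i P' = (\<lambda>t x. 0)"
      "Dx i Q = (\<lambda>t x. 0)" "Dx i Hs = (\<lambda>t x. 0)" "Dx j Hs = (\<lambda>t x. P' t x * Q t x - 1)"
    and z: "\<And>x. \<Gamma> 0 x = 0" "\<And>x. h 0 x = 0"
    and \<theta>p: "\<theta>p = (\<lambda>t x. - (\<Gamma> t x * (Dx j A t x * P t x + A t x * P' t x)))"
    and \<theta>c: "\<theta>c = (\<lambda>t x. h t x * Dx i A t x)"
    and w: "w = (\<lambda>t x. g t x * Q t x)"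
    and A': "A' = (\<lambda>t x. h t x * Dt A t x + \<Gamma> t x * g t x * Dx j A t x * (Hs t x - P t x * Q t x)
        + U t x * (\<theta>p t x + \<theta>c t x) + w t x * (r t x + \<theta>c t x))"
    and B': "B' = (\<lambda>t x. B t x - (\<Gamma>' t x * A t x + \<Gamma> t x * Dt A t x) * P t x
        - \<Gamma> t x * g t x * Dx i A t x * Hs t x + V t x * (\<theta>p t x + \<theta>c t x))"
  shows "Sys i j (\<lambda>t x. r t x + (\<theta>p t x + \<theta>c t x)) (\<lambda>t x. U t x + w t x) V A' B'"
proof -
  have sa: "r \<in> alg" "U \<in> alg" "V \<in> alg" "A \<in> alg" "B \<in> alg"
    and s0: "\<And>x. r 0 x = 0" and su: "Dx i U = (\<lambda>t x. 0)" "Dx j V = (\<lambda>t x. 0)"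
    and eq: "\<And>t x. Dt r t x + U t x * Dx i r t x + V t x * Dx j r t x = Dx i A t x + Dx j B t x"
    using sys unfolding Sys_def by auto
  note mem = sa alg alg_Dt(1) alg_Dx(1) alg_add alg_diff alg_mult alg_uminus
  have tp: "\<theta>p \<in> alg" and tc: "\<theta>c \<in> alg" and wa: "w \<in> alg" unfolding \<theta>p \<theta>c w by (simp_all add: mem)
  have a': "A' \<in> alg" "B' \<in> alg" unfolding A' B' using tp tc wa by (simp_all add: mem)
  note ds = Dx_simps Dt_simps mem D su Dt_Dx_commute tp tc wa Dx_Dx_commute[of A j i]
  have 1: "Dt \<theta>p = (\<lambda>t x. - (\<Gamma>' t x * (Dx j A t x * P t x + A t x * P' t x)
     + \<Gamma> t x * (Dx j (Dt A) t x * P t x + Dt A t x * P' t x)))"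
    unfolding \<theta>p by (simp add: ds)
  have 2: "Dx i \<theta>p = (\<lambda>t x. - (\<Gamma> t x * (Dx i (Dx j A) t x * P t x + Dx i A t x * P' t x)))"
    unfolding \<theta>p by (simp add: ds)
  have 3: "Dt \<theta>c = (\<lambda>t x. (\<Gamma> t x * g t x - 1) * Dx i A t x + h t x * Dx i (Dt A) t x)"
    unfolding \<theta>c by (simp add: ds)
  have 4: "Dx i w = (\<lambda>t x. 0)" unfolding w by (simp add: ds)
  have 5: "Dx i A' = (\<lambda>t x. h t x * Dx i (Dt A) t x + \<Gamma> t x * g t x * Dx i (Dx j A) t x * (Hs t x - P t x * Q t x)
        + U t x * (Dx i \<theta>p t x + Dx i \<theta>c t x) + w t x * (Dx i r t x + Dx i \<theta>c t x))"
    unfolding A' by (simp add: ds 4 del: Dx_Dx_commute)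
  have 6: "Dx j B' = (\<lambda>t x. Dx j B t x - (\<Gamma>' t x * Dx j A t x + \<Gamma> t x * Dx j (Dt A) t x) * P t x
        - (\<Gamma>' t x * A t x + \<Gamma> t x * Dt A t x) * P' t x
        - \<Gamma> t x * g t x * (Dx i (Dx j A) t x * Hs t x + Dx i A t x * (P' t x * Q t x - 1))
        + V t x * (Dx j \<theta>p t x + Dx j \<theta>c t x))"
    unfolding B' by (simp add: ds algebra_simps)
  \<comment> \<open>The cancellation: \<open>w * Dx i \<theta>p\<close> contributes
    \<open>- \<Gamma> g P' Q * Dx i A\<close> and a term with \<open>P Q\<close>. Added to the old
    error \<open>Dx i A\<close>, the first leaves \<open>- Dx i A\<close> times
    \<open>\<Gamma> g (P' Q - 1) + (\<Gamma> g - 1)\<close>. The first of these is a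
    \<open>j\<close>-derivative through \<open>Hs\<close>, up to a term that joins
    \<open>P Q\<close> in \<open>A'\<close>; the second is compensated by
    \<open>Dt \<theta>c\<close>, at the cost of \<open>h * Dt A\<close>. The time derivative of
    \<open>\<theta>p\<close> is minus the \<open>j\<close>-derivative of
    \<open>Dt (\<Gamma> A) P\<close>, and the remaining products are divergences because
    \<open>U\<close> and \<open>w\<close> do not depend on coordinate \<open>i\<close>, nor
    \<open>V\<close> on \<open>j\<close>.\<close>
  have "Dt (\<lambda>t x. r t x + (\<theta>p t x + \<theta>c t x)) t x + (U t x + w t x) * Dx i (\<lambda>t x. r t x + (\<theta>p t x + \<theta>c t x)) t x
    + V t x * Dx j (\<lambda>t x. r t x + (\<theta>p t x + \<theta>c t x)) t x = Dx i A' t x + Dx j B' t x" for t x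
  proof -
    have "Dt r t x = Dx i A t x + Dx j B t x - U t x * Dx i r t x - V t x * Dx j r t x"
      using eq[of t x] by simp
    then show ?thesis
      by (simp add: Dt_simps Dx_simps mem tp tc 1 2 3 5 6)
         (simp add: w algebra_simps)
  qed
  moreover have "(\<lambda>t x. r t x + (\<theta>p t x + \<theta>c t x)) 0 x = 0" for x using s0 z by (simp add: \<theta>p \<theta>c)
  moreover have "Dx i (\<lambda>t x. U t x + w t x) = (\<lambda>t x. 0)" by (simp add: Dx_simps sa wa su 4)
  ultimately show ?thesis unfolding Sys_def using sa tp tc wa a' su by (auto intro: alg_add)
qed

section \<open>Estimates for a single perturbation\<close>

lemma powr_sum_bound:
  fixes x y p :: real assumes "0 \<le> x" "0 \<le> y" "0 \<le> p"
  shows "(x + y) powr p \<le> 2 powr p * (x powr p + y powr p)"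
proof -
  have "(x + y) powr p \<le> (2 * max x y) powr p" using assms by (intro powr_mono2) auto
  also have "\<dots> = 2 powr p * max x y powr p" using assms by (simp add: powr_mult)
  also have "max x y powr p \<le> x powr p + y powr p" by (auto simp: max_def)
  finally show ?thesis by (simp add: mult_left_mono)
qed

lemma stint_abs_sum4:
  assumes a: "jcont a" "jcont b" "jcont c" "jcont d"
  shows "stint T (\<lambda>t x. \<bar>a t x + b t x + c t x + d t x\<bar>) \<le> stint T (\<lambda>t x. \<bar>a t x\<bar>) + stint T (\<lambda>t x. \<bar>b t x\<bar>)
      + stint T (\<lambda>t x. \<bar>c t x\<bar>) + stint T (\<lambda>t x. \<bar>d t x\<bar>)"
    "stint T (\<lambda>t x. \<bar>a t x - b t x - c t x - d t x\<bar>) \<le> stint T (\<lambda>t x. \<bar>a t x\<bar>) + stint T (\<lambda>t x. \<bar>b t x\<bar>)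
      + stint T (\<lambda>t x. \<bar>c t x\<bar>) + stint T (\<lambda>t x. \<bar>d t x\<bar>)"
    "stint T (\<lambda>t x. \<bar>a t x + b t x - c t x - d t x\<bar>) \<le> stint T (\<lambda>t x. \<bar>a t x\<bar>) + stint T (\<lambda>t x. \<bar>b t x\<bar>)
      + stint T (\<lambda>t x. \<bar>c t x\<bar>) + stint T (\<lambda>t x. \<bar>d t x\<bar>)"
proof -
  note i = jcont_intros(1,2)
  show "stint T (\<lambda>t x. \<bar>a t x + b t x + c t x + d t x\<bar>) \<le> stint T (\<lambda>t x. \<bar>a t x\<bar>) + stint T (\<lambda>t x. \<bar>b t x\<bar>)
      + stint T (\<lambda>t x. \<bar>c t x\<bar>) + stint T (\<lambda>t x. \<bar>d t x\<bar>)"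
    using stint_abs_add[OF i(1)[OF i(1)[OF a(1,2)] a(3)] a(4), of T]
      stint_abs_add[OF i(1)[OF a(1,2)] a(3), of T] stint_abs_add[OF a(1,2), of T] by linarith
  show "stint T (\<lambda>t x. \<bar>a t x - b t x - c t x - d t x\<bar>) \<le> stint T (\<lambda>t x. \<bar>a t x\<bar>) + stint T (\<lambda>t x. \<bar>b t x\<bar>)
      + stint T (\<lambda>t x. \<bar>c t x\<bar>) + stint T (\<lambda>t x. \<bar>d t x\<bar>)"
    using stint_abs_diff[OF i(2)[OF i(2)[OF a(1,2)] a(3)] a(4), of T]
      stint_abs_diff[OF i(2)[OF a(1,2)] a(3), of T] stint_abs_diff[OF a(1,2), of T] by linarith
  show "stint T (\<lambda>t x. \<bar>a t x + b t x - c t x - d t x\<bar>) \<le> stint T (\<lambda>t x. \<bar>a t x\<bar>) + stint T (\<lambda>t x. \<bar>b t x\<bar>)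
      + stint T (\<lambda>t x. \<bar>c t x\<bar>) + stint T (\<lambda>t x. \<bar>d t x\<bar>)"
    using stint_abs_diff[OF i(2)[OF i(1)[OF a(1,2)] a(3)] a(4), of T]
      stint_abs_diff[OF i(1)[OF a(1,2)] a(3), of T] stint_abs_add[OF a(1,2), of T] by linarith
qed

lemma alg_bounded_list:
  assumes "\<And>F. F \<in> set Fs \<Longrightarrow> F \<in> alg"
  shows "\<exists>M\<ge>1. \<forall>F\<in>set Fs. \<forall>t\<in>{0..T}. \<forall>x. \<bar>F t x\<bar> \<le> M"
  using assms
proof (induction Fs)
  case (Cons F Fs)
  then obtain M where M: "M \<ge> 1" "\<forall>F\<in>set Fs. \<forall>t\<in>{0..T}. \<forall>x. \<bar>F t x\<bar> \<le> M" by auto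
  obtain N where N: "N \<ge> 0" "\<forall>t\<in>{0..T}. \<forall>x. \<bar>F t x\<bar> \<le> N" using alg_bounded[of F T] Cons.prems by auto
  have "\<bar>E t x\<bar> \<le> M + N" if "E \<in> set (F # Fs)" "t \<in> {0..T}" for E t x
  proof (cases "E = F")
    case True
    then have "\<bar>E t x\<bar> \<le> N" using N that by blast
    then show ?thesis using M(1) by simp
  next
    case False
    then have "\<bar>E t x\<bar> \<le> M" using M that by auto
    then show ?thesis using N(1) by simp
  qed
  then show ?case using M(1) N(1) by (intro exI[of _ "M + N"]) auto
qed (auto intro: exI[of _ 1])

lemma alg_stint_bound:
  assumes "f \<in> alg" "continuous_on UNIV a" "\<And>t x. t \<in> {0..T} \<Longrightarrow> \<bar>f t x\<bar> \<le> a t" "integral {0..T} a \<le> b"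
  shows "stint T (\<lambda>t x. \<bar>f t x\<bar>) \<le> b"
  by (rule order_trans[OF stint_time_bound[OF jcont_alg[OF assms(1)] assms(2,3)] assms(4)])

text \<open>The continuous function \<open>a\<close> majorises all derivatives up to order
  \<open>q\<close> simultaneously and stands in for the \<open>C^q\<close> norm, whose dependence on
  time is examined only later. The factor \<open>c\<close>, eventually \<open>2 ^ q\<close>,
  provides the geometric weights with which the increments are summed in \<open>L^p\<close>.\<close>

definition small_density :: "real \<Rightarrow> nat \<Rightarrow> real \<Rightarrow> real \<Rightarrow> (real \<Rightarrow> real ^ 'n \<Rightarrow> real) \<Rightarrow> bool" where
  "small_density T q c \<epsilon> \<theta> \<longleftrightarrow> (\<exists>a. continuous_on UNIV a \<and> (\<forall>t. 0 \<le> a t) \<and>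
     (\<forall>bs. set bs \<subseteq> Basis \<and> length bs \<le> q \<longrightarrow> (\<forall>t\<in>{0..T}. \<forall>x. \<bar>foldr partial bs (\<theta> t) x\<bar> \<le> a t)) \<and>
     (\<forall>p. 1 \<le> p \<and> p \<le> real q \<longrightarrow> integral {0..T} (\<lambda>t. (c * a t) powr p) \<le> \<epsilon>))"

text \<open>A single \<open>G\<close> controls the \<open>L^p\<close> norms for every
  \<open>p\<close> in \<open>[1,q]\<close>, so that one integrable function of time governs the
  whole scale of Sobolev norms.\<close>

definition small_field :: "real \<Rightarrow> nat \<Rightarrow> real \<Rightarrow> (real \<Rightarrow> real ^ 'n \<Rightarrow> real) \<Rightarrow> bool" where
  "small_field T q \<epsilon> w \<longleftrightarrow> (\<exists>G. continuous_on UNIV G \<and> (\<forall>t. 0 \<le> G t) \<and> integral {0..T} G \<le> \<epsilon> \<and>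
     (\<forall>t p. 1 \<le> p \<and> p \<le> real q \<longrightarrow>
        integral cube (\<lambda>x. \<bar>w t x\<bar> powr p) \<le> G t powr p \<and>
        (\<forall>k. integral cube (\<lambda>x. \<bar>Dx k w t x\<bar> powr p) \<le> G t powr p)))"

lemma small_parameter: assumes "0 \<le> C" "0 < e" shows "\<exists>\<delta>::real. 0 < \<delta> \<and> \<delta> \<le> 1 \<and> C * \<delta> \<le> e"
proof (intro exI[of _ "min 1 (e / (C + 1))"] conjI)
  have "C * min 1 (e / (C + 1)) \<le> (C + 1) * (e / (C + 1))" using assms by (intro mult_mono) auto
  then show "C * min 1 (e / (C + 1)) \<le> e" using assms by simp
qed (use assms in auto)

lemma large_parameter: assumes "0 < e" shows "\<exists>m::nat. 0 < m \<and> C / real m \<le> e"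
proof -
  obtain m :: nat where "C / e < real m" using reals_Archimedean2 by blast
  then have "C / real (Suc m) \<le> e" using assms by (simp add: field_simps)
  then show ?thesis by blast
qed

text \<open>Only the error \<open>A\<close> is treated here; \<open>B\<close> follows by exchanging the two coordinates.\<close>

lemma half_step:
  fixes r U V A B :: "real \<Rightarrow> real ^ 'n \<Rightarrow> real"
  assumes sys: "Sys i j r U V A B" and ij: "i \<noteq> j" and T: "T > 0" and \<epsilon>: "\<epsilon> > 0" and c: "c > 0"
  obtains r' U' A' B' where "Sys i j r' U' V A' B'"
    "stint T (\<lambda>t x. \<bar>A' t x\<bar>) \<le> \<epsilon>" "stint T (\<lambda>t x. \<bar>B' t x - B t x\<bar>) \<le> \<epsilon>"
    "small_density T q c \<epsilon> (\<lambda>t x. r' t x - r t x)" "small_field T q \<epsilon> (\<lambda>t x. U' t x - U t x)"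
    "stint T (\<lambda>t x. \<bar>r' t x * U' t x - r t x * U t x\<bar>) \<le> stint T (\<lambda>t x. \<bar>A t x\<bar>) + \<epsilon>"
    "stint T (\<lambda>t x. \<bar>r' t x * V t x - r t x * V t x\<bar>) \<le> \<epsilon>"
proof -
  have sa: "r \<in> alg" "U \<in> alg" "V \<in> alg" "A \<in> alg" "B \<in> alg" using sys unfolding Sys_def by auto
  note al = sa alg_Dt(1)[OF sa(4)] alg_Dx(1)[OF sa(4)]
  define e where "e = \<epsilon> / 20"
  have e: "e > 0" "\<epsilon> = 20 * e" using \<epsilon> by (simp_all add: e_def)
  obtain K where K: "K \<ge> 0" "\<And>m F1 H1 F2 H2. m > 0 \<Longrightarrow> osc F1 H1 \<Longrightarrow> osc F2 H2 \<Longrightarrow>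
    stint T (\<lambda>t x. \<bar>A t x * (F1 (real m / T * t) * F2 (real m * x $ j))\<bar>) \<le>
    stint T (\<lambda>t x. \<bar>A t x\<bar>) + e + K / real m"
    using oscillation_bound[OF sa(4) T e(1), of j] by blast
  have "F \<in> alg" if "F \<in> set [r, U, V, A, Dt A, Dx i A, Dx j A]" for F using that al by auto
  from alg_bounded_list[OF this, where T = T]
  obtain M where M1: "M \<ge> 1" and "\<forall>F\<in>set [r, U, V, A, Dt A, Dx i A, Dx j A]. \<forall>t\<in>{0..T}. \<forall>x. \<bar>F t x\<bar> \<le> M"
    by blast
  then have M: "\<bar>r t x\<bar> \<le> M" "\<bar>U t x\<bar> \<le> M" "\<bar>V t x\<bar> \<le> M" "\<bar>A t x\<bar> \<le> M" "\<bar>Dt A t x\<bar> \<le> M"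
    "\<bar>Dx i A t x\<bar> \<le> M" "\<bar>Dx j A t x\<bar> \<le> M" if "t \<in> {0..T}" for t x using that by auto
  obtain N where N: "N \<ge> 0" "\<And>bs t x. set bs \<subseteq> Basis \<Longrightarrow> length bs \<le> q \<Longrightarrow> t \<in> {0..T} \<Longrightarrow>
      \<bar>foldr partial bs (Dx i A t) x\<bar> \<le> N"
    using alg_partials_bounded[OF alg_Dx(1)[OF sa(4)], of q T i] by blast
  \<comment> \<open>The frequency is chosen first: \<open>K0\<close> collects the constants of all
    terms decaying like \<open>1 / m\<close>, and these depend on the given stage alone. The
    oscillation constant \<open>K\<close> is among them because it is uniform in the
    profiles.\<close>
  define K0 where "K0 = K + M * T * T + 9 * M * T + M * M * T * T + c * N * T + 2 ^ q * T * (c * N * T)"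
  obtain m :: nat where m: "m > 0" "K0 / real m \<le> min e 1" using large_parameter[of "min e 1" K0] e by auto
  have km: "X / real m \<le> e" "X / real m \<le> 1" if "X \<le> K0" for X
    using divide_right_mono[OF that, of "real m"] m(2) by linarith+
  have nn: "0 \<le> K" "0 \<le> M * T * T" "0 \<le> 9 * M * T" "0 \<le> M * M * T * T" "0 \<le> c * N * T" "0 \<le> 2 ^ q * T * (c * N * T)"
    using K M1 T c N by auto
  have k: "K / real m \<le> e" "M * T * T / real m \<le> e" "9 * M * T / real m \<le> e" "M * M * T * T / real m \<le> e"
     "c * N * T / real m \<le> 1" "2 ^ q * T * (c * N * T) / real m \<le> e"
    by (rule km; use nn in \<open>simp add: K0_def\<close>)+
  \<comment> \<open>The concentration in space is chosen second. Its constant may contain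
    \<open>m\<close>: one derivative of \<open>Q\<close> costs a factor \<open>m\<close>.\<close>
  define D0 where "D0 = 2 * T * M * (1 + T) + 2 * M + 2 * T * real m"
  have D0: "D0 \<ge> 0" unfolding D0_def using T M1 by simp
  obtain \<delta> where \<delta>: "0 < \<delta>" "\<delta> \<le> 1" "D0 * \<delta> \<le> e" using small_parameter[OF D0 e(1)] by blast
  have d: "2 * T * M * (1 + T) * \<delta> \<le> e" "2 * M * \<delta> \<le> e" "2 * T * real m * \<delta> \<le> e"
  proof -
    have "0 \<le> 2 * T * M * (1 + T) * \<delta>" "0 \<le> 2 * M * \<delta>" "0 \<le> 2 * T * real m * \<delta>" using T M1 \<delta> by auto
    moreover have "2 * T * M * (1 + T) * \<delta> + 2 * M * \<delta> + 2 * T * real m * \<delta> \<le> e"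
      using \<delta>(3) by (simp add: D0_def algebra_simps)
    ultimately show "2 * T * M * (1 + T) * \<delta> \<le> e" "2 * M * \<delta> \<le> e" "2 * T * real m * \<delta> \<le> e" by linarith+
  qed
  obtain \<Phi> \<Phi>' \<psi> \<psi>' H2 where "space_profile q \<delta> \<Phi> \<Phi>' \<psi> \<psi>' H2"
    using space_profile_exists[OF \<delta>(1,2)] by blast
  then have tr2: "\<Phi> \<in> trig" "\<Phi>' \<in> trig" "\<psi> \<in> trig" "\<psi>' \<in> trig" "H2 \<in> trig"
    and d2: "\<And>y. (\<Phi> has_real_derivative \<Phi>' y) (at y)" "\<And>y. (\<psi> has_real_derivative \<psi>' y) (at y)"
    and b2: "integral {0..1} (\<lambda>y. \<bar>\<Phi> y\<bar>) \<le> \<delta>" "\<And>y. \<bar>\<psi> y\<bar> \<le> \<delta>"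
    "\<And>p. 1 \<le> p \<Longrightarrow> p \<le> real q \<Longrightarrow> integral {0..1} (\<lambda>y. \<bar>\<psi>' y\<bar> powr p) \<le> \<delta> powr p"
    "\<And>y. \<Phi>' y * \<psi> y \<ge> 0" "\<And>y. (H2 has_real_derivative \<Phi>' y * \<psi> y - 1) (at y)" "\<And>y. \<bar>H2 y\<bar> \<le> 1"
    "\<And>y. \<bar>\<Phi> y * \<psi> y\<bar> \<le> 8"
    unfolding space_profile_def by auto
  have o2: "osc (\<lambda>y. \<Phi>' y * \<psi> y) H2" unfolding osc_def using tr2 b2 by (auto intro: trig_mult)
  define P where "P = (\<lambda>(t::real) (x::real^'n). \<Phi> (real m * x $ j) / real m)"
  define P' where "P' = (\<lambda>(t::real) (x::real^'n). \<Phi>' (real m * x $ j))"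
  define Q where "Q = (\<lambda>(t::real) (x::real^'n). \<psi> (real m * x $ j))"
  define Q' where "Q' = (\<lambda>(t::real) (x::real^'n). real m * \<psi>' (real m * x $ j))"
  define Hs where "Hs = (\<lambda>(t::real) (x::real^'n). H2 (real m * x $ j) / real m)"
  have sp: "P \<in> alg" "P' \<in> alg" "Q \<in> alg" "Q' \<in> alg" "Hs \<in> alg"
    unfolding P_def P'_def Q_def Q'_def Hs_def
    using alg_divide[OF alg_space_nat[OF tr2(1)]] alg_space_nat[OF tr2(2)] alg_space_nat[OF tr2(3)]
      alg_mult[OF alg_const alg_space_nat[OF tr2(4)]] alg_divide[OF alg_space_nat[OF tr2(5)]] by this+
  have DxP: "Dx k P = (if k = j then P' else (\<lambda>t x. 0))" "Dx k Q = (if k = j then Q' else (\<lambda>t x. 0))"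
    "Dx k Hs = (if k = j then (\<lambda>t x. P' t x * Q t x - 1) else (\<lambda>t x. 0))"
    "k \<noteq> j \<Longrightarrow> Dx k P' = (\<lambda>t x. 0)" for k
  proof -
    show "Dx k P = (if k = j then P' else (\<lambda>t x. 0))" 
      unfolding P_def P'_def Dx_simps(4)[OF alg_space_nat[OF tr2(1)]] Dx_space_nat[OF tr2(1) d2(1)] using m by auto
    show "Dx k Q = (if k = j then Q' else (\<lambda>t x. 0))" 
      unfolding Q_def Q'_def Dx_space_nat[OF tr2(3) d2(2)] by auto
    show "Dx k Hs = (if k = j then (\<lambda>t x. P' t x * Q t x - 1) else (\<lambda>t x. 0))" 
      unfolding Hs_def P'_def Q_def Dx_simps(4)[OF alg_space_nat[OF tr2(5)]] Dx_space_nat[OF tr2(5) b2(5)] using m by auto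
    obtain f where f: "\<And>y. (\<Phi>' has_real_derivative f y) (at y)" using trig_deriv[OF tr2(2)] by blast
    show "k \<noteq> j \<Longrightarrow> Dx k P' = (\<lambda>t x. 0)" unfolding P'_def Dx_space_nat[OF tr2(2) f] by auto
  qed
  \<comment> \<open>\<open>\<theta>p\<close> is \<open>- \<Gamma> Y\<close>: all dependence on space
    is in \<open>Y\<close>, whose \<open>C^q\<close> bound \<open>C3\<close> is fixed by now but may
    be enormous because the profile is concentrated.\<close>
  define Y where "Y = (\<lambda>t x. Dx j A t x * P t x + A t x * P' t x)"
  have Y: "Y \<in> alg" unfolding Y_def by (intro alg_add alg_mult al sp)
  obtain C3 where C3: "C3 \<ge> 0" "\<And>bs t x. set bs \<subseteq> Basis \<Longrightarrow> length bs \<le> q \<Longrightarrow> t \<in> {0..T} \<Longrightarrow>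
      \<bar>foldr partial bs (Y t) x\<bar> \<le> C3"
    using alg_partials_bounded[OF Y, of q T] by blast
  have Yb: "\<bar>Y t x\<bar> \<le> C3" if "t \<in> {0..T}" for t x using C3(2)[of "[]"] that by simp
  obtain C2 where C2: "C2 \<ge> 0" "\<And>t x. t \<in> {0..T} \<Longrightarrow> \<bar>P t x\<bar> \<le> C2" using alg_bounded[OF sp(1), of T] by blast
  \<comment> \<open>The concentration in time is chosen last and absorbs \<open>C3\<close> and
    \<open>C2\<close>. The power of \<open>max 1 (c * C3)\<close> dominates
    \<open>(c * C3) powr p\<close> for all \<open>p\<close> in \<open>[1,q]\<close>.\<close>
  define E0 where "E0 = M * C3 * T + M * C2 * T + 2 ^ q * max 1 (c * C3) ^ q * T"
  have E0: "E0 \<ge> 0" unfolding E0_def using T M1 C3 C2 by auto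
  obtain \<delta>2 where \<delta>2: "0 < \<delta>2" "E0 * \<delta>2 \<le> e" using small_parameter[OF E0 e(1)] by blast
  have d3: "M * C3 * T * \<delta>2 \<le> e" "M * C2 * T * \<delta>2 \<le> e" "2 ^ q * max 1 (c * C3) ^ q * T * \<delta>2 \<le> e"
  proof -
    have "0 \<le> M * C3 * T * \<delta>2" "0 \<le> M * C2 * T * \<delta>2" "0 \<le> 2 ^ q * max 1 (c * C3) ^ q * T * \<delta>2"
      using T M1 \<delta>2 C3 C2 by auto
    moreover have "M * C3 * T * \<delta>2 + M * C2 * T * \<delta>2 + 2 ^ q * max 1 (c * C3) ^ q * T * \<delta>2 \<le> e"
      using \<delta>2(2) by (simp add: E0_def algebra_simps)
    ultimately show "M * C3 * T * \<delta>2 \<le> e" "M * C2 * T * \<delta>2 \<le> e" "2 ^ q * max 1 (c * C3) ^ q * T * \<delta>2 \<le> e" by linarith+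
  qed
  obtain \<gamma> \<gamma>' G H1 where "time_profile \<delta>2 \<gamma> \<gamma>' G H1"
    using time_profile_exists[OF \<delta>2(1)] by blast
  then have tr1: "\<gamma> \<in> trig" "\<gamma>' \<in> trig" "G \<in> trig" "H1 \<in> trig"
    and b1: "\<And>y. 0 \<le> \<gamma> y" "\<And>y. \<gamma> y \<le> 1" "\<gamma> 0 = 0"
    "\<And>y. (\<gamma> has_real_derivative \<gamma>' y) (at y)"
    "integral {0..1} \<gamma> \<le> \<delta>2" "integral {0..1} (\<lambda>y. \<bar>\<gamma>' y\<bar>) \<le> 2"
    "\<And>y. \<gamma> y * G y \<ge> 0" "\<And>y. (H1 has_real_derivative \<gamma> y * G y - 1) (at y)"
    "H1 0 = 0" "\<And>y. \<bar>H1 y\<bar> \<le> 1" "integral {0..1} (\<lambda>y. \<bar>G y\<bar>) \<le> 2"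
    unfolding time_profile_def by auto
  have o1: "osc (\<lambda>y. \<gamma> y * G y) H1" unfolding osc_def using tr1 b1 by (auto intro: trig_mult)
  define \<tau> where "\<tau> = real m / T"
  have \<tau>: "\<tau> > 0" unfolding \<tau>_def using m T by simp
  define \<Gamma> where "\<Gamma> = (\<lambda>t (x::real^'n). \<gamma> (\<tau> * t))"
  define \<Gamma>' where "\<Gamma>' = (\<lambda>t (x::real^'n). \<tau> * \<gamma>' (\<tau> * t))"
  define g where "g = (\<lambda>t (x::real^'n). G (\<tau> * t))"
  define h where "h = (\<lambda>t (x::real^'n). H1 (\<tau> * t) / \<tau>)"
  have ti: "\<Gamma> \<in> alg" "\<Gamma>' \<in> alg" "g \<in> alg" "h \<in> alg"
    unfolding \<Gamma>_def \<Gamma>'_def g_def h_def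
    using alg_time[OF tr1(1)] alg_mult[OF alg_const alg_time[OF tr1(2)]] alg_time[OF tr1(3)]
      alg_divide[OF alg_time[OF tr1(4)]] by this+
  have Dt\<Gamma>: "Dt \<Gamma> = \<Gamma>'" unfolding \<Gamma>_def \<Gamma>'_def by (rule Dt_time[OF b1(4)])
  have Dth: "Dt h = (\<lambda>t x. \<Gamma> t x * g t x - 1)"
    unfolding h_def \<Gamma>_def g_def Dt_simps(4)[OF alg_time[OF tr1(4)]] Dt_time[OF b1(8)] using \<tau> by simp
  define \<theta>p where "\<theta>p = (\<lambda>t x. - (\<Gamma> t x * (Dx j A t x * P t x + A t x * P' t x)))"
  define \<theta>c where "\<theta>c = (\<lambda>t x. h t x * Dx i A t x)"
  define w where "w = (\<lambda>t x. g t x * Q t x)"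
  define A' where "A' = (\<lambda>t x. h t x * Dt A t x + \<Gamma> t x * g t x * Dx j A t x * (Hs t x - P t x * Q t x)
        + U t x * (\<theta>p t x + \<theta>c t x) + w t x * (r t x + \<theta>c t x))"
  define B' where "B' = (\<lambda>t x. B t x - (\<Gamma>' t x * A t x + \<Gamma> t x * Dt A t x) * P t x
        - \<Gamma> t x * g t x * Dx i A t x * Hs t x + V t x * (\<theta>p t x + \<theta>c t x))"
  have new: "Sys i j (\<lambda>t x. r t x + (\<theta>p t x + \<theta>c t x)) (\<lambda>t x. U t x + w t x) V A' B'"
  proof (rule perturbed_system[OF sys ij ti sp])
    show "Dx k \<Gamma> = (\<lambda>t x. 0)" "Dx k \<Gamma>' = (\<lambda>t x. 0)" "Dx k g = (\<lambda>t x. 0)" "Dx k h = (\<lambda>t x. 0)" for k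
      unfolding \<Gamma>_def \<Gamma>'_def g_def h_def by simp_all
    show "Dt P = (\<lambda>t x. 0)" "Dt P' = (\<lambda>t x. 0)" unfolding P_def P'_def by simp_all
    show "\<Gamma> 0 x = 0" "h 0 x = 0" for x unfolding \<Gamma>_def h_def using b1 by simp_all
  qed (use Dt\<Gamma> Dth DxP ij in \<open>auto simp: \<theta>p_def \<theta>c_def w_def A'_def B'_def\<close>)
  have tp: "\<theta>p \<in> alg" "\<theta>c \<in> alg" "w \<in> alg"
    unfolding \<theta>p_def \<theta>c_def w_def by (intro alg_add alg_mult alg_uminus al sp ti)+
  note mem = alg_add alg_diff alg_mult alg_uminus al sp ti tp
  have cg: "continuous_on UNIV (\<lambda>t. \<gamma> (\<tau> * t))" "continuous_on UNIV (\<lambda>t. \<gamma>' (\<tau> * t))"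
      "continuous_on UNIV (\<lambda>t. G (\<tau> * t))"
    by (rule trig_continuous2[OF tr1(1)] trig_continuous2[OF tr1(2)] trig_continuous2[OF tr1(3)],
        intro continuous_intros)+
  have I1: "integral {0..T} (\<lambda>t. \<gamma> (\<tau> * t)) \<le> T * \<delta>2"
    unfolding \<tau>_def integral_trig_time(1)[OF tr1(1) m(1) T] using b1(5) T by simp
  have I2: "integral {0..T} (\<lambda>t. \<bar>\<gamma>' (\<tau> * t)\<bar>) \<le> T * 2"
    unfolding \<tau>_def integral_trig_time(2)[OF tr1(2) m(1) T] using b1(6) T by simp
  have I3: "integral {0..T} (\<lambda>t. \<bar>G (\<tau> * t)\<bar>) \<le> T * 2"
    unfolding \<tau>_def integral_trig_time(2)[OF tr1(3) m(1) T] using b1(11) T by simp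
  have I4: "integral {0..T} (\<lambda>t. \<gamma> (\<tau> * t) * G (\<tau> * t)) = T"
    using integral_trig_time(1)[OF trig_mult[OF tr1(1,3)] m(1) T] osc_mean[OF o1] by (simp add: \<tau>_def)
  have I5: "integral {0..T} (\<lambda>t. \<gamma> (\<tau> * t) * G (\<tau> * t) * C) = T * C" for C
    by (simp only: integral_mult_left I4)
  have hb: "\<bar>h t x\<bar> \<le> T / real m" for t x
  proof -
    have "\<bar>h t x\<bar> = \<bar>H1 (\<tau> * t)\<bar> / \<tau>" using \<tau> by (simp add: h_def)
    also have "\<dots> \<le> 1 / \<tau>" using b1 \<tau> by (intro divide_right_mono) auto
    finally show ?thesis by (simp add: \<tau>_def)
  qed
  have Hb: "\<bar>Hs t x\<bar> \<le> 1 / real m" "\<bar>P t x * Q t x\<bar> \<le> 8 / real m" for t x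
    using b2(6)[of "real m * x $ j"] b2(7)[of "real m * x $ j"] m
    by (auto simp: Hs_def P_def Q_def abs_mult abs_divide divide_right_mono)
  have fg: "\<Gamma> t x * g t x = \<gamma> (\<tau> * t) * G (\<tau> * t)" "\<Gamma> t x * g t x \<ge> 0" for t x
    using b1 by (auto simp: \<Gamma>_def g_def)
  have \<theta>pb: "\<bar>\<theta>p t x\<bar> \<le> C3 * \<gamma> (\<tau> * t)" if "t \<in> {0..T}" for t x
  proof -
    have "\<bar>\<theta>p t x\<bar> = \<gamma> (\<tau> * t) * \<bar>Y t x\<bar>" using b1 by (simp add: \<theta>p_def Y_def \<Gamma>_def abs_mult)
    also have "\<dots> \<le> \<gamma> (\<tau> * t) * C3" using Yb[OF that] b1 by (intro mult_left_mono) auto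
    finally show ?thesis by (simp add: mult.commute)
  qed
  have \<theta>cb: "\<bar>\<theta>c t x\<bar> \<le> M * T / real m" if "t \<in> {0..T}" for t x
  proof -
    have "\<bar>\<theta>c t x\<bar> \<le> (T / real m) * M" unfolding \<theta>c_def abs_mult
      using hb[of t x] M(6)[OF that] T by (intro mult_mono) auto
    then show ?thesis by (simp add: mult.commute)
  qed
  have MT: "M * T / real m \<le> M * T"
  proof -
    have "M * T * 1 \<le> M * T * real m" using m(1) M1 T by (intro mult_left_mono) auto
    then show ?thesis using m(1) by (simp add: divide_le_eq)
  qed
  have X1: "stint T (\<lambda>t x. \<bar>h t x * Dt A t x\<bar>) \<le> e"
  proof (rule alg_stint_bound)
    show "\<bar>h t x * Dt A t x\<bar> \<le> (T / real m) * M" if "t \<in> {0..T}" for t x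
      unfolding abs_mult using hb[of t x] M(5)[OF that] T by (intro mult_mono) auto
    show "integral {0..T} (\<lambda>t. (T / real m) * M) \<le> e" using k(2) T by (simp add: mult_ac)
  qed (intro mem continuous_on_const)+
  have X2: "stint T (\<lambda>t x. \<bar>\<Gamma> t x * g t x * Dx j A t x * (Hs t x - P t x * Q t x)\<bar>) \<le> e"
  proof (rule alg_stint_bound)
    show "\<bar>\<Gamma> t x * g t x * Dx j A t x * (Hs t x - P t x * Q t x)\<bar> \<le>
       (\<gamma> (\<tau> * t) * G (\<tau> * t)) * (M * (9 / real m))" if "t \<in> {0..T}" for t x
    proof -
      have "\<bar>Hs t x - P t x * Q t x\<bar> \<le> 1 / real m + 8 / real m" using Hb[of t x] by linarith
      then have "\<bar>Hs t x - P t x * Q t x\<bar> \<le> 9 / real m" by (simp add: add_divide_distrib[symmetric])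
      then have "\<bar>\<Gamma> t x * g t x\<bar> * (\<bar>Dx j A t x\<bar> * \<bar>Hs t x - P t x * Q t x\<bar>) \<le> (\<gamma> (\<tau> * t) * G (\<tau> * t)) * (M * (9 / real m))"
        using M(7)[OF that, of x] fg[of t x] M1 by (intro mult_mono) auto
      then show ?thesis by (simp add: abs_mult mult_ac)
    qed
    show "integral {0..T} (\<lambda>t. (\<gamma> (\<tau> * t) * G (\<tau> * t)) * (M * (9 / real m))) \<le> e"
      unfolding I5 using k(3) by (simp add: mult_ac)
  qed (intro mem continuous_on_mult cg continuous_on_const)+
  \<comment> \<open>The part with \<open>P Q\<close> alone is estimated once more, because in the
    flux it appears without \<open>Hs\<close>.\<close>
  have X2': "stint T (\<lambda>t x. \<bar>\<Gamma> t x * g t x * Dx j A t x * (P t x * Q t x)\<bar>) \<le> e"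
  proof (rule alg_stint_bound)
    show "\<bar>\<Gamma> t x * g t x * Dx j A t x * (P t x * Q t x)\<bar> \<le>
       (\<gamma> (\<tau> * t) * G (\<tau> * t)) * (M * (9 / real m))" if "t \<in> {0..T}" for t x
    proof -
      have "\<bar>P t x * Q t x\<bar> \<le> 9 / real m"
        using Hb(2)[of t x] divide_right_mono[of 8 9 "real m"] by linarith
      then have "\<bar>\<Gamma> t x * g t x\<bar> * (\<bar>Dx j A t x\<bar> * \<bar>P t x * Q t x\<bar>) \<le> (\<gamma> (\<tau> * t) * G (\<tau> * t)) * (M * (9 / real m))"
        using M(7)[OF that, of x] fg[of t x] M1 by (intro mult_mono) auto
      then show ?thesis by (simp add: abs_mult mult_ac)
    qed
    show "integral {0..T} (\<lambda>t. (\<gamma> (\<tau> * t) * G (\<tau> * t)) * (M * (9 / real m))) \<le> e"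
      unfolding I5 using k(3) by (simp add: mult_ac)
  qed (intro mem continuous_on_mult cg continuous_on_const)+
  have X3: "stint T (\<lambda>t x. \<bar>W t x * (\<theta>p t x + \<theta>c t x)\<bar>) \<le> 2 * e" if W: "W \<in> alg" "\<And>t x. t \<in> {0..T} \<Longrightarrow> \<bar>W t x\<bar> \<le> M" for W
  proof (rule alg_stint_bound)
    show "\<bar>W t x * (\<theta>p t x + \<theta>c t x)\<bar> \<le> M * (C3 * \<gamma> (\<tau> * t) + M * T / real m)" if "t \<in> {0..T}" for t x
      unfolding abs_mult using \<theta>pb[OF that, of x] \<theta>cb[OF that, of x] W(2)[OF that, of x] M1
      by (intro mult_mono) auto
    have "integral {0..T} (\<lambda>t. M * (C3 * \<gamma> (\<tau> * t) + M * T / real m)) =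
      M * C3 * integral {0..T} (\<lambda>t. \<gamma> (\<tau> * t)) + M * M * T * T / real m"
      unfolding distrib_left
      using T by (subst integral_add) (auto intro!: integrable_continuous_real continuous_on_mult continuous_on_const continuous_on_subset[OF cg(1)])
    also have "M * C3 * integral {0..T} (\<lambda>t. \<gamma> (\<tau> * t)) \<le> M * C3 * (T * \<delta>2)"
      using I1 M1 C3 by (intro mult_left_mono) auto
    finally show "integral {0..T} (\<lambda>t. M * (C3 * \<gamma> (\<tau> * t) + M * T / real m)) \<le> 2 * e"
      using k(4) d3(1) by (simp add: mult.assoc)
  qed (intro mem W continuous_on_mult continuous_on_add cg continuous_on_const)+
  have X4: "stint T (\<lambda>t x. \<bar>w t x * (r t x + \<theta>c t x)\<bar>) \<le> e"
  proof (rule alg_stint_bound)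
    show "\<bar>w t x * (r t x + \<theta>c t x)\<bar> \<le> \<bar>G (\<tau> * t)\<bar> * (\<delta> * (M + M * T))" if "t \<in> {0..T}" for t x
    proof -
      have "\<bar>G (\<tau> * t)\<bar> * (\<bar>Q t x\<bar> * \<bar>r t x + \<theta>c t x\<bar>) \<le> \<bar>G (\<tau> * t)\<bar> * (\<delta> * (M + M * T))"
        using \<theta>cb[OF that, of x] M(1)[OF that, of x] MT b2(2)[of "real m * x $ j"] \<delta>
        by (intro mult_mono mult_nonneg_nonneg) (auto simp: Q_def)
      then show ?thesis by (simp add: w_def g_def abs_mult mult_ac)
    qed
    have "integral {0..T} (\<lambda>t. \<bar>G (\<tau> * t)\<bar> * (\<delta> * (M + M * T))) = integral {0..T} (\<lambda>t. \<bar>G (\<tau> * t)\<bar>) * (\<delta> * (M + M * T))"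
      by simp
    also have "\<dots> \<le> (T * 2) * (\<delta> * (M + M * T))" using I3 \<delta> M1 T by (intro mult_right_mono) auto
    also have "\<dots> = 2 * T * M * (1 + T) * \<delta>" by (simp add: algebra_simps)
    finally show "integral {0..T} (\<lambda>t. \<bar>G (\<tau> * t)\<bar> * (\<delta> * (M + M * T))) \<le> e" using d(1) by simp
  qed (intro mem continuous_on_mult continuous_on_rabs cg continuous_on_const)+
  \<comment> \<open>\<open>\<Gamma>'\<close> carries the factor \<open>\<tau> = m / T\<close>, and
    no concentration in time can help since the total variation of \<open>\<gamma>\<close> is fixed.
    The \<open>1 / m\<close> in \<open>P\<close> cancels the frequency, and the small mean of
    \<open>\<Phi>\<close> gives the gain; hence a bound by a product of a time and a space
    integral.\<close>
  have Y1: "stint T (\<lambda>t x. \<bar>\<Gamma>' t x * A t x * P t x\<bar>) \<le> e"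
  proof -
    have cP: "continuous_on UNIV (\<lambda>y. \<bar>\<Phi> y\<bar>)" by (intro continuous_on_rabs trig_continuous tr2)
    have cP': "continuous_on UNIV (\<lambda>x::real^'n. \<bar>\<Phi> (real m * x $ j)\<bar>)"
      by (rule continuous_on_compose2[OF cP]) (auto intro!: continuous_intros)
    have "stint T (\<lambda>t x. \<bar>\<Gamma>' t x * A t x * P t x\<bar>) \<le>
      integral {0..T} (\<lambda>t. \<tau> * \<bar>\<gamma>' (\<tau> * t)\<bar>) * integral cube (\<lambda>x::real^'n. (M / real m) * \<bar>\<Phi> (real m * x $ j)\<bar>)"
    proof (rule stint_prod_bound)
      show "\<bar>\<Gamma>' t x * A t x * P t x\<bar> \<le> \<tau> * \<bar>\<gamma>' (\<tau> * t)\<bar> * ((M / real m) * \<bar>\<Phi> (real m * x $ j)\<bar>)" if "t \<in> {0..T}" for t x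
      proof -
        have "\<bar>A t x\<bar> * (\<tau> * \<bar>\<gamma>' (\<tau> * t)\<bar> * (\<bar>\<Phi> (real m * x $ j)\<bar> / real m)) \<le> M * (\<tau> * \<bar>\<gamma>' (\<tau> * t)\<bar> * (\<bar>\<Phi> (real m * x $ j)\<bar> / real m))"
          using M(4)[OF that, of x] \<tau> by (intro mult_right_mono) auto
        then show ?thesis using \<tau> by (simp add: \<Gamma>'_def P_def abs_mult mult_ac)
      qed
    qed (intro jcont_alg mem continuous_on_mult continuous_on_rabs cg cP' continuous_on_const)+
    also have "integral {0..T} (\<lambda>t. \<tau> * \<bar>\<gamma>' (\<tau> * t)\<bar>) = \<tau> * integral {0..T} (\<lambda>t. \<bar>\<gamma>' (\<tau> * t)\<bar>)" by simp
    also have "integral cube (\<lambda>x::real^'n. (M / real m) * \<bar>\<Phi> (real m * x $ j)\<bar>) =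
       (M / real m) * integral {0..1} (\<lambda>y. \<bar>\<Phi> y\<bar>)"
      using integral_cube_coordinate[OF cP _ m(1), of j] trig_periodic1[OF tr2(1)] by simp
    also have "\<tau> * integral {0..T} (\<lambda>t. \<bar>\<gamma>' (\<tau> * t)\<bar>) * ((M / real m) * integral {0..1} (\<lambda>y. \<bar>\<Phi> y\<bar>)) \<le>
       \<tau> * (T * 2) * ((M / real m) * \<delta>)"
      using \<tau> I2 b2(1) M1 T m by (intro mult_mono mult_left_mono mult_nonneg_nonneg integral_nonneg
         integrable_continuous_real continuous_on_subset[OF cP]) auto
    also have "\<dots> = 2 * M * \<delta>" using T m by (simp add: \<tau>_def)
    finally show ?thesis using d(2) by simp
  qed
  have Y2: "stint T (\<lambda>t x. \<bar>\<Gamma> t x * Dt A t x * P t x\<bar>) \<le> e"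
  proof (rule alg_stint_bound)
    show "\<bar>\<Gamma> t x * Dt A t x * P t x\<bar> \<le> \<gamma> (\<tau> * t) * (M * C2)" if "t \<in> {0..T}" for t x
    proof -
      have "\<bar>\<Gamma> t x\<bar> * (\<bar>Dt A t x\<bar> * \<bar>P t x\<bar>) \<le> \<gamma> (\<tau> * t) * (M * C2)"
        using M(5)[OF that, of x] C2(2)[OF that, of x] b1 M1 by (intro mult_mono) (auto simp: \<Gamma>_def)
      then show ?thesis by (simp add: abs_mult mult_ac)
    qed
    have "integral {0..T} (\<lambda>t. \<gamma> (\<tau> * t) * (M * C2)) = integral {0..T} (\<lambda>t. \<gamma> (\<tau> * t)) * (M * C2)" by simp
    also have "\<dots> \<le> (T * \<delta>2) * (M * C2)" using I1 M1 C2 by (intro mult_right_mono) auto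
    finally show "integral {0..T} (\<lambda>t. \<gamma> (\<tau> * t) * (M * C2)) \<le> e" using d3(2) by (simp add: mult_ac)
  qed (intro mem continuous_on_mult cg continuous_on_const)+
  have Y3: "stint T (\<lambda>t x. \<bar>\<Gamma> t x * g t x * Dx i A t x * Hs t x\<bar>) \<le> e"
  proof (rule alg_stint_bound)
    show "\<bar>\<Gamma> t x * g t x * Dx i A t x * Hs t x\<bar> \<le> (\<gamma> (\<tau> * t) * G (\<tau> * t)) * (M * (9 / real m))" if "t \<in> {0..T}" for t x
    proof -
      have "\<bar>Hs t x\<bar> \<le> 9 / real m"
        using Hb(1)[of t x] divide_right_mono[of 1 9 "real m"] by linarith
      then have "\<bar>\<Gamma> t x * g t x\<bar> * (\<bar>Dx i A t x\<bar> * \<bar>Hs t x\<bar>) \<le> (\<gamma> (\<tau> * t) * G (\<tau> * t)) * (M * (9 / real m))"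
        using M(6)[OF that, of x] fg[of t x] M1 by (intro mult_mono) auto
      then show ?thesis by (simp add: abs_mult mult_ac)
    qed
    show "integral {0..T} (\<lambda>t. (\<gamma> (\<tau> * t) * G (\<tau> * t)) * (M * (9 / real m))) \<le> e"
      unfolding I5 using k(3) by (simp add: mult_ac)
  qed (intro mem continuous_on_mult cg continuous_on_const)+
  have R1: "stint T (\<lambda>t x. \<bar>A' t x\<bar>) \<le> \<epsilon>"
  proof -
    have "stint T (\<lambda>t x. \<bar>A' t x\<bar>) \<le> stint T (\<lambda>t x. \<bar>h t x * Dt A t x\<bar>) +
       stint T (\<lambda>t x. \<bar>\<Gamma> t x * g t x * Dx j A t x * (Hs t x - P t x * Q t x)\<bar>) +
       stint T (\<lambda>t x. \<bar>U t x * (\<theta>p t x + \<theta>c t x)\<bar>) + stint T (\<lambda>t x. \<bar>w t x * (r t x + \<theta>c t x)\<bar>)"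
      unfolding A'_def
      by (intro stint_abs_sum4(1) jcont_alg mem)
    then show ?thesis using X1 X2 X3[OF sa(2) M(2)] X4 e by linarith
  qed
  have R2: "stint T (\<lambda>t x. \<bar>B' t x - B t x\<bar>) \<le> \<epsilon>"
  proof -
    have "stint T (\<lambda>t x. \<bar>B' t x - B t x\<bar>) = stint T (\<lambda>t x. \<bar>((V t x * (\<theta>p t x + \<theta>c t x) - \<Gamma>' t x * A t x * P t x)
       - \<Gamma> t x * Dt A t x * P t x) - \<Gamma> t x * g t x * Dx i A t x * Hs t x\<bar>)"
      unfolding B'_def by (simp add: algebra_simps)
    also have "\<dots> \<le> stint T (\<lambda>t x. \<bar>V t x * (\<theta>p t x + \<theta>c t x)\<bar>) + stint T (\<lambda>t x. \<bar>\<Gamma>' t x * A t x * P t x\<bar>)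
       + stint T (\<lambda>t x. \<bar>\<Gamma> t x * Dt A t x * P t x\<bar>) + stint T (\<lambda>t x. \<bar>\<Gamma> t x * g t x * Dx i A t x * Hs t x\<bar>)"
      by (intro stint_abs_sum4(2) jcont_alg mem)
    finally show ?thesis using X3[OF sa(3) M(3)] Y1 Y2 Y3 e by linarith
  qed
  have R3: "stint T (\<lambda>t x. \<bar>(r t x + (\<theta>p t x + \<theta>c t x)) * V t x - r t x * V t x\<bar>) \<le> \<epsilon>"
  proof -
    have "(r t x + (\<theta>p t x + \<theta>c t x)) * V t x - r t x * V t x = V t x * (\<theta>p t x + \<theta>c t x)" for t x
      by (simp add: algebra_simps)
    moreover have "stint T (\<lambda>t x. \<bar>V t x * (\<theta>p t x + \<theta>c t x)\<bar>) \<le> \<epsilon>"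
      using X3[OF sa(3) M(3)] e by linarith
    ultimately show ?thesis by (simp only:)
  qed
  have R4: "stint T (\<lambda>t x. \<bar>(r t x + (\<theta>p t x + \<theta>c t x)) * (U t x + w t x) - r t x * U t x\<bar>) \<le>
      stint T (\<lambda>t x. \<bar>A t x\<bar>) + \<epsilon>"
  proof -
    \<comment> \<open>The last summand is the one part of the flux increment that cannot be small:
      its mean has to cancel \<open>A\<close>. Its \<open>L^1\<close> norm is nevertheless close to
      that of \<open>A\<close>, since the weights have mean 1 and oscillate fast.\<close>
    have E1: "\<theta>p t x * w t x = - (\<Gamma> t x * g t x * Dx j A t x * (P t x * Q t x)) - A t x * ((\<Gamma> t x * g t x) * (P' t x * Q t x))"
      for t x by (simp add: \<theta>p_def w_def algebra_simps)
    have E2: "(r t x + (\<theta>p t x + \<theta>c t x)) * (U t x + w t x) - r t x * U t x =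
      ((U t x * (\<theta>p t x + \<theta>c t x) + w t x * (r t x + \<theta>c t x))
         - \<Gamma> t x * g t x * Dx j A t x * (P t x * Q t x)) - A t x * ((\<Gamma> t x * g t x) * (P' t x * Q t x))" for t x
      using E1[of t x] by (simp add: ring_distribs mult.commute)
    have "stint T (\<lambda>t x. \<bar>(r t x + (\<theta>p t x + \<theta>c t x)) * (U t x + w t x) - r t x * U t x\<bar>) =
      stint T (\<lambda>t x. \<bar>((U t x * (\<theta>p t x + \<theta>c t x) + w t x * (r t x + \<theta>c t x))
         - \<Gamma> t x * g t x * Dx j A t x * (P t x * Q t x)) - A t x * ((\<Gamma> t x * g t x) * (P' t x * Q t x))\<bar>)"
      by (simp only: E2)
    also have "\<dots> \<le> stint T (\<lambda>t x. \<bar>U t x * (\<theta>p t x + \<theta>c t x)\<bar>) + stint T (\<lambda>t x. \<bar>w t x * (r t x + \<theta>c t x)\<bar>)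
       + stint T (\<lambda>t x. \<bar>\<Gamma> t x * g t x * Dx j A t x * (P t x * Q t x)\<bar>)
       + stint T (\<lambda>t x. \<bar>A t x * ((\<Gamma> t x * g t x) * (P' t x * Q t x))\<bar>)"
      by (intro stint_abs_sum4(3) jcont_alg mem)
    also have "stint T (\<lambda>t x. \<bar>A t x * ((\<Gamma> t x * g t x) * (P' t x * Q t x))\<bar>) \<le> stint T (\<lambda>t x. \<bar>A t x\<bar>) + e + K / real m"
      using K(2)[OF m(1) o1 o2] by (simp add: \<Gamma>_def g_def P'_def Q_def \<tau>_def)
    finally show ?thesis using X3[OF sa(2) M(2)] X4 X2' k(1) e  by linarith
  qed
  have R5: "small_density T q c \<epsilon> (\<lambda>t x. \<theta>p t x + \<theta>c t x)"
    unfolding small_density_def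
  proof (intro exI[of _ "\<lambda>t. C3 * \<gamma> (\<tau> * t) + N * T / real m"] conjI allI impI ballI)
    show "continuous_on UNIV (\<lambda>t. C3 * \<gamma> (\<tau> * t) + N * T / real m)"
      by (intro continuous_on_add continuous_on_mult cg continuous_on_const)
    show "0 \<le> C3 * \<gamma> (\<tau> * t) + N * T / real m" for t using C3 b1 N T by auto
    fix bs :: "(real^'n) list" and t x assume bs: "set bs \<subseteq> Basis \<and> length bs \<le> q" and t: "t \<in> {0..T}"
    \<comment> \<open>\<open>h\<close> depends on time only, so \<open>h t 0\<close> exhibits it as
      a constant factor for the space derivatives.\<close>
    have "(\<lambda>x. \<theta>p t x + \<theta>c t x) = (\<lambda>x. h t 0 * Dx i A t x - \<gamma> (\<tau> * t) * Y t x)"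
      by (simp add: \<theta>p_def \<theta>c_def Y_def h_def \<Gamma>_def)
    moreover have "foldr partial bs (\<lambda>x. h t 0 * Dx i A t x - \<gamma> (\<tau> * t) * Y t x) =
       (\<lambda>x. foldr partial bs (\<lambda>x. h t 0 * Dx i A t x) x - foldr partial bs (\<lambda>x. \<gamma> (\<tau> * t) * Y t x) x)"
      using foldr_partial_diff_alg[of "\<lambda>s x. h t 0 * Dx i A s x" "\<lambda>s x. \<gamma> (\<tau> * t) * Y s x" bs t t] bs
        alg_mult[OF alg_const] Y al by auto
    moreover have "foldr partial bs (\<lambda>x. b * F t x) = (\<lambda>x. b * foldr partial bs (F t) x)" if "F \<in> alg" for b F
      using bs[THEN conjunct1]
    proof (induction bs)
      case (Cons v bs)
      then have F: "(\<lambda>t. foldr partial bs (F t)) \<in> alg" using alg_partials[OF that] by auto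
      obtain l where l: "v = axis l 1" using Cons.prems Basis_axis by auto
      have "partial v (\<lambda>x. b * foldr partial bs (F t) x) x = b * partial v (foldr partial bs (F t)) x" for x
        using fun_cong[OF fun_cong[OF Dx_simps(5)[OF alg_const F, of l b]], of t x] by (simp add: Dx_def l)
      then show ?case using Cons by auto
    qed simp
    ultimately have "\<bar>foldr partial bs (\<lambda>x. \<theta>p t x + \<theta>c t x) x\<bar> =
       \<bar>h t 0 * foldr partial bs (Dx i A t) x - \<gamma> (\<tau> * t) * foldr partial bs (Y t) x\<bar>"
      using Y al by simp
    also have "\<dots> \<le> \<bar>h t 0\<bar> * \<bar>foldr partial bs (Dx i A t) x\<bar> + \<bar>\<gamma> (\<tau> * t)\<bar> * \<bar>foldr partial bs (Y t) x\<bar>"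
      unfolding abs_mult[symmetric] by (rule abs_triangle_ineq4)
    also have "\<dots> \<le> (T / real m) * N + \<gamma> (\<tau> * t) * C3"
      using hb N C3 bs t b1 T by (intro add_mono mult_mono) auto
    finally show "\<bar>foldr partial bs (\<lambda>x. \<theta>p t x + \<theta>c t x) x\<bar> \<le> C3 * \<gamma> (\<tau> * t) + N * T / real m"
      by (simp add: mult_ac add.commute)
  next
    fix p assume p: "1 \<le> p \<and> p \<le> real q"
    define \<beta> where "\<beta> = c * N * T / real m"
    have \<beta>: "0 \<le> \<beta>" "\<beta> \<le> 1" using k(5) c N T by (auto simp: \<beta>_def)
    define R where "R = max 1 (c * C3) ^ q"
    have R: "R \<ge> 0" "(c * C3) powr p \<le> R"
    proof -
      show "R \<ge> 0" by (simp add: R_def)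
      have "(c * C3) powr p \<le> max 1 (c * C3) powr p" using p c C3 by (intro powr_mono2) auto
      also have "\<dots> \<le> max 1 (c * C3) powr (real q)" using p by (intro powr_mono) auto
      also have "\<dots> = R" by (simp add: R_def powr_realpow)
      finally show "(c * C3) powr p \<le> R" .
    qed
    have cp: "continuous_on UNIV (\<lambda>t. 2 ^ q * R * \<gamma> (\<tau> * t) + 2 ^ q * \<beta>)"
      by (intro continuous_on_add continuous_on_mult cg continuous_on_const)
    have "integral {0..T} (\<lambda>t. (c * (C3 * \<gamma> (\<tau> * t) + N * T / real m)) powr p) \<le>
      integral {0..T} (\<lambda>t. 2 ^ q * R * \<gamma> (\<tau> * t) + 2 ^ q * \<beta>)"
    proof (rule integral_le)
      show "(\<lambda>t. (c * (C3 * \<gamma> (\<tau> * t) + N * T / real m)) powr p) integrable_on {0..T}"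
        using p c C3 N T b1 by (intro integrable_continuous_real continuous_on_powr' continuous_on_mult
          continuous_on_add continuous_on_const continuous_on_subset[OF cg(1)]) auto
      show "(\<lambda>t. 2 ^ q * R * \<gamma> (\<tau> * t) + 2 ^ q * \<beta>) integrable_on {0..T}"
        by (intro integrable_continuous_real continuous_on_subset[OF cp]) auto
      fix t
      define y where "y = \<gamma> (\<tau> * t)"
      have y: "0 \<le> y" "y \<le> 1" using b1 by (auto simp: y_def)
      have "(c * (C3 * y + N * T / real m)) powr p = (c * C3 * y + \<beta>) powr p"
        by (simp add: \<beta>_def algebra_simps)
      also have "\<dots> \<le> 2 powr p * ((c * C3 * y) powr p + \<beta> powr p)"
        using c C3 y \<beta> p by (intro powr_sum_bound) auto
      also have "\<dots> \<le> 2 ^ q * (R * y + \<beta>)"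
      proof (intro mult_mono add_mono)
        have "2 powr p \<le> 2 powr (real q)" using p by (intro powr_mono) auto
        then show "2 powr p \<le> (2::real) ^ q" by (simp add: powr_realpow)
        \<comment> \<open>As \<open>\<gamma>\<close> takes values in \<open>[0,1]\<close> and
          \<open>p\<close> is at least 1, all powers are controlled by the mean of
          \<open>\<gamma>\<close> itself.\<close>
        have "y powr p \<le> y powr 1" using y p by (intro powr_mono') auto
        then have "(c * C3) powr p * y powr p \<le> R * y" using R y by (intro mult_mono) auto
        then show "(c * C3 * y) powr p \<le> R * y" using c C3 y by (simp add: powr_mult)
        have "\<beta> powr p \<le> \<beta> powr 1" using \<beta> p by (intro powr_mono') auto
        then show "\<beta> powr p \<le> \<beta>" using \<beta> by simp
      qed (use R y \<beta> in auto)
      finally show "(c * (C3 * \<gamma> (\<tau> * t) + N * T / real m)) powr p \<le> 2 ^ q * R * \<gamma> (\<tau> * t) + 2 ^ q * \<beta>"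
        by (simp add: y_def algebra_simps)
    qed
    also have "\<dots> = 2 ^ q * R * integral {0..T} (\<lambda>t. \<gamma> (\<tau> * t)) + T * (2 ^ q * \<beta>)"
      using T by (subst integral_add) (auto intro!: integrable_continuous_real continuous_on_mult continuous_on_const continuous_on_subset[OF cg(1)])
    also have "2 ^ q * R * integral {0..T} (\<lambda>t. \<gamma> (\<tau> * t)) \<le> 2 ^ q * R * (T * \<delta>2)"
      using I1 R by (intro mult_left_mono) auto
    also have "2 ^ q * R * (T * \<delta>2) \<le> e" using d3(3) by (simp add: R_def mult_ac)
    finally have "integral {0..T} (\<lambda>t. (c * (C3 * \<gamma> (\<tau> * t) + N * T / real m)) powr p) \<le> e + T * (2 ^ q * \<beta>)" by simp
    also have "T * (2 ^ q * \<beta>) \<le> e" using k(6) by (simp add: \<beta>_def mult_ac)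
    finally show "integral {0..T} (\<lambda>t. (c * (C3 * \<gamma> (\<tau> * t) + N * T / real m)) powr p) \<le> \<epsilon>"
      using e by linarith
  qed
  have Dw: "Dx k w = (\<lambda>t x. g t x * Dx k Q t x)" for k
  proof -
    have "Dx k g = (\<lambda>t x. 0)" unfolding g_def by simp
    then show ?thesis unfolding w_def using Dx_simps(5)[OF ti(3) sp(3)] by simp
  qed
  \<comment> \<open>The witness is the time factor of \<open>w\<close> times
    \<open>real m * \<delta>\<close>: the \<open>m\<close> is the price of a space derivative,
    already paid for by the choice of \<open>\<delta>\<close>, and the mean of \<open>|G|\<close> is
    at most 2.\<close>
  have R6: "small_field T q \<epsilon> w"
    unfolding small_field_def
  proof (intro exI[of _ "\<lambda>t. \<bar>G (\<tau> * t)\<bar> * (real m * \<delta>)"] conjI allI impI)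
    show "continuous_on UNIV (\<lambda>t. \<bar>G (\<tau> * t)\<bar> * (real m * \<delta>))"
      by (intro continuous_on_mult continuous_on_rabs cg continuous_on_const)
    show "0 \<le> \<bar>G (\<tau> * t)\<bar> * (real m * \<delta>)" for t using \<delta> by simp
    have "integral {0..T} (\<lambda>t. \<bar>G (\<tau> * t)\<bar> * (real m * \<delta>)) = integral {0..T} (\<lambda>t. \<bar>G (\<tau> * t)\<bar>) * (real m * \<delta>)" by simp
    also have "\<dots> \<le> (T * 2) * (real m * \<delta>)" using I3 \<delta> by (intro mult_right_mono) auto
    also have "(T * 2) * (real m * \<delta>) \<le> e" using d(3) by (simp add: mult_ac)
    finally show "integral {0..T} (\<lambda>t. \<bar>G (\<tau> * t)\<bar> * (real m * \<delta>)) \<le> \<epsilon>" using e by linarith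
    fix t p assume p: "1 \<le> p \<and> p \<le> real q"
    show "integral cube (\<lambda>x. \<bar>w t x\<bar> powr p) \<le> (\<bar>G (\<tau> * t)\<bar> * (real m * \<delta>)) powr p"
    proof -
      have "integral cube (\<lambda>x. \<bar>w t x\<bar> powr p) \<le> integral cube (\<lambda>x::real^'n. (\<bar>G (\<tau> * t)\<bar> * (real m * \<delta>)) powr p)"
      proof (rule integral_le)
        show "(\<lambda>x. \<bar>w t x\<bar> powr p) integrable_on cube" unfolding cube_def
          using p by (intro integrable_continuous continuous_on_powr' continuous_on_rabs continuous_on_const
            jcont_section(1) jcont_alg tp) auto
        show "(\<lambda>x::real^'n. (\<bar>G (\<tau> * t)\<bar> * (real m * \<delta>)) powr p) integrable_on cube" unfolding cube_def
          by (intro integrable_continuous continuous_on_const)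
        fix x :: "real^'n"
        have "\<bar>Q t x\<bar> \<le> real m * \<delta>" using b2(2)[of "real m * x $ j"] m \<delta>
          by (auto simp: Q_def intro: order_trans[OF _ mult_right_mono[of 1 "real m" \<delta>, simplified]])
        then have "\<bar>w t x\<bar> \<le> \<bar>G (\<tau> * t)\<bar> * (real m * \<delta>)"
          by (simp add: w_def g_def abs_mult mult_left_mono)
        then show "\<bar>w t x\<bar> powr p \<le> (\<bar>G (\<tau> * t)\<bar> * (real m * \<delta>)) powr p" using p by (intro powr_mono2) auto
      qed
      then show ?thesis by simp
    qed
    fix k
    show "integral cube (\<lambda>x. \<bar>Dx k w t x\<bar> powr p) \<le> (\<bar>G (\<tau> * t)\<bar> * (real m * \<delta>)) powr p"
    proof (cases "k = j")
      case True
      have c1: "continuous_on UNIV (\<lambda>y. \<bar>\<psi>' y\<bar> powr p)"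
        using p by (intro continuous_on_powr' continuous_on_rabs trig_continuous tr2 continuous_on_const) auto
      have "\<bar>Dx k w t x\<bar> powr p = (\<bar>G (\<tau> * t)\<bar> * real m) powr p * (\<bar>\<psi>' (real m * x $ j)\<bar> powr p)" for x
        unfolding Dw using True by (simp add: DxP(2) Q'_def g_def abs_mult powr_mult[symmetric] mult_ac)
      then have "integral cube (\<lambda>x. \<bar>Dx k w t x\<bar> powr p) =
        (\<bar>G (\<tau> * t)\<bar> * real m) powr p * integral {0..1} (\<lambda>y. \<bar>\<psi>' y\<bar> powr p)"
        using integral_cube_coordinate[OF c1 _ m(1), of j] trig_periodic1[OF tr2(4)] by simp
      also have "\<dots> \<le> (\<bar>G (\<tau> * t)\<bar> * real m) powr p * \<delta> powr p" using b2(3) p by (intro mult_left_mono) auto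
      also have "\<dots> = (\<bar>G (\<tau> * t)\<bar> * (real m * \<delta>)) powr p" using \<delta> by (simp add: powr_mult[symmetric] mult_ac)
      finally show ?thesis .
    qed (simp add: Dw DxP(2))
  qed
  show thesis
    by (rule that[OF new R1 R2 _ _ R4 R3]) (use R5 R6 in simp_all)
qed

subsection \<open>Iteration\<close>

text \<open>Adding majorants inside a power loses the constant \<open>2 powr p\<close>, bounded by
  \<open>2 ^ q\<close>, and there are two summands. The loss is the same for all stages of order
  \<open>q\<close>, so it can be divided out beforehand.\<close>

lemma small_density_add:
  fixes \<theta>1 \<theta>2 :: "real \<Rightarrow> real ^ 'n \<Rightarrow> real"
  assumes s: "small_density T q c \<epsilon> \<theta>1" "small_density T q c \<epsilon> \<theta>2" and al: "\<theta>1 \<in> alg" "\<theta>2 \<in> alg" and c: "c > 0"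
  shows "small_density T q c (2 ^ Suc q * \<epsilon>) (\<lambda>t x. \<theta>1 t x + \<theta>2 t x)"
proof -
  obtain a where a: "continuous_on UNIV a" "\<And>t. 0 \<le> a t"
     "\<And>bs t x. set bs \<subseteq> Basis \<Longrightarrow> length bs \<le> q \<Longrightarrow> t\<in>{0..T} \<Longrightarrow> \<bar>foldr partial bs (\<theta>1 t) x\<bar> \<le> a t"
     "\<And>p. 1 \<le> p \<Longrightarrow> p \<le> real q \<Longrightarrow> integral {0..T} (\<lambda>t. (c * a t) powr p) \<le> \<epsilon>"
    using s(1) unfolding small_density_def by blast
  obtain b where b: "continuous_on UNIV b" "\<And>t. 0 \<le> b t"
     "\<And>bs t x. set bs \<subseteq> Basis \<Longrightarrow> length bs \<le> q \<Longrightarrow> t\<in>{0..T} \<Longrightarrow> \<bar>foldr partial bs (\<theta>2 t) x\<bar> \<le> b t"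
     "\<And>p. 1 \<le> p \<Longrightarrow> p \<le> real q \<Longrightarrow> integral {0..T} (\<lambda>t. (c * b t) powr p) \<le> \<epsilon>"
    using s(2) unfolding small_density_def by blast
  show ?thesis unfolding small_density_def
  proof (intro exI[of _ "\<lambda>t. a t + b t"] conjI allI impI ballI)
    show "continuous_on UNIV (\<lambda>t. a t + b t)" by (intro continuous_on_add a b)
    show "0 \<le> a t + b t" for t using a(2)[of t] b(2)[of t] by simp
    fix bs :: "(real^'n) list" and t x assume bs: "set bs \<subseteq> Basis \<and> length bs \<le> q" and t: "t \<in> {0..T}"
    have al3: "(\<lambda>t x. - \<theta>2 t x) \<in> alg" "(\<lambda>(t::real) (x::real^'n). 0) \<in> alg" by (intro alg_uminus al alg_const)+
    have bs': "set bs \<subseteq> Basis" using bs by simp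
    have z: "foldr partial bs (\<lambda>x. 0::real) = (\<lambda>x. 0)"
      using foldr_partial_diff_alg[where t=t and s=t, OF al3(2,2) bs'] by simp
    have n: "foldr partial bs (\<lambda>x. - \<theta>2 t x) = (\<lambda>x. - foldr partial bs (\<theta>2 t) x)"
      using foldr_partial_diff_alg[where t=t and s=t, OF al3(2) al(2) bs'] z by simp
    have "foldr partial bs (\<lambda>x. \<theta>1 t x + \<theta>2 t x) x = foldr partial bs (\<theta>1 t) x + foldr partial bs (\<theta>2 t) x"
      using foldr_partial_diff_alg[where t=t and s=t, OF al(1) al3(1) bs'] n by simp
    then show "\<bar>foldr partial bs (\<lambda>x. \<theta>1 t x + \<theta>2 t x) x\<bar> \<le> a t + b t"
      using a(3)[of bs t x] b(3)[of bs t x] bs t by linarith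
  next
    fix p assume p: "1 \<le> p \<and> p \<le> real q"
    have ca: "continuous_on S (\<lambda>t. (c * a t) powr p)" "continuous_on S (\<lambda>t. (c * b t) powr p)"
       "continuous_on S (\<lambda>t. (c * (a t + b t)) powr p)" for S
      using p c a(2) b(2) by (auto intro!: continuous_on_powr' continuous_on_mult continuous_on_add continuous_on_const
         continuous_on_subset[OF a(1)] continuous_on_subset[OF b(1)] add_nonneg_nonneg)
    have "integral {0..T} (\<lambda>t. (c * (a t + b t)) powr p) \<le> integral {0..T} (\<lambda>t. 2 ^ q * ((c * a t) powr p + (c * b t) powr p))"
    proof (rule integral_le)
      show "(\<lambda>t. (c * (a t + b t)) powr p) integrable_on {0..T}" by (intro integrable_continuous_real ca)
      show "(\<lambda>t. 2 ^ q * ((c * a t) powr p + (c * b t) powr p)) integrable_on {0..T}"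
        by (intro integrable_continuous_real continuous_on_mult continuous_on_add continuous_on_const ca)
      fix t
      have "(c * (a t + b t)) powr p \<le> 2 powr p * ((c * a t) powr p + (c * b t) powr p)"
        unfolding distrib_left using c a(2)[of t] b(2)[of t] p powr_sum_bound[of "c * a t" "c * b t" p]
        by (simp add: algebra_simps)
      also have "\<dots> \<le> 2 powr (real q) * ((c * a t) powr p + (c * b t) powr p)"
        using p by (intro mult_right_mono powr_mono) auto
      finally show "(c * (a t + b t)) powr p \<le> 2 ^ q * ((c * a t) powr p + (c * b t) powr p)"
        by (simp add: powr_realpow)
    qed
    also have "\<dots> = 2 ^ q * (integral {0..T} (\<lambda>t. (c * a t) powr p) + integral {0..T} (\<lambda>t. (c * b t) powr p))"
      by (simp add: integral_add[symmetric] integrable_continuous_real ca)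
    also have "\<dots> \<le> 2 ^ q * (\<epsilon> + \<epsilon>)" using a(4) b(4) p by (intro mult_left_mono add_mono) auto
    finally show "integral {0..T} (\<lambda>t. (c * (a t + b t)) powr p) \<le> 2 ^ Suc q * \<epsilon>" by simp
  qed
qed

lemma small_mono:
  "small_density T q c \<epsilon> \<theta> \<Longrightarrow> \<epsilon> \<le> \<epsilon>' \<Longrightarrow> small_density T q c \<epsilon>' \<theta>"
  "small_field T q \<epsilon> w \<Longrightarrow> \<epsilon> \<le> \<epsilon>' \<Longrightarrow> small_field T q \<epsilon>' w"
  unfolding small_density_def small_field_def by (meson order_trans)+

text \<open>The flux increments get their own bound \<open>d\<close>: they are of the size of the
  previous error and do not become small with \<open>\<epsilon>\<close>.\<close>

definition close_step :: "real \<Rightarrow> nat \<Rightarrow> real \<Rightarrow> real \<Rightarrow> (real \<Rightarrow> real ^ 'n \<Rightarrow> real) \<Rightarrow> (real \<Rightarrow> real ^ 'n \<Rightarrow> real) \<Rightarrow>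
   (real \<Rightarrow> real ^ 'n \<Rightarrow> real) \<Rightarrow> (real \<Rightarrow> real ^ 'n \<Rightarrow> real) \<Rightarrow> (real \<Rightarrow> real ^ 'n \<Rightarrow> real) \<Rightarrow> (real \<Rightarrow> real ^ 'n \<Rightarrow> real) \<Rightarrow> bool" where
  "close_step T q \<epsilon> d r U V r' U' V' \<longleftrightarrow>
    small_density T q (2 ^ q) \<epsilon> (\<lambda>t x. r' t x - r t x) \<and>
    small_field T q \<epsilon> (\<lambda>t x. U' t x - U t x) \<and> small_field T q \<epsilon> (\<lambda>t x. V' t x - V t x) \<and>
    stint T (\<lambda>t x. \<bar>r' t x * U' t x - r t x * U t x\<bar>) \<le> d \<and>
    stint T (\<lambda>t x. \<bar>r' t x * V' t x - r t x * V t x\<bar>) \<le> d"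

text \<open>The second half step works on the system with the coordinates exchanged. The first has
  changed \<open>B\<close> by at most \<open>e\<close> in \<open>L^1\<close>, so the price for
  cancelling it is still about \<open>D\<close>; conversely the second spoils the already small
  first error by at most \<open>e\<close>.\<close>

lemma full_step:
  fixes r U V A B :: "real \<Rightarrow> real ^ 'n \<Rightarrow> real"
  assumes sys: "Sys i j r U V A B" and ij: "i \<noteq> j" and T: "T > 0" and \<epsilon>: "\<epsilon> > 0"
    and A: "stint T (\<lambda>t x. \<bar>A t x\<bar>) \<le> D" and B: "stint T (\<lambda>t x. \<bar>B t x\<bar>) \<le> D"
  shows "\<exists>r' U' V' A' B'. Sys i j r' U' V' A' B' \<and>
    stint T (\<lambda>t x. \<bar>A' t x\<bar>) \<le> \<epsilon> \<and> stint T (\<lambda>t x. \<bar>B' t x\<bar>) \<le> \<epsilon> \<and>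
    close_step T q \<epsilon> (D + \<epsilon>) r U V r' U' V'"
proof -
  \<comment> \<open>This compensates the factor \<open>2 ^ Suc q\<close> lost in
    \<open>small_density_add\<close> and leaves room for sums of up to four errors.\<close>
  define e where "e = \<epsilon> / 2 ^ (Suc (Suc q))"
  have p2: "(2::real) ^ Suc (Suc q) \<ge> 4" using one_le_power[of "2::real" q] by simp
  have e0: "e > 0" "2 ^ Suc (Suc q) * e = \<epsilon>" unfolding e_def using \<epsilon> by auto
  have "4 * e \<le> 2 ^ Suc (Suc q) * e" using p2 e0(1) by (intro mult_right_mono) auto
  then have e: "e > 0" "4 * e \<le> \<epsilon>" using e0 by auto
  have "2 ^ Suc q * e \<le> 2 ^ Suc (Suc q) * e" using e0(1) by (intro mult_right_mono) auto
  then have e': "2 ^ Suc q * e \<le> \<epsilon>" by (simp only: e0(2))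
  have c: "(2::real) ^ q > 0" by simp
  obtain r1 U1 A1 B1 where s1: "Sys i j r1 U1 V A1 B1"
    "stint T (\<lambda>t x. \<bar>A1 t x\<bar>) \<le> e" "stint T (\<lambda>t x. \<bar>B1 t x - B t x\<bar>) \<le> e"
    "small_density T q (2 ^ q) e (\<lambda>t x. r1 t x - r t x)" "small_field T q e (\<lambda>t x. U1 t x - U t x)"
    "stint T (\<lambda>t x. \<bar>r1 t x * U1 t x - r t x * U t x\<bar>) \<le> stint T (\<lambda>t x. \<bar>A t x\<bar>) + e"
    "stint T (\<lambda>t x. \<bar>r1 t x * V t x - r t x * V t x\<bar>) \<le> e"
    using half_step[OF sys ij T e(1) c, of q] by blast
  have sw: "Sys j i r1 V U1 B1 A1" using s1(1) by (simp add: Sys_swap)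
  obtain r2 V2 B2 A2 where s2: "Sys j i r2 V2 U1 B2 A2"
    "stint T (\<lambda>t x. \<bar>B2 t x\<bar>) \<le> e" "stint T (\<lambda>t x. \<bar>A2 t x - A1 t x\<bar>) \<le> e"
    "small_density T q (2 ^ q) e (\<lambda>t x. r2 t x - r1 t x)" "small_field T q e (\<lambda>t x. V2 t x - V t x)"
    "stint T (\<lambda>t x. \<bar>r2 t x * V2 t x - r1 t x * V t x\<bar>) \<le> stint T (\<lambda>t x. \<bar>B1 t x\<bar>) + e"
    "stint T (\<lambda>t x. \<bar>r2 t x * U1 t x - r1 t x * U1 t x\<bar>) \<le> e"
    using half_step[OF sw ij[symmetric] T e(1) c, of q] by blast
  have al: "r \<in> alg" "U \<in> alg" "V \<in> alg" "A \<in> alg" "B \<in> alg" "r1 \<in> alg" "U1 \<in> alg" "A1 \<in> alg" "B1 \<in> alg"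
    "r2 \<in> alg" "V2 \<in> alg" "A2 \<in> alg" "B2 \<in> alg"
    using sys s1(1) s2(1) unfolding Sys_def by auto
  have tri: "stint T (\<lambda>t x. \<bar>f t x\<bar>) \<le> stint T (\<lambda>t x. \<bar>f t x - g t x\<bar>) + stint T (\<lambda>t x. \<bar>g t x\<bar>)"
    if "f \<in> alg" "g \<in> alg" for f g :: "real \<Rightarrow> real ^ 'n \<Rightarrow> real"
    using stint_abs_add[OF jcont_alg[OF alg_diff[OF that]] jcont_alg[OF that(2)], of T] by simp
  have tri2: "stint T (\<lambda>t x. \<bar>f t x - h t x\<bar>) \<le> stint T (\<lambda>t x. \<bar>f t x - g t x\<bar>) + stint T (\<lambda>t x. \<bar>g t x - h t x\<bar>)"
    if "f \<in> alg" "g \<in> alg" "h \<in> alg" for f g h :: "real \<Rightarrow> real ^ 'n \<Rightarrow> real"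
    using stint_abs_add[OF jcont_alg[OF alg_diff[OF that(1,2)]] jcont_alg[OF alg_diff[OF that(2,3)]], of T] by simp
  have b1: "stint T (\<lambda>t x. \<bar>B1 t x\<bar>) \<le> D + e" using tri[OF al(9) al(5)] s1(3) B by linarith
  have a2: "stint T (\<lambda>t x. \<bar>A2 t x\<bar>) \<le> \<epsilon>" using tri[OF al(12) al(8)] s2(3) s1(2) e by linarith
  have ru: "stint T (\<lambda>t x. \<bar>r2 t x * U1 t x - r t x * U t x\<bar>) \<le> D + \<epsilon>"
    using tri2[OF alg_mult[OF al(10,7)] alg_mult[OF al(6,7)] alg_mult[OF al(1,2)]] s2(7) s1(6) A e by linarith
  have rv: "stint T (\<lambda>t x. \<bar>r2 t x * V2 t x - r t x * V t x\<bar>) \<le> D + \<epsilon>"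
    using tri2[OF alg_mult[OF al(10,11)] alg_mult[OF al(6,3)] alg_mult[OF al(1,3)]] s2(6) s1(7) b1 e by linarith
  have "small_density T q (2 ^ q) (2 ^ Suc q * e) (\<lambda>t x. (r2 t x - r1 t x) + (r1 t x - r t x))"
    by (intro small_density_add s1 s2 alg_diff al c)
  then have sd: "small_density T q (2 ^ q) \<epsilon> (\<lambda>t x. r2 t x - r t x)" using small_mono(1)[OF _ e'] by simp
  have ee: "e \<le> \<epsilon>" using e by linarith
  have "close_step T q \<epsilon> (D + \<epsilon>) r U V r2 U1 V2"
    unfolding close_step_def using sd small_mono(2)[OF s1(5) ee] small_mono(2)[OF s2(5) ee] ru rv by blast
  moreover have "Sys i j r2 U1 V2 A2 B2" using s2(1) by (simp add: Sys_swap)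
  moreover have "stint T (\<lambda>t x. \<bar>B2 t x\<bar>) \<le> \<epsilon>" using s2(2) ee by linarith
  ultimately show ?thesis using a2 by blast
qed

lemma initial_system:
  assumes T: "T > 0"
  obtains r A :: "real \<Rightarrow> real ^ 'n \<Rightarrow> real" where "Sys i j r (\<lambda>t x. 0) (\<lambda>t x. 0) A (\<lambda>t x. 0)"
    "stint T (\<lambda>t x. \<bar>r t x\<bar>) \<ge> 4"
proof -
  \<comment> \<open>The density grows linearly from 0 with zero field, and its time derivative is an
    \<open>i\<close>-derivative, namely the initial error. With this \<open>L\<close> the integral
    of \<open>L * t\<close> is 8, and the mean of the squared cosine is \<open>1 / 2\<close>, whence
    the lower bound 4.\<close>
  define L where "L = 16 / T\<^sup>2"
  define c where "c y = cos (2 * pi * of_int 1 * y)" for y :: real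
  define s where "s y = sin (2 * pi * of_int 1 * y)" for y :: real
  have tr: "c \<in> trig" "s \<in> trig" unfolding c_def s_def by (rule trig_cos trig_sin)+
  have ds: "(s has_real_derivative 2 * pi * c y) (at y)" for y
    unfolding s_def c_def by (auto intro!: derivative_eq_intros)
  define r where "r = (\<lambda>t (x::real^'n). L * t * c (real 1 * x $ i))"
  define A where "A = (\<lambda>(t::real) (x::real^'n). (L / (2 * pi)) * s (real 1 * x $ i))"
  have C: "(\<lambda>t x. c (real 1 * x $ i)) \<in> alg" and S: "(\<lambda>t x. s (real 1 * x $ i)) \<in> alg"
    by (rule alg_space_nat[OF tr(1)] alg_space_nat[OF tr(2)])+
  have Lt: "(\<lambda>t x. L * t) \<in> alg" by (rule alg_mult[OF alg_const alg_id])
  have al: "r \<in> alg" "A \<in> alg" unfolding r_def A_def by (intro alg_mult Lt C S alg_const)+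
  have "Dx i A = (\<lambda>t x. L * c (real 1 * x $ i))"
    unfolding A_def Dx_simps(5)[OF alg_const S] Dx_space_nat[OF tr(2) ds] by simp
  moreover have "Dt (\<lambda>t x. L * t) = (\<lambda>(t::real) (x::real^'n). L)"
    by (rule Dt_eqI) (auto intro!: derivative_eq_intros)
  then have "Dt r = (\<lambda>t x. L * c (real 1 * x $ i))"
    unfolding r_def Dt_simps(5)[OF Lt C] by simp
  ultimately have "Sys i j r (\<lambda>t x. 0) (\<lambda>t x. 0) A (\<lambda>t x. 0)"
    unfolding Sys_def using al by (auto simp: alg_const r_def)
  moreover have "stint T (\<lambda>t x. \<bar>r t x\<bar>) \<ge> 4"
  proof -
    have cc: "continuous_on UNIV (\<lambda>y. c y * c y)" by (intro trig_continuous trig_mult tr)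
    have ccx: "continuous_on UNIV (\<lambda>x::real^'n. c (real 1 * x $ i) * c (real 1 * x $ i))"
      by (rule continuous_on_compose2[OF cc]) (auto intro!: continuous_intros)
    have "((\<lambda>y. c y * c y) has_integral (1/2 + s 1 * c 1 / (4 * pi)) - (0/2 + s 0 * c 0 / (4 * pi))) {0..1}"
    proof (rule has_integral_deriv)
      fix y
      have dc: "(c has_real_derivative - (2 * pi * s y)) (at y)"
        unfolding s_def c_def by (auto intro!: derivative_eq_intros)
      have "((\<lambda>y. y / 2 + s y * c y / (4 * pi)) has_real_derivative
         1 / 2 + (2 * pi * c y * c y + - (2 * pi * s y) * s y) / (4 * pi)) (at y)"
        by (intro DERIV_add DERIV_cdivide DERIV_mult ds dc DERIV_ident)
      moreover have "1 / 2 + (2 * pi * c y * c y + - (2 * pi * s y) * s y) / (4 * pi) = c y * c y"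
      proof -
        have ss: "s y * s y = 1 - c y * c y" using sin_squared_eq[of "2 * pi * of_int 1 * y"]
          by (simp add: s_def c_def power2_eq_square)
        have "2 * pi * c y * c y + - (2 * pi * s y) * s y = 2 * pi * (c y * c y) - 2 * pi * (s y * s y)"
          by simp
        also have "\<dots> = 4 * pi * (c y * c y) - 2 * pi" unfolding ss by (simp add: algebra_simps)
        finally show ?thesis by (simp add: diff_divide_distrib)
      qed
      ultimately show "((\<lambda>y. y / 2 + s y * c y / (4 * pi)) has_real_derivative c y * c y) (at y)" by simp
    qed simp
    then have i1: "integral {0..1} (\<lambda>y. c y * c y) = 1 / 2" by (simp add: integral_unique s_def)
    have i2: "integral cube (\<lambda>x::real^'n. c (real 1 * x $ i) * c (real 1 * x $ i)) = 1 / 2"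
      using integral_cube_coordinate[OF cc, of 1 i] trig_periodic1[OF tr(1)] i1 by simp
    have "((\<lambda>t. L * t) has_integral L * T\<^sup>2 / 2 - L * 0\<^sup>2 / 2) {0..T}"
      using T by (intro has_integral_deriv) (auto intro!: derivative_eq_intros)
    then have i3: "integral {0..T} (\<lambda>t. L * t) = 8" using T by (simp add: integral_unique L_def)
    have cL: "continuous_on UNIV (\<lambda>t. L * t)" by (intro continuous_intros)
    have "4 = stint T (\<lambda>t x. (L * t) * (c (real 1 * x $ i) * c (real 1 * x $ i)))"
      unfolding stint_prod[OF cL ccx] i2 i3 by simp
    also have "\<dots> \<le> stint T (\<lambda>t x. \<bar>r t x\<bar>)"
    proof (rule stint_mono)
      show "jcont (\<lambda>t x. L * t * (c (real 1 * x $ i) * c (real 1 * x $ i)))"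
        by (rule jcont_alg) (intro alg_mult Lt C)
      show "jcont (\<lambda>t x. \<bar>r t x\<bar>)" by (intro jcont_intros jcont_alg al)
      fix t x
      have "\<bar>r t x\<bar> * \<bar>c (real 1 * x $ i)\<bar> \<le> \<bar>r t x\<bar> * 1" by (intro mult_left_mono) (auto simp: c_def)
      then show "L * t * (c (real 1 * x $ i) * c (real 1 * x $ i)) \<le> \<bar>r t x\<bar>"
        by (simp add: r_def abs_mult[symmetric] mult.assoc del: of_nat_1)
    qed
    finally show ?thesis .
  qed
  ultimately show thesis by (rule that)
qed

text \<open>The order \<open>Suc n\<close> of the step grows with \<open>n\<close>, so every fixed
  exponent and every fixed number of derivatives is controlled from some stage on. The flux
  increments are bounded by the preceding errors, which decay geometrically.\<close>

lemma approximate_solutions: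
  assumes ij: "i \<noteq> (j::'n::finite)" and T: "T > 0"
  obtains r U V A B :: "nat \<Rightarrow> real \<Rightarrow> real ^ 'n \<Rightarrow> real" and D where
    "\<And>n. Sys i j (r n) (U n) (V n) (A n) (B n)"
    "\<And>n. stint T (\<lambda>t x. \<bar>A n t x\<bar>) \<le> D * (1/4) ^ n" "\<And>n. stint T (\<lambda>t x. \<bar>B n t x\<bar>) \<le> D * (1/4) ^ n"
    "\<And>n. close_step T (Suc n) ((1/4) ^ Suc n) (2 * D * (1/4) ^ n) (r n) (U n) (V n) (r (Suc n)) (U (Suc n)) (V (Suc n))"
    "stint T (\<lambda>t x. \<bar>r 0 t x\<bar>) \<ge> 4"
proof -
  obtain r0 A0 :: "real \<Rightarrow> real ^ 'n \<Rightarrow> real" where 0: "Sys i j r0 (\<lambda>t x. 0) (\<lambda>t x. 0) A0 (\<lambda>t x. 0)"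
    "stint T (\<lambda>t x. \<bar>r0 t x\<bar>) \<ge> 4"
    using initial_system[OF T] by blast
  define D where "D = max 1 (stint T (\<lambda>t x. \<bar>A0 t x\<bar>))"
  have D: "D \<ge> 1" "stint T (\<lambda>t x. \<bar>A0 t x\<bar>) \<le> D" unfolding D_def by auto
  \<comment> \<open>The lower bound for the initial density is stored in the case
    \<open>n = 0\<close> of the invariant, since dependent choice returns only the sequence and its
    properties.\<close>
  define P where "P n = (\<lambda>(r, U, V, A, B). Sys i j r U V A B \<and>
     stint T (\<lambda>t x. \<bar>A t x\<bar>) \<le> D * (1/4) ^ n \<and> stint T (\<lambda>t x. \<bar>B t x\<bar>) \<le> D * (1/4) ^ n \<and>
     (n = 0 \<longrightarrow> stint T (\<lambda>t x. \<bar>r t x\<bar>) \<ge> 4))" for n :: nat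
  define Q where "Q n = (\<lambda>(r::real \<Rightarrow> real ^ 'n \<Rightarrow> real, U, V, A::real \<Rightarrow> real ^ 'n \<Rightarrow> real, B::real \<Rightarrow> real ^ 'n \<Rightarrow> real) (r', U', V', A'::real \<Rightarrow> real ^ 'n \<Rightarrow> real, B'::real \<Rightarrow> real ^ 'n \<Rightarrow> real).
     close_step T (Suc n) ((1/4) ^ Suc n) (2 * D * (1/4) ^ n) r U V r' U' V')" for n
  have "\<exists>f. \<forall>n. P n (f n) \<and> Q n (f n) (f (Suc n))"
  proof (rule dependent_nat_choice)
    have "stint T (\<lambda>(t::real) (x::real^'n). \<bar>0\<bar>) = 0" by (simp add: stint_iter jcont_intros(6))
    then show "\<exists>x. P 0 x" unfolding P_def using 0 D by (intro exI[of _ "(r0, \<lambda>t x. 0, \<lambda>t x. 0, A0, \<lambda>t x. 0)"]) auto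
    fix x n assume P: "P n x"
    obtain r U V A B where x: "x = (r, U, V, A, B)" by (cases x)
    have p4: "(1/4::real) ^ Suc n > 0" by simp
    from P have "Sys i j r U V A B" "stint T (\<lambda>t x. \<bar>A t x\<bar>) \<le> D * (1/4) ^ n" "stint T (\<lambda>t x. \<bar>B t x\<bar>) \<le> D * (1/4) ^ n"
      by (auto simp: P_def x)
    from full_step[OF this(1) ij T p4 this(2,3), of "Suc n"]
    obtain r' U' V' A' B' where n: "Sys i j r' U' V' A' B'"
      "stint T (\<lambda>t x. \<bar>A' t x\<bar>) \<le> (1/4) ^ Suc n" "stint T (\<lambda>t x. \<bar>B' t x\<bar>) \<le> (1/4) ^ Suc n"
      "close_step T (Suc n) ((1/4) ^ Suc n) (D * (1/4) ^ n + (1/4) ^ Suc n) r U V r' U' V'" by blast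
    have "(1/4) ^ Suc n \<le> D * (1/4::real) ^ Suc n" using D by simp
    moreover have "D * (1/4) ^ n + (1/4) ^ Suc n \<le> 2 * D * (1/4::real) ^ n"
    proof -
      have "(1/4) ^ Suc n \<le> (1/4::real) ^ n" by simp
      also have "\<dots> \<le> D * (1/4) ^ n" using D by simp
      finally show ?thesis by simp
    qed
    ultimately have "P (Suc n) (r', U', V', A', B')" "Q n x (r', U', V', A', B')"
      using n unfolding P_def Q_def x close_step_def by (auto simp del: power_Suc intro: order_trans)
    then show "\<exists>y. P (Suc n) y \<and> Q n x y" by blast
  qed
  then obtain f where f: "\<And>n. P n (f n)" "\<And>n. Q n (f n) (f (Suc n))" by blast
  show thesis
    by (rule that[of "\<lambda>n. fst (f n)" "\<lambda>n. fst (snd (f n))" "\<lambda>n. fst (snd (snd (f n)))"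
       "\<lambda>n. fst (snd (snd (snd (f n))))" "\<lambda>n. snd (snd (snd (snd (f n))))" D])
      (use f in \<open>auto simp: P_def Q_def split_beta\<close>)
qed

subsection \<open>Weak formulation for the approximate solutions\<close>

context
  fixes \<phi> :: "real \<times> (real ^ 'n) \<Rightarrow> real"
  assumes smooth: "smooth \<phi>" and per: "\<And>t. periodic (\<lambda>x. \<phi> (t, x))"
begin

lemma test_has_derivative: "(\<phi> has_derivative frechet_derivative \<phi> (at z)) (at z)"
proof -
  have "C_k (Suc 0) \<phi>" using smooth unfolding smooth_def by blast
  then have "\<phi> differentiable (at z)" by (simp only: C_k.simps)
  then show ?thesis by (simp only: frechet_derivative_works)
qed

lemma test_partial_continuous: "b \<in> Basis \<Longrightarrow> continuous_on UNIV (partial b \<phi>)"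
proof -
  have "C_k (Suc 0) \<phi>" using smooth unfolding smooth_def by blast
  then show "b \<in> Basis \<Longrightarrow> continuous_on UNIV (partial b \<phi>)" by auto
qed

lemma test_derivs:
  "((\<lambda>s. \<phi> (s, x)) has_real_derivative partial (1, 0) \<phi> (t, x)) (at t)"
  "((\<lambda>s. \<phi> (t, x + s *\<^sub>R axis k 1)) has_real_derivative partial (0, axis k 1) \<phi> (t, x + s *\<^sub>R axis k 1)) (at s)"
proof -
  have lin: "frechet_derivative \<phi> (at z) (h *\<^sub>R v) = h * frechet_derivative \<phi> (at z) v" for z h v
    using has_derivative_linear[OF test_has_derivative] by (simp add: linear_scale)
  have "((\<lambda>s. (s, x)) has_derivative (\<lambda>h. h *\<^sub>R (1, 0))) (at t)"
    by (auto intro!: derivative_eq_intros)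
  from has_derivative_compose[OF this test_has_derivative]
  show "((\<lambda>s. \<phi> (s, x)) has_real_derivative partial (1, 0) \<phi> (t, x)) (at t)"
    unfolding lin has_field_derivative_def by (simp add: partial_def mult_commute_abs)
  have "((\<lambda>s. (t, x + s *\<^sub>R axis k 1)) has_derivative (\<lambda>h. h *\<^sub>R (0, axis k 1))) (at s)"
    by (auto intro!: derivative_eq_intros)
  from has_derivative_compose[OF this test_has_derivative]
  show "((\<lambda>s. \<phi> (t, x + s *\<^sub>R axis k 1)) has_real_derivative partial (0, axis k 1) \<phi> (t, x + s *\<^sub>R axis k 1)) (at s)"
    unfolding lin has_field_derivative_def by (simp add: partial_def mult_commute_abs)
qed

lemma test_jcont:
  "jcont (\<lambda>t x. \<phi> (t, x))" "jcont (\<lambda>t x. partial (1, 0) \<phi> (t, x))" "jcont (\<lambda>t x. partial (0, axis k 1) \<phi> (t, x))"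
proof -
  have "continuous_on UNIV \<phi>" using smooth unfolding smooth_def by (metis C_k.simps(1))
  then show "jcont (\<lambda>t x. \<phi> (t, x))" unfolding jcont_def by (simp add: split_beta)
  have "(1, 0) \<in> (Basis :: (real \<times> (real^'n)) set)" "(0, axis k 1) \<in> (Basis :: (real \<times> (real^'n)) set)"
    using Basis_axis[of "axis k 1 :: real^'n"] by (auto simp: Basis_prod_def simp del: Basis_axis)
  then show "jcont (\<lambda>t x. partial (1, 0) \<phi> (t, x))" "jcont (\<lambda>t x. partial (0, axis k 1) \<phi> (t, x))"
    unfolding jcont_def using test_partial_continuous by (simp_all add: split_beta)
qed

lemma test_partial_eqs:
  "deriv (\<lambda>s. \<phi> (s, x)) t = partial (1, 0) \<phi> (t, x)"
  "grad (\<lambda>y. \<phi> (t, y)) x = (\<chi> k. partial (0, axis k 1) \<phi> (t, x))"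
proof -
  show "deriv (\<lambda>s. \<phi> (s, x)) t = partial (1, 0) \<phi> (t, x)" by (rule DERIV_imp_deriv[OF test_derivs(1)])
  have "((\<lambda>y. (t, y)) has_derivative (\<lambda>h. (0, h))) (at x)" by (auto intro!: derivative_eq_intros)
  from has_derivative_compose[OF this test_has_derivative]
  show "grad (\<lambda>y. \<phi> (t, y)) x = (\<chi> k. partial (0, axis k 1) \<phi> (t, x))"
    unfolding grad_def by (simp add: partial_eqI) (simp add: partial_def)
qed

lemma test_partial_periodic: "periodic (\<lambda>x. partial (0, axis k 1) \<phi> (t, x))"
  unfolding periodic_def
proof (intro allI impI)
  fix x m :: "real ^ 'n" assume m: "\<forall>i. m $ i \<in> \<int>"
  have "(\<lambda>s. \<phi> (t, (x + m) + s *\<^sub>R axis k 1)) = (\<lambda>s. \<phi> (t, x + s *\<^sub>R axis k 1))"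
  proof
    fix s
    have "\<phi> (t, (x + s *\<^sub>R axis k 1) + m) = \<phi> (t, x + s *\<^sub>R axis k 1)"
      using per[of t] m unfolding periodic_def by blast
    then show "\<phi> (t, (x + m) + s *\<^sub>R axis k 1) = \<phi> (t, x + s *\<^sub>R axis k 1)" by (simp add: algebra_simps)
  qed
  then show "partial (0, axis k 1) \<phi> (t, x + m) = partial (0, axis k 1) \<phi> (t, x)"
    using DERIV_unique[of "\<lambda>s. \<phi> (t, x + s *\<^sub>R axis k 1)" "partial (0, axis k 1) \<phi> (t, x + m)" 0]
      test_derivs(2)[of t "x + m" k 0] test_derivs(2)[of t x k 0] by simp
qed

lemma stint_space_parts:
  assumes F: "F \<in> alg"
  shows "stint T (\<lambda>t x. Dx k F t x * \<phi> (t, x) + F t x * partial (0, axis k 1) \<phi> (t, x)) = 0"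
proof -
  have jc: "jcont (\<lambda>t x. Dx k F t x * \<phi> (t, x) + F t x * partial (0, axis k 1) \<phi> (t, x))"
    by (intro jcont_intros jcont_alg alg_Dx F test_jcont)
  have "integral cube (\<lambda>x. Dx k F t x * \<phi> (t, x) + F t x * partial (0, axis k 1) \<phi> (t, x)) = 0" for t
  proof (rule integral_cube_derivative[of "\<lambda>x. F t x * \<phi> (t, x)" _ k])
    have p: "periodic (F t)" "periodic (Dx k F t)" "periodic (\<lambda>x. \<phi> (t, x))"
      by (auto intro: alg_periodic alg_Dx F per)
    show "periodic (\<lambda>x. F t x * \<phi> (t, x))"
      using p unfolding periodic_def by simp
    show "periodic (\<lambda>x. Dx k F t x * \<phi> (t, x) + F t x * partial (0, axis k 1) \<phi> (t, x))"
      using p test_partial_periodic[of k t] unfolding periodic_def by simp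
    show "continuous_on UNIV (\<lambda>x. Dx k F t x * \<phi> (t, x) + F t x * partial (0, axis k 1) \<phi> (t, x))"
      using jcont_section(1)[OF jc, of UNIV t] .
    show "((\<lambda>s. F t (x + s *\<^sub>R axis k 1) * \<phi> (t, x + s *\<^sub>R axis k 1)) has_real_derivative
      Dx k F t (x + s *\<^sub>R axis k 1) * \<phi> (t, x + s *\<^sub>R axis k 1) +
      F t (x + s *\<^sub>R axis k 1) * partial (0, axis k 1) \<phi> (t, x + s *\<^sub>R axis k 1)) (at s)" for x s
      using DERIV_mult[OF alg_Dx_line[OF F] test_derivs(2)] by (simp add: add.commute mult.commute)
  qed
  then show ?thesis by (simp add: stint_iter[OF jc])
qed

text \<open>Both end values vanish, at time 0 because of the density and at time \<open>T\<close>
  because of the test function. This is where the initial datum 0 enters the weak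
  formulation.\<close>

lemma stint_time_parts:
  assumes F: "F \<in> alg" and z: "\<And>x. F 0 x = 0" "\<And>x. \<phi> (T, x) = 0" and T: "T > 0"
  shows "stint T (\<lambda>t x. Dt F t x * \<phi> (t, x) + F t x * partial (1, 0) \<phi> (t, x)) = 0"
proof -
  have jc: "jcont (\<lambda>t x. Dt F t x * \<phi> (t, x) + F t x * partial (1, 0) \<phi> (t, x))"
    by (intro jcont_intros jcont_alg alg_Dt F test_jcont)
  have "((\<lambda>t. Dt F t x * \<phi> (t, x) + F t x * partial (1, 0) \<phi> (t, x)) has_integral F T x * \<phi> (T, x) - F 0 x * \<phi> (0, x)) {0..T}" for x
    using T DERIV_mult[OF alg_Dt(2)[OF F] test_derivs(1)]
    by (intro has_integral_deriv) (auto simp: add.commute mult.commute)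
  then have "integral {0..T} (\<lambda>t. Dt F t x * \<phi> (t, x) + F t x * partial (1, 0) \<phi> (t, x)) = 0" for x
    using z by (simp add: integral_unique)
  then show ?thesis by (simp add: stint_swap[OF jc])
qed

text \<open>The system is tested with \<open>\<phi>\<close> and every derivative is moved onto
  \<open>\<phi>\<close>; the field may be taken inside the divergence because its components are
  constant along their own directions. The errors end up paired with bounded functions, so only
  their \<open>L^1\<close> norms matter.\<close>

lemma Sys_weak:
  assumes sys: "Sys i j r U V A B" and z: "\<And>x. \<phi> (T, x) = 0" and T: "T > 0"
  shows "stint T (\<lambda>t x. r t x * partial (1, 0) \<phi> (t, x) + r t x * U t x * partial (0, axis i 1) \<phi> (t, x)
      + r t x * V t x * partial (0, axis j 1) \<phi> (t, x)) =
    stint T (\<lambda>t x. A t x * partial (0, axis i 1) \<phi> (t, x) + B t x * partial (0, axis j 1) \<phi> (t, x))"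
proof -
  have al: "r \<in> alg" "U \<in> alg" "V \<in> alg" "A \<in> alg" "B \<in> alg" "\<And>x. r 0 x = 0" "Dx i U = (\<lambda>t x. 0)" "Dx j V = (\<lambda>t x. 0)"
    and eq: "\<And>t x. Dt r t x + U t x * Dx i r t x + V t x * Dx j r t x = Dx i A t x + Dx j B t x"
    using sys unfolding Sys_def by auto
  define g1 where "g1 = (\<lambda>t x. Dt r t x * \<phi> (t, x) + r t x * partial (1, 0) \<phi> (t, x))"
  define g2 where "g2 = (\<lambda>t x. Dx i (\<lambda>t x. r t x * U t x) t x * \<phi> (t, x) + r t x * U t x * partial (0, axis i 1) \<phi> (t, x))"
  define g3 where "g3 = (\<lambda>t x. Dx j (\<lambda>t x. r t x * V t x) t x * \<phi> (t, x) + r t x * V t x * partial (0, axis j 1) \<phi> (t, x))"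
  define g4 where "g4 = (\<lambda>t x. Dx i A t x * \<phi> (t, x) + A t x * partial (0, axis i 1) \<phi> (t, x))"
  define g5 where "g5 = (\<lambda>t x. Dx j B t x * \<phi> (t, x) + B t x * partial (0, axis j 1) \<phi> (t, x))"
  have s: "stint T g1 = 0" "stint T g2 = 0" "stint T g3 = 0" "stint T g4 = 0" "stint T g5 = 0"
    unfolding g1_def g2_def g3_def g4_def g5_def
    by (intro stint_time_parts stint_space_parts alg_mult al z T)+
  have jc: "jcont g1" "jcont g2" "jcont g3" "jcont g4" "jcont g5"
    unfolding g1_def g2_def g3_def g4_def g5_def
    by (intro jcont_intros(1,3) jcont_alg alg_Dt alg_Dx alg_mult al test_jcont)+
  define h where "h = (\<lambda>t x. A t x * partial (0, axis i 1) \<phi> (t, x) + B t x * partial (0, axis j 1) \<phi> (t, x))"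
  have jh: "jcont h" unfolding h_def by (intro jcont_intros(1,3) jcont_alg al test_jcont)
  have F: "(\<lambda>t x. r t x * partial (1, 0) \<phi> (t, x) + r t x * U t x * partial (0, axis i 1) \<phi> (t, x)
      + r t x * V t x * partial (0, axis j 1) \<phi> (t, x)) =
     (\<lambda>t x. (h t x + (g1 t x + g2 t x + g3 t x)) - (g4 t x + g5 t x))"
  proof (intro ext)
    fix t x
    have "Dx i (\<lambda>t x. r t x * U t x) t x = U t x * Dx i r t x" "Dx j (\<lambda>t x. r t x * V t x) t x = V t x * Dx j r t x"
      using al by (simp_all add: Dx_simps)
    then have "(g1 t x + g2 t x + g3 t x) - (g4 t x + g5 t x) = (Dt r t x + U t x * Dx i r t x + V t x * Dx j r t x - (Dx i A t x + Dx j B t x)) * \<phi> (t, x)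
       + (r t x * partial (1, 0) \<phi> (t, x) + r t x * U t x * partial (0, axis i 1) \<phi> (t, x)
      + r t x * V t x * partial (0, axis j 1) \<phi> (t, x)) - h t x"
      unfolding g1_def g2_def g3_def g4_def g5_def h_def by (simp add: algebra_simps)
    then show "r t x * partial (1, 0) \<phi> (t, x) + r t x * U t x * partial (0, axis i 1) \<phi> (t, x)
      + r t x * V t x * partial (0, axis j 1) \<phi> (t, x) = (h t x + (g1 t x + g2 t x + g3 t x)) - (g4 t x + g5 t x)"
      by (simp add: eq)
  qed
  show ?thesis unfolding F h_def[symmetric]
    using s jc jh by (simp add: stint_diff stint_add jcont_intros(1,2))
qed

lemma Sys_divergence_free:
  assumes sys: "Sys i j r U V A B"
  shows "stint T (\<lambda>t x. U t x * partial (0, axis i 1) \<phi> (t, x) + V t x * partial (0, axis j 1) \<phi> (t, x)) = 0"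
proof -
  have al: "U \<in> alg" "V \<in> alg" "Dx i U = (\<lambda>t x. 0)" "Dx j V = (\<lambda>t x. 0)"
    using sys unfolding Sys_def by auto
  have "stint T (\<lambda>t x. U t x * partial (0, axis i 1) \<phi> (t, x)) = 0" "stint T (\<lambda>t x. V t x * partial (0, axis j 1) \<phi> (t, x)) = 0"
    using stint_space_parts[OF al(1), of T i] stint_space_parts[OF al(2), of T j] al(3,4) by simp_all
  then show ?thesis
    by (subst stint_add) (rule test_jcont jcont_intros(3) jcont_alg al | simp)+
qed

end

subsection \<open>Uniqueness of weak derivatives\<close>

lemma trig_polynomial:
  assumes "real_polynomial_function p" "f \<in> trig" shows "(\<lambda>y. p (f y)) \<in> trig"
  using assms(1)
proof (induction rule: real_polynomial_function.induct)
  case (linear g)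
  have "g y = g 1 * y" for y using bounded_linear.linear[OF linear] linear_cmul[of g y 1] by simp
  then have "(\<lambda>y. g (f y)) = (\<lambda>y. g 1 * f y)" by (intro ext)
  then show ?case using trig_scale[OF assms(2), of "g 1"] by (simp only:)
qed (auto intro: trig_const trig_add trig_mult)

text \<open>\<open>s\<close> is a trigonometric polynomial that, on the unit interval, is positive
  exactly on the given open interval. Truncating \<open>n * s\<close> to \<open>[0,1]\<close>
  therefore converges to the indicator, and a polynomial in \<open>s\<close>, uniformly close to the
  truncation on the range of \<open>s\<close>, stays in \<open>trig\<close>.\<close>

lemma trig_indicator_approx:
  fixes c d :: real
  assumes cd: "0 \<le> c" "c < d" "d \<le> 1"
  shows "\<exists>q::nat \<Rightarrow> real \<Rightarrow> real. (\<forall>n. q n \<in> trig) \<and> (\<forall>n y. \<bar>q n y\<bar> \<le> 2) \<and>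
     (\<forall>y\<in>{0..1}. (\<lambda>n. q n y) \<longlonglongrightarrow> indicator {c<..<d} y)"
proof -
  define m where "m = (c + d) / 2"
  define r where "r = (d - c) / 2"
  define s where "s y = cos (2 * pi * (y - m)) - cos (2 * pi * r)" for y
  define clamp where "clamp z = max 0 (min 1 z)" for z :: real
  have str: "s \<in> trig"
  proof -
    have "s = (\<lambda>y. (cos (2 * pi * m) * cos (2 * pi * of_int 1 * y) + sin (2 * pi * m) * sin (2 * pi * of_int 1 * y)) - cos (2 * pi * r))"
      by (auto simp: s_def fun_eq_iff right_diff_distrib cos_diff)
    also have "\<dots> \<in> trig" by (intro trig_diff trig_add trig_scale trig_cos trig_sin trig_const)
    finally show ?thesis .
  qed
  have sb: "s y \<in> {-2..2}" for y
    using cos_ge_minus_one[of "2 * pi * (y - m)"] cos_le_one[of "2 * pi * (y - m)"]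
      cos_ge_minus_one[of "2 * pi * r"] cos_le_one[of "2 * pi * r"] unfolding s_def atLeastAtMost_iff by linarith
  have "\<exists>p. real_polynomial_function p \<and> (\<forall>z\<in>{-2..2}. \<bar>clamp (real n * z) - p z\<bar> < 1 / real (Suc n))" for n
  proof -
    have "continuous_on {-2..2} (\<lambda>z. clamp (real n * z))" unfolding clamp_def by (intro continuous_intros)
    moreover have "1 / real (Suc n) > 0" by simp
    ultimately obtain p where "real_polynomial_function p"
      "\<And>z. z \<in> {-2..2} \<Longrightarrow> \<bar>clamp (real n * z) - p z\<bar> < 1 / real (Suc n)"
      using Stone_Weierstrass_real_polynomial_function[OF compact_Icc] by blast
    then show ?thesis by blast
  qed
  then have "\<forall>n. \<exists>p. real_polynomial_function p \<and> (\<forall>z\<in>{-2..2}. \<bar>clamp (real n * z) - p z\<bar> < 1 / real (Suc n))" by blast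
  from choice[OF this] obtain P where P: "\<And>n. real_polynomial_function (P n)"
      "\<And>n z. z \<in> {-2..2} \<Longrightarrow> \<bar>clamp (real n * z) - P n z\<bar> < 1 / real (Suc n)"
    by blast
  define q where "q n y = P n (s y)" for n y
  have "q n \<in> trig" for n unfolding q_def by (rule trig_polynomial[OF P(1) str])
  moreover have "\<bar>q n y\<bar> \<le> 2" for n y
  proof -
    have "\<bar>clamp (real n * s y)\<bar> \<le> 1" unfolding clamp_def by auto
    moreover have "1 / real (Suc n) \<le> 1" by simp
    ultimately show ?thesis using P(2)[OF sb[of y], of n] unfolding q_def by linarith
  qed
  moreover have "(\<lambda>n. q n y) \<longlonglongrightarrow> indicator {c<..<d} y" if y: "y \<in> {0..1}" for y
  proof -
    have z1: "\<bar>y - m\<bar> \<le> 1 - r" using y cd unfolding m_def r_def by (auto simp: abs_le_iff field_simps)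
    have r: "0 < r" "r \<le> 1/2" using cd unfolding r_def by auto
    have ce: "cos (2 * pi * (y - m)) = cos (2 * pi * \<bar>y - m\<bar>)" 
      using cos_abs_real[of "2 * pi * (y - m)"] by (simp add: abs_mult)
    have "eventually (\<lambda>n. clamp (real n * s y) = indicator {c<..<d} y) sequentially"
    proof (cases "\<bar>y - m\<bar> < r")
      case True
      then have "cos (2 * pi * r) < cos (2 * pi * \<bar>y - m\<bar>)"
        using r by (intro cos_monotone_0_pi) auto
      then have sp: "s y > 0" unfolding s_def ce by simp
      have "y \<in> {c<..<d}" using True unfolding m_def r_def by (auto simp: abs_less_iff field_simps)
      moreover have "eventually (\<lambda>n. real n \<ge> 1 / s y) sequentially"
        using eventually_ge_at_top[of "nat \<lceil>1 / s y\<rceil>"] by eventually_elim linarith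
      ultimately show ?thesis
        using sp by (auto elim!: eventually_mono simp: clamp_def field_simps)
    next
      case False
      have "cos (2 * pi * \<bar>y - m\<bar>) \<le> cos (2 * pi * r)"
      proof (cases "\<bar>y - m\<bar> \<le> 1/2")
        case True
        then show ?thesis using False r by (intro cos_monotone_0_pi_le) auto
      next
        case F2: False
        \<comment> \<open>Beyond half a period the relevant distance is that to the neighbouring
          copy of the centre, and it is still at least \<open>r\<close>.\<close>
        have "cos (2 * pi * \<bar>y - m\<bar>) = cos (2 * pi * (1 - \<bar>y - m\<bar>))"
          by (simp add: right_diff_distrib cos_diff)
        also have "\<dots> \<le> cos (2 * pi * r)"
          using F2 z1 r by (intro cos_monotone_0_pi_le) auto
        finally show ?thesis .
      qed
      then have sp: "s y \<le> 0" unfolding s_def ce by simp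
      have "y \<notin> {c<..<d}" using False unfolding m_def r_def by (auto simp: abs_less_iff field_simps)
      moreover have "clamp (real n * s y) = 0" for n
        using sp mult_nonneg_nonpos[of "real n" "s y"] by (simp add: clamp_def)
      ultimately show ?thesis by simp
    qed
    then have 1: "(\<lambda>n. clamp (real n * s y)) \<longlonglongrightarrow> indicator {c<..<d} y" by (rule tendsto_eventually)
    have "(\<lambda>n. clamp (real n * s y) - q n y) \<longlonglongrightarrow> 0"
      by (rule Lim_null_comparison[OF _ LIMSEQ_inverse_real_of_nat])
         (use P(2)[OF sb[of y]] in \<open>auto simp: q_def inverse_eq_divide less_imp_le intro!: always_eventually\<close>)
    from tendsto_diff[OF 1 this] show ?thesis by simp
  qed
  ultimately show ?thesis by blast
qed

lemma trig_product_smooth: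
  assumes "\<And>k. q k \<in> trig"
  shows "smooth (\<lambda>x::real^'n. \<Prod>k\<in>UNIV. q k (x $ k))" "periodic (\<lambda>x::real^'n. \<Prod>k\<in>UNIV. q k (x $ k))"
    "continuous_on UNIV (\<lambda>x::real^'n. \<Prod>k\<in>UNIV. q k (x $ k))"
proof -
  have "(\<lambda>t x. q k (x $ k)) \<in> alg" for k :: 'n using alg_space_nat[OF assms, where m = 1] by simp
  then have al: "(\<lambda>(t::real) (x::real^'n). \<Prod>k\<in>UNIV. q k (x $ k)) \<in> alg" by (intro alg_prod)
  show "smooth (\<lambda>x::real^'n. \<Prod>k\<in>UNIV. q k (x $ k))" "periodic (\<lambda>x::real^'n. \<Prod>k\<in>UNIV. q k (x $ k))"
    "continuous_on UNIV (\<lambda>x::real^'n. \<Prod>k\<in>UNIV. q k (x $ k))"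
    using alg_smooth[OF al] alg_periodic[OF al] jcont_section(1)[OF jcont_alg[OF al]] by simp_all
qed

text \<open>Open boxes form an intersection-stable generator of the Borel sets, and the sets with
  vanishing integral form a Dynkin system; the hypothesis on the whole space serves the
  complements.\<close>

lemma integral_zero_on_boxes_imp_zero:
  fixes f :: "'a::euclidean_space \<Rightarrow> real"
  assumes f: "integrable lborel f" and z: "integral\<^sup>L lborel f = 0"
    and b: "\<And>a b. (LINT x:box a b|lborel. f x) = 0"
  shows "AE x in lborel. f x = 0"
proof (rule sigma_finite_measure.density_zero[OF lborel.sigma_finite_measure_axioms f])
  have fi: "set_integrable lborel A f" if "A \<in> sets borel" for A
    unfolding set_integrable_def using integrable_mult_indicator[OF _ f, of A] that by simp
  fix A :: "'a set" assume "A \<in> sets lborel"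
  then have A: "A \<in> sigma_sets UNIV (range (\<lambda>(a, b). box a b :: 'a set))"
    using borel_eq_box[where 'a='a] by (metis sets_lborel sets_measure_of top_greatest Pow_UNIV)
  have sb: "sigma_sets UNIV (range (\<lambda>(a, b). box a b :: 'a set)) = sets borel"
    by (subst borel_eq_box) simp
  show "set_lebesgue_integral lborel A f = 0"
  proof (rule sigma_sets_induct_disjoint[where P = "\<lambda>A. set_lebesgue_integral lborel A f = 0", OF _ _ A])
    show "Int_stable (range (\<lambda>(a, b). box a b :: 'a set))"
    proof (rule Int_stableI)
      fix X Y :: "'a set" assume "X \<in> range (\<lambda>(a, b). box a b)" "Y \<in> range (\<lambda>(a, b). box a b)"
      then obtain a b c d where "X = box a b" "Y = box c d" by auto
      then have "X \<inter> Y = (\<lambda>(a, b). box a b) (\<Sum>i\<in>Basis. max (a \<bullet> i) (c \<bullet> i) *\<^sub>R i, \<Sum>i\<in>Basis. min (b \<bullet> i) (d \<bullet> i) *\<^sub>R i)"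
        by (simp add: box_Int_box)
      then show "X \<inter> Y \<in> range (\<lambda>(a, b). box a b)" by blast
    qed
    show "range (\<lambda>(a, b). box a b :: 'a set) \<subseteq> Pow UNIV" by simp
    show "set_lebesgue_integral lborel A f = 0" if "A \<in> range (\<lambda>(a, b). box a b)" for A using that b by auto
    show "set_lebesgue_integral lborel {} f = 0" by (simp add: set_lebesgue_integral_def)
  next
    fix A :: "'a set" assume compl: "A \<in> sigma_sets UNIV (range (\<lambda>(a, b). box a b))" "set_lebesgue_integral lborel A f = 0"
    then have Ab: "A \<in> sets borel" using sb by simp
    have "(LINT x:UNIV - A|lborel. f x) = (LINT x|lborel. f x - indicator A x *\<^sub>R f x)"
      unfolding set_lebesgue_integral_def by (intro Bochner_Integration.integral_cong) (auto simp: indicator_def)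
    also have "\<dots> = integral\<^sup>L lborel f - (LINT x:A|lborel. f x)"
      unfolding set_lebesgue_integral_def
      by (rule Bochner_Integration.integral_diff[OF f fi[OF Ab, unfolded set_integrable_def]])
    finally show "set_lebesgue_integral lborel (UNIV - A) f = 0" using z compl(2) by simp
  next
    fix A :: "nat \<Rightarrow> 'a set" assume union: "disjoint_family A" "range A \<subseteq> sigma_sets UNIV (range (\<lambda>(a, b). box a b))"
      "\<And>i. set_lebesgue_integral lborel (A i) f = 0"
    then have Ab: "A i \<in> sets borel" for i using sb by auto
    have "(LINT x:(\<Union>i. A i)|lborel. f x) = (\<Sum>i. LINT x:A i|lborel. f x)"
    proof (rule lebesgue_integral_countable_add)
      show "A i \<in> sets lborel" for i using Ab by simp
      show "A i \<inter> A j = {}" if "i \<noteq> j" for i j using union(1) that by (auto simp: disjoint_family_on_def)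
      show "set_integrable lborel (\<Union>i. A i) f" using Ab by (intro fi) auto
    qed
    then show "set_lebesgue_integral lborel (\<Union>i. A i) f = 0" using union(3) by simp
  qed
qed

text \<open>Products of one-dimensional approximants converge boundedly to indicators of boxes, so
  by dominated convergence the orthogonality passes to boxes. Cutting \<open>v\<close> off to the
  open unit box makes a box indistinguishable from its intersection with the unit box, including at
  the faces.\<close>

lemma trig_orthogonal_imp_zero:
  fixes v :: "real^'n \<Rightarrow> real"
  assumes int: "set_integrable lborel cube v"
    and orth: "\<And>q. (\<And>k. q k \<in> trig) \<Longrightarrow> (LINT x:cube|lborel. (\<Prod>k\<in>UNIV. q k (x $ k)) * v x) = 0"
  shows "AE x in lborel. x \<in> cube \<longrightarrow> v x = 0"
proof -
  define f where "f x = indicator (box 0 1) x * v x" for x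
  have AEc: "AE x in lborel. x \<notin> cbox 0 1 - box 0 (1::real^'n)"
    by (rule AE_not_in[OF null_sets_cbox_Diff_box])
  have iv: "integrable lborel (\<lambda>x. indicator cube x * v x)" using int by (simp add: set_integrable_def)
  have f: "integrable lborel f"
  proof -
    have "integrable lborel (\<lambda>x. indicator (box 0 1) x *\<^sub>R (indicator cube x * v x))"
      by (rule integrable_mult_indicator[OF _ iv]) simp
    moreover have "(\<lambda>x. indicator (box 0 1) x *\<^sub>R (indicator cube x * v x)) = f"
      unfolding f_def cube_def using box_subset_cbox[of 0 "1::real^'n"] by (auto simp: fun_eq_iff indicator_def)
    ultimately show ?thesis by simp
  qed
  have fm: "f \<in> borel_measurable borel" using borel_measurable_integrable[OF f] by simp
  have qf: "(LINT x|lborel. (\<Prod>k\<in>UNIV. q k (x $ k)) * f x) = 0" if q: "\<And>k. q k \<in> trig" for q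
  proof -
    have qm: "(\<lambda>x::real^'n. \<Prod>k\<in>UNIV. q k (x $ k)) \<in> borel_measurable borel"
      by (intro borel_measurable_continuous_onI trig_product_smooth q)
    have "(LINT x|lborel. (\<Prod>k\<in>UNIV. q k (x $ k)) * f x) = (LINT x|lborel. (\<Prod>k\<in>UNIV. q k (x $ k)) * (indicator cube x * v x))"
    proof (rule integral_cong_AE)
      show "AE x in lborel. (\<Prod>k\<in>UNIV. q k (x $ k)) * f x = (\<Prod>k\<in>UNIV. q k (x $ k)) * (indicator cube x * v x)"
        using AEc by eventually_elim (use box_subset_cbox[of 0 "1::real^'n"] in \<open>auto simp: f_def cube_def indicator_def\<close>)
      show "(\<lambda>x. (\<Prod>k\<in>UNIV. q k (x $ k)) * f x) \<in> borel_measurable lborel" using qm fm by simp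
      show "(\<lambda>x. (\<Prod>k\<in>UNIV. q k (x $ k)) * (indicator cube x * v x)) \<in> borel_measurable lborel"
        using qm borel_measurable_integrable[OF iv] by simp
    qed
    also have "\<dots> = 0" using orth[of q, OF q] by (simp add: set_lebesgue_integral_def mult_ac)
    finally show ?thesis .
  qed
  have z: "integral\<^sup>L lborel f = 0" using qf[of "\<lambda>k y. 1"] trig_const by simp
  have b: "(LINT x:box a b|lborel. f x) = 0" for a b :: "real^'n"
  proof (cases "\<forall>k. max 0 (a $ k) < min 1 (b $ k)")
    case False
    then obtain k where k: "\<not> max 0 (a $ k) < min 1 (b $ k)" by blast
    have "indicator (box a b) x *\<^sub>R f x = 0" for x
    proof (rule ccontr)
      assume "\<not> ?thesis"
      then have "x \<in> box a b" "x \<in> box 0 1" by (auto simp: f_def indicator_def split: if_splits)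
      then have "a $ k < x $ k" "x $ k < b $ k" "0 < x $ k" "x $ k < 1" by (auto simp: mem_box_cart)
      with k show False by auto
    qed
    then show ?thesis unfolding set_lebesgue_integral_def
      by (subst Bochner_Integration.integral_cong[where g = "\<lambda>x. 0"]) auto
  next
    case True
    have "\<exists>q::nat \<Rightarrow> real \<Rightarrow> real. (\<forall>n. q n \<in> trig) \<and> (\<forall>n y. \<bar>q n y\<bar> \<le> 2) \<and>
     (\<forall>y\<in>{0..1}. (\<lambda>n. q n y) \<longlonglongrightarrow> indicator {max 0 (a $ k)<..<min 1 (b $ k)} y)" for k
      using True by (intro trig_indicator_approx) auto
    then have "\<forall>k. \<exists>q::nat \<Rightarrow> real \<Rightarrow> real. (\<forall>n. q n \<in> trig) \<and> (\<forall>n y. \<bar>q n y\<bar> \<le> 2) \<and>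
     (\<forall>y\<in>{0..1}. (\<lambda>n. q n y) \<longlonglongrightarrow> indicator {max 0 (a $ k)<..<min 1 (b $ k)} y)" by blast
    from choice[OF this] obtain q :: "'n \<Rightarrow> nat \<Rightarrow> real \<Rightarrow> real" where q: "\<And>k n. q k n \<in> trig" "\<And>k n y. \<bar>q k n y\<bar> \<le> 2"
      "\<And>k y. y \<in> {0..1} \<Longrightarrow> (\<lambda>n. q k n y) \<longlonglongrightarrow> indicator {max 0 (a $ k)<..<min 1 (b $ k)} y"
      by blast
    have qm: "(\<lambda>x::real^'n. \<Prod>k\<in>UNIV. q k n (x $ k)) \<in> borel_measurable borel" for n
      by (intro borel_measurable_continuous_onI trig_product_smooth q)
    have "(\<lambda>n. LINT x|lborel. (\<Prod>k\<in>UNIV. q k n (x $ k)) * f x) \<longlonglongrightarrow> (LINT x|lborel. indicator (box a b) x * f x)"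
    proof (rule integral_dominated_convergence[where w="\<lambda>x. 2 ^ CARD('n) * \<bar>f x\<bar>"])
      show "(\<lambda>x. indicator (box a b) x * f x) \<in> borel_measurable lborel" using fm by simp
      show "(\<lambda>x. (\<Prod>k\<in>UNIV. q k n (x $ k)) * f x) \<in> borel_measurable lborel" for n using qm[of n] fm by simp
      show "integrable lborel (\<lambda>x. 2 ^ CARD('n) * \<bar>f x\<bar>)" using f by simp
      show "AE x in lborel. norm ((\<Prod>k\<in>UNIV. q k n (x $ k)) * f x) \<le> 2 ^ CARD('n) * \<bar>f x\<bar>" for n
      proof (rule AE_I2)
        fix x :: "real^'n"
        have "\<bar>\<Prod>k\<in>UNIV. q k n (x $ k)\<bar> \<le> (\<Prod>k\<in>(UNIV::'n set). 2)"
          unfolding abs_prod by (intro prod_mono) (use q in auto)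
        then show "norm ((\<Prod>k\<in>UNIV. q k n (x $ k)) * f x) \<le> 2 ^ CARD('n) * \<bar>f x\<bar>"
          by (simp add: abs_mult mult_right_mono)
      qed
      show "AE x in lborel. (\<lambda>n. (\<Prod>k\<in>UNIV. q k n (x $ k)) * f x) \<longlonglongrightarrow> indicator (box a b) x * f x"
      proof (rule AE_I2)
        fix x :: "real^'n"
        show "(\<lambda>n. (\<Prod>k\<in>UNIV. q k n (x $ k)) * f x) \<longlonglongrightarrow> indicator (box a b) x * f x"
        proof (cases "x \<in> box 0 1")
          case True
          then have x: "0 < x $ k" "x $ k < 1" for k by (auto simp: mem_box_cart)
          have "(\<lambda>n. \<Prod>k\<in>UNIV. q k n (x $ k)) \<longlonglongrightarrow> (\<Prod>k\<in>UNIV. indicator {max 0 (a $ k)<..<min 1 (b $ k)} (x $ k))"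
            using x by (intro tendsto_prod q) (auto simp: less_imp_le)
          also have "(\<Prod>k\<in>UNIV. indicator {max 0 (a $ k)<..<min 1 (b $ k)} (x $ k)) = (indicator (box a b) x :: real)"
          proof (cases "x \<in> box a b")
            case True
            then show ?thesis using x by (simp add: mem_box_cart)
          next
            case False
            then obtain k where "\<not> (a $ k < x $ k \<and> x $ k < b $ k)" by (auto simp: mem_box_cart)
            then have "indicator {max 0 (a $ k)<..<min 1 (b $ k)} (x $ k) = (0::real)" by auto
            then have "(\<Prod>k\<in>UNIV. indicator {max 0 (a $ k)<..<min 1 (b $ k)} (x $ k)) = (0::real)"
              by (intro prod_zero) auto
            then show ?thesis using False by simp
          qed
          finally show ?thesis by (intro tendsto_mult tendsto_const)
        qed (simp add: f_def)
      qed
    qed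
    then have "(\<lambda>n. 0::real) \<longlonglongrightarrow> (LINT x|lborel. indicator (box a b) x * f x)" using qf[OF q(1)] by simp
    then have "(LINT x|lborel. indicator (box a b) x * f x) = 0" by (simp add: LIMSEQ_const_iff)
    then show ?thesis by (simp add: set_lebesgue_integral_def)
  qed
  have "AE x in lborel. f x = 0" by (rule integral_zero_on_boxes_imp_zero[OF f z b])
  with AEc show ?thesis by eventually_elim (auto simp: f_def cube_def indicator_def)
qed

lemma cube_sets [measurable, simp]: "cube \<in> sets borel" "cube \<in> sets lebesgue" "cube \<in> sets lborel"
  unfolding cube_def by simp_all

lemma torus_L1_integrable:
  fixes f :: "real^'n \<Rightarrow> 'b::euclidean_space"
  assumes "f \<in> torus_Lp 1"
  shows "integrable lebesgue (\<lambda>x. indicator cube x *\<^sub>R f x)"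
proof -
  have m: "(\<lambda>x. indicator cube x *\<^sub>R f x) \<in> borel_measurable lebesgue"
    using assms by (simp add: torus_Lp_def borel_measurable_restrict_space_iff)
  have "integrable lebesgue (\<lambda>x. indicator cube x *\<^sub>R (norm (f x) powr 1))"
    using assms by (simp add: torus_Lp_def set_integrable_def)
  then have "integrable lebesgue (\<lambda>x. norm (indicator cube x *\<^sub>R f x))" by simp
  from integrable_norm_cancel[OF this m] show ?thesis .
qed

text \<open>The difference of two weak derivatives is orthogonal to all smooth periodic functions,
  in particular to products of trigonometric polynomials in the single coordinates, and these
  determine it almost everywhere.\<close>

lemma weak_partial_unique:
  fixes f :: "real^'n \<Rightarrow> 'b::euclidean_space"
  assumes v: "has_weak_partial i f v" and v': "has_weak_partial i f v'"
  shows "AE x in lebesgue. x \<in> cube \<longrightarrow> v x = v' x"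
proof -
  have vi: "integrable lebesgue (\<lambda>x. indicator cube x *\<^sub>R v x)" "integrable lebesgue (\<lambda>x. indicator cube x *\<^sub>R v' x)"
    by (rule torus_L1_integrable; use v v' in \<open>unfold has_weak_partial_def, blast\<close>)+
  define w where "w x = indicator cube x *\<^sub>R v x - indicator cube x *\<^sub>R v' x" for x
  have w: "integrable lebesgue w" unfolding w_def using vi by simp
  have "AE x in lebesgue. w x \<bullet> b = 0" if b: "b \<in> Basis" for b
  proof -
    have wb: "integrable lebesgue (\<lambda>x. w x \<bullet> b)" using w by simp
    \<comment> \<open>Weak derivatives are only Lebesgue measurable; each component is replaced by a
      Borel representative, for which the orthogonality criterion is stated.\<close>
    obtain g where g: "g \<in> borel_measurable lborel" "AE x in lborel. w x \<bullet> b = g x"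
      using completion_ex_borel_measurable_real[OF borel_measurable_integrable[OF wb]] by blast
    have gAE: "AE x in lebesgue. w x \<bullet> b = g x" using AE_completion[OF g(2)] .
    have gm: "g \<in> borel_measurable lebesgue" using g(1) by (rule measurable_completion)
    have gi: "integrable lborel g"
      using wb integrable_cong_AE[OF borel_measurable_integrable[OF wb] gm gAE] integrable_completion[OF g(1)] by simp
    have "AE x in lborel. x \<in> cube \<longrightarrow> g x = 0"
    proof (rule trig_orthogonal_imp_zero)
      show "set_integrable lborel cube g" unfolding set_integrable_def
        by (rule integrable_mult_indicator[OF _ gi]) simp
      fix q :: "'n \<Rightarrow> real \<Rightarrow> real" assume q: "\<And>k. q k \<in> trig"
      define \<phi> where "\<phi> x = (\<Prod>k\<in>UNIV. q k (x $ k))" for x :: "real^'n"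
      have \<phi>: "smooth \<phi>" "periodic \<phi>" "continuous_on UNIV \<phi>"
        using trig_product_smooth[of q, OF q] unfolding \<phi>_def by auto
      have \<phi>m: "\<phi> \<in> borel_measurable borel" by (rule borel_measurable_continuous_onI[OF \<phi>(3)])
      obtain C where C: "\<And>x. \<bar>\<phi> x\<bar> \<le> C"
      proof -
        have "\<forall>k. \<exists>M\<ge>0. \<forall>y. \<bar>q k y\<bar> \<le> M" using trig_bounded[OF q] by blast
        from choice[OF this] obtain M where M: "\<And>k. M k \<ge> 0" "\<And>k y. \<bar>q k y\<bar> \<le> M k" by blast
        have "\<bar>\<phi> x\<bar> \<le> (\<Prod>k\<in>UNIV. M k)" for x unfolding \<phi>_def abs_prod by (intro prod_mono) (use M in auto)
        then show thesis by (rule that)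
      qed
      have ii: "integrable lebesgue (\<lambda>x. \<phi> x *\<^sub>R h x)" if "integrable lebesgue h" for h :: "real^'n \<Rightarrow> 'b"
      proof (rule Bochner_Integration.integrable_bound[OF integrable_scaleR_right[OF that, of C]])
        show "(\<lambda>x. \<phi> x *\<^sub>R h x) \<in> borel_measurable lebesgue"
          by (intro borel_measurable_scaleR borel_measurable_integrable[OF that] measurable_completion) (use \<phi>m in simp)
        have "C \<ge> 0" using C[of 0] by linarith
        then show "AE x in lebesgue. norm (\<phi> x *\<^sub>R h x) \<le> norm (C *\<^sub>R h x)"
          using C by (auto intro!: mult_right_mono)
      qed
      have "(LINT x:cube|lebesgue. partial (axis i 1) \<phi> x *\<^sub>R f x) = - (LINT x:cube|lebesgue. \<phi> x *\<^sub>R v x)"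
        using v \<phi> unfolding has_weak_partial_def by blast
      moreover have "(LINT x:cube|lebesgue. partial (axis i 1) \<phi> x *\<^sub>R f x) = - (LINT x:cube|lebesgue. \<phi> x *\<^sub>R v' x)"
        using v' \<phi> unfolding has_weak_partial_def by blast
      ultimately have "(LINT x:cube|lebesgue. \<phi> x *\<^sub>R v x) = (LINT x:cube|lebesgue. \<phi> x *\<^sub>R v' x)" by simp
      then have "(LINT x|lebesgue. \<phi> x *\<^sub>R (indicator cube x *\<^sub>R v x)) = (LINT x|lebesgue. \<phi> x *\<^sub>R (indicator cube x *\<^sub>R v' x))"
        by (simp add: set_lebesgue_integral_def mult.commute)
      then have 0: "(LINT x|lebesgue. \<phi> x *\<^sub>R w x) = 0"
        unfolding w_def scaleR_diff_right using ii[OF vi(1)] ii[OF vi(2)] by simp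
      have 1: "(LINT x|lebesgue. \<phi> x * (w x \<bullet> b)) = 0"
        using integral_inner_left[OF ii[OF w], of b] 0 by simp
      have "(LINT x|lebesgue. \<phi> x * g x) = (LINT x|lebesgue. \<phi> x * (w x \<bullet> b))"
        by (rule integral_cong_AE)
          (use gAE gm borel_measurable_integrable[OF wb] measurable_completion[of \<phi> lborel borel] \<phi>m in \<open>auto elim!: eventually_mono\<close>)
      then have 2: "(LINT x|lborel. \<phi> x * g x) = 0"
        using 1 integral_completion[of "\<lambda>x. \<phi> x * g x" lborel] \<phi>m g(1) by simp
      have "(LINT x:cube|lborel. \<phi> x * g x) = (LINT x|lborel. \<phi> x * g x)"
        unfolding set_lebesgue_integral_def
      proof (rule integral_cong_AE)
        show "AE x in lborel. indicator cube x *\<^sub>R (\<phi> x * g x) = \<phi> x * g x"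
          using g(2) by eventually_elim (auto simp: w_def indicator_def)
      qed (use \<phi>m g(1) in auto)
      then show "(LINT x:cube|lborel. (\<Prod>k\<in>UNIV. q k (x $ k)) * g x) = 0" using 2 unfolding \<phi>_def by simp
    qed
    then have "AE x in lebesgue. x \<in> cube \<longrightarrow> g x = 0" by (rule AE_completion)
    with gAE show ?thesis by eventually_elim (auto simp: w_def indicator_def)
  qed
  then have "AE x in lebesgue. \<forall>b\<in>Basis. w x \<bullet> b = 0" by (subst AE_finite_all) auto
  then show ?thesis
  proof eventually_elim
    fix x assume "\<forall>b\<in>Basis. w x \<bullet> b = 0"
    then have "w x = 0" using euclidean_eqI[of "w x" 0] by simp
    then show "x \<in> cube \<longrightarrow> v x = v' x" unfolding w_def by (intro impI) simp
  qed
qed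

text \<open>\<open>weak_partial\<close> is an arbitrary choice, so its norm can be computed only
  through almost everywhere uniqueness; every Sobolev norm that occurs is evaluated in this
  way.\<close>

lemma Lp_norm_weak_partial:
  fixes f :: "real^'n \<Rightarrow> 'b::euclidean_space"
  assumes v: "has_weak_partial i f v"
  shows "Lp_norm p (weak_partial i f) = Lp_norm p v"
proof -
  have w: "has_weak_partial i f (weak_partial i f)" unfolding weak_partial_def by (rule someI[where P = "has_weak_partial i f", OF v])
  have m: "(\<lambda>x. indicator cube x *\<^sub>R (norm (g x) powr p)) \<in> borel_measurable lebesgue" if "has_weak_partial i f g" for g
  proof -
    have "g \<in> borel_measurable (lebesgue_on cube)" using that by (auto simp: has_weak_partial_def torus_Lp_def)
    then have "(\<lambda>x. norm (g x) powr p) \<in> borel_measurable (lebesgue_on cube)" by measurable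
    then show ?thesis by (simp add: borel_measurable_restrict_space_iff)
  qed
  have "(LINT x:cube|lebesgue. norm (weak_partial i f x) powr p) = (LINT x:cube|lebesgue. norm (v x) powr p)"
    unfolding set_lebesgue_integral_def
    using weak_partial_unique[OF w v] by (intro integral_cong_AE m v w) (auto elim!: eventually_mono simp: indicator_def)
  then show ?thesis by (simp add: Lp_norm_def)
qed

subsection \<open>Convergence of series of functions\<close>

text \<open>Beppo Levi: in \<open>ennreal\<close> sum and integral may be exchanged, and a function
  with finite integral is finite almost everywhere.\<close>

lemma AE_summable_integrals:
  fixes g :: "nat \<Rightarrow> 'a \<Rightarrow> real"
  assumes g: "\<And>n. integrable M (g n)" "\<And>n x. 0 \<le> g n x" and s: "summable (\<lambda>n. \<integral>x. g n x \<partial>M)"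
  shows "AE x in M. summable (\<lambda>n. g n x)"
proof -
  have gm: "(\<lambda>x. ennreal (g n x)) \<in> borel_measurable M" for n using borel_measurable_integrable[OF g(1)[of n]] by simp
  have "(\<integral>\<^sup>+ x. (\<Sum>n. ennreal (g n x)) \<partial>M) = (\<Sum>n. \<integral>\<^sup>+ x. ennreal (g n x) \<partial>M)"
    by (rule nn_integral_suminf[OF gm])
  also have "\<dots> = (\<Sum>n. ennreal (\<integral>x. g n x \<partial>M))"
    by (intro suminf_cong nn_integral_eq_integral g AE_I2)
  also have "\<dots> = ennreal (\<Sum>n. \<integral>x. g n x \<partial>M)"
    by (intro suminf_ennreal2 s integral_nonneg_AE AE_I2 g)
  finally have "(\<integral>\<^sup>+ x. (\<Sum>n. ennreal (g n x)) \<partial>M) \<noteq> \<infinity>" by simp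
  from nn_integral_PInf_AE[OF borel_measurable_suminf_order[OF gm] this]
  show ?thesis by eventually_elim (auto intro: summable_suminf_not_top g)
qed

lemma telescoping_limit:
  fixes f :: "nat \<Rightarrow> real"
  assumes d: "\<And>l. \<bar>f (Suc l) - f l\<bar> \<le> a l" and a: "summable a"
  shows "f \<longlonglongrightarrow> lim f" "\<bar>lim f - f 0\<bar> \<le> suminf a"
proof -
  define g where "g l = f (Suc l) - f l" for l
  have g: "summable (\<lambda>l. \<bar>g l\<bar>)" by (rule summable_comparison_test'[OF a, of 0]) (use d in \<open>auto simp: g_def\<close>)
  have sg: "g sums suminf g" using summable_rabs_cancel[OF g] by (rule summable_sums)
  have "(\<lambda>n. \<Sum>l<n. g l) = (\<lambda>n. f n - f 0)" unfolding g_def by (simp add: sum_lessThan_telescope)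
  then have "(\<lambda>n. f n - f 0) \<longlonglongrightarrow> suminf g" using sg unfolding sums_def by simp
  from tendsto_add[OF this tendsto_const[of "f 0"]] have L: "f \<longlonglongrightarrow> suminf g + f 0" by simp
  then have lf: "lim f = suminf g + f 0" by (rule limI)
  show "f \<longlonglongrightarrow> lim f" using L lf by simp
  have "\<bar>suminf g\<bar> \<le> (\<Sum>l. \<bar>g l\<bar>)" by (rule summable_rabs[OF g])
  also have "\<dots> \<le> suminf a" using d by (intro suminf_le g a) (auto simp: g_def)
  finally show "\<bar>lim f - f 0\<bar> \<le> suminf a" using lf by simp
qed

text \<open>Control of the increments begins at index \<open>n\<close> only, as it does for
  derivatives of order \<open>n\<close> and for exponents up to \<open>n\<close>; the limit itself
  is unaffected by the first terms.\<close>

lemma telescoping_tail: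
  fixes f :: "nat \<Rightarrow> real"
  assumes d: "\<And>l. n \<le> l \<Longrightarrow> \<bar>f (Suc l) - f l\<bar> \<le> a l" and a: "summable a"
  shows "f \<longlonglongrightarrow> lim f" "\<bar>lim f - f n\<bar> \<le> (\<Sum>l. a (l + n))"
proof -
  have s: "summable (\<lambda>l. a (l + n))" using a by (simp add: summable_iff_shift)
  have d': "\<bar>f (Suc l + n) - f (l + n)\<bar> \<le> a (l + n)" for l using d[of "l + n"] by simp
  note t = telescoping_limit[of "\<lambda>l. f (l + n)", OF d' s]
  have c: "f \<longlonglongrightarrow> lim (\<lambda>l. f (l + n))" using t(1) by (rule LIMSEQ_offset)
  have e: "lim f = lim (\<lambda>l. f (l + n))" using limI[OF c] by simp
  show "f \<longlonglongrightarrow> lim f" using c e by simp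
  show "\<bar>lim f - f n\<bar> \<le> (\<Sum>l. a (l + n))" using t(2) e by simp
qed

lemma suminf_tail_tendsto_zero:
  fixes a :: "nat \<Rightarrow> real" assumes "summable a" shows "(\<lambda>n. \<Sum>l. a (l + n)) \<longlonglongrightarrow> 0"
proof -
  have "(\<lambda>n. suminf a - (\<Sum>l<n. a l)) \<longlonglongrightarrow> suminf a - suminf a"
    by (intro tendsto_diff tendsto_const summable_LIMSEQ assms)
  then show ?thesis using suminf_minus_initial_segment[OF assms] by simp
qed

text \<open>\<open>lim\<close> defines the limit function at every point, with an unspecified but
  measurable default where the sequence diverges. The series of absolute increments is an integrable
  dominating function, which gives convergence in \<open>L^1\<close>.\<close>

lemma L1_limit:
  fixes f :: "nat \<Rightarrow> 'a \<Rightarrow> real"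
  assumes f: "\<And>n. integrable M (f n)" and s: "summable (\<lambda>n. \<integral>x. \<bar>f (Suc n) x - f n x\<bar> \<partial>M)"
  shows "AE x in M. (\<lambda>n. f n x) \<longlonglongrightarrow> lim (\<lambda>n. f n x)" "integrable M (\<lambda>x. lim (\<lambda>n. f n x))"
    "(\<lambda>n. \<integral>x. \<bar>f n x - lim (\<lambda>n. f n x)\<bar> \<partial>M) \<longlonglongrightarrow> 0"
proof -
  define g where "g n x = \<bar>f (Suc n) x - f n x\<bar>" for n x
  have g: "integrable M (g n)" "0 \<le> g n x" for n x unfolding g_def using f by auto
  have fm: "f n \<in> borel_measurable M" for n using f by (rule borel_measurable_integrable)
  have lm: "(\<lambda>x. lim (\<lambda>n. f n x)) \<in> borel_measurable M" using fm by (rule borel_measurable_lim_metric)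
  have AE: "AE x in M. summable (\<lambda>n. g n x)"
    using s by (intro AE_summable_integrals g) (simp add: g_def)
  show 1: "AE x in M. (\<lambda>n. f n x) \<longlonglongrightarrow> lim (\<lambda>n. f n x)"
    using AE by eventually_elim (rule telescoping_limit, auto simp: g_def)
  have hi: "integrable M (\<lambda>x. \<Sum>n. g n x)"
    using AE s by (intro integrable_suminf g) (auto simp: g_def)
  have b: "AE x in M. \<bar>f n x - lim (\<lambda>n. f n x)\<bar> \<le> (\<Sum>n. g n x)" for n
    using AE
  proof eventually_elim
    fix x assume sm: "summable (\<lambda>n. g n x)"
    have "\<bar>lim (\<lambda>n. f n x) - f n x\<bar> \<le> (\<Sum>l. g (l + n) x)"
      by (rule telescoping_tail(2)[where a = "\<lambda>n. g n x"]) (use sm in \<open>auto simp: g_def\<close>)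
    also have "\<dots> = (\<Sum>n. g n x) - (\<Sum>l<n. g l x)" using suminf_minus_initial_segment[OF sm, of n] by simp
    also have "\<dots> \<le> (\<Sum>n. g n x)" using sum_nonneg[of "{..<n}" "\<lambda>l. g l x"] g by simp
    finally show "\<bar>f n x - lim (\<lambda>n. f n x)\<bar> \<le> (\<Sum>n. g n x)" by (simp add: abs_minus_commute)
  qed
  have "integrable M (\<lambda>x. f 0 x - lim (\<lambda>n. f n x))"
  proof (rule Bochner_Integration.integrable_bound[OF hi])
    show "(\<lambda>x. f 0 x - lim (\<lambda>n. f n x)) \<in> borel_measurable M" using fm lm by simp
    show "AE x in M. norm (f 0 x - lim (\<lambda>n. f n x)) \<le> norm (\<Sum>n. g n x)"
      using b[of 0] by eventually_elim (auto intro: order_trans[OF _ abs_ge_self])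
  qed
  from Bochner_Integration.integrable_diff[OF f[of 0] this]
  show "integrable M (\<lambda>x. lim (\<lambda>n. f n x))" by simp
  have "(\<lambda>n. \<integral>x. \<bar>f n x - lim (\<lambda>n. f n x)\<bar> \<partial>M) \<longlonglongrightarrow> (\<integral>x. 0 \<partial>M)"
  proof (rule integral_dominated_convergence[OF _ _ hi])
    show "(\<lambda>x. \<bar>f n x - lim (\<lambda>n. f n x)\<bar>) \<in> borel_measurable M" for n using fm lm by simp
    show "AE x in M. (\<lambda>n. \<bar>f n x - lim (\<lambda>n. f n x)\<bar>) \<longlonglongrightarrow> 0"
      using 1 by eventually_elim (simp add: LIM_zero_iff tendsto_rabs_zero)
    show "AE x in M. norm \<bar>f n x - lim (\<lambda>n. f n x)\<bar> \<le> (\<Sum>n. g n x)" for n using b[of n] by simp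
  qed simp
  then show "(\<lambda>n. \<integral>x. \<bar>f n x - lim (\<lambda>n. f n x)\<bar> \<partial>M) \<longlonglongrightarrow> 0" by simp
qed

text \<open>A replacement for Minkowski's inequality for infinite sums: if \<open>Y\<close> is the
  weighted sum, each \<open>a l\<close> is at most \<open>(1/2) ^ Suc l * Y powr (1/p)\<close>, and
  these coefficients add up to 1. The price is the weights \<open>2 ^ Suc l\<close>, which geometric
  decay of the increments can afford.\<close>

lemma powr_suminf_le:
  fixes a :: "nat \<Rightarrow> real"
  assumes a: "\<And>l. 0 \<le> a l" and p: "p \<ge> 1" and fin: "(\<Sum>l. ennreal ((2 ^ Suc l * a l) powr p)) \<noteq> top"
  shows "summable a" "ennreal (suminf a powr p) \<le> (\<Sum>l. ennreal ((2 ^ Suc l * a l) powr p))"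
proof -
  define b where "b l = (2 ^ Suc l * a l) powr p" for l
  have b: "0 \<le> b l" for l by (simp add: b_def)
  have sb: "summable b" using fin by (intro summable_suminf_not_top b) (simp add: b_def)
  define Y where "Y = suminf b"
  have bY: "b l \<le> Y" for l unfolding Y_def using sum_le_suminf[OF sb, of "{l}"] b by simp
  have Y0: "Y \<ge> 0" using bY[of 0] b[of 0] by linarith
  have al: "a l \<le> (1/2) ^ Suc l * Y powr (1/p)" for l
  proof -
    have "2 ^ Suc l * a l = b l powr (1/p)" using a[of l] p by (simp add: b_def powr_powr del: power_Suc)
    also have "\<dots> \<le> Y powr (1/p)" using b bY p by (intro powr_mono2) auto
    finally show ?thesis by (simp add: power_one_over field_simps)
  qed
  have gs: "(\<lambda>l. (1/2::real) ^ Suc l * Y powr (1/p)) sums (1 * Y powr (1/p))"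
    by (intro sums_mult2 power_half_series)
  show sa: "summable a"
    by (rule summable_comparison_test'[OF sums_summable[OF gs], of 0]) (use a al in auto)
  have "suminf a \<le> Y powr (1/p)"
    using suminf_le[OF al sa sums_summable[OF gs]] sums_unique[OF gs] by simp
  then have "suminf a powr p \<le> (Y powr (1/p)) powr p" using p a suminf_nonneg[OF sa] by (intro powr_mono2) auto
  also have "\<dots> = Y" using p Y0 by (simp add: powr_powr)
  finally have "ennreal (suminf a powr p) \<le> ennreal Y" by (rule ennreal_leI)
  also have "ennreal Y = (\<Sum>l. ennreal (b l))" unfolding Y_def by (rule suminf_ennreal2[OF b sb, symmetric])
  finally show "ennreal (suminf a powr p) \<le> (\<Sum>l. ennreal ((2 ^ Suc l * a l) powr p))" by (simp add: b_def)
qed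

text \<open>Summable sequences embed into the \<open>p\<close>-summable ones: \<open>p - 1\<close>
  of the powers are estimated by the total sum, which dominates each term.\<close>

lemma suminf_powr_le:
  fixes x :: "nat \<Rightarrow> real"
  assumes x: "\<And>l. 0 \<le> x l" "summable x" and p: "p \<ge> 1"
  shows "summable (\<lambda>l. x l powr p)" "(\<Sum>l. x l powr p) \<le> suminf x powr p"
proof -
  have xl: "x l \<le> suminf x" for l using sum_le_suminf[OF x(2), of "{l}"] x(1) by simp
  have X: "suminf x \<ge> 0" using x suminf_nonneg by blast
  have b: "x l powr p \<le> x l * suminf x powr (p - 1)" for l
  proof -
    have "x l powr p = x l * x l powr (p - 1)" using x(1)[of l] by (cases "x l = 0") (auto simp: powr_diff)
    also have "\<dots> \<le> x l * suminf x powr (p - 1)" using x(1)[of l] xl p by (intro mult_left_mono powr_mono2) auto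
    finally show ?thesis .
  qed
  have sm: "summable (\<lambda>l. x l * suminf x powr (p - 1))" using x(2) by (rule summable_mult2)
  show s: "summable (\<lambda>l. x l powr p)" by (rule summable_comparison_test'[OF sm, of 0]) (use b in auto)
  have "(\<Sum>l. x l powr p) \<le> (\<Sum>l. x l * suminf x powr (p - 1))" by (intro suminf_le b s sm)
  also have "\<dots> = suminf x * suminf x powr (p - 1)" by (rule suminf_mult2[OF x(2), symmetric])
  also have "\<dots> = suminf x powr p" using X by (cases "suminf x = 0") (auto simp: powr_diff)
  finally show "(\<Sum>l. x l powr p) \<le> suminf x powr p" .
qed

lemma continuous_cbox_integral:
  fixes f :: "'a::euclidean_space \<Rightarrow> real"
  assumes "continuous_on UNIV f"
  shows "set_integrable lborel (cbox a b) f" "(LINT x:cbox a b|lborel. f x) = integral (cbox a b) f"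
proof -
  show s: "set_integrable lborel (cbox a b) f" unfolding set_integrable_def
    by (rule borel_integrable_compact) (auto intro: continuous_on_subset[OF assms])
  show "(LINT x:cbox a b|lborel. f x) = integral (cbox a b) f" by (rule set_borel_integral_eq_integral(2)[OF s])
qed

lemma continuous_cbox_nn_integral:
  fixes f :: "'a::euclidean_space \<Rightarrow> real"
  assumes "continuous_on UNIV f" "\<And>x. 0 \<le> f x"
  shows "(\<integral>\<^sup>+x. ennreal (indicator (cbox a b) x * f x) \<partial>lborel) = ennreal (integral (cbox a b) f)"
proof -
  have "(\<integral>\<^sup>+x. ennreal (indicator (cbox a b) x * f x) \<partial>lborel) = ennreal (LINT x|lborel. indicator (cbox a b) x * f x)"
    using continuous_cbox_integral(1)[OF assms(1), of a b] assms(2)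
    by (intro nn_integral_eq_integral) (auto simp: set_integrable_def)
  then show ?thesis using continuous_cbox_integral(2)[OF assms(1), of a b] by (simp add: set_lebesgue_integral_def)
qed

text \<open>The pointwise sum estimate \<open>powr_suminf_le\<close> is integrated over the box. The
  same extended integral yields convergence almost everywhere and the norm bound, so completeness of
  \<open>L^p\<close> does not have to be invoked separately.\<close>

lemma Lp_limit:
  fixes f :: "nat \<Rightarrow> 'a::euclidean_space \<Rightarrow> real"
  assumes f: "\<And>l. continuous_on UNIV (f l)" and p: "p \<ge> 1"
    and g: "\<And>l. integral (cbox a b) (\<lambda>x. \<bar>f (Suc l) x - f l x\<bar> powr p) \<le> g l powr p" "\<And>l. 0 \<le> g l"
    and s: "summable (\<lambda>l. 2 ^ Suc l * g l)"
  shows "AE x in lborel. x \<in> cbox a b \<longrightarrow> (\<lambda>l. f l x) \<longlonglongrightarrow> lim (\<lambda>l. f l x)"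
    "(\<integral>\<^sup>+x. ennreal (indicator (cbox a b) x * \<bar>lim (\<lambda>l. f l x) - f 0 x\<bar> powr p) \<partial>lborel) \<le>
      ennreal ((\<Sum>l. 2 ^ Suc l * g l) powr p)"
proof -
  define I where "I = (indicator (cbox a b) :: 'a \<Rightarrow> real)"
  define d where "d l x = (2 ^ Suc l * \<bar>f (Suc l) x - f l x\<bar>) powr p" for l x
  have dc: "continuous_on UNIV (d l)" for l
    unfolding d_def using p by (intro continuous_on_powr' continuous_intros f) auto
  have dm: "(\<lambda>x. ennreal (I x * d l x)) \<in> borel_measurable lborel" for l
    unfolding I_def using borel_measurable_continuous_onI[OF dc[of l]] by simp
  have "(\<integral>\<^sup>+x. (\<Sum>l. ennreal (I x * d l x)) \<partial>lborel) = (\<Sum>l. \<integral>\<^sup>+x. ennreal (I x * d l x) \<partial>lborel)"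
    by (rule nn_integral_suminf[OF dm])
  also have "\<dots> = (\<Sum>l. ennreal (integral (cbox a b) (d l)))"
    unfolding I_def by (intro suminf_cong continuous_cbox_nn_integral dc) (simp add: d_def)
  also have "\<dots> \<le> (\<Sum>l. ennreal ((2 ^ Suc l * g l) powr p))"
  proof (intro suminf_le ennreal_leI)
    fix l
    have "integral (cbox a b) (d l) = (2 ^ Suc l) powr p * integral (cbox a b) (\<lambda>x. \<bar>f (Suc l) x - f l x\<bar> powr p)"
      unfolding d_def by (simp add: powr_mult)
    also have "\<dots> \<le> (2 ^ Suc l) powr p * g l powr p" using g by (intro mult_left_mono) auto
    also have "\<dots> = (2 ^ Suc l * g l) powr p" using g by (simp add: powr_mult)
    finally show "integral (cbox a b) (d l) \<le> (2 ^ Suc l * g l) powr p" .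
  qed auto
  also have "\<dots> = ennreal (\<Sum>l. (2 ^ Suc l * g l) powr p)"
    using g s p by (intro suminf_ennreal2 suminf_powr_le) auto
  also have "\<dots> \<le> ennreal ((\<Sum>l. 2 ^ Suc l * g l) powr p)"
    using g s p by (intro ennreal_leI suminf_powr_le) auto
  finally have main: "(\<integral>\<^sup>+x. (\<Sum>l. ennreal (I x * d l x)) \<partial>lborel) \<le> ennreal ((\<Sum>l. 2 ^ Suc l * g l) powr p)" .
  have nt: "(\<integral>\<^sup>+x. (\<Sum>l. ennreal (I x * d l x)) \<partial>lborel) \<noteq> \<infinity>"
  proof
    assume "(\<integral>\<^sup>+x. (\<Sum>l. ennreal (I x * d l x)) \<partial>lborel) = \<infinity>"
    with main show False by (simp add: top_unique)
  qed
  have AE: "AE x in lborel. (\<Sum>l. ennreal (I x * d l x)) \<noteq> \<infinity>"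
    by (rule nn_integral_PInf_AE[OF borel_measurable_suminf_order[OF dm] nt])
  have conv: "(\<lambda>l. f l x) \<longlonglongrightarrow> lim (\<lambda>l. f l x)"
     "ennreal (\<bar>lim (\<lambda>l. f l x) - f 0 x\<bar> powr p) \<le> (\<Sum>l. ennreal (d l x))"
    if fin: "(\<Sum>l. ennreal (d l x)) \<noteq> \<infinity>" for x
  proof -
    have fin': "(\<Sum>l. ennreal ((2 ^ Suc l * \<bar>f (Suc l) x - f l x\<bar>) powr p)) \<noteq> top"
      using fin by (simp add: d_def)
    note P = powr_suminf_le[OF _ p fin']
    have sm: "summable (\<lambda>l. \<bar>f (Suc l) x - f l x\<bar>)" by (rule P(1)) simp
    note t = telescoping_limit[of "\<lambda>l. f l x" "\<lambda>l. \<bar>f (Suc l) x - f l x\<bar>", OF order_refl sm]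
    show "(\<lambda>l. f l x) \<longlonglongrightarrow> lim (\<lambda>l. f l x)" by (rule t(1))
    have "\<bar>lim (\<lambda>l. f l x) - f 0 x\<bar> powr p \<le> (\<Sum>l. \<bar>f (Suc l) x - f l x\<bar>) powr p"
      using p t(2) by (intro powr_mono2) auto
    then have "ennreal (\<bar>lim (\<lambda>l. f l x) - f 0 x\<bar> powr p) \<le> ennreal ((\<Sum>l. \<bar>f (Suc l) x - f l x\<bar>) powr p)"
      by (rule ennreal_leI)
    also have "\<dots> \<le> (\<Sum>l. ennreal (d l x))" unfolding d_def by (rule P(2)) simp
    finally show "ennreal (\<bar>lim (\<lambda>l. f l x) - f 0 x\<bar> powr p) \<le> (\<Sum>l. ennreal (d l x))" .
  qed
  show "AE x in lborel. x \<in> cbox a b \<longrightarrow> (\<lambda>l. f l x) \<longlonglongrightarrow> lim (\<lambda>l. f l x)"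
    using AE
  proof eventually_elim
    fix x assume fin: "(\<Sum>l. ennreal (I x * d l x)) \<noteq> \<infinity>"
    show "x \<in> cbox a b \<longrightarrow> (\<lambda>l. f l x) \<longlonglongrightarrow> lim (\<lambda>l. f l x)"
    proof
      assume "x \<in> cbox a b"
      with fin have "(\<Sum>l. ennreal (d l x)) \<noteq> \<infinity>" by (simp add: I_def)
      then show "(\<lambda>l. f l x) \<longlonglongrightarrow> lim (\<lambda>l. f l x)" by (rule conv(1))
    qed
  qed
  have "(\<integral>\<^sup>+x. ennreal (I x * \<bar>lim (\<lambda>l. f l x) - f 0 x\<bar> powr p) \<partial>lborel) \<le> (\<integral>\<^sup>+x. (\<Sum>l. ennreal (I x * d l x)) \<partial>lborel)"
  proof (rule nn_integral_mono_AE, use AE in eventually_elim)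
    fix x assume fin: "(\<Sum>l. ennreal (I x * d l x)) \<noteq> \<infinity>"
    show "ennreal (I x * \<bar>lim (\<lambda>l. f l x) - f 0 x\<bar> powr p) \<le> (\<Sum>l. ennreal (I x * d l x))"
    proof (cases "x \<in> cbox a b")
      case True
      then show ?thesis using conv(2)[of x] fin by (simp add: I_def)
    qed (simp add: I_def)
  qed
  with main show "(\<integral>\<^sup>+x. ennreal (indicator (cbox a b) x * \<bar>lim (\<lambda>l. f l x) - f 0 x\<bar> powr p) \<partial>lborel) \<le>
      ennreal ((\<Sum>l. 2 ^ Suc l * g l) powr p)" unfolding I_def by (rule order_trans[rotated])
qed

subsection \<open>Bochner spaces\<close>

text \<open>Sampling at the grid points of mesh \<open>1 / K\<close> gives finitely many values on
  \<open>[0,T]\<close>, and the level sets are measurable whatever the type of the values, because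
  the floor takes values in a countable discrete space.\<close>

lemma floor_step_simple:
  fixes c :: "int \<Rightarrow> 'x"
  assumes K: "K > 0"
  shows "finite ((\<lambda>t. c \<lfloor>t * K\<rfloor>) ` {0..T::real})" "{t \<in> {0..T}. c \<lfloor>t * K\<rfloor> = h} \<in> sets lebesgue"
proof -
  have "\<lfloor>t * K\<rfloor> \<in> {0..\<lfloor>T * K\<rfloor>}" if "t \<in> {0..T}" for t
  proof -
    have "t * K \<le> T * K" "0 \<le> t * K" using that K by auto
    then show ?thesis using floor_mono by auto
  qed
  then have "(\<lambda>t. c \<lfloor>t * K\<rfloor>) ` {0..T} \<subseteq> c ` {0..\<lfloor>T * K\<rfloor>}" by blast
  then show "finite ((\<lambda>t. c \<lfloor>t * K\<rfloor>) ` {0..T})" by (rule finite_subset) simp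
  have "(\<lambda>t. \<lfloor>t * K\<rfloor>) \<in> borel \<rightarrow>\<^sub>M count_space UNIV" by measurable
  from measurable_sets[OF this, of "c -` {h}"]
  have "(\<lambda>t. \<lfloor>t * K\<rfloor>) -` (c -` {h}) \<in> sets borel" by simp
  then have "{0..T} \<inter> (\<lambda>t. \<lfloor>t * K\<rfloor>) -` (c -` {h}) \<in> sets borel" by (intro sets.Int) auto
  moreover have "{0..T} \<inter> (\<lambda>t. \<lfloor>t * K\<rfloor>) -` (c -` {h}) = {t \<in> {0..T}. c \<lfloor>t * K\<rfloor> = h}" by auto
  ultimately have "{t \<in> {0..T}. c \<lfloor>t * K\<rfloor> = h} \<in> sets borel" by simp
  then show "{t \<in> {0..T}. c \<lfloor>t * K\<rfloor> = h} \<in> sets lebesgue" by simp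
qed

lemma floor_step_near:
  fixes t K :: real assumes "K > 0" "t \<in> {0..T}"
  shows "of_int \<lfloor>t * K\<rfloor> / K \<in> {0..T}" "\<bar>t - of_int \<lfloor>t * K\<rfloor> / K\<bar> \<le> 1 / K"
proof -
  have f: "of_int \<lfloor>t * K\<rfloor> \<le> t * K" "t * K < of_int \<lfloor>t * K\<rfloor> + 1" "0 \<le> \<lfloor>t * K\<rfloor>" using assms by auto
  have 1: "of_int \<lfloor>t * K\<rfloor> / K \<le> t" using f assms by (simp add: pos_divide_le_eq)
  have 2: "t \<le> of_int \<lfloor>t * K\<rfloor> / K + 1 / K" using f assms by (simp add: add_divide_distrib[symmetric] pos_le_divide_eq)
  have 3: "0 \<le> of_int \<lfloor>t * K\<rfloor> / K" using f(3) assms(1) by simp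
  show "of_int \<lfloor>t * K\<rfloor> / K \<in> {0..T}" using 1 3 assms by auto
  show "\<bar>t - of_int \<lfloor>t * K\<rfloor> / K\<bar> \<le> 1 / K" using 1 2 by linarith
qed

text \<open>The simple functions demanded by \<open>bochner_Lp\<close> are stage \<open>n\<close>
  frozen at grid times. The mesh may depend on \<open>n\<close>, so a stage with fast oscillation in
  time receives a correspondingly fine grid.\<close>

lemma bochner_Lp_stepI:
  fixes R :: "nat \<Rightarrow> real \<Rightarrow> real^'n \<Rightarrow> 'b::euclidean_space"
  assumes K: "\<And>n. K n > (0::real)"
    and X: "\<And>n t. t \<in> {0..T} \<Longrightarrow> R n t \<in> X"
    and g: "AE t in lborel. t \<in> {0..T} \<longrightarrow> f t \<in> X \<and> (\<lambda>n. N (\<lambda>x. R n (of_int \<lfloor>t * K n\<rfloor> / K n) x - f t x)) \<longlonglongrightarrow> 0"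
    and i: "set_integrable lborel {0..T} (\<lambda>t. N (f t) powr p)"
  shows "f \<in> bochner_Lp T p X N"
proof -
  define s where "s n t = R n (of_int \<lfloor>t * K n\<rfloor> / K n)" for n t
  have "finite (s n ` {0..T})" "{t \<in> {0..T}. s n t = h} \<in> sets lebesgue" for n h
    unfolding s_def
    using floor_step_simple[where c = "\<lambda>z. R n (of_int z / K n)" and T = T, OF K[of n]] by auto
  moreover have "s n ` {0..T} \<subseteq> X" for n unfolding s_def using floor_step_near(1)[OF K] X by blast
  moreover have "AE t in lebesgue_on {0..T}. f t \<in> X \<and> (\<lambda>n::nat. N (\<lambda>x. s n t x - f t x)) \<longlonglongrightarrow> 0"
  proof -
    have "AE t in lebesgue. t \<in> {0..T} \<longrightarrow> f t \<in> X \<and> (\<lambda>n. N (\<lambda>x. R n (of_int \<lfloor>t * K n\<rfloor> / K n) x - f t x)) \<longlonglongrightarrow> 0"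
      using g by (rule AE_completion)
    then show ?thesis unfolding s_def by (subst AE_restrict_space_iff) simp_all
  qed
  moreover have "set_integrable lebesgue {0..T} (\<lambda>t. N (f t) powr p)"
    using i integrable_completion[OF borel_measurable_integrable[OF i[unfolded set_integrable_def]]]
    unfolding set_integrable_def by simp
  ultimately show ?thesis unfolding bochner_Lp_def by (intro CollectI exI[of _ f] exI[of _ s]) auto
qed

lemma alg_lipschitz: assumes F: "F \<in> alg"
  shows "\<exists>L\<ge>0. \<forall>s\<in>{0..T}. \<forall>t\<in>{0..T}. \<forall>x. \<bar>F t x - F s x\<bar> \<le> L * \<bar>t - s\<bar>"
proof -
  obtain L where L: "L \<ge> 0" "\<And>t x. t \<in> {0..T} \<Longrightarrow> \<bar>Dt F t x\<bar> \<le> L"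
    using alg_bounded[OF alg_Dt(1)[OF F], of T] by blast
  have "\<bar>F t x - F s x\<bar> \<le> L * \<bar>t - s\<bar>" if "s \<in> {0..T}" "t \<in> {0..T}" for s t x
    using field_differentiable_bound[of "{0..T}" "\<lambda>t. F t x" "\<lambda>t. Dt F t x" L t s] that L
      has_field_derivative_at_within[OF alg_Dt(2)[OF F]] by simp
  then show ?thesis using L(1) by blast
qed

lemma alg_partials_lipschitz: assumes F: "F \<in> alg"
  shows "\<exists>L\<ge>0. \<forall>bs. set bs \<subseteq> Basis \<and> length bs \<le> q \<longrightarrow>
     (\<forall>s\<in>{0..T}. \<forall>t\<in>{0..T}. \<forall>x. \<bar>foldr partial bs (F t) x - foldr partial bs (F s) x\<bar> \<le> L * \<bar>t - s\<bar>)"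
proof -
  let ?B = "{bs. set bs \<subseteq> (Basis :: (real^'a) set) \<and> length bs \<le> q}"
  have "\<forall>bs\<in>?B. \<exists>M\<ge>0. \<forall>s\<in>{0..T}. \<forall>t\<in>{0..T}. \<forall>x. \<bar>foldr partial bs (F t) x - foldr partial bs (F s) x\<bar> \<le> M * \<bar>t - s\<bar>"
    using alg_lipschitz[OF alg_partials[OF F]] by auto
  from bchoice[OF this] obtain M where M: "\<forall>bs\<in>?B. M bs \<ge> 0 \<and>
     (\<forall>s\<in>{0..T}. \<forall>t\<in>{0..T}. \<forall>x. \<bar>foldr partial bs (F t) x - foldr partial bs (F s) x\<bar> \<le> M bs * \<bar>t - s\<bar>)"
    by blast
  have le: "M bs \<le> sum M ?B" if "bs \<in> ?B" for bs
    using member_le_sum[OF that, of M] M finite_partial_lists[of q] by auto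
  have "\<bar>foldr partial bs (F t) x - foldr partial bs (F s) x\<bar> \<le> sum M ?B * \<bar>t - s\<bar>"
    if b: "bs \<in> ?B" and st: "s \<in> {0..T}" "t \<in> {0..T}" for bs s t x
  proof -
    have "\<bar>foldr partial bs (F t) x - foldr partial bs (F s) x\<bar> \<le> M bs * \<bar>t - s\<bar>" using M b st by blast
    also have "\<dots> \<le> sum M ?B * \<bar>t - s\<bar>" using le[OF b] by (intro mult_right_mono) auto
    finally show ?thesis .
  qed
  moreover have "sum M ?B \<ge> 0" using M by (intro sum_nonneg) auto
  ultimately show ?thesis by blast
qed

subsection \<open>The limit density\<close>

text \<open>Uniform convergence of the derivatives of the next order permits differentiation of the
  limit. The uniform bounds are required eventually only, because low stages say nothing about
  derivatives of high order.\<close>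

lemma Ck_limit_derivative:
  fixes f :: "nat \<Rightarrow> real^'n \<Rightarrow> real" and F :: "(real^'n) list \<Rightarrow> real^'n \<Rightarrow> real"
  assumes d: "\<And>n bs x. set bs \<subseteq> Basis \<Longrightarrow>
      (foldr partial bs (f n) has_derivative (\<lambda>h. \<Sum>k\<in>UNIV. h $ k * foldr partial (axis k 1 # bs) (f n) x)) (at x)"
    and l: "\<And>bs. set bs \<subseteq> Basis \<Longrightarrow> \<exists>e. e \<longlonglongrightarrow> 0 \<and> (\<forall>\<^sub>F n in sequentially. \<forall>x. \<bar>foldr partial bs (f n) x - F bs x\<bar> \<le> e n)"
    and bs: "set bs \<subseteq> Basis"
  shows "(F bs has_derivative (\<lambda>h. \<Sum>k\<in>UNIV. h $ k * F (axis k 1 # bs) x)) (at x)"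
proof -
  have bk: "set (axis k 1 # bs) \<subseteq> Basis" for k using bs Basis_axis by auto
  have "\<forall>k. \<exists>e. e \<longlonglongrightarrow> 0 \<and> (\<forall>\<^sub>F n in sequentially. \<forall>x. \<bar>foldr partial (axis k 1 # bs) (f n) x - F (axis k 1 # bs) x\<bar> \<le> e n)"
    using l[OF bk] by blast
  from choice[OF this] obtain E where E: "\<And>k. E k \<longlonglongrightarrow> 0"
    "\<And>k. \<forall>\<^sub>F n in sequentially. \<forall>x. \<bar>foldr partial (axis k 1 # bs) (f n) x - F (axis k 1 # bs) x\<bar> \<le> E k n" by blast
  have pt: "(\<lambda>n. foldr partial bs (f n) x) \<longlonglongrightarrow> F bs x" for x
  proof -
    obtain e where e: "e \<longlonglongrightarrow> 0" "\<forall>\<^sub>F n in sequentially. \<forall>x. \<bar>foldr partial bs (f n) x - F bs x\<bar> \<le> e n" using l[OF bs] by blast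
    have "(\<lambda>n. foldr partial bs (f n) x - F bs x) \<longlonglongrightarrow> 0"
      by (rule Lim_null_comparison[OF _ e(1)]) (use e(2) in eventually_elim, auto)
    then show ?thesis by (simp add: LIM_zero_iff)
  qed
  have "\<exists>g. \<forall>x\<in>UNIV. (\<lambda>n. foldr partial bs (f n) x) \<longlonglongrightarrow> g x \<and>
     (g has_derivative (\<lambda>h. \<Sum>k\<in>UNIV. h $ k * F (axis k 1 # bs) x)) (at x within UNIV)"
  proof (rule has_derivative_sequence[where f' = "\<lambda>n x h. \<Sum>k\<in>UNIV. h $ k * foldr partial (axis k 1 # bs) (f n) x"])
    show "convex (UNIV :: (real^'n) set)" by simp
    show "(foldr partial bs (f n) has_derivative (\<lambda>h. \<Sum>k\<in>UNIV. h $ k * foldr partial (axis k 1 # bs) (f n) x)) (at x within UNIV)" for n x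
      using d[OF bs] by simp
    show "(0::real^'n) \<in> UNIV" by simp
    show "(\<lambda>n. foldr partial bs (f n) 0) \<longlonglongrightarrow> F bs 0" by (rule pt)
    fix e :: real assume e: "e > 0"
    have "(\<lambda>n. \<Sum>k\<in>UNIV. E k n) \<longlonglongrightarrow> (\<Sum>k\<in>(UNIV::'n set). 0)" by (intro tendsto_sum E)
    then have "\<forall>\<^sub>F n in sequentially. (\<Sum>k\<in>UNIV. E k n) < e" using e by (simp add: order_tendstoD)
    moreover have "\<forall>\<^sub>F n in sequentially. \<forall>k\<in>UNIV. \<forall>x. \<bar>foldr partial (axis k 1 # bs) (f n) x - F (axis k 1 # bs) x\<bar> \<le> E k n"
      by (intro eventually_ball_finite) (use E in auto)
    ultimately show "\<forall>\<^sub>F n in sequentially. \<forall>x\<in>UNIV. \<forall>h. norm ((\<Sum>k\<in>UNIV. h $ k * foldr partial (axis k 1 # bs) (f n) x) -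
        (\<Sum>k\<in>UNIV. h $ k * F (axis k 1 # bs) x)) \<le> e * norm h"
    proof eventually_elim
      fix n assume n1: "(\<Sum>k\<in>UNIV. E k n) < e"
        and n2: "\<forall>k\<in>UNIV. \<forall>x. \<bar>foldr partial (axis k 1 # bs) (f n) x - F (axis k 1 # bs) x\<bar> \<le> E k n"
      show "\<forall>x\<in>UNIV. \<forall>h. norm ((\<Sum>k\<in>UNIV. h $ k * foldr partial (axis k 1 # bs) (f n) x) -
        (\<Sum>k\<in>UNIV. h $ k * F (axis k 1 # bs) x)) \<le> e * norm h"
      proof (intro ballI allI)
        fix x h :: "real^'n"
        have "norm ((\<Sum>k\<in>UNIV. h $ k * foldr partial (axis k 1 # bs) (f n) x) - (\<Sum>k\<in>UNIV. h $ k * F (axis k 1 # bs) x)) =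
          norm (\<Sum>k\<in>UNIV. h $ k * (foldr partial (axis k 1 # bs) (f n) x - F (axis k 1 # bs) x))"
          by (simp add: sum_subtractf right_diff_distrib)
        also have "\<dots> \<le> (\<Sum>k\<in>UNIV. norm h * E k n)"
        proof (rule sum_norm_le)
          fix k
          have "\<bar>foldr partial (axis k 1 # bs) (f n) x - F (axis k 1 # bs) x\<bar> \<le> E k n" using n2 by blast
          then show "norm (h $ k * (foldr partial (axis k 1 # bs) (f n) x - F (axis k 1 # bs) x)) \<le> norm h * E k n"
            unfolding real_norm_def abs_mult using component_le_norm_cart[of h k] by (intro mult_mono) auto
        qed
        also have "\<dots> = norm h * (\<Sum>k\<in>UNIV. E k n)" by (simp add: sum_distrib_left)
        also have "\<dots> \<le> norm h * e" using n1 by (intro mult_left_mono) auto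
        finally show "norm ((\<Sum>k\<in>UNIV. h $ k * foldr partial (axis k 1 # bs) (f n) x) -
          (\<Sum>k\<in>UNIV. h $ k * F (axis k 1 # bs) x)) \<le> e * norm h" by (simp add: mult.commute)
      qed
    qed
  qed
  then obtain g where g: "\<And>x. (\<lambda>n. foldr partial bs (f n) x) \<longlonglongrightarrow> g x"
     "\<And>x. (g has_derivative (\<lambda>h. \<Sum>k\<in>UNIV. h $ k * F (axis k 1 # bs) x)) (at x)" by auto
  have "g = F bs" using LIMSEQ_unique[OF g(1) pt] by (intro ext)
  with g(2) show ?thesis by simp
qed

text \<open>A family indexed by lists of directions, each member differentiable with the one-step
  extensions as coordinates, must consist of the iterated partial derivatives of its first member;
  this avoids exchanging limits and \<open>foldr\<close> one order at a time.\<close>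

lemma derivative_family:
  fixes F :: "(real^'n) list \<Rightarrow> real^'n \<Rightarrow> real"
  assumes d: "\<And>bs x. set bs \<subseteq> Basis \<Longrightarrow> (F bs has_derivative (\<lambda>h. \<Sum>k\<in>UNIV. h $ k * F (axis k 1 # bs) x)) (at x)"
  shows "set bs \<subseteq> Basis \<Longrightarrow> foldr partial bs (F []) = F bs" "set bs \<subseteq> Basis \<Longrightarrow> C_k m (F bs)"
proof -
  have p: "partial (axis l 1) (F bs) = F (axis l 1 # bs)" if "set bs \<subseteq> Basis" for l bs
  proof
    fix x
    have "partial (axis l 1) (F bs) x = (\<Sum>k\<in>UNIV. (axis l 1 :: real^'n) $ k * F (axis k 1 # bs) x)"
      by (rule partial_eqI[OF d[OF that]])
    also have "\<dots> = (\<Sum>k\<in>UNIV. if k = l then F (axis k 1 # bs) x else 0)"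
      by (rule sum.cong) (auto simp: axis_def)
    finally show "partial (axis l 1) (F bs) x = F (axis l 1 # bs) x" by simp
  qed
  show "set bs \<subseteq> Basis \<Longrightarrow> foldr partial bs (F []) = F bs"
  proof (induction bs)
    case (Cons b bs)
    then obtain l where "b = axis l 1" using Basis_axis by auto
    with Cons p[of bs l] show ?case by simp
  qed simp
  show "set bs \<subseteq> Basis \<Longrightarrow> C_k m (F bs)"
  proof (induction m arbitrary: bs)
    case 0
    have "continuous (at x) (F bs)" for x using has_derivative_continuous[OF d[OF 0]] .
    then show ?case by (simp add: continuous_on_eq_continuous_at)
  next
    case (Suc m)
    have "C_k m (partial b (F bs))" if "b \<in> Basis" for b
    proof -
      obtain l where l: "b = axis l 1" using \<open>b \<in> Basis\<close> Basis_axis by auto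
      then have "set (axis l 1 # bs) \<subseteq> Basis" using Suc.prems that by simp
      from Suc.IH[OF this] show ?thesis using p[OF Suc.prems] l by simp
    qed
    moreover have "F bs differentiable (at x)" for x using d[OF Suc.prems] by (auto simp: differentiable_def)
    ultimately show ?case by simp
  qed
qed

lemma foldr_partial_diff:
  fixes f g :: "real^'n \<Rightarrow> real"
  assumes f: "\<And>bs x. set bs \<subseteq> Basis \<Longrightarrow> foldr partial bs f differentiable (at x)"
    and g: "\<And>bs x. set bs \<subseteq> Basis \<Longrightarrow> foldr partial bs g differentiable (at x)"
  shows "set bs \<subseteq> Basis \<Longrightarrow> foldr partial bs (\<lambda>x. f x - g x) = (\<lambda>x. foldr partial bs f x - foldr partial bs g x)"
proof (induction bs)
  case (Cons b bs)
  have bs: "set bs \<subseteq> Basis" using Cons by simp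
  have "partial b (\<lambda>x. foldr partial bs f x - foldr partial bs g x) x = partial b (foldr partial bs f) x - partial b (foldr partial bs g) x" for x
    using partial_eqI[OF has_derivative_diff[OF f[OF bs, of x, unfolded frechet_derivative_works] g[OF bs, of x, unfolded frechet_derivative_works]]]
    by (simp add: partial_def)
  then show ?case using Cons by auto
qed simp

text \<open>An explicit bound accompanies the norm because the real \<open>Sup\<close> carries
  information only about sets that are bounded above.\<close>

definition Ck_bounded :: "nat \<Rightarrow> (real^'n \<Rightarrow> real) \<Rightarrow> real \<Rightarrow> bool" where
  "Ck_bounded k f c \<longleftrightarrow> (\<forall>bs x. set bs \<subseteq> Basis \<and> length bs \<le> k \<longrightarrow> \<bar>foldr partial bs f x\<bar> \<le> c)"

lemma Ck_norm_bounds: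
  assumes "Ck_bounded k f c"
  shows "Ck_norm k f \<le> c" "0 \<le> Ck_norm k f"
    "set bs \<subseteq> Basis \<Longrightarrow> length bs \<le> k \<Longrightarrow> \<bar>foldr partial bs f x\<bar> \<le> Ck_norm k f"
proof -
  let ?S = "{norm (foldr partial bs f x) | bs x. set bs \<subseteq> Basis \<and> length bs \<le> k}"
  have bdd: "bdd_above ?S" using assms unfolding Ck_bounded_def bdd_above_def by (intro exI[of _ c]) auto
  have "norm (foldr partial [] f 0) \<in> ?S" by (intro CollectI exI[of _ "[]"] exI[of _ 0]) simp
  then have ne: "?S \<noteq> {}" by blast
  show "Ck_norm k f \<le> c" unfolding Ck_norm_def using assms by (intro cSup_least ne) (auto simp: Ck_bounded_def)
  have up: "\<bar>foldr partial bs f x\<bar> \<le> Ck_norm k f" if "set bs \<subseteq> Basis" "length bs \<le> k" for bs x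
    unfolding Ck_norm_def using that by (intro cSup_upper bdd) auto
  show "set bs \<subseteq> Basis \<Longrightarrow> length bs \<le> k \<Longrightarrow> \<bar>foldr partial bs f x\<bar> \<le> Ck_norm k f" by (rule up)
  show "0 \<le> Ck_norm k f" using up[of "[]" 0] by simp
qed

lemma Ck_norm_close:
  fixes f g :: "real^'n \<Rightarrow> real"
  assumes f: "Ck_bounded k f c" and g: "Ck_bounded k g d"
    and fg: "\<And>bs x. set bs \<subseteq> Basis \<Longrightarrow> length bs \<le> k \<Longrightarrow> \<bar>foldr partial bs f x - foldr partial bs g x\<bar> \<le> e"
  shows "\<bar>Ck_norm k f - Ck_norm k g\<bar> \<le> e"
proof -
  have "Ck_bounded k f (Ck_norm k g + e)" unfolding Ck_bounded_def
  proof (intro allI impI)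
    fix bs :: "(real^'n) list" and x assume "set bs \<subseteq> Basis \<and> length bs \<le> k"
    then show "\<bar>foldr partial bs f x\<bar> \<le> Ck_norm k g + e"
      using Ck_norm_bounds(3)[OF g, of bs x] fg[of bs x] by linarith
  qed
  moreover have "Ck_bounded k g (Ck_norm k f + e)" unfolding Ck_bounded_def
  proof (intro allI impI)
    fix bs :: "(real^'n) list" and x assume "set bs \<subseteq> Basis \<and> length bs \<le> k"
    then show "\<bar>foldr partial bs g x\<bar> \<le> Ck_norm k f + e"
      using Ck_norm_bounds(3)[OF f, of bs x] fg[of bs x] by linarith
  qed
  ultimately have "Ck_norm k f \<le> Ck_norm k g + e" "Ck_norm k g \<le> Ck_norm k f + e"
    using Ck_norm_bounds(1) by blast+
  then show ?thesis by linarith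
qed

lemma partials_zero: "set bs \<subseteq> Basis \<Longrightarrow> foldr partial bs (\<lambda>x::real^'n. 0::real) = (\<lambda>x. 0)"
proof (induction bs)
  case (Cons b bs)
  have "partial b (\<lambda>x::real^'n. 0::real) = (\<lambda>x. 0)" by (auto simp: partial_def fun_eq_iff)
  with Cons show ?case by simp
qed simp

text \<open>Finiteness of an extended sum expresses summability of nonnegative terms in a form whose
  measurability is immediate. Convergence holds at all these times, and integrable series reach
  almost every time.\<close>

definition finite_times :: "real \<Rightarrow> (nat \<Rightarrow> real \<Rightarrow> real) \<Rightarrow> real set" where
  "finite_times T a = {t \<in> {0..T}. (\<Sum>n. ennreal (a n t)) \<noteq> top}"

lemma finite_times_sets:
  assumes "\<And>n. a n \<in> borel_measurable borel" shows "finite_times T a \<in> sets borel"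
proof -
  have "(\<lambda>t. \<Sum>n. ennreal (a n t)) \<in> borel_measurable borel"
    by (intro borel_measurable_suminf_order measurable_compose[OF assms] measurable_ennreal)
  then have "(\<lambda>t. \<Sum>n. ennreal (a n t)) -` {top} \<in> sets borel"
    using measurable_sets[of "\<lambda>t. \<Sum>n. ennreal (a n t)" borel borel "{top}"] by simp
  moreover have "finite_times T a = {0..T} - (\<lambda>t. \<Sum>n. ennreal (a n t)) -` {top}" by (auto simp: finite_times_def)
  ultimately show ?thesis by simp
qed

lemma finite_times_summable: "(\<And>n t. 0 \<le> a n t) \<Longrightarrow> t \<in> finite_times T a \<Longrightarrow> summable (\<lambda>n. a n t)"
  unfolding finite_times_def by (intro summable_suminf_not_top) auto

lemma AE_finite_times:
  assumes a: "\<And>n. continuous_on UNIV (a n)" "\<And>n t. 0 \<le> a n t"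
    and c: "\<And>n. integral {0..T} (a n) \<le> c n" "summable c"
  shows "AE t in lborel. t \<in> {0..T} \<longrightarrow> t \<in> finite_times T a"
proof -
  have ii: "integrable lborel (\<lambda>t. indicator (cbox 0 T) t * a n t)" for n
    using continuous_cbox_integral(1)[OF a(1), of 0 T] by (simp add: set_integrable_def)
  have "AE t in lborel. summable (\<lambda>n. indicator (cbox 0 T) t * a n t)"
  proof (rule AE_summable_integrals)
    show "0 \<le> indicator (cbox 0 T) t * a n t" for n t by (simp add: a)
    show "summable (\<lambda>n. LINT t|lborel. indicator (cbox 0 T) t * a n t)"
    proof (rule summable_comparison_test'[OF c(2)])
      fix n
      have e: "(LINT t|lborel. indicator (cbox 0 T) t * a n t) = integral {0..T} (a n)"
        using continuous_cbox_integral(2)[OF a(1), of 0 T] by (simp add: set_lebesgue_integral_def)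
      show "norm (LINT t|lborel. indicator (cbox 0 T) t * a n t) \<le> c n"
        unfolding e using integral_nonneg[of "a n" "{0..T}"] a(2) c(1)[of n]
          integrable_continuous_real[OF continuous_on_subset[OF a(1)[of n], of "{0..T}"]] by simp
    qed
  qed (rule ii)
  then show ?thesis
  proof eventually_elim
    fix t assume s: "summable (\<lambda>n. indicator (cbox 0 T) t * a n t)"
    show "t \<in> {0..T} \<longrightarrow> t \<in> finite_times T a"
    proof
      assume t: "t \<in> {0..T}"
      then have "summable (\<lambda>n. a n t)" using s by simp
      then have "(\<Sum>n. ennreal (a n t)) \<noteq> top" using suminf_ennreal2[OF a(2)] by simp
      with t show "t \<in> finite_times T a" by (simp add: finite_times_def)
    qed
  qed
qed

lemma Ck_norm_zero: "Ck_norm k (\<lambda>x::real^'n. 0::real) = 0"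
proof -
  have "Ck_bounded k (\<lambda>x::real^'n. 0) 0" unfolding Ck_bounded_def by (auto simp: partials_zero)
  then show ?thesis using Ck_norm_bounds(1,2)[of k "\<lambda>x::real^'n. 0" 0] by simp
qed

text \<open>The order \<open>Suc n\<close> in the two bounds increases with the stage, so a fixed
  order and a fixed exponent are covered from some stage on. The weight \<open>2 ^ Suc n\<close> is
  the one required by \<open>powr_suminf_le\<close>.\<close>

locale density_scheme =
  fixes T :: real and r :: "nat \<Rightarrow> real \<Rightarrow> real^'n \<Rightarrow> real" and a :: "nat \<Rightarrow> real \<Rightarrow> real"
  assumes T: "T > 0" and r: "\<And>n. r n \<in> alg"
    and a_cont: "\<And>n. continuous_on UNIV (a n)" and a_nonneg: "\<And>n t. 0 \<le> a n t"
    and a_bound: "\<And>n bs t x. set bs \<subseteq> Basis \<Longrightarrow> length bs \<le> Suc n \<Longrightarrow> t \<in> {0..T} \<Longrightarrow>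
      \<bar>foldr partial bs (\<lambda>x. r (Suc n) t x - r n t x) x\<bar> \<le> a n t"
    and a_int: "\<And>n p. 1 \<le> p \<Longrightarrow> p \<le> real (Suc n) \<Longrightarrow> integral {0..T} (\<lambda>t. (2 ^ Suc n * a n t) powr p) \<le> (1/4) ^ Suc n"
begin

definition good :: "real set" where "good = finite_times T a"
text \<open>The value 0 at bad times makes the density smooth and periodic at every time, so
  exceptional times do not have to be carried through the measurability arguments.\<close>

definition rho :: "real \<Rightarrow> real^'n \<Rightarrow> real" where "rho t x = (if t \<in> good then lim (\<lambda>n. r n t x) else 0)"
definition tail :: "nat \<Rightarrow> real \<Rightarrow> real" where "tail n t = (\<Sum>l. a (l + n) t)"
definition F :: "real \<Rightarrow> (real^'n) list \<Rightarrow> real^'n \<Rightarrow> real" where "F t bs x = lim (\<lambda>n. foldr partial bs (r n t) x)"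

lemma a_borel: "a n \<in> borel_measurable borel"
  by (rule borel_measurable_continuous_onI[OF a_cont])

lemma good_subset: "good \<subseteq> {0..T}" by (auto simp: good_def finite_times_def)

lemma good_sets: "good \<in> sets borel"
  unfolding good_def by (rule finite_times_sets[OF a_borel])

lemma good_summable: "t \<in> good \<Longrightarrow> summable (\<lambda>n. a n t)"
  unfolding good_def by (rule finite_times_summable[OF a_nonneg])

lemma a_integral: "integral {0..T} (a n) \<le> (1/4) ^ Suc n"
proof -
  have "integral {0..T} (a n) \<le> integral {0..T} (\<lambda>t. (2 ^ Suc n * a n t) powr 1)"
  proof (rule integral_le)
    show "a n integrable_on {0..T}" by (intro integrable_continuous_real continuous_on_subset[OF a_cont]) simp
    show "(\<lambda>t. (2 ^ Suc n * a n t) powr 1) integrable_on {0..T}"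
      using a_nonneg by (intro integrable_continuous_real continuous_on_powr' continuous_on_mult continuous_on_const
        continuous_on_subset[OF a_cont]) auto
    fix t
    have "1 * a n t \<le> 2 ^ Suc n * a n t" by (rule mult_right_mono[OF one_le_power a_nonneg]) simp
    then show "a n t \<le> (2 ^ Suc n * a n t) powr 1" using a_nonneg[of n t] by simp
  qed
  also have "\<dots> \<le> (1/4) ^ Suc n" by (rule a_int) auto
  finally show ?thesis .
qed

lemma AE_good: "AE t in lborel. t \<in> {0..T} \<longrightarrow> t \<in> good"
  unfolding good_def by (rule AE_finite_times[OF a_cont a_nonneg a_integral]) simp

lemma r_step: "set bs \<subseteq> Basis \<Longrightarrow> length bs \<le> Suc n \<Longrightarrow> t \<in> {0..T} \<Longrightarrow>
    \<bar>foldr partial bs (r (Suc n) t) x - foldr partial bs (r n t) x\<bar> \<le> a n t"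
  using a_bound[of bs n t x] foldr_partial_diff_alg[OF r r, of bs "Suc n" t n t] by simp

lemma r_lim:
  assumes t: "t \<in> good" and bs: "set bs \<subseteq> Basis" "length bs \<le> n"
  shows "(\<lambda>n. foldr partial bs (r n t) x) \<longlonglongrightarrow> F t bs x" "\<bar>foldr partial bs (r n t) x - F t bs x\<bar> \<le> tail n t"
proof -
  have d: "\<bar>foldr partial bs (r (Suc l) t) x - foldr partial bs (r l t) x\<bar> \<le> a l t" if "n \<le> l" for l
    using that bs t good_subset by (intro r_step) auto
  note t = telescoping_tail[of n "\<lambda>n. foldr partial bs (r n t) x" "\<lambda>l. a l t", OF d good_summable[OF t]]
  show "(\<lambda>n. foldr partial bs (r n t) x) \<longlonglongrightarrow> F t bs x" using t(1) unfolding F_def .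
  show "\<bar>foldr partial bs (r n t) x - F t bs x\<bar> \<le> tail n t" using t(2) unfolding F_def tail_def by (simp add: abs_minus_commute)
qed

lemma tail_zero: "t \<in> good \<Longrightarrow> (\<lambda>n. tail n t) \<longlonglongrightarrow> 0"
  unfolding tail_def by (rule suminf_tail_tendsto_zero[OF good_summable])

lemma tail_nonneg: "t \<in> good \<Longrightarrow> 0 \<le> tail n t"
  unfolding tail_def using summable_ignore_initial_segment[OF good_summable] a_nonneg by (intro suminf_nonneg) blast+

lemma r_partials_derivative:
  assumes "set bs \<subseteq> Basis"
  shows "(foldr partial bs (r n t) has_derivative (\<lambda>h. \<Sum>k\<in>UNIV. h $ k * foldr partial (axis k 1 # bs) (r n t) x)) (at x)"
  using alg_Dx(2)[OF alg_partials[OF r assms], of n t x] by (simp add: Dx_def)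

lemma F_derivative:
  assumes t: "t \<in> good" and bs: "set bs \<subseteq> Basis"
  shows "(F t bs has_derivative (\<lambda>h. \<Sum>k\<in>UNIV. h $ k * F t (axis k 1 # bs) x)) (at x)"
proof (rule Ck_limit_derivative[where f = "\<lambda>n. r n t", OF r_partials_derivative _ bs])
  fix bs :: "(real^'n) list" assume bs: "set bs \<subseteq> Basis"
  have "\<forall>\<^sub>F n in sequentially. \<forall>x. \<bar>foldr partial bs (r n t) x - F t bs x\<bar> \<le> tail n t"
    using eventually_ge_at_top[of "length bs"] by eventually_elim (intro allI r_lim(2)[OF t bs])
  then show "\<exists>e. e \<longlonglongrightarrow> 0 \<and> (\<forall>\<^sub>F n in sequentially. \<forall>x. \<bar>foldr partial bs (r n t) x - F t bs x\<bar> \<le> e n)"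
    using tail_zero[OF t] by blast
qed

lemma rho_good: "t \<in> good \<Longrightarrow> rho t = F t []"
  by (auto simp: rho_def F_def)

lemma rho_bad: "t \<notin> good \<Longrightarrow> rho t = (\<lambda>x. 0)"
  by (auto simp: rho_def)

lemma rho_partials: "t \<in> good \<Longrightarrow> set bs \<subseteq> Basis \<Longrightarrow> foldr partial bs (rho t) = F t bs"
  using derivative_family(1)[of "F t" bs] F_derivative by (simp add: rho_good)

lemma rho_Ck: "C_k k (rho t)"
proof (cases "t \<in> good")
  case True
  then show ?thesis using derivative_family(2)[of "F t" "[]" k] F_derivative by (simp add: rho_good)
next
  case False
  have "(\<lambda>(t::real) (x::real^'n). 0) \<in> alg" by (rule alg_const)
  from alg_Ck[OF this] show ?thesis using rho_bad[OF False] by simp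
qed

lemma rho_periodic: "periodic (rho t)"
  unfolding periodic_def
proof (intro allI impI)
  fix x m :: "real^'n" assume "\<forall>i. m $ i \<in> \<int>"
  then have "r n t (x + m) = r n t x" for n using alg_periodic[OF r, of n t] unfolding periodic_def by blast
  then show "rho t (x + m) = rho t x" by (simp add: rho_def)
qed

lemma rho_borel: "(\<lambda>z. rho (fst z) (snd z)) \<in> borel_measurable borel"
proof -
  have "(\<lambda>z. r n (fst z) (snd z)) \<in> borel_measurable borel" for n
    using alg_continuous[OF r[of n]] by (intro borel_measurable_continuous_onI) (simp add: split_beta)
  then have 1: "(\<lambda>z. lim (\<lambda>n. r n (fst z) (snd z))) \<in> borel_measurable borel" by (rule borel_measurable_lim_metric)
  have "(\<lambda>z. indicator good (fst z) :: real) \<in> borel_measurable borel"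
    by (rule measurable_compose[OF borel_measurable_continuous_onI[OF continuous_on_fst[OF continuous_on_id]]
      borel_measurable_indicator[OF good_sets]])
  from borel_measurable_times[OF this 1] show ?thesis
    unfolding rho_def by (rule measurable_cong[THEN iffD1, rotated]) (simp add: indicator_def)
qed

lemma r_bounded: "\<exists>c. \<forall>t\<in>{0..T}. Ck_bounded k (r n t) c"
  using alg_partials_bounded[OF r, of k T n] unfolding Ck_bounded_def by blast

lemma rho_bounded:
  assumes t: "t \<in> good" and c: "Ck_bounded k (r n t) c" and n: "k \<le> n"
  shows "Ck_bounded k (rho t) (c + tail n t)"
  unfolding Ck_bounded_def
proof (intro allI impI)
  fix bs :: "(real^'n) list" and x assume bs: "set bs \<subseteq> Basis \<and> length bs \<le> k"
  have "\<bar>foldr partial bs (r n t) x - F t bs x\<bar> \<le> tail n t" using bs n by (intro r_lim(2) t) auto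
  moreover have "\<bar>foldr partial bs (r n t) x\<bar> \<le> c" using c bs unfolding Ck_bounded_def by blast
  ultimately show "\<bar>foldr partial bs (rho t) x\<bar> \<le> c + tail n t" using rho_partials[OF t] bs by auto
qed

lemma Ck_norm_rho_lim:
  assumes t: "t \<in> good" shows "(\<lambda>n. Ck_norm k (r n t)) \<longlonglongrightarrow> Ck_norm k (rho t)"
proof -
  have t': "t \<in> {0..T}" using t good_subset by blast
  have "\<forall>\<^sub>F n in sequentially. norm (Ck_norm k (r n t) - Ck_norm k (rho t)) \<le> tail n t"
    using eventually_ge_at_top[of k]
  proof eventually_elim
    fix n assume n: "k \<le> n"
    obtain c where c: "Ck_bounded k (r n t) c" using r_bounded t' by blast
    show "norm (Ck_norm k (r n t) - Ck_norm k (rho t)) \<le> tail n t" unfolding real_norm_def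
    proof (rule Ck_norm_close[OF c rho_bounded[OF t c n]])
      fix bs :: "(real^'n) list" and x assume bs: "set bs \<subseteq> Basis" "length bs \<le> k"
      show "\<bar>foldr partial bs (r n t) x - foldr partial bs (rho t) x\<bar> \<le> tail n t"
        unfolding rho_partials[OF t bs(1)] using bs n by (intro r_lim(2) t) auto
    qed
  qed
  from Lim_null_comparison[OF this tail_zero[OF t]] show ?thesis by (simp add: LIM_zero_iff)
qed

lemma Ck_norm_r_continuous: "continuous_on {0..T} (\<lambda>t. Ck_norm k (r n t))"
proof -
  obtain L where L: "L \<ge> 0" "\<And>bs s t x. set bs \<subseteq> Basis \<and> length bs \<le> k \<Longrightarrow> s \<in> {0..T} \<Longrightarrow> t \<in> {0..T} \<Longrightarrow>
      \<bar>foldr partial bs (r n t) x - foldr partial bs (r n s) x\<bar> \<le> L * \<bar>t - s\<bar>"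
    using alg_partials_lipschitz[OF r[of n], of k T] by blast
  obtain c where c: "\<And>t. t \<in> {0..T} \<Longrightarrow> Ck_bounded k (r n t) c" using r_bounded by blast
  have "L-lipschitz_on {0..T} (\<lambda>t. Ck_norm k (r n t))"
  proof (rule lipschitz_onI[OF _ L(1)])
    fix s t assume st: "s \<in> {0..T}" "t \<in> {0..T}"
    show "dist (Ck_norm k (r n s)) (Ck_norm k (r n t)) \<le> L * dist s t"
      unfolding dist_real_def by (rule Ck_norm_close[OF c c]) (use L st in auto)
  qed
  then show ?thesis by (rule lipschitz_on_continuous_on)
qed

lemma Ck_norm_rho_bad: "t \<notin> good \<Longrightarrow> Ck_norm k (rho t) = 0"
  by (simp add: rho_bad Ck_norm_zero)

text \<open>The norm is a supremum over uncountably many points. It is measurable in time as the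
  limit, at good times, of the norms of the stages, which are Lipschitz in time because the stages
  and their derivatives are.\<close>

lemma Ck_norm_rho_borel: "(\<lambda>t. Ck_norm k (rho t)) \<in> borel_measurable borel"
proof (rule borel_measurable_LIMSEQ_real)
  fix n
  have "(\<lambda>t. indicator {0..T} t *\<^sub>R Ck_norm k (r n t)) \<in> borel_measurable borel"
    by (rule borel_measurable_continuous_on_indicator[OF _ Ck_norm_r_continuous]) simp
  then show "(\<lambda>t. indicator good t * (indicator {0..T} t *\<^sub>R Ck_norm k (r n t))) \<in> borel_measurable borel"
    using good_sets by (intro borel_measurable_times borel_measurable_indicator) auto
next
  fix t
  show "(\<lambda>n. indicator good t * (indicator {0..T} t *\<^sub>R Ck_norm k (r n t))) \<longlonglongrightarrow> Ck_norm k (rho t)"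
  proof (cases "t \<in> good")
    case True
    then show ?thesis using Ck_norm_rho_lim[OF True] good_subset by auto
  qed (simp add: Ck_norm_rho_bad)
qed

text \<open>The density is compared with a stage late enough to control both \<open>k\<close> and
  \<open>p\<close>. That stage is bounded, and the \<open>p\<close>-th power of the remaining tail
  is dominated by the weighted series, whose integrals decay geometrically.\<close>

lemma Ck_norm_rho_integrable:
  assumes p: "p \<ge> 1" shows "set_integrable lborel {0..T} (\<lambda>t. Ck_norm k (rho t) powr p)"
proof -
  define m where "m = max k (nat \<lceil>p\<rceil>)"
  have m: "k \<le> m" "p \<le> real m" unfolding m_def by (auto simp: le_max_iff_disj) linarith
  obtain c where c: "\<And>t. t \<in> {0..T} \<Longrightarrow> Ck_bounded k (r m t) c" using r_bounded by blast
  define C where "C = max 0 c"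
  define b where "b l t = (2 ^ Suc (l + m) * a (l + m) t) powr p" for l t
  have bc: "continuous_on UNIV (b l)" for l
    unfolding b_def using p a_nonneg by (intro continuous_on_powr' continuous_on_mult continuous_on_const a_cont) auto
  have b0: "0 \<le> b l t" for l t by (simp add: b_def)
  have bm: "(\<lambda>t. ennreal (indicator (cbox 0 T) t * b l t)) \<in> borel_measurable lborel" for l
    using borel_measurable_continuous_onI[OF bc[of l]] by simp
  have pw: "ennreal (indicator (cbox 0 T) t * (Ck_norm k (rho t) powr p)) \<le>
     ennreal (2 powr p) * (ennreal (C powr p) * indicator (cbox 0 T) t + (\<Sum>l. ennreal (indicator (cbox 0 T) t * b l t)))" for t
  proof (cases "t \<in> good")
    case False then show ?thesis using p by (simp add: Ck_norm_rho_bad)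
  next
    case True
    then have t: "t \<in> {0..T}" using good_subset by blast
    have n0: "0 \<le> Ck_norm k (rho t)" "Ck_norm k (rho t) \<le> C + tail m t"
      using Ck_norm_bounds[OF rho_bounded[OF True c[OF t] m(1)]] by (auto simp: C_def)
    have "ennreal (Ck_norm k (rho t) powr p) \<le> ennreal (2 powr p * (C powr p + tail m t powr p))"
    proof (rule ennreal_leI)
      have "Ck_norm k (rho t) powr p \<le> (C + tail m t) powr p" using n0 p by (intro powr_mono2) auto
      also have "\<dots> \<le> 2 powr p * (C powr p + tail m t powr p)"
        using p tail_nonneg[OF True] by (intro powr_sum_bound) (auto simp: C_def)
      finally show "Ck_norm k (rho t) powr p \<le> 2 powr p * (C powr p + tail m t powr p)" .
    qed
    also have "\<dots> = ennreal (2 powr p) * (ennreal (C powr p) + ennreal (tail m t powr p))"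
      by (simp add: ennreal_mult)
    \<comment> \<open>The available weights \<open>2 ^ Suc (l + m)\<close> exceed the weights
      \<open>2 ^ Suc l\<close> of the summation lemma. That lemma wants a finite sum; otherwise the
      right side is infinite and the bound is trivial.\<close>
    also have "ennreal (tail m t powr p) \<le> (\<Sum>l. ennreal (b l t))"
    proof (cases "(\<Sum>l. ennreal ((2 ^ Suc l * a (l + m) t) powr p)) = top")
      case False
      have "ennreal (tail m t powr p) \<le> (\<Sum>l. ennreal ((2 ^ Suc l * a (l + m) t) powr p))"
        unfolding tail_def using False p a_nonneg by (intro powr_suminf_le) auto
      also have "\<dots> \<le> (\<Sum>l. ennreal (b l t))"
      proof (intro suminf_le ennreal_leI)
        fix l
        have "(2::real) ^ Suc l \<le> 2 ^ Suc (l + m)" by (intro power_increasing) auto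
        then show "(2 ^ Suc l * a (l + m) t) powr p \<le> b l t"
          unfolding b_def using p a_nonneg by (intro powr_mono2 mult_right_mono mult_nonneg_nonneg) auto
      qed auto
      finally show ?thesis .
    next
      case True
      have "(\<Sum>l. ennreal ((2 ^ Suc l * a (l + m) t) powr p)) \<le> (\<Sum>l. ennreal (b l t))"
      proof (intro suminf_le ennreal_leI)
        fix l
        have "(2::real) ^ Suc l \<le> 2 ^ Suc (l + m)" by (intro power_increasing) auto
        then show "(2 ^ Suc l * a (l + m) t) powr p \<le> b l t"
          unfolding b_def using p a_nonneg by (intro powr_mono2 mult_right_mono mult_nonneg_nonneg) auto
      qed auto
      then show ?thesis using True by (simp add: top_unique)
    qed
    finally show ?thesis using t by (simp add: mult_left_mono add_left_mono)
  qed
  have "(\<integral>\<^sup>+t. ennreal (indicator (cbox 0 T) t * (Ck_norm k (rho t) powr p)) \<partial>lborel) \<le>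
     (\<integral>\<^sup>+t. ennreal (2 powr p) * (ennreal (C powr p) * indicator (cbox 0 T) t + (\<Sum>l. ennreal (indicator (cbox 0 T) t * b l t))) \<partial>lborel)"
    by (intro nn_integral_mono pw)
  also have "\<dots> = ennreal (2 powr p) * (ennreal (C powr p) * emeasure lborel (cbox 0 T) + (\<Sum>l. \<integral>\<^sup>+t. ennreal (indicator (cbox 0 T) t * b l t) \<partial>lborel))"
    using bm by (subst nn_integral_cmult, measurable) (subst nn_integral_add; simp add: nn_integral_cmult_indicator nn_integral_suminf)
  also have "(\<Sum>l. \<integral>\<^sup>+t. ennreal (indicator (cbox 0 T) t * b l t) \<partial>lborel) = (\<Sum>l. ennreal (integral (cbox 0 T) (b l)))"
    by (intro suminf_cong continuous_cbox_nn_integral bc b0)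
  also have "\<dots> \<le> (\<Sum>l. ennreal ((1/4) ^ Suc (l + m)))"
    unfolding b_def using a_int p m by (intro suminf_le ennreal_leI) auto
  also have "\<dots> = ennreal (\<Sum>l. (1/4) ^ Suc (l + m))"
    by (intro suminf_ennreal2) (auto simp: power_add summable_mult2 summable_mult)
  also have "ennreal (2 powr p) * (ennreal (C powr p) * emeasure lborel (cbox 0 T) + \<dots>) < \<infinity>"
    using T by (simp add: ennreal_mult_less_top)
  finally have fin: "(\<integral>\<^sup>+t. ennreal (indicator (cbox 0 T) t * (Ck_norm k (rho t) powr p)) \<partial>lborel) < \<infinity>"
    by (simp add: mult_left_mono add_left_mono)
  show ?thesis unfolding set_integrable_def
  proof (rule integrableI_bounded)
    show "(\<lambda>t. indicator {0..T} t *\<^sub>R Ck_norm k (rho t) powr p) \<in> borel_measurable lborel"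
      using Ck_norm_rho_borel by simp
    show "(\<integral>\<^sup>+t. ennreal (norm (indicator {0..T} t *\<^sub>R Ck_norm k (rho t) powr p)) \<partial>lborel) < \<infinity>"
      using fin by simp
  qed
qed

lemma rho_bochner:
  assumes p: "p \<ge> 1" shows "rho \<in> bochner_Lp T p (torus_Ck k) (Ck_norm k)"
proof -
  have "\<forall>n. \<exists>L\<ge>0. \<forall>bs. set bs \<subseteq> Basis \<and> length bs \<le> k \<longrightarrow>
     (\<forall>s\<in>{0..T}. \<forall>t\<in>{0..T}. \<forall>x. \<bar>foldr partial bs (r n t) x - foldr partial bs (r n s) x\<bar> \<le> L * \<bar>t - s\<bar>)"
    using alg_partials_lipschitz[OF r] by blast
  from choice[OF this] obtain L where L: "\<And>n. L n \<ge> 0" "\<And>n bs s t x. set bs \<subseteq> Basis \<Longrightarrow> length bs \<le> k \<Longrightarrow> s \<in> {0..T} \<Longrightarrow> t \<in> {0..T} \<Longrightarrow>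
      \<bar>foldr partial bs (r n t) x - foldr partial bs (r n s) x\<bar> \<le> L n * \<bar>t - s\<bar>" by blast
  \<comment> \<open>With this mesh, stage \<open>n\<close> varies by at most
    \<open>(1/2) ^ n\<close> between a time and its grid point; adding 1 keeps \<open>K n\<close>
    positive when the Lipschitz constant is 0.\<close>
  define K where "K n = (L n + 1) * 2 ^ n" for n
  have K: "K n > 0" for n using L(1)[of n] by (simp add: K_def add_nonneg_pos)
  have LK: "L n * (1 / K n) \<le> (1/2) ^ n" for n
  proof -
    have "L n * (1 / K n) = (L n / (L n + 1)) * (1/2) ^ n" by (simp add: K_def power_one_over)
    also have "\<dots> \<le> 1 * (1/2) ^ n" using L(1)[of n] by (intro mult_right_mono) auto
    finally show ?thesis by simp
  qed
  show ?thesis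
  proof (rule bochner_Lp_stepI[where R = r and K = K and f = rho and N = "Ck_norm k", OF K _ _ Ck_norm_rho_integrable[OF p]])
    show "r n t \<in> torus_Ck k" for n t using alg_periodic[OF r] alg_Ck[OF r] by (simp add: torus_Ck_def)
    show "AE t in lborel. t \<in> {0..T} \<longrightarrow> rho t \<in> torus_Ck k \<and>
       (\<lambda>n. Ck_norm k (\<lambda>x. r n (of_int \<lfloor>t * K n\<rfloor> / K n) x - rho t x)) \<longlonglongrightarrow> 0"
      using AE_good
    proof (eventually_elim, intro impI conjI)
      fix t assume tg: "t \<in> {0..T} \<longrightarrow> t \<in> good" and t: "t \<in> {0..T}"
      then have g: "t \<in> good" by blast
      show "rho t \<in> torus_Ck k" using rho_periodic rho_Ck by (simp add: torus_Ck_def)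
      have "\<forall>\<^sub>F n in sequentially. norm (Ck_norm k (\<lambda>x. r n (of_int \<lfloor>t * K n\<rfloor> / K n) x - rho t x)) \<le> (1/2) ^ n + tail n t"
        using eventually_ge_at_top[of k]
      proof eventually_elim
        fix n assume n: "k \<le> n"
        define s where "s = of_int \<lfloor>t * K n\<rfloor> / K n"
        have s: "s \<in> {0..T}" "\<bar>t - s\<bar> \<le> 1 / K n" unfolding s_def by (rule floor_step_near[OF K t])+
        have "Ck_bounded k (\<lambda>x. r n s x - rho t x) ((1/2) ^ n + tail n t)"
          unfolding Ck_bounded_def
        proof (intro allI impI)
          fix bs :: "(real^'n) list" and x assume bs: "set bs \<subseteq> Basis \<and> length bs \<le> k"
          have e: "foldr partial bs (\<lambda>x. r n s x - rho t x) x = foldr partial bs (r n s) x - foldr partial bs (rho t) x"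
          proof -
            have "foldr partial bs (r n s) differentiable (at x)" if "set bs \<subseteq> Basis" for bs x
              using r_partials_derivative[OF that] by (auto simp: differentiable_def)
            moreover have "foldr partial bs (rho t) differentiable (at x)" if "set bs \<subseteq> Basis" for bs x
              using F_derivative[OF g that] rho_partials[OF g that] by (auto simp: differentiable_def)
            ultimately show ?thesis using foldr_partial_diff[of "r n s" "rho t" bs] bs by simp
          qed
          have "\<bar>foldr partial bs (r n t) x - foldr partial bs (r n s) x\<bar> \<le> L n * \<bar>t - s\<bar>" using L(2) bs s t by blast
          also have "\<dots> \<le> L n * (1 / K n)" using s L(1) by (intro mult_left_mono) auto
          finally have 1: "\<bar>foldr partial bs (r n t) x - foldr partial bs (r n s) x\<bar> \<le> (1/2) ^ n" using LK[of n] by linarith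
          have 2: "\<bar>foldr partial bs (r n t) x - F t bs x\<bar> \<le> tail n t" using bs n by (intro r_lim(2) g) auto
          show "\<bar>foldr partial bs (\<lambda>x. r n s x - rho t x) x\<bar> \<le> (1/2) ^ n + tail n t"
            unfolding e using 1 2 rho_partials[OF g] bs by auto
        qed
        from Ck_norm_bounds(1,2)[OF this]
        show "norm (Ck_norm k (\<lambda>x. r n (of_int \<lfloor>t * K n\<rfloor> / K n) x - rho t x)) \<le> (1/2) ^ n + tail n t"
          unfolding s_def by simp
      qed
      moreover have "(\<lambda>n. (1/2) ^ n + tail n t) \<longlonglongrightarrow> 0"
        using tendsto_add[OF LIMSEQ_realpow_zero[of "1/2"] tail_zero[OF g]] by simp
      ultimately show "(\<lambda>n. Ck_norm k (\<lambda>x. r n (of_int \<lfloor>t * K n\<rfloor> / K n) x - rho t x)) \<longlonglongrightarrow> 0"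
        by (rule Lim_null_comparison)
    qed
  qed
qed

end

subsection \<open>Lebesgue and Sobolev norms on the torus\<close>

lemma borel_lebesgue_on:
  "f \<in> borel_measurable borel \<Longrightarrow> f \<in> borel_measurable (lebesgue_on S)" for f :: "'a::euclidean_space \<Rightarrow> 'b::euclidean_space"
  by (intro measurable_restrict_space1 measurable_completion) simp

lemma set_integral_lebesgue_lborel:
  fixes h :: "'a::euclidean_space \<Rightarrow> 'b::euclidean_space"
  assumes h: "h \<in> borel_measurable borel" and S: "S \<in> sets borel"
  shows "(LINT x:S|lebesgue. h x) = (LINT x:S|lborel. h x)" "set_integrable lebesgue S h \<longleftrightarrow> set_integrable lborel S h"
proof -
  have "(\<lambda>x. indicator S x *\<^sub>R h x) \<in> borel_measurable lborel" using h S by simp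
  then show "(LINT x:S|lebesgue. h x) = (LINT x:S|lborel. h x)" "set_integrable lebesgue S h \<longleftrightarrow> set_integrable lborel S h"
    unfolding set_lebesgue_integral_def set_integrable_def by (rule integral_completion, rule integrable_completion)
qed

lemma torus_Lp_bound:
  fixes f :: "real^'n \<Rightarrow> 'b::euclidean_space"
  assumes f: "f \<in> borel_measurable borel" "periodic f" and p: "p \<ge> 1" and c: "c \<ge> 0"
    and b: "(\<integral>\<^sup>+x. ennreal (indicator cube x * norm (f x) powr p) \<partial>lborel) \<le> ennreal (c powr p)"
  shows "f \<in> torus_Lp p" "Lp_norm p f \<le> c"
proof -
  have m: "(\<lambda>x. norm (f x) powr p) \<in> borel_measurable borel" using f(1) by measurable
  have i: "integrable lborel (\<lambda>x. indicator cube x *\<^sub>R (norm (f x) powr p))"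
  proof (rule integrableI_bounded)
    have "ennreal (c powr p) < \<infinity>" by simp
    with b show "(\<integral>\<^sup>+x. ennreal (norm (indicator cube x *\<^sub>R (norm (f x) powr p))) \<partial>lborel) < \<infinity>"
      by (simp add: le_less_trans)
  qed (use m in measurable)
  show "f \<in> torus_Lp p"
    unfolding torus_Lp_def using f borel_lebesgue_on[OF f(1)] i set_integral_lebesgue_lborel(2)[OF m cube_sets(1)]
    by (simp add: set_integrable_def)
  have "ennreal (LINT x|lborel. indicator cube x *\<^sub>R (norm (f x) powr p)) \<le> ennreal (c powr p)"
    using b nn_integral_eq_integral[OF i] by simp
  then have "(LINT x|lborel. indicator cube x *\<^sub>R (norm (f x) powr p)) \<le> c powr p" by simp
  then have "(LINT x:cube|lebesgue. norm (f x) powr p) \<le> c powr p"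
    unfolding set_integral_lebesgue_lborel(1)[OF m cube_sets(1)] by (simp add: set_lebesgue_integral_def)
  moreover have "0 \<le> (LINT x:cube|lebesgue. norm (f x) powr p)" by (simp add: set_lebesgue_integral_def)
  ultimately have "Lp_norm p f \<le> (c powr p) powr (1 / p)"
    unfolding Lp_norm_def using p by (intro powr_mono2) simp_all
  also have "\<dots> = c" using p c by (simp add: powr_powr)
  finally show "Lp_norm p f \<le> c" .
qed

lemma Lp_norm_nonneg: "0 \<le> Lp_norm p f" by (simp add: Lp_norm_def)

lemma torus_Lp_nn_integral:
  fixes f :: "real^'n \<Rightarrow> 'b::euclidean_space"
  assumes f: "f \<in> borel_measurable borel" "f \<in> torus_Lp p" and p: "p \<ge> 1"
  shows "(\<integral>\<^sup>+x. ennreal (indicator cube x * norm (f x) powr p) \<partial>lborel) = ennreal (Lp_norm p f powr p)"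
proof -
  have m: "(\<lambda>x. norm (f x) powr p) \<in> borel_measurable borel" using f(1) by measurable
  have i: "integrable lborel (\<lambda>x. indicator cube x * norm (f x) powr p)"
    using f(2) set_integral_lebesgue_lborel(2)[OF m cube_sets(1)] by (simp add: torus_Lp_def set_integrable_def)
  have "0 \<le> (LINT x:cube|lborel. norm (f x) powr p)" unfolding set_lebesgue_integral_def by simp
  then have "Lp_norm p f powr p = (LINT x:cube|lborel. norm (f x) powr p)"
    unfolding Lp_norm_def set_integral_lebesgue_lborel(1)[OF m cube_sets(1)] using p by (simp add: powr_powr)
  then show ?thesis using nn_integral_eq_integral[OF i] by (simp add: set_lebesgue_integral_def)
qed

text \<open>A triangle inequality up to the factor 2, obtained pointwise from
  \<open>powr_sum_bound\<close> and then from superadditivity of the \<open>p\<close>-th power. The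
  factor is harmless, since the inequality serves to prove finiteness and convergence to 0.\<close>

lemma Lp_triangle:
  fixes f g h :: "real^'n \<Rightarrow> 'b::euclidean_space"
  assumes p: "p \<ge> 1" and f: "f \<in> borel_measurable borel" "f \<in> torus_Lp p" and g: "g \<in> borel_measurable borel" "g \<in> torus_Lp p"
    and h: "h \<in> borel_measurable borel" "periodic h" "\<And>x. norm (h x) \<le> norm (f x) + norm (g x)"
  shows "h \<in> torus_Lp p" "Lp_norm p h \<le> 2 * (Lp_norm p f + Lp_norm p g)"
proof -
  define a b where "a = Lp_norm p f" and "b = Lp_norm p g"
  have ab: "0 \<le> a" "0 \<le> b" unfolding a_def b_def by (rule Lp_norm_nonneg)+
  have mf: "(\<lambda>x. ennreal (indicator cube x * norm (f x) powr p)) \<in> borel_measurable lborel"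
    "(\<lambda>x. ennreal (indicator cube x * norm (g x) powr p)) \<in> borel_measurable lborel"
    using f(1) g(1) by (auto intro!: measurable_compose[OF _ measurable_ennreal])
  have "(\<integral>\<^sup>+x. ennreal (indicator cube x * norm (h x) powr p) \<partial>lborel) \<le>
    (\<integral>\<^sup>+x. ennreal (2 powr p) * (ennreal (indicator cube x * norm (f x) powr p) + ennreal (indicator cube x * norm (g x) powr p)) \<partial>lborel)"
  proof (rule nn_integral_mono)
    fix x
    have "norm (h x) powr p \<le> (norm (f x) + norm (g x)) powr p" using h(3)[of x] p by (intro powr_mono2) auto
    also have "\<dots> \<le> 2 powr p * (norm (f x) powr p + norm (g x) powr p)" using p by (intro powr_sum_bound) auto
    finally have "ennreal (norm (h x) powr p) \<le> ennreal (2 powr p * (norm (f x) powr p + norm (g x) powr p))" by (rule ennreal_leI)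
    then show "ennreal (indicator cube x * norm (h x) powr p) \<le> ennreal (2 powr p) *
       (ennreal (indicator cube x * norm (f x) powr p) + ennreal (indicator cube x * norm (g x) powr p))"
      by (cases "x \<in> cube") (simp_all add: ennreal_mult)
  qed
  also have "\<dots> = ennreal (2 powr p) * (ennreal (a powr p) + ennreal (b powr p))"
    unfolding a_def b_def torus_Lp_nn_integral[OF f p, symmetric] torus_Lp_nn_integral[OF g p, symmetric]
    using mf by (subst nn_integral_cmult, measurable) (subst nn_integral_add; simp)
  also have "\<dots> = ennreal (2 powr p * (a powr p + b powr p))" by (simp add: ennreal_mult)
  also have "\<dots> \<le> ennreal ((2 * (a + b)) powr p)"
  proof (rule ennreal_leI)
    have "c powr p = c * c powr (p - 1)" if "0 \<le> c" for c
      using that by (cases "c = 0") (auto simp: powr_diff)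
    then have "a powr p = a * a powr (p - 1)" "b powr p = b * b powr (p - 1)" "(a + b) powr p = (a + b) * (a + b) powr (p - 1)"
      using ab by (simp_all only: add_nonneg_nonneg)
    moreover have "a * a powr (p - 1) \<le> a * (a + b) powr (p - 1)" "b * b powr (p - 1) \<le> b * (a + b) powr (p - 1)"
      using ab p by (intro mult_left_mono powr_mono2; simp)+
    ultimately have "a powr p + b powr p \<le> (a + b) powr p" by (simp add: distrib_right)
    then have "2 powr p * (a powr p + b powr p) \<le> 2 powr p * (a + b) powr p" by (rule mult_left_mono) simp
    also have "\<dots> = (2 * (a + b)) powr p" using ab by (intro powr_mult[symmetric])
    finally show "2 powr p * (a powr p + b powr p) \<le> (2 * (a + b)) powr p" .
  qed
  finally have *: "(\<integral>\<^sup>+x. ennreal (indicator cube x * norm (h x) powr p) \<partial>lborel) \<le> ennreal ((2 * (a + b)) powr p)" .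
  have c: "0 \<le> 2 * (a + b)" using ab by simp
  show "h \<in> torus_Lp p" "Lp_norm p h \<le> 2 * (Lp_norm p f + Lp_norm p g)"
    using torus_Lp_bound[OF h(1,2) p c *] unfolding a_def b_def .
qed

lemma emeasure_cube: "emeasure lborel (cube :: (real^'n) set) = 1"
proof -
  have "measure lborel (cube :: (real^'n) set) = 1"
    unfolding cube_def using content_cbox_cart[of "0::real^'n" 1] by (simp add: interval_eq_empty_cart)
  moreover have "emeasure lborel (cube :: (real^'n) set) < \<infinity>" unfolding cube_def by (rule emeasure_lborel_cbox_finite)
  ultimately show ?thesis using emeasure_eq_ennreal_measure[of lborel "cube :: (real^'n) set"] by simp
qed

lemma torus_Lp_sup_bound:
  fixes f :: "real^'n \<Rightarrow> 'b::euclidean_space"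
  assumes f: "f \<in> borel_measurable borel" "periodic f" and p: "p \<ge> 1" and c: "c \<ge> 0" "\<And>x. norm (f x) \<le> c"
  shows "f \<in> torus_Lp p" "Lp_norm p f \<le> c"
proof -
  have "(\<integral>\<^sup>+x. ennreal (indicator cube x * norm (f x) powr p) \<partial>lborel) \<le> (\<integral>\<^sup>+x. ennreal (c powr p) * indicator (cube :: (real^'n) set) x \<partial>lborel)"
    by (intro nn_integral_mono) (use c p in \<open>auto simp: indicator_def intro!: ennreal_leI powr_mono2\<close>)
  also have "\<dots> = ennreal (c powr p)" by (subst nn_integral_cmult_indicator) (simp_all add: emeasure_cube)
  finally show "f \<in> torus_Lp p" "Lp_norm p f \<le> c" using torus_Lp_bound[OF f p c(1)] by blast+
qed

section \<open>Vector-valued limits in \<open>L^p\<close>\<close>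

lemma lim_shift: "lim (\<lambda>l. X (l + n)) = lim (X :: nat \<Rightarrow> real)"
proof -
  have "((\<lambda>l. X (l + n)) \<longlonglongrightarrow> L) = (X \<longlonglongrightarrow> L)" for L
    using LIMSEQ_offset[of X n L] LIMSEQ_ignore_initial_segment[of X L n] by blast
  then show ?thesis by (simp add: lim_def)
qed

text \<open>Taken in each component, so that measurability and convergence reduce to the total
  \<open>lim\<close> on real sequences.\<close>

definition vlim :: "(nat \<Rightarrow> 'x \<Rightarrow> real^'n) \<Rightarrow> 'x \<Rightarrow> real^'n" where
  "vlim f x = (\<chi> k. lim (\<lambda>n. f n x $ k))"

lemma borel_measurable_vec_iff:
  fixes f :: "'a \<Rightarrow> real^'n"
  shows "f \<in> borel_measurable M \<longleftrightarrow> (\<forall>k. (\<lambda>x. f x $ k) \<in> borel_measurable M)"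
  unfolding borel_measurable_euclidean_space[of f] Ball_def Basis_axis by (auto simp: inner_axis)

lemma vlim_borel:
  assumes "\<And>n. f n \<in> borel_measurable M" shows "vlim f \<in> borel_measurable M"
  unfolding borel_measurable_vec_iff vlim_def
  using assms by (auto intro!: borel_measurable_lim_metric simp: borel_measurable_vec_iff)

lemma norm_vec_powr_le:
  fixes v :: "real^'n" assumes p: "p \<ge> 1"
  shows "norm v powr p \<le> real CARD('n) powr p * (\<Sum>k\<in>UNIV. \<bar>v $ k\<bar> powr p)"
proof -
  have "norm v \<le> (\<Sum>k\<in>UNIV. \<bar>v $ k\<bar>)" by (rule norm_le_l1_cart)
  have "Max (range (\<lambda>k. \<bar>v $ k\<bar>)) \<in> range (\<lambda>k. \<bar>v $ k\<bar>)" by (intro Max_in) auto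
  then obtain l where "Max (range (\<lambda>k. \<bar>v $ k\<bar>)) = \<bar>v $ l\<bar>" by blast
  then have l: "\<bar>v $ k\<bar> \<le> \<bar>v $ l\<bar>" for k using Max_ge[of "range (\<lambda>k. \<bar>v $ k\<bar>)" "\<bar>v $ k\<bar>"] by simp
  have "(\<Sum>k\<in>UNIV. \<bar>v $ k\<bar>) \<le> real CARD('n) * \<bar>v $ l\<bar>" using sum_bounded_above[of UNIV "\<lambda>k. \<bar>v $ k\<bar>"] l by simp
  with \<open>norm v \<le> _\<close> have "norm v powr p \<le> (real CARD('n) * \<bar>v $ l\<bar>) powr p" using p by (intro powr_mono2) auto
  also have "\<dots> = real CARD('n) powr p * \<bar>v $ l\<bar> powr p" by (simp add: powr_mult)
  also have "\<bar>v $ l\<bar> powr p \<le> (\<Sum>k\<in>UNIV. \<bar>v $ k\<bar> powr p)" using member_le_sum[of l UNIV "\<lambda>k. \<bar>v $ k\<bar> powr p"] by simp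
  finally show ?thesis by (simp add: mult_left_mono)
qed

text \<open>One factor of the dimension comes from comparing the norm with the largest component,
  the other from summing the components; for the latter the \<open>p\<close>-th root is bounded by
  the dimension itself, which gives a constant free of \<open>p\<close>.\<close>

lemma vlim_Lp:
  fixes f :: "nat \<Rightarrow> real^'n \<Rightarrow> real^'n"
  assumes f: "\<And>n. continuous_on UNIV (f n)" "\<And>n. periodic (f n)" and p: "p \<ge> 1"
    and g: "\<And>l k. n \<le> l \<Longrightarrow> integral cube (\<lambda>x. \<bar>f (Suc l) x $ k - f l x $ k\<bar> powr p) \<le> g l powr p" "\<And>l. 0 \<le> g l"
    and s: "summable (\<lambda>l. 2 ^ Suc l * g l)"
  shows "(\<lambda>x. f n x - vlim f x) \<in> torus_Lp p"
    "Lp_norm p (\<lambda>x. f n x - vlim f x) \<le> (real CARD('n))\<^sup>2 * (\<Sum>l. 2 ^ Suc (l + n) * g (l + n))"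
proof -
  define N where "N = real CARD('n)"
  have N: "N \<ge> 1" unfolding N_def using zero_less_card_finite[where 'a='n] by linarith
  define \<tau> where "\<tau> = (\<Sum>l. 2 ^ Suc (l + n) * g (l + n))"
  have fc: "continuous_on UNIV (\<lambda>x. f l x $ k)" for l k by (intro continuous_on_component f)
  have s1: "summable (\<lambda>l. 2 ^ Suc (l + n) * g (l + n))" by (rule summable_ignore_initial_segment[OF s])
  have le: "2 ^ Suc l * g (l + n) \<le> 2 ^ Suc (l + n) * g (l + n)" for l
    by (rule mult_right_mono[OF power_increasing g(2)]) auto
  have s2: "summable (\<lambda>l. 2 ^ Suc l * g (l + n))"
    by (rule summable_comparison_test'[OF s1, of 0]) (use le g(2) in auto)
  have "0 \<le> 2 ^ Suc l * g (l + n)" for l using g(2) by simp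
  from suminf_nonneg[OF s2 this] have s0: "0 \<le> (\<Sum>l. 2 ^ Suc l * g (l + n))" .
  have st: "(\<Sum>l. 2 ^ Suc l * g (l + n)) \<le> \<tau>" unfolding \<tau>_def by (rule suminf_le[OF le s2 s1])
  have \<tau>0: "\<tau> \<ge> 0" using s0 st by linarith
  have comp: "(\<integral>\<^sup>+x. ennreal (indicator cube x * \<bar>f n x $ k - vlim f x $ k\<bar> powr p) \<partial>lborel) \<le> ennreal (\<tau> powr p)" for k
  proof -
    have "(\<integral>\<^sup>+x. ennreal (indicator (cbox 0 1) x * \<bar>lim (\<lambda>l. f (l + n) x $ k) - f (0 + n) x $ k\<bar> powr p) \<partial>lborel) \<le>
      ennreal ((\<Sum>l. 2 ^ Suc l * g (l + n)) powr p)"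
      using g(1)[of "_ + n" k] unfolding cube_def
      by (intro Lp_limit(2)[where f = "\<lambda>l x. f (l + n) x $ k" and g = "\<lambda>l. g (l + n)"] fc p s2 g(2)) auto
    also have "\<dots> \<le> ennreal (\<tau> powr p)" using st s0 p by (intro ennreal_leI powr_mono2) auto
    finally show ?thesis using lim_shift[of "\<lambda>l. f l _ $ k" n] by (simp add: vlim_def cube_def abs_minus_commute)
  qed
  have fm: "f l \<in> borel_measurable borel" for l by (rule borel_measurable_continuous_onI[OF f(1)])
  have dm: "(\<lambda>x. f n x - vlim f x) \<in> borel_measurable borel" by (intro borel_measurable_diff vlim_borel fm)
  have dc: "(\<lambda>x. f n x $ k - vlim f x $ k) \<in> borel_measurable borel" for k
    using dm unfolding borel_measurable_vec_iff by simp
  have km: "(\<lambda>x. ennreal (indicator cube x * \<bar>f n x $ k - vlim f x $ k\<bar> powr p)) \<in> borel_measurable lborel" for k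
    using dc[of k] by (auto intro!: measurable_compose[OF _ measurable_ennreal])
  have "(\<integral>\<^sup>+x. ennreal (indicator cube x * norm (f n x - vlim f x) powr p) \<partial>lborel) \<le>
    (\<integral>\<^sup>+x. ennreal (N powr p) * (\<Sum>k\<in>UNIV. ennreal (indicator cube x * \<bar>f n x $ k - vlim f x $ k\<bar> powr p)) \<partial>lborel)"
  proof (rule nn_integral_mono)
    fix x
    show "ennreal (indicator cube x * norm (f n x - vlim f x) powr p) \<le>
      ennreal (N powr p) * (\<Sum>k\<in>UNIV. ennreal (indicator cube x * \<bar>f n x $ k - vlim f x $ k\<bar> powr p))"
      using ennreal_leI[OF norm_vec_powr_le[OF p, of "f n x - vlim f x"]]
      by (cases "x \<in> cube") (simp_all add: ennreal_mult sum_nonneg N_def)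
  qed
  also have "\<dots> = ennreal (N powr p) * (\<Sum>k\<in>UNIV. \<integral>\<^sup>+x. ennreal (indicator cube x * \<bar>f n x $ k - vlim f x $ k\<bar> powr p) \<partial>lborel)"
    unfolding nn_integral_cmult[OF borel_measurable_sum[OF km]] nn_integral_sum[OF km] by (rule refl)
  also have "\<dots> \<le> ennreal (N powr p) * (\<Sum>k\<in>(UNIV::'n set). ennreal (\<tau> powr p))" by (intro mult_left_mono sum_mono comp) simp
  also have "\<dots> = ennreal (N powr p * (N * \<tau> powr p))" by (simp add: N_def ennreal_mult ennreal_of_nat_eq_real_of_nat)
  also have "\<dots> \<le> ennreal ((N\<^sup>2 * \<tau>) powr p)"
  proof (rule ennreal_leI)
    have "N powr 1 \<le> N powr p" using N p by (intro powr_mono) auto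
    then have "N * \<tau> powr p \<le> N powr p * \<tau> powr p" using N by (intro mult_right_mono) auto
    then have "N powr p * (N * \<tau> powr p) \<le> N powr p * (N powr p * \<tau> powr p)" by (intro mult_left_mono) auto
    then show "N powr p * (N * \<tau> powr p) \<le> (N\<^sup>2 * \<tau>) powr p" using N \<tau>0 by (simp add: power2_eq_square powr_mult mult.assoc)
  qed
  finally have main: "(\<integral>\<^sup>+x. ennreal (indicator cube x * norm (f n x - vlim f x) powr p) \<partial>lborel) \<le> ennreal ((N\<^sup>2 * \<tau>) powr p)" .
  have per: "periodic (\<lambda>x. f n x - vlim f x)" using f(2) unfolding periodic_def vlim_def by simp
  have c: "0 \<le> N\<^sup>2 * \<tau>" using \<tau>0 by simp
  show "(\<lambda>x. f n x - vlim f x) \<in> torus_Lp p"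
    "Lp_norm p (\<lambda>x. f n x - vlim f x) \<le> (real CARD('n))\<^sup>2 * (\<Sum>l. 2 ^ Suc (l + n) * g (l + n))"
    using torus_Lp_bound[OF dm per p c main] unfolding N_def \<tau>_def .
qed

section \<open>Weak derivatives of limits\<close>

lemma line_derivative_unique_periodic:
  fixes \<phi> \<psi> :: "real^'n \<Rightarrow> real"
  assumes \<phi>: "periodic \<phi>" and d: "\<And>x s. ((\<lambda>s. \<phi> (x + s *\<^sub>R e)) has_real_derivative \<psi> (x + s *\<^sub>R e)) (at s)"
  shows "periodic \<psi>"
  unfolding periodic_def
proof (intro allI impI)
  fix x m :: "real^'n" assume m: "\<forall>i. m $ i \<in> \<int>"
  have "(\<lambda>s. \<phi> ((x + m) + s *\<^sub>R e)) = (\<lambda>s. \<phi> (x + s *\<^sub>R e))"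
    using \<phi> m unfolding periodic_def by (metis (no_types, opaque_lifting) add.assoc add.commute)
  then show "\<psi> (x + m) = \<psi> x" using DERIV_unique[of "\<lambda>s. \<phi> (x + s *\<^sub>R e)" "\<psi> (x + m)" 0 "\<psi> x"] d[of "x + m" 0] d[of x 0] by simp
qed

lemma smooth_partial:
  fixes \<phi> :: "real^'n \<Rightarrow> real"
  assumes "smooth \<phi>"
  shows "continuous_on UNIV \<phi>" "continuous_on UNIV (partial (axis l 1) \<phi>)"
    "((\<lambda>s. \<phi> (x + s *\<^sub>R axis l 1)) has_real_derivative partial (axis l 1) \<phi> (x + s *\<^sub>R axis l 1)) (at s)"
proof -
  have "C_k 0 \<phi>" "C_k (Suc 0) \<phi>" using assms unfolding smooth_def by blast+
  then show "continuous_on UNIV \<phi>" "continuous_on UNIV (partial (axis l 1) \<phi>)" using Basis_axis by auto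
  have D: "(\<phi> has_derivative frechet_derivative \<phi> (at z)) (at z)" for z
    using \<open>C_k (Suc 0) \<phi>\<close> by (simp only: C_k.simps frechet_derivative_works)
  have "((\<lambda>s. x + s *\<^sub>R axis l 1) has_derivative (\<lambda>h. h *\<^sub>R axis l 1)) (at s)" by (auto intro!: derivative_eq_intros)
  from has_derivative_compose[OF this D]
  show "((\<lambda>s. \<phi> (x + s *\<^sub>R axis l 1)) has_real_derivative partial (axis l 1) \<phi> (x + s *\<^sub>R axis l 1)) (at s)"
    unfolding has_field_derivative_def partial_def
    by (rule has_derivative_eq_rhs) (simp add: linear_scale[OF has_derivative_linear[OF D]] fun_eq_iff)
qed

lemma torus_test_integral:
  fixes h :: "real^'n \<Rightarrow> 'b::euclidean_space" and \<psi> :: "real^'n \<Rightarrow> real"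
  assumes h: "h \<in> torus_Lp 1" and \<psi>: "continuous_on UNIV \<psi>" and C: "\<And>x. x \<in> cube \<Longrightarrow> \<bar>\<psi> x\<bar> \<le> C"
  shows "integrable lebesgue (\<lambda>x. indicator cube x *\<^sub>R (\<psi> x *\<^sub>R h x))"
    "norm (LINT x:cube|lebesgue. \<psi> x *\<^sub>R h x) \<le> C * Lp_norm 1 h"
proof -
  have hi: "integrable lebesgue (\<lambda>x. indicator cube x *\<^sub>R h x)" by (rule torus_L1_integrable[OF h])
  have \<psi>m: "\<psi> \<in> borel_measurable lebesgue"
    using borel_measurable_continuous_onI[OF \<psi>] by (intro measurable_completion) simp
  have b: "norm (indicator cube x *\<^sub>R (\<psi> x *\<^sub>R h x)) \<le> C * norm (indicator cube x *\<^sub>R h x)" for x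
    using C[of x] by (auto simp: indicator_def intro!: mult_right_mono)
  show i: "integrable lebesgue (\<lambda>x. indicator cube x *\<^sub>R (\<psi> x *\<^sub>R h x))"
  proof (rule Bochner_Integration.integrable_bound[OF integrable_mult_right[OF integrable_norm[OF hi], of C]])
    have "(\<lambda>x. \<psi> x *\<^sub>R (indicator cube x *\<^sub>R h x)) \<in> borel_measurable lebesgue"
      by (rule borel_measurable_scaleR[OF \<psi>m borel_measurable_integrable[OF hi]])
    then show "(\<lambda>x. indicator cube x *\<^sub>R (\<psi> x *\<^sub>R h x)) \<in> borel_measurable lebesgue" by (simp add: mult.commute)
    show "AE x in lebesgue. norm (indicator cube x *\<^sub>R (\<psi> x *\<^sub>R h x)) \<le> norm (C * norm (indicator cube x *\<^sub>R h x))"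
      by (intro AE_I2 order_trans[OF b]) simp
  qed
  have "norm (LINT x|lebesgue. indicator cube x *\<^sub>R (\<psi> x *\<^sub>R h x)) \<le> (LINT x|lebesgue. norm (indicator cube x *\<^sub>R (\<psi> x *\<^sub>R h x)))"
    by (rule integral_norm_bound)
  also have "\<dots> \<le> (LINT x|lebesgue. C * norm (indicator cube x *\<^sub>R h x))"
    by (intro integral_mono integrable_norm i integrable_mult_right hi b)
  also have "\<dots> = C * (LINT x:cube|lebesgue. norm (h x))" by (simp add: set_lebesgue_integral_def)
  also have "(LINT x:cube|lebesgue. norm (h x)) = Lp_norm 1 h"
    unfolding Lp_norm_def by (simp add: set_lebesgue_integral_def)
  finally show "norm (LINT x:cube|lebesgue. \<psi> x *\<^sub>R h x) \<le> C * Lp_norm 1 h" by (simp add: set_lebesgue_integral_def)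
qed

text \<open>At each stage integration by parts on the torus is classical. A test function and its
  derivative are bounded on the cube, so both sides of the identity are continuous under
  \<open>L^1\<close> convergence of the functions and of their derivatives.\<close>

lemma weak_partial_limit:
  fixes f d :: "nat \<Rightarrow> real^'n \<Rightarrow> real^'n"
  assumes f: "\<And>n. continuous_on UNIV (f n)" "\<And>n. periodic (f n)" "\<And>n. f n \<in> torus_Lp 1"
    and d: "\<And>n. continuous_on UNIV (d n)" "\<And>n. d n \<in> torus_Lp 1"
    and fd: "\<And>n c x s. ((\<lambda>s. f n (x + s *\<^sub>R axis l 1) $ c) has_real_derivative d n (x + s *\<^sub>R axis l 1) $ c) (at s)"
    and F: "F \<in> torus_Lp 1" "\<And>n. (\<lambda>x. f n x - F x) \<in> torus_Lp 1" "(\<lambda>n. Lp_norm 1 (\<lambda>x. f n x - F x)) \<longlonglongrightarrow> 0"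
    and D: "D \<in> torus_Lp 1" "\<And>n. (\<lambda>x. d n x - D x) \<in> torus_Lp 1" "(\<lambda>n. Lp_norm 1 (\<lambda>x. d n x - D x)) \<longlonglongrightarrow> 0"
  shows "has_weak_partial l F D"
  unfolding has_weak_partial_def
proof (intro conjI F D allI impI)
  fix \<phi> :: "real^'n \<Rightarrow> real" assume "smooth \<phi> \<and> periodic \<phi>"
  then have \<phi>: "smooth \<phi>" "periodic \<phi>" by auto
  define \<psi> where "\<psi> = partial (axis l 1) \<phi>"
  note sp = smooth_partial(1)[OF \<phi>(1)] smooth_partial(2,3)[OF \<phi>(1), where l = l, folded \<psi>_def]
  have \<psi>p: "periodic \<psi>" by (rule line_derivative_unique_periodic[OF \<phi>(2) sp(3)])
  have "compact (\<phi> ` cube)" "compact (\<psi> ` cube)" unfolding cube_def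
    by (intro compact_continuous_image continuous_on_subset[OF sp(1)] continuous_on_subset[OF sp(2)]; simp)+
  then obtain C1 C2 where "\<And>x. x \<in> cube \<Longrightarrow> \<bar>\<phi> x\<bar> \<le> C1" "\<And>x. x \<in> cube \<Longrightarrow> \<bar>\<psi> x\<bar> \<le> C2"
    using compact_imp_bounded[of "\<phi> ` cube"] compact_imp_bounded[of "\<psi> ` cube"] unfolding bounded_iff by fastforce
  then have C1: "\<And>x. x \<in> cube \<Longrightarrow> \<bar>\<phi> x\<bar> \<le> C1" and C2: "\<And>x. x \<in> cube \<Longrightarrow> \<bar>\<psi> x\<bar> \<le> C2" by blast+
  note t1 = torus_test_integral[OF _ sp(1) C1] and t2 = torus_test_integral[OF _ sp(2) C2]
  define I where "I \<psi> h = (LINT x:cube|lebesgue. \<psi> x *\<^sub>R h x)" for \<psi> and h :: "real^'n \<Rightarrow> real^'n"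
  \<comment> \<open>In each component the integrand is the derivative of the periodic function
    \<open>\<phi> x * f n x $ c\<close> along coordinate lines, so its integral over the cube
    vanishes.\<close>
  have stage: "I \<psi> (f n) + I \<phi> (d n) = 0" for n
  unfolding vec_eq_iff zero_index
  proof
    fix c
    have i1: "integrable lebesgue (\<lambda>x. indicator cube x *\<^sub>R (\<psi> x *\<^sub>R f n x))" by (rule t2(1)[OF f(3)])
    have i2: "integrable lebesgue (\<lambda>x. indicator cube x *\<^sub>R (\<phi> x *\<^sub>R d n x))" by (rule t1(1)[OF d(2)])
    define G where "G x = \<psi> x * f n x $ c + \<phi> x * d n x $ c" for x
    have fcc: "continuous_on UNIV (\<lambda>x. f n x $ c)" "continuous_on UNIV (\<lambda>x. d n x $ c)" by (intro continuous_on_component f d)+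
    have Gc: "continuous_on UNIV G" unfolding G_def by (intro continuous_on_add continuous_on_mult sp fcc)
    have fp: "periodic (\<lambda>x. f n x $ c)" using f(2)[of n] unfolding periodic_def by simp
    have dp: "periodic (\<lambda>x. d n x $ c)" by (rule line_derivative_unique_periodic[OF fp fd])
    have "integral cube G = 0"
    proof (rule integral_cube_derivative[where F = "\<lambda>x. \<phi> x * f n x $ c" and k = l])
      show "periodic (\<lambda>x. \<phi> x * f n x $ c)" using \<phi>(2) fp unfolding periodic_def by simp
      show "periodic G" using \<phi>(2) fp \<psi>p dp unfolding periodic_def G_def by simp
      fix x s
      show "((\<lambda>s. \<phi> (x + s *\<^sub>R axis l 1) * f n (x + s *\<^sub>R axis l 1) $ c) has_real_derivative G (x + s *\<^sub>R axis l 1)) (at s)"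
        unfolding G_def using DERIV_mult[OF sp(3)[of x s] fd[where n = n and x = x and c = c and s = s]] by (simp add: mult_ac add.commute)
    qed (rule Gc)
    then have "(LINT x:cube|lebesgue. G x) = 0"
      using continuous_cbox_integral(2)[OF Gc, of 0 1]
        set_integral_lebesgue_lborel(1)[OF borel_measurable_continuous_onI[OF Gc] cube_sets(1)] by (simp add: cube_def)
    then have G0: "(LINT x|lebesgue. indicator cube x * G x) = 0" by (simp add: set_lebesgue_integral_def)
    have "(I \<psi> (f n) + I \<phi> (d n)) $ c =
      (LINT x|lebesgue. (indicator cube x *\<^sub>R (\<psi> x *\<^sub>R f n x) + indicator cube x *\<^sub>R (\<phi> x *\<^sub>R d n x)) $ c)"
      unfolding I_def set_lebesgue_integral_def
      using integral_bounded_linear[OF bounded_linear_vec_nth Bochner_Integration.integrable_add[OF i1 i2], of c]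
        Bochner_Integration.integral_add[OF i1 i2] by simp
    also have "\<dots> = (LINT x|lebesgue. indicator cube x * G x)" by (simp add: G_def algebra_simps)
    finally show "(I \<psi> (f n) + I \<phi> (d n)) $ c = 0" using G0 by simp
  qed
  have "norm (I \<psi> F + I \<phi> D) \<le> C2 * Lp_norm 1 (\<lambda>x. f n x - F x) + C1 * Lp_norm 1 (\<lambda>x. d n x - D x)" for n
  proof -
    have "I \<psi> (\<lambda>x. f n x - F x) = I \<psi> (f n) - I \<psi> F"
      unfolding I_def set_lebesgue_integral_def scaleR_diff_right
      by (rule Bochner_Integration.integral_diff[OF t2(1)[OF f(3)] t2(1)[OF F(1)]])
    moreover have "I \<phi> (\<lambda>x. d n x - D x) = I \<phi> (d n) - I \<phi> D"
      unfolding I_def set_lebesgue_integral_def scaleR_diff_right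
      by (rule Bochner_Integration.integral_diff[OF t1(1)[OF d(2)] t1(1)[OF D(1)]])
    ultimately have "I \<psi> (\<lambda>x. f n x - F x) + I \<phi> (\<lambda>x. d n x - D x) = (I \<psi> (f n) + I \<phi> (d n)) - (I \<psi> F + I \<phi> D)"
      by (simp only: add_diff_add)
    then have "I \<psi> F + I \<phi> D = - (I \<psi> (\<lambda>x. f n x - F x) + I \<phi> (\<lambda>x. d n x - D x))" by (simp add: stage)
    then have "norm (I \<psi> F + I \<phi> D) \<le> norm (I \<psi> (\<lambda>x. f n x - F x)) + norm (I \<phi> (\<lambda>x. d n x - D x))"
      by (simp only: norm_minus_cancel norm_triangle_ineq)
    also have "\<dots> \<le> C2 * Lp_norm 1 (\<lambda>x. f n x - F x) + C1 * Lp_norm 1 (\<lambda>x. d n x - D x)"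
      unfolding I_def by (intro add_mono t1(2) t2(2) F D)
    finally show ?thesis .
  qed
  moreover have "(\<lambda>n. C2 * Lp_norm 1 (\<lambda>x. f n x - F x) + C1 * Lp_norm 1 (\<lambda>x. d n x - D x)) \<longlonglongrightarrow> C2 * 0 + C1 * 0"
    by (intro tendsto_add tendsto_mult tendsto_const F D)
  ultimately have "norm (I \<psi> F + I \<phi> D) \<le> 0" using tendsto_lowerbound[of _ "C2 * 0 + C1 * 0" sequentially "norm (I \<psi> F + I \<phi> D)"] by simp
  then show "(LINT x:cube|lebesgue. partial (axis l 1) \<phi> x *\<^sub>R F x) = - (LINT x:cube|lebesgue. \<phi> x *\<^sub>R D x)"
    unfolding I_def \<psi>_def by (simp add: add_eq_0_iff2)
qed

subsection \<open>The limit field\<close>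

lemma alg_lipschitz_derivatives:
  fixes F :: "real \<Rightarrow> real^'n \<Rightarrow> real"
  assumes F: "F \<in> alg"
  shows "\<exists>L\<ge>0. \<forall>s\<in>{0..T}. \<forall>t\<in>{0..T}. \<forall>x. \<bar>F t x - F s x\<bar> \<le> L * \<bar>t - s\<bar> \<and> (\<forall>l. \<bar>Dx l F t x - Dx l F s x\<bar> \<le> L * \<bar>t - s\<bar>)"
proof -
  obtain L where L: "L \<ge> 0" "\<forall>bs. set bs \<subseteq> Basis \<and> length bs \<le> Suc 0 \<longrightarrow>
     (\<forall>s\<in>{0..T}. \<forall>t\<in>{0..T}. \<forall>x. \<bar>foldr partial bs (F t) x - foldr partial bs (F s) x\<bar> \<le> L * \<bar>t - s\<bar>)"
    using alg_partials_lipschitz[OF F] by blast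
  have 0: "\<forall>s\<in>{0..T}. \<forall>t\<in>{0..T}. \<forall>x. \<bar>F t x - F s x\<bar> \<le> L * \<bar>t - s\<bar>" using L(2)[rule_format, of "[]"] by simp
  have "\<forall>s\<in>{0..T}. \<forall>t\<in>{0..T}. \<forall>x. \<bar>Dx l F t x - Dx l F s x\<bar> \<le> L * \<bar>t - s\<bar>" for l
  proof -
    have "set [axis l 1 :: real^'n] \<subseteq> Basis \<and> length [axis l 1 :: real^'n] \<le> Suc 0" using Basis_axis by auto
    from L(2)[rule_format, OF this] show ?thesis by (simp add: Dx_def)
  qed
  with 0 L(1) show ?thesis by blast
qed

locale field_scheme =
  fixes T :: real and w :: "'n::finite \<Rightarrow> nat \<Rightarrow> real \<Rightarrow> real^'n \<Rightarrow> real" and G :: "nat \<Rightarrow> real \<Rightarrow> real"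
  assumes T: "T > 0" and w: "\<And>k n. w k n \<in> alg"
    and G_cont: "\<And>n. continuous_on UNIV (G n)" and G_nonneg: "\<And>n t. 0 \<le> G n t"
    and G_int: "\<And>n. integral {0..T} (G n) \<le> (1/4) ^ n"
    and w_step: "\<And>n p k t. 1 \<le> p \<Longrightarrow> p \<le> real (Suc n) \<Longrightarrow> integral cube (\<lambda>x. \<bar>w k (Suc n) t x - w k n t x\<bar> powr p) \<le> G n t powr p"
    and Dw_step: "\<And>n p k l t. 1 \<le> p \<Longrightarrow> p \<le> real (Suc n) \<Longrightarrow>
        integral cube (\<lambda>x. \<bar>Dx l (w k (Suc n)) t x - Dx l (w k n) t x\<bar> powr p) \<le> G n t powr p"
begin

text \<open>The weights anticipate the loss in \<open>Lp_limit\<close>; against the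
  \<open>(1/4) ^ n\<close> of \<open>G_int\<close> they still leave a convergent geometric
  series.\<close>

definition good :: "real set" where "good = finite_times T (\<lambda>n t. 2 ^ Suc n * G n t)"

definition g :: "real \<Rightarrow> nat \<Rightarrow> real" where "g t n = (if t \<in> good then G n t else 0)"

definition tail :: "nat \<Rightarrow> real \<Rightarrow> real" where "tail n t = (\<Sum>l. 2 ^ Suc (l + n) * g t (l + n))"

text \<open>Cutting the stages off at the bad times lets one treat all times alike.\<close>

definition stage :: "('n \<Rightarrow> nat \<Rightarrow> real \<Rightarrow> real^'n \<Rightarrow> real) \<Rightarrow> real \<Rightarrow> nat \<Rightarrow> real^'n \<Rightarrow> real^'n" where
  "stage F t n x = (\<chi> k. if t \<in> good then F k n t x else 0)"

definition field :: "('n \<Rightarrow> nat \<Rightarrow> real \<Rightarrow> real^'n \<Rightarrow> real) \<Rightarrow> real \<Rightarrow> real^'n \<Rightarrow> real^'n" where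
  "field F t = vlim (stage F t)"

text \<open>The common hypotheses for the field and for each family of its derivatives: limits are
  studied once and then applied to \<open>w\<close> and to every \<open>Dw l\<close>.\<close>

definition admissible :: "('n \<Rightarrow> nat \<Rightarrow> real \<Rightarrow> real^'n \<Rightarrow> real) \<Rightarrow> bool" where
  "admissible F \<longleftrightarrow> (\<forall>k n. F k n \<in> alg) \<and> (\<forall>n p k t. 1 \<le> p \<longrightarrow> p \<le> real (Suc n) \<longrightarrow>
     integral cube (\<lambda>x. \<bar>F k (Suc n) t x - F k n t x\<bar> powr p) \<le> G n t powr p)"

definition Dw :: "'n \<Rightarrow> 'n \<Rightarrow> nat \<Rightarrow> real \<Rightarrow> real^'n \<Rightarrow> real" where "Dw l k n = Dx l (w k n)"

lemma admissible: "admissible w" "admissible (Dw l)"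
  unfolding admissible_def Dw_def using w w_step Dw_step alg_Dx(1) by blast+

lemma a_cont: "continuous_on UNIV (\<lambda>t. 2 ^ Suc n * G n t)" by (intro continuous_on_mult continuous_on_const G_cont)

lemma a_nonneg: "0 \<le> 2 ^ Suc n * G n t" using G_nonneg by simp

lemma good_sets: "good \<in> sets borel"
  unfolding good_def by (rule finite_times_sets[OF borel_measurable_continuous_onI[OF a_cont]])

lemma good_subset: "good \<subseteq> {0..T}" by (auto simp: good_def finite_times_def)

lemma a_integral: "integral {0..T} (\<lambda>t. 2 ^ Suc n * G n t) \<le> 2 * (1/2) ^ n"
proof -
  have "integral {0..T} (\<lambda>t. 2 ^ Suc n * G n t) = 2 ^ Suc n * integral {0..T} (G n)" by simp
  also have "\<dots> \<le> 2 ^ Suc n * (1/4) ^ n" by (intro mult_left_mono G_int) simp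
  also have "\<dots> = 2 * (1/2) ^ n" using power_mult_distrib[of 2 "1/4::real" n] by simp
  finally show ?thesis .
qed

lemma AE_good: "AE t in lborel. t \<in> {0..T} \<longrightarrow> t \<in> good"
  unfolding good_def
  by (rule AE_finite_times[OF a_cont a_nonneg a_integral]) (intro summable_mult summable_geometric, simp)

lemma g_nonneg: "0 \<le> g t n" by (simp add: g_def G_nonneg)

lemma g_summable: "summable (\<lambda>n. 2 ^ Suc n * g t n)"
  using finite_times_summable[where a = "\<lambda>n t. 2 ^ Suc n * G n t" and t = t and T = T, OF a_nonneg]
  by (cases "t \<in> good") (auto simp: g_def good_def)

lemma tail_zero: "(\<lambda>n. tail n t) \<longlonglongrightarrow> 0"
  unfolding tail_def by (rule suminf_tail_tendsto_zero[OF g_summable])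

lemma tail_nonneg: "0 \<le> tail n t"
  unfolding tail_def by (rule suminf_nonneg[OF summable_ignore_initial_segment[OF g_summable]]) (simp add: g_nonneg)

context
  fixes F assumes adm: "admissible F"
begin

lemma F_alg: "F k n \<in> alg" using adm unfolding admissible_def by blast

lemma F_continuous: "continuous_on S (\<lambda>x. \<chi> k. F k n t x)"
  by (intro continuous_on_vec_lambda jcont_section jcont_alg F_alg)

lemma stage_continuous: "continuous_on UNIV (stage F t n)"
  using F_continuous[of UNIV n t] by (cases "t \<in> good") (simp_all add: stage_def[abs_def])

lemma F_periodic: "periodic (\<lambda>x. \<chi> k. F k n t x)"
  using alg_periodic[OF F_alg] unfolding periodic_def by simp

lemma stage_periodic: "periodic (stage F t n)"
  using F_periodic[of n t] by (cases "t \<in> good") (simp_all add: stage_def[abs_def] periodic_def)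

lemma field_periodic: "periodic (field F t)"
  using stage_periodic unfolding periodic_def field_def vlim_def by simp

lemma stage_joint_borel: "(\<lambda>z. stage F (fst z) n (snd z)) \<in> borel_measurable borel"
  unfolding borel_measurable_vec_iff
proof
  fix k
  have 1: "(\<lambda>z. F k n (fst z) (snd z)) \<in> borel_measurable borel"
    using alg_continuous[OF F_alg[of k n]] by (intro borel_measurable_continuous_onI) (simp add: split_beta)
  have "(\<lambda>z. indicator good (fst z) :: real) \<in> borel_measurable (borel :: (real \<times> (real^'n)) measure)"
    by (rule measurable_compose[OF borel_measurable_continuous_onI[OF continuous_on_fst[OF continuous_on_id]]
      borel_measurable_indicator[OF good_sets]])
  from borel_measurable_times[OF this 1] show "(\<lambda>z. stage F (fst z) n (snd z) $ k) \<in> borel_measurable borel"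
    unfolding stage_def by (rule measurable_cong[THEN iffD1, rotated]) (simp add: indicator_def)
qed

lemma field_joint_borel: "(\<lambda>z. field F (fst z) (snd z)) \<in> borel_measurable borel"
proof -
  have "vlim (\<lambda>n z. stage F (fst z) n (snd z)) \<in> borel_measurable borel" by (rule vlim_borel[OF stage_joint_borel])
  then show ?thesis unfolding field_def vlim_def .
qed

lemma stage_borel: "stage F t n \<in> borel_measurable borel" by (rule borel_measurable_continuous_onI[OF stage_continuous])

lemma field_borel: "field F t \<in> borel_measurable borel" unfolding field_def by (rule vlim_borel[OF stage_borel])

lemma stage_step:
  assumes "1 \<le> p" "p \<le> real (Suc n)"
  shows "integral cube (\<lambda>x. \<bar>stage F t (Suc n) x $ k - stage F t n x $ k\<bar> powr p) \<le> g t n powr p"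
  using adm assms unfolding admissible_def stage_def g_def by simp

lemma stage_close:
  assumes p: "1 \<le> p" "p \<le> real (Suc n)"
  shows "(\<lambda>x. stage F t n x - field F t x) \<in> torus_Lp p"
    "Lp_norm p (\<lambda>x. stage F t n x - field F t x) \<le> (real CARD('n))\<^sup>2 * tail n t"
proof -
  have st: "integral cube (\<lambda>x. \<bar>stage F t (Suc l) x $ k - stage F t l x $ k\<bar> powr p) \<le> g t l powr p" if "n \<le> l" for l k
    using that p by (intro stage_step) auto
  show "(\<lambda>x. stage F t n x - field F t x) \<in> torus_Lp p"
    "Lp_norm p (\<lambda>x. stage F t n x - field F t x) \<le> (real CARD('n))\<^sup>2 * tail n t"
    unfolding field_def tail_def
    using vlim_Lp[of "stage F t", OF stage_continuous stage_periodic p(1) st g_nonneg g_summable] by blast+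
qed

lemma F_bounded: "\<exists>C\<ge>0. \<forall>t\<in>{0..T}. \<forall>x. norm (\<chi> k. F k n t x) \<le> C"
proof -
  have "\<forall>k. \<exists>M\<ge>0. \<forall>t\<in>{0..T}. \<forall>x. \<bar>F k n t x\<bar> \<le> M" using alg_bounded[OF F_alg] by blast
  from choice[OF this] obtain M where M: "\<And>k. M k \<ge> 0" "\<And>k t x. t \<in> {0..T} \<Longrightarrow> \<bar>F k n t x\<bar> \<le> M k" by blast
  have "norm (\<chi> k. F k n t x) \<le> (\<Sum>k\<in>UNIV. M k)" if "t \<in> {0..T}" for t x
    using norm_le_l1_cart[of "\<chi> k. F k n t x"] sum_mono[of UNIV "\<lambda>k. \<bar>F k n t x\<bar>" M] M(2)[OF that] by force
  moreover have "0 \<le> (\<Sum>k\<in>UNIV. M k)" using M(1) by (simp add: sum_nonneg)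
  ultimately show ?thesis by blast
qed

lemma stage_torus_Lp:
  assumes p: "1 \<le> p"
  shows "\<exists>C\<ge>0. \<forall>t. stage F t n \<in> torus_Lp p \<and> Lp_norm p (stage F t n) \<le> C"
proof -
  obtain C where C: "C \<ge> 0" "\<And>t x. t \<in> {0..T} \<Longrightarrow> norm (\<chi> k. F k n t x) \<le> C" using F_bounded by blast
  have "norm (stage F t n x) \<le> C" for t x
  proof (cases "t \<in> good")
    case True then show ?thesis using C(2)[of t x] good_subset by (auto simp: stage_def)
  next
    case False
    then have "stage F t n x = 0" by (simp add: stage_def vec_eq_iff)
    then show ?thesis using C by simp
  qed
  then show ?thesis using torus_Lp_sup_bound[OF stage_borel stage_periodic p C(1)] C(1) by blast
qed

lemma field_torus_Lp:
  assumes p: "1 \<le> p"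
  shows "field F t \<in> torus_Lp p"
    "\<exists>C\<ge>0. \<forall>t. Lp_norm p (field F t) \<le> 2 * (C + (real CARD('n))\<^sup>2 * tail (nat \<lceil>p\<rceil>) t)"
proof -
  define m where "m = nat \<lceil>p\<rceil>"
  have m: "p \<le> real (Suc m)" unfolding m_def by linarith
  obtain C where C: "C \<ge> 0" "\<And>t. stage F t m \<in> torus_Lp p" "\<And>t. Lp_norm p (stage F t m) \<le> C" using stage_torus_Lp[OF p, of m] by blast
  have tri: "norm (field F t x) \<le> norm (stage F t m x) + norm (stage F t m x - field F t x)" for t x
    using norm_triangle_ineq4[of "stage F t m x" "stage F t m x - field F t x"] by simp
  note L = Lp_triangle[OF p stage_borel C(2) borel_measurable_diff[OF stage_borel field_borel] stage_close(1)[OF p m] field_borel field_periodic tri]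
  show "field F t \<in> torus_Lp p" by (rule L(1))
  have "Lp_norm p (field F t) \<le> 2 * (C + (real CARD('n))\<^sup>2 * tail m t)" for t
    by (rule order_trans[OF L(2) mult_left_mono[OF add_mono[OF C(3) stage_close(2)[OF p m]]]]) simp
  then show "\<exists>C\<ge>0. \<forall>t. Lp_norm p (field F t) \<le> 2 * (C + (real CARD('n))\<^sup>2 * tail (nat \<lceil>p\<rceil>) t)"
    using C(1) unfolding m_def by blast
qed

lemma Lp_norm_field_borel: "(\<lambda>t. Lp_norm p (field F t)) \<in> borel_measurable borel"
proof -
  have m: "(\<lambda>x. norm (field F t x) powr p) \<in> borel_measurable borel" for t using field_borel[of t] by measurable
  have j: "(\<lambda>z. norm (field F (fst z) (snd z)) powr p) \<in> borel_measurable borel" using field_joint_borel by measurable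
  have i: "(\<lambda>z. indicator cube (snd z) :: real) \<in> borel_measurable (borel :: (real \<times> (real^'n)) measure)"
    by (rule measurable_compose[OF borel_measurable_continuous_onI[OF continuous_on_snd[OF continuous_on_id]]
      borel_measurable_indicator[OF cube_sets(1)]])
  have "(\<lambda>z. indicator cube (snd z) * norm (field F (fst z) (snd z)) powr p) \<in> borel_measurable (borel \<Otimes>\<^sub>M lborel)"
    using borel_measurable_times[OF i j] by (simp add: borel_prod[symmetric] cong: measurable_cong_sets)
  then have "(\<lambda>(t, x). indicator cube x * norm (field F t x) powr p) \<in> borel_measurable (borel \<Otimes>\<^sub>M lborel)"
    by (simp add: split_beta)
  then have "(\<lambda>t. LINT x|lborel. indicator cube x * norm (field F t x) powr p) \<in> borel_measurable borel"
    by (rule lborel.borel_measurable_lebesgue_integral)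
  then show ?thesis
    unfolding Lp_norm_def set_integral_lebesgue_lborel(1)[OF m cube_sets(1)] by (simp add: set_lebesgue_integral_def)
qed

text \<open>The stage frozen at a grid time is compared with the limit at the true time by way of
  the stage at the true time: \<open>e\<close> measures the variation in time, the tail measures the
  distance to the limit.\<close>

lemma stage_near:
  assumes p: "1 \<le> p" "p \<le> real (Suc n)" and t: "t \<in> good" and e: "0 \<le> e"
    and s: "\<And>x. norm ((\<chi> k. F k n s x) - (\<chi> k. F k n t x)) \<le> e"
  shows "Lp_norm p (\<lambda>x. (\<chi> k. F k n s x) - field F t x) \<le> 2 * (e + (real CARD('n))\<^sup>2 * tail n t)"
proof -
  have st: "stage F t n x = (\<chi> k. F k n t x)" for x using t by (simp add: stage_def)
  have bm: "(\<lambda>x. \<chi> k. F k n s x) \<in> borel_measurable borel" for s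
    by (rule borel_measurable_continuous_onI[OF F_continuous])
  have per: "periodic (\<lambda>x. (\<chi> k. F k n s x) - (\<chi> k. F k n t x))"
    using F_periodic[of n s] F_periodic[of n t] unfolding periodic_def by simp
  have per': "periodic (\<lambda>x. (\<chi> k. F k n s x) - field F t x)"
    using F_periodic[of n s] field_periodic[of t] unfolding periodic_def by simp
  note sup = torus_Lp_sup_bound[OF borel_measurable_diff[OF bm bm] per p(1) e s]
  have tri: "norm ((\<chi> k. F k n s x) - field F t x) \<le> norm ((\<chi> k. F k n s x) - (\<chi> k. F k n t x)) + norm (stage F t n x - field F t x)" for x
    using norm_triangle_ineq[of "(\<chi> k. F k n s x) - (\<chi> k. F k n t x)" "stage F t n x - field F t x"] by (simp add: st)
  note L = Lp_triangle(2)[OF p(1) borel_measurable_diff[OF bm bm] sup(1) borel_measurable_diff[OF stage_borel field_borel]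
        stage_close(1)[OF p] borel_measurable_diff[OF bm field_borel] per' tri]
  show ?thesis by (rule order_trans[OF L mult_left_mono[OF add_mono[OF sup(2) stage_close(2)[OF p]]]]) simp
qed

end

lemma stage_derivative:
  "((\<lambda>s. stage w t n (x + s *\<^sub>R axis l 1) $ c) has_real_derivative stage (Dw l) t n (x + s *\<^sub>R axis l 1) $ c) (at s)"
  using alg_Dx_line[OF w, of c n t x l s] by (cases "t \<in> good") (simp_all add: stage_def Dw_def)

lemma field_Lp_limit: "admissible F \<Longrightarrow> (\<lambda>n. Lp_norm 1 (\<lambda>x. stage F t n x - field F t x)) \<longlonglongrightarrow> 0"
proof (rule tendsto_sandwich[of "\<lambda>_. 0"])
  assume F: "admissible F"
  show "\<forall>\<^sub>F n in sequentially. Lp_norm 1 (\<lambda>x. stage F t n x - field F t x) \<le> (real CARD('n))\<^sup>2 * tail n t"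
    using stage_close(2)[OF F] by simp
  show "(\<lambda>n. (real CARD('n))\<^sup>2 * tail n t) \<longlonglongrightarrow> 0" by (rule tendsto_mult_right_zero[OF tail_zero])
qed (simp_all add: Lp_norm_nonneg)

text \<open>The Sobolev norm of a difference refers to the chosen weak derivative of the difference
  itself, which the choice operator does not split. A weak derivative of the difference is therefore
  exhibited directly, as the limit of the classical derivatives of \<open>s\<close> minus a
  stage.\<close>

lemma weak_partial_difference:
  fixes s ds :: "real^'n \<Rightarrow> real^'n"
  assumes s: "continuous_on UNIV s" "periodic s" "s \<in> torus_Lp 1"
    and ds: "continuous_on UNIV ds" "periodic ds" "ds \<in> torus_Lp 1"
    and d: "\<And>c x r. ((\<lambda>r. s (x + r *\<^sub>R axis l 1) $ c) has_real_derivative ds (x + r *\<^sub>R axis l 1) $ c) (at r)"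
  shows "has_weak_partial l (\<lambda>x. s x - field w t x) (\<lambda>x. ds x - field (Dw l) t x)"
proof -
  have mem: "(\<lambda>x. h x - f x) \<in> torus_Lp 1"
    if "continuous_on UNIV h" "periodic h" "h \<in> torus_Lp 1" "f \<in> borel_measurable borel" "periodic f" "f \<in> torus_Lp 1" for h f :: "real^'n \<Rightarrow> real^'n"
  proof (rule Lp_triangle(1)[OF _ _ that(3) that(4) that(6)])
    show hm: "h \<in> borel_measurable borel" by (rule borel_measurable_continuous_onI[OF that(1)])
    show "(\<lambda>x. h x - f x) \<in> borel_measurable borel" by (rule borel_measurable_diff[OF hm that(4)])
    show "periodic (\<lambda>x. h x - f x)" using that(2,5) unfolding periodic_def by simp
  qed (simp_all add: norm_triangle_ineq4)
  have sw: "(\<lambda>x. h x - stage F t n x) \<in> torus_Lp 1" if "continuous_on UNIV h" "periodic h" "h \<in> torus_Lp 1" "admissible F" for h F n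
    by (rule mem[OF that(1,2,3) stage_borel[OF that(4)] stage_periodic[OF that(4)]]) (use stage_torus_Lp[OF that(4), of 1] in blast)
  have sf: "(\<lambda>x. h x - field F t x) \<in> torus_Lp 1" if "continuous_on UNIV h" "periodic h" "h \<in> torus_Lp 1" "admissible F" for h F
    by (rule mem[OF that(1,2,3) field_borel[OF that(4)] field_periodic[OF that(4)] field_torus_Lp(1)[OF that(4)]]) simp
  have e: "(\<lambda>x. (h x - stage F t n x) - (h x - field F t x)) = (\<lambda>x. - (stage F t n x - field F t x))" for h F n
    by (simp add: fun_eq_iff)
  have en: "Lp_norm 1 (\<lambda>x. (h x - stage F t n x) - (h x - field F t x)) = Lp_norm 1 (\<lambda>x. stage F t n x - field F t x)" for h F n
    unfolding e by (simp only: Lp_norm_def norm_minus_cancel)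
  have et: "(\<lambda>x. (h x - stage F t n x) - (h x - field F t x)) \<in> torus_Lp 1" if "admissible F" for h F n
  proof -
    have "(\<lambda>x. stage F t n x - field F t x) \<in> torus_Lp 1" by (rule stage_close(1)[OF that]) auto
    then show ?thesis unfolding e torus_Lp_def periodic_def by (auto simp: norm_minus_commute simp del: minus_diff_eq)
  qed
  show ?thesis
  proof (rule weak_partial_limit[where f = "\<lambda>n x. s x - stage w t n x" and d = "\<lambda>n x. ds x - stage (Dw l) t n x"])
    show "continuous_on UNIV (\<lambda>x. s x - stage w t n x)" "continuous_on UNIV (\<lambda>x. ds x - stage (Dw l) t n x)" for n
      by (intro continuous_on_diff s ds stage_continuous admissible)+
    show "periodic (\<lambda>x. s x - stage w t n x)" for n using s(2) stage_periodic[OF admissible(1), of t n] unfolding periodic_def by simp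
    show "((\<lambda>r. (s (x + r *\<^sub>R axis l 1) - stage w t n (x + r *\<^sub>R axis l 1)) $ c) has_real_derivative
        (ds (x + r *\<^sub>R axis l 1) - stage (Dw l) t n (x + r *\<^sub>R axis l 1)) $ c) (at r)" for n c x r
      unfolding vector_minus_component by (intro DERIV_diff d stage_derivative)
    show "(\<lambda>n. Lp_norm 1 (\<lambda>x. s x - stage w t n x - (s x - field w t x))) \<longlonglongrightarrow> 0"
      "(\<lambda>n. Lp_norm 1 (\<lambda>x. ds x - stage (Dw l) t n x - (ds x - field (Dw l) t x))) \<longlonglongrightarrow> 0"
      unfolding en by (intro field_Lp_limit admissible)+
  qed (intro sw sf et s ds admissible)+
qed

lemma zero_torus_Lp: "p \<ge> 1 \<Longrightarrow> (\<lambda>x::real^'n. 0::real^'n) \<in> torus_Lp p"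
  by (rule torus_Lp_sup_bound(1)[where c = 0]) (simp_all add: periodic_def)

lemma field_weak_partial: "has_weak_partial l (field w t) (field (Dw l) t)"
proof -
  \<comment> \<open>Taking the zero function for \<open>s\<close> gives the claim for the negative
    of the field; the signs are then removed from membership and from the identity.\<close>
  have "has_weak_partial l (\<lambda>x. 0 - field w t x) (\<lambda>x. 0 - field (Dw l) t x)"
    by (rule weak_partial_difference) (auto simp: zero_torus_Lp periodic_def)
  moreover have "(\<lambda>x. - f x) \<in> torus_Lp 1 \<Longrightarrow> f \<in> torus_Lp 1" for f :: "real^'n \<Rightarrow> real^'n"
    using borel_measurable_uminus[of "\<lambda>x. - f x"] unfolding torus_Lp_def periodic_def by simp
  ultimately have "field w t \<in> torus_Lp 1" "field (Dw l) t \<in> torus_Lp 1" and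
    eq: "smooth \<phi> \<Longrightarrow> periodic \<phi> \<Longrightarrow> - (LINT x:cube|lebesgue. partial (axis l 1) \<phi> x *\<^sub>R field w t x) =
      (LINT x:cube|lebesgue. \<phi> x *\<^sub>R field (Dw l) t x)" for \<phi>
    unfolding has_weak_partial_def by (auto simp: set_lebesgue_integral_def)
  moreover have "(LINT x:cube|lebesgue. partial (axis l 1) \<phi> x *\<^sub>R field w t x) =
      - (LINT x:cube|lebesgue. \<phi> x *\<^sub>R field (Dw l) t x)" if "smooth \<phi>" "periodic \<phi>" for \<phi>
    unfolding eq[OF that, symmetric] by simp
  ultimately show ?thesis unfolding has_weak_partial_def by blast
qed

lemma W1p_norm_field:
  "W1p_norm p (field w t) = Lp_norm p (field w t) + (\<Sum>l\<in>UNIV. Lp_norm p (field (Dw l) t))"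
  unfolding W1p_norm_def Lp_norm_weak_partial[OF field_weak_partial] ..

lemma field_W1p: "1 \<le> p \<Longrightarrow> field w t \<in> torus_W1p p"
  unfolding torus_W1p_def using field_weak_partial field_torus_Lp(1) admissible by blast

text \<open>
  The negative time is a bad one, where the limit field vanishes; this turns weak derivatives of
  differences from the limit into weak derivatives of the stages themselves.
\<close>

lemma field_outside: "field F (-1) = (\<lambda>x. 0)"
proof -
  have "-1 \<notin> good" using good_subset by auto
  then show ?thesis by (simp add: field_def vlim_def stage_def fun_eq_iff vec_eq_iff)
qed

lemma stage_weak_partial:
  assumes s: "s \<in> {0..T}"
  shows "has_weak_partial l (\<lambda>x. (\<chi> k. w k n s x) - field w t x) (\<lambda>x. (\<chi> k. Dw l k n s x) - field (Dw l) t x)"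
proof (rule weak_partial_difference)
  have mem: "(\<lambda>x. \<chi> k. F k n s x) \<in> torus_Lp 1" if F: "admissible F" for F
  proof -
    obtain C where "C \<ge> 0" "\<And>x. norm (\<chi> k. F k n s x) \<le> C" using F_bounded[OF F, of n] s by blast
    then show ?thesis
      using torus_Lp_sup_bound(1)[OF borel_measurable_continuous_onI[OF F_continuous[OF F]] F_periodic[OF F], of 1 C n s] by simp
  qed
  show "(\<lambda>x. \<chi> k. w k n s x) \<in> torus_Lp 1" "(\<lambda>x. \<chi> k. Dw l k n s x) \<in> torus_Lp 1" by (rule mem[OF admissible(1)] mem[OF admissible(2)])+
  show "((\<lambda>r. (\<chi> k. w k n s (x + r *\<^sub>R axis l 1)) $ c) has_real_derivative (\<chi> k. Dw l k n s (x + r *\<^sub>R axis l 1)) $ c) (at r)" for c x r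
    using alg_Dx_line[OF w, of c n s x l r] by (simp add: Dw_def)
qed (intro F_continuous F_periodic admissible)+

lemma stage_W1p:
  assumes s: "s \<in> {0..T}" and p: "p \<ge> 1" shows "(\<lambda>x. \<chi> k. w k n s x) \<in> torus_W1p p"
proof -
  have mem: "(\<lambda>x. \<chi> k. F k n s x) \<in> torus_Lp p" if F: "admissible F" for F
  proof -
    obtain C where "C \<ge> 0" "\<And>x. norm (\<chi> k. F k n s x) \<le> C" using F_bounded[OF F, of n] s by blast
    then show ?thesis
      using torus_Lp_sup_bound(1)[OF borel_measurable_continuous_onI[OF F_continuous[OF F]] F_periodic[OF F], of p C n s] p by simp
  qed
  have "has_weak_partial l (\<lambda>x. \<chi> k. w k n s x) (\<lambda>x. \<chi> k. Dw l k n s x)" for l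
    using stage_weak_partial[OF s, of l n "-1"] unfolding field_outside by simp
  then show ?thesis unfolding torus_W1p_def using mem[OF admissible(1)] mem[OF admissible(2)] by blast
qed

lemma tail_integrable: "set_integrable lborel {0..T} (tail m)"
  unfolding set_integrable_def
proof (rule integrableI_bounded)
  have gb: "(\<lambda>t. g t n) \<in> borel_measurable borel" for n
  proof -
    have "(\<lambda>t. indicator good t * G n t) \<in> borel_measurable borel"
      by (intro borel_measurable_times borel_measurable_indicator good_sets borel_measurable_continuous_onI G_cont)
    then show ?thesis by (rule measurable_cong[THEN iffD1, rotated]) (simp add: g_def)
  qed
  have "tail m \<in> borel_measurable borel" unfolding tail_def
    by (intro borel_measurable_suminf borel_measurable_times gb) simp
  then show "(\<lambda>t. indicator {0..T} t *\<^sub>R tail m t) \<in> borel_measurable lborel" by simp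
  define b where "b l t = 2 ^ Suc (l + m) * G (l + m) t" for l t
  have bc: "continuous_on UNIV (b l)" "0 \<le> b l t" for l t
    unfolding b_def using a_cont[of "l + m"] a_nonneg[of "l + m" t] by auto
  have bm: "(\<lambda>t. ennreal (indicator (cbox 0 T) t * b l t)) \<in> borel_measurable lborel" for l
    using borel_measurable_continuous_onI[OF bc(1)[of l]] by simp
  have "(\<integral>\<^sup>+t. ennreal (norm (indicator {0..T} t *\<^sub>R tail m t)) \<partial>lborel) \<le> (\<integral>\<^sup>+t. (\<Sum>l. ennreal (indicator (cbox 0 T) t * b l t)) \<partial>lborel)"
  proof (rule nn_integral_mono)
    fix t
    have "ennreal (tail m t) = (\<Sum>l. ennreal (2 ^ Suc (l + m) * g t (l + m)))"
      unfolding tail_def by (rule suminf_ennreal2[symmetric, OF _ summable_ignore_initial_segment[OF g_summable]]) (simp add: g_nonneg)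
    also have "\<dots> \<le> (\<Sum>l. ennreal (b l t))"
      by (intro suminf_le ennreal_leI) (auto simp: b_def g_def G_nonneg)
    finally show "ennreal (norm (indicator {0..T} t *\<^sub>R tail m t)) \<le> (\<Sum>l. ennreal (indicator (cbox 0 T) t * b l t))"
      by (cases "t \<in> {0..T}") (simp_all add: tail_nonneg)
  qed
  also have "\<dots> = (\<Sum>l. \<integral>\<^sup>+t. ennreal (indicator (cbox 0 T) t * b l t) \<partial>lborel)" by (rule nn_integral_suminf[OF bm])
  also have "\<dots> = (\<Sum>l. ennreal (integral (cbox 0 T) (b l)))"
    by (intro suminf_cong continuous_cbox_nn_integral bc)
  also have "\<dots> \<le> (\<Sum>l. ennreal (2 * (1/2) ^ (l + m)))"
    unfolding b_def cbox_interval by (intro suminf_le ennreal_leI a_integral) auto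
  also have "\<dots> = ennreal (\<Sum>l. 2 * (1/2) ^ (l + m))"
    by (intro suminf_ennreal2) (auto simp: power_add intro!: summable_mult summable_mult2)
  also have "\<dots> < \<infinity>" by simp
  finally show "(\<integral>\<^sup>+t. ennreal (norm (indicator {0..T} t *\<^sub>R tail m t)) \<partial>lborel) < \<infinity>" .
qed

lemma W1p_norm_integrable:
  assumes p: "p \<ge> 1" shows "set_integrable lborel {0..T} (\<lambda>t. W1p_norm p (field w t) powr 1)"
proof -
  define m where "m = nat \<lceil>p\<rceil>"
  define N where "N = (real CARD('n))\<^sup>2"
  obtain C where C: "\<And>t. Lp_norm p (field w t) \<le> 2 * (C + N * tail m t)"
    using field_torus_Lp(2)[OF admissible(1) p] unfolding m_def N_def by blast
  have "\<forall>l. \<exists>C. \<forall>t. Lp_norm p (field (Dw l) t) \<le> 2 * (C + N * tail m t)"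
    using field_torus_Lp(2)[OF admissible(2) p] unfolding m_def N_def by blast
  from choice[OF this] obtain E where E: "\<And>l t. Lp_norm p (field (Dw l) t) \<le> 2 * (E l + N * tail m t)" by blast
  define h where "h t = 2 * (C + N * tail m t) + (\<Sum>l\<in>UNIV. 2 * (E l + N * tail m t))" for t
  have W: "W1p_norm p (field w t) \<le> h t" "0 \<le> W1p_norm p (field w t)" for t
    unfolding W1p_norm_field h_def by (intro add_mono sum_mono C E add_nonneg_nonneg sum_nonneg Lp_norm_nonneg)+
  have he: "h t = (2 * C + (\<Sum>l\<in>UNIV. 2 * E l)) + (2 * N + real CARD('n) * (2 * N)) * tail m t" for t
    unfolding h_def by (simp add: sum.distrib algebra_simps sum_distrib_left)
  have "integrable lborel (\<lambda>t. indicator {0..T} t *\<^sub>R (2 * C + (\<Sum>l\<in>UNIV. 2 * E l)) + (2 * N + real CARD('n) * (2 * N)) * (indicator {0..T} t *\<^sub>R tail m t))"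
    using tail_integrable[of m] unfolding set_integrable_def
    by (intro Bochner_Integration.integrable_add integrable_mult_right integrable_scaleR_left integrable_real_indicator) (auto simp: emeasure_lborel_Icc_eq)
  then have hi: "integrable lborel (\<lambda>t. indicator {0..T} t *\<^sub>R h t)" unfolding he by (simp add: algebra_simps)
  have Wm: "(\<lambda>t. W1p_norm p (field w t)) \<in> borel_measurable borel"
    unfolding W1p_norm_field by (intro borel_measurable_add borel_measurable_sum Lp_norm_field_borel admissible)
  show ?thesis unfolding set_integrable_def
  proof (rule Bochner_Integration.integrable_bound[OF hi])
    show "(\<lambda>t. indicator {0..T} t *\<^sub>R W1p_norm p (field w t) powr 1) \<in> borel_measurable lborel" using Wm W(2) by simp
    show "AE t in lborel. norm (indicator {0..T} t *\<^sub>R W1p_norm p (field w t) powr 1) \<le> norm (indicator {0..T} t *\<^sub>R h t)"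
    proof (rule AE_I2)
      fix t
      show "norm (indicator {0..T} t *\<^sub>R W1p_norm p (field w t) powr 1) \<le> norm (indicator {0..T} t *\<^sub>R h t)"
        using W[of t] by (cases "t \<in> {0..T}") simp_all
    qed
  qed
qed

lemma field_bochner:
  assumes p: "p \<ge> 1" shows "field w \<in> bochner_Lp T 1 (torus_W1p p) (W1p_norm p)"
proof -
  define N where "N = (real CARD('n))\<^sup>2"
  \<comment> \<open>One Lipschitz constant per pair \<open>z\<close> of component and stage covers
    the component and all its first derivatives, so a single mesh serves the whole Sobolev
    norm.\<close>
  have "\<forall>z. \<exists>L\<ge>0. \<forall>s\<in>{0..T}. \<forall>t\<in>{0..T}. \<forall>x. \<bar>w (fst z) (snd z) t x - w (fst z) (snd z) s x\<bar> \<le> L * \<bar>t - s\<bar> \<and>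
      (\<forall>l. \<bar>Dx l (w (fst z) (snd z)) t x - Dx l (w (fst z) (snd z)) s x\<bar> \<le> L * \<bar>t - s\<bar>)"
    using alg_lipschitz_derivatives[OF w] by blast
  from choice[OF this] obtain L0 where L0: "\<And>z. L0 z \<ge> 0" "\<And>z s t x. s \<in> {0..T} \<Longrightarrow> t \<in> {0..T} \<Longrightarrow>
      \<bar>w (fst z) (snd z) t x - w (fst z) (snd z) s x\<bar> \<le> L0 z * \<bar>t - s\<bar>"
      "\<And>z s t x l. s \<in> {0..T} \<Longrightarrow> t \<in> {0..T} \<Longrightarrow> \<bar>Dx l (w (fst z) (snd z)) t x - Dx l (w (fst z) (snd z)) s x\<bar> \<le> L0 z * \<bar>t - s\<bar>"
    by blast
  define L where "L n = (\<Sum>k\<in>UNIV. L0 (k, n))" for n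
  have L: "L n \<ge> 0" for n unfolding L_def using L0(1) by (simp add: sum_nonneg)
  have vec: "norm ((\<chi> k. F k n s x) - (\<chi> k. F k n t x)) \<le> L n * \<bar>s - t\<bar>"
    if F: "\<And>k. \<bar>F k n s x - F k n t x\<bar> \<le> L0 (k, n) * \<bar>s - t\<bar>" for F :: "'n \<Rightarrow> nat \<Rightarrow> real \<Rightarrow> real^'n \<Rightarrow> real" and n s t x
  proof -
    have "norm ((\<chi> k. F k n s x) - (\<chi> k. F k n t x)) \<le> (\<Sum>k\<in>UNIV. \<bar>((\<chi> k. F k n s x) - (\<chi> k. F k n t x)) $ k\<bar>)"
      by (rule norm_le_l1_cart)
    also have "\<dots> \<le> (\<Sum>k\<in>UNIV. L0 (k, n) * \<bar>s - t\<bar>)" using F by (intro sum_mono) simp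
    finally show ?thesis by (simp add: L_def sum_distrib_right)
  qed
  define K where "K n = (L n + 1) * 2 ^ n" for n
  have K: "K n > 0" for n using L[of n] by (simp add: K_def add_nonneg_pos)
  have LK: "L n * (1 / K n) \<le> (1/2) ^ n" for n
  proof -
    have "L n * (1 / K n) = (L n / (L n + 1)) * (1/2) ^ n" by (simp add: K_def power_one_over)
    also have "\<dots> \<le> 1 * (1/2) ^ n" using L[of n] by (intro mult_right_mono) auto
    finally show ?thesis by simp
  qed
  define R where "R n t x = (\<chi> k. w k n t x)" for n t x
  show ?thesis
  proof (rule bochner_Lp_stepI[where R = R and K = K and f = "field w" and N = "W1p_norm p", OF K _ _ W1p_norm_integrable[OF p]])
    show "R n t \<in> torus_W1p p" if "t \<in> {0..T}" for n t using stage_W1p[OF that p, of n] unfolding R_def[abs_def] .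
    show "AE t in lborel. t \<in> {0..T} \<longrightarrow> field w t \<in> torus_W1p p \<and>
       (\<lambda>n. W1p_norm p (\<lambda>x. R n (of_int \<lfloor>t * K n\<rfloor> / K n) x - field w t x)) \<longlonglongrightarrow> 0"
      using AE_good
    proof (eventually_elim, intro impI conjI)
      fix t assume tg: "t \<in> {0..T} \<longrightarrow> t \<in> good" and t: "t \<in> {0..T}"
      then have gd: "t \<in> good" by blast
      show "field w t \<in> torus_W1p p" by (rule field_W1p[OF p])
      define q where "q n = 2 * ((1/2) ^ n + N * tail n t) + (\<Sum>l\<in>(UNIV::'n set). 2 * ((1/2) ^ n + N * tail n t))" for n
      have "\<forall>\<^sub>F n in sequentially. norm (W1p_norm p (\<lambda>x. R n (of_int \<lfloor>t * K n\<rfloor> / K n) x - field w t x)) \<le> q n"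
        using eventually_ge_at_top[of "nat \<lceil>p\<rceil>"]
      proof eventually_elim
        fix n assume n: "nat \<lceil>p\<rceil> \<le> n"
        then have pn: "p \<le> real (Suc n)" by linarith
        define s where "s = of_int \<lfloor>t * K n\<rfloor> / K n"
        have s: "s \<in> {0..T}" "\<bar>t - s\<bar> \<le> 1 / K n" unfolding s_def by (rule floor_step_near[OF K t])+
        have "L n * \<bar>s - t\<bar> \<le> L n * (1 / K n)" using s(2) L[of n] by (intro mult_left_mono) (auto simp: abs_minus_commute)
        with LK[of n] have Ls: "L n * \<bar>s - t\<bar> \<le> (1/2) ^ n" by linarith
        have "\<bar>w k n s x - w k n t x\<bar> \<le> L0 (k, n) * \<bar>s - t\<bar>" for k x using L0(2)[OF t s(1), of "(k, n)" x] by simp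
        then have v1: "norm ((\<chi> k. w k n s x) - (\<chi> k. w k n t x)) \<le> (1/2) ^ n" for x
          by (rule order_trans[OF vec[of w] Ls])
        have "\<bar>Dw l k n s x - Dw l k n t x\<bar> \<le> L0 (k, n) * \<bar>s - t\<bar>" for k l x
          using L0(3)[OF t s(1), of l "(k, n)" x] by (simp add: Dw_def)
        then have v2: "norm ((\<chi> k. Dw l k n s x) - (\<chi> k. Dw l k n t x)) \<le> (1/2) ^ n" for x l
          by (rule order_trans[OF vec[of "Dw l"] Ls])
        have "W1p_norm p (\<lambda>x. R n s x - field w t x) = Lp_norm p (\<lambda>x. (\<chi> k. w k n s x) - field w t x) +
            (\<Sum>l\<in>UNIV. Lp_norm p (\<lambda>x. (\<chi> k. Dw l k n s x) - field (Dw l) t x))"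
          unfolding W1p_norm_def R_def Lp_norm_weak_partial[OF stage_weak_partial[OF s(1)]] ..
        also have "\<dots> \<le> q n" unfolding q_def N_def
          by (intro add_mono sum_mono stage_near[OF admissible(1)] stage_near[OF admissible(2)] p pn gd v1 v2) simp_all
        finally have "W1p_norm p (\<lambda>x. R n s x - field w t x) \<le> q n" .
        moreover have "0 \<le> W1p_norm p (\<lambda>x. R n s x - field w t x)"
          unfolding W1p_norm_def by (intro add_nonneg_nonneg sum_nonneg Lp_norm_nonneg)
        ultimately show "norm (W1p_norm p (\<lambda>x. R n (of_int \<lfloor>t * K n\<rfloor> / K n) x - field w t x)) \<le> q n"
          unfolding s_def by simp
      qed
      moreover have "q \<longlonglongrightarrow> 0"
      proof -
        have "q \<longlonglongrightarrow> 2 * (0 + N * 0) + (\<Sum>l\<in>(UNIV::'n set). 2 * (0 + N * 0))"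
        unfolding q_def by (intro tendsto_add tendsto_mult tendsto_sum tendsto_const tail_zero LIMSEQ_realpow_zero) simp_all
        then show ?thesis by simp
      qed
      ultimately show "(\<lambda>n. W1p_norm p (\<lambda>x. R n (of_int \<lfloor>t * K n\<rfloor> / K n) x - field w t x)) \<longlonglongrightarrow> 0"
        by (rule Lim_null_comparison)
    qed
  qed
qed

end

subsection \<open>Passing to the limit in the weak formulation\<close>

text \<open>One measure on pairs, to which \<open>L1_limit\<close> applies directly. The iterated
  Lebesgue integrals of the weak formulation are recovered afterwards by Fubini's theorem, for Borel
  integrands.\<close>

definition slab :: "real \<Rightarrow> (real \<times> (real^'n)) measure" where
  "slab T = restrict_space lborel (cbox (0, 0) (T, 1))"

lemma spacetime_cbox: "spacetime T = cbox (0, 0) (T, 1)"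
  by (simp add: spacetime_def cube_def cbox_Pair_eq)

lemma slab_integral:
  fixes f :: "real \<times> (real^'n) \<Rightarrow> 'b::euclidean_space"
  shows "(LINT z|slab T. f z) = (LINT z:cbox (0, 0) (T, 1)|lborel. f z)" "integrable (slab T) f \<longleftrightarrow> set_integrable lborel (cbox (0, 0) (T, 1)) f"
  unfolding slab_def set_lebesgue_integral_def set_integrable_def
  by (simp_all add: integral_restrict_space integrable_restrict_space)

lemma slab_jcont:
  assumes "jcont f" shows "integrable (slab T) (\<lambda>z. f (fst z) (snd z))" "(LINT z|slab T. f (fst z) (snd z)) = stint T f"
  unfolding slab_integral stint_def split_beta
  using continuous_cbox_integral assms unfolding jcont_def split_beta by blast+

lemma AE_slab: "(AE z in slab T. P z) \<longleftrightarrow> (AE z in lborel. z \<in> cbox (0, 0) (T, 1) \<longrightarrow> P z)"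
  unfolding slab_def by (simp add: AE_restrict_space_iff)

lemma borel_slab: "f \<in> borel_measurable borel \<Longrightarrow> f \<in> borel_measurable (slab T)" for f :: "real \<times> (real^'n) \<Rightarrow> 'b::euclidean_space"
  unfolding slab_def by (intro measurable_restrict_space1) simp

lemma jcont_bounded:
  fixes \<psi> :: "real \<Rightarrow> real^'n \<Rightarrow> real"
  assumes "jcont \<psi>" shows "\<exists>C\<ge>0. \<forall>z\<in>cbox (0, 0) (T, 1). \<bar>\<psi> (fst z) (snd z)\<bar> \<le> C"
proof -
  have "continuous_on (cbox (0, 0) (T, 1)) (\<lambda>z. \<psi> (fst z) (snd z))"
    using assms unfolding jcont_def split_beta by (rule continuous_on_subset) simp
  from compact_imp_bounded[OF compact_continuous_image[OF this compact_cbox]]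
  obtain C where "\<forall>z\<in>cbox (0, 0) (T, 1). \<bar>\<psi> (fst z) (snd z)\<bar> \<le> C" unfolding bounded_iff by auto
  then show ?thesis by (intro exI[of _ "max 0 C"]) (auto simp: le_max_iff_disj)
qed

lemma stint_test_bound:
  assumes f: "jcont f" and \<psi>: "jcont \<psi>" and C: "\<forall>z\<in>cbox (0, 0) (T, 1). \<bar>\<psi> (fst z) (snd z)\<bar> \<le> C"
  shows "\<bar>stint T (\<lambda>t x. f t x * \<psi> t x)\<bar> \<le> C * stint T (\<lambda>t x. \<bar>f t x\<bar>)"
proof -
  have "\<bar>stint T (\<lambda>t x. f t x * \<psi> t x)\<bar> \<le> integral (cbox (0, 0) (T, 1)) (\<lambda>(t, x). C * \<bar>f t x\<bar>)"
    unfolding stint_def real_norm_def[symmetric]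
  proof (rule integral_norm_bound_integral)
    show "(\<lambda>(t, x). f t x * \<psi> t x) integrable_on cbox (0, 0) (T, 1)" "(\<lambda>(t, x). C * norm (f t x)) integrable_on cbox (0, 0) (T, 1)"
      unfolding real_norm_def by (intro jcont_integrable jcont_intros f \<psi>)+
    fix z assume "z \<in> cbox (0, 0) (T, 1 :: real^'a)"
    with C have "\<bar>f (fst z) (snd z)\<bar> * \<bar>\<psi> (fst z) (snd z)\<bar> \<le> \<bar>f (fst z) (snd z)\<bar> * C" by (intro mult_left_mono) auto
    then show "norm (case z of (t, x) \<Rightarrow> f t x * \<psi> t x) \<le> (case z of (t, x) \<Rightarrow> C * norm (f t x))"
      by (simp add: split_beta abs_mult mult.commute)
  qed
  then show ?thesis unfolding stint_cmult[symmetric] unfolding stint_def .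
qed

text \<open>A continuous test function is bounded on the compact slab, hence pairing with it is
  continuous in \<open>L^1\<close>. The limit is again the pointwise \<open>lim\<close>, which
  allows limits of different sequences to be compared point by point.\<close>

lemma stint_limit:
  fixes f :: "nat \<Rightarrow> real \<Rightarrow> real^'n \<Rightarrow> real"
  assumes f: "\<And>n. jcont (f n)" and s: "\<And>n. stint T (\<lambda>t x. \<bar>f (Suc n) t x - f n t x\<bar>) \<le> c n" "summable c"
  defines "h \<equiv> \<lambda>z. lim (\<lambda>n. f n (fst z) (snd z))"
  shows "AE z in slab T. (\<lambda>n. f n (fst z) (snd z)) \<longlonglongrightarrow> h z" "integrable (slab T) h"
    "jcont \<psi> \<Longrightarrow> integrable (slab T) (\<lambda>z. h z * \<psi> (fst z) (snd z))"
    "jcont \<psi> \<Longrightarrow> (\<lambda>n. stint T (\<lambda>t x. f n t x * \<psi> t x)) \<longlonglongrightarrow> (LINT z|slab T. h z * \<psi> (fst z) (snd z))"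
    "(\<lambda>n. LINT z|slab T. \<bar>f n (fst z) (snd z) - h z\<bar>) \<longlonglongrightarrow> 0"
proof -
  have fi: "integrable (slab T) (\<lambda>z. f n (fst z) (snd z))" for n by (rule slab_jcont[OF f])
  have e: "(LINT z|slab T. \<bar>f (Suc n) (fst z) (snd z) - f n (fst z) (snd z)\<bar>) = stint T (\<lambda>t x. \<bar>f (Suc n) t x - f n t x\<bar>)" for n
    by (intro slab_jcont jcont_intros f)
  have "summable (\<lambda>n. LINT z|slab T. \<bar>f (Suc n) (fst z) (snd z) - f n (fst z) (snd z)\<bar>)"
  proof (rule summable_comparison_test'[OF s(2), of 0])
    fix n
    have "0 \<le> stint T (\<lambda>t x. \<bar>f (Suc n) t x - f n t x\<bar>)" unfolding e[symmetric] by simp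
    with s(1)[of n] show "norm (LINT z|slab T. \<bar>f (Suc n) (fst z) (snd z) - f n (fst z) (snd z)\<bar>) \<le> c n" unfolding e by simp
  qed
  note L0 = L1_limit[of "slab T" "\<lambda>n z. f n (fst z) (snd z)", OF fi this]
  have L: "AE z in slab T. (\<lambda>n. f n (fst z) (snd z)) \<longlonglongrightarrow> h z" "integrable (slab T) h"
    "(\<lambda>n. LINT z|slab T. \<bar>f n (fst z) (snd z) - h z\<bar>) \<longlonglongrightarrow> 0"
    unfolding h_def by (rule L0)+
  show "AE z in slab T. (\<lambda>n. f n (fst z) (snd z)) \<longlonglongrightarrow> h z" "integrable (slab T) h" by (rule L(1) L(2))+
  show l1: "(\<lambda>n. LINT z|slab T. \<bar>f n (fst z) (snd z) - h z\<bar>) \<longlonglongrightarrow> 0" by (rule L(3))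
  assume \<psi>: "jcont \<psi>"
  obtain C where C: "C \<ge> 0" "\<forall>z\<in>cbox (0, 0) (T, 1). \<bar>\<psi> (fst z) (snd z)\<bar> \<le> C" using jcont_bounded[OF \<psi>] by blast
  have \<psi>m: "(\<lambda>z. \<psi> (fst z) (snd z)) \<in> borel_measurable (slab T)"
    using \<psi> unfolding jcont_def split_beta by (intro borel_slab borel_measurable_continuous_onI)
  have b: "z \<in> cbox (0, 0) (T, 1) \<Longrightarrow> \<bar>k z * \<psi> (fst z) (snd z)\<bar> \<le> C * \<bar>k z\<bar>" for k z
    using mult_left_mono[of "\<bar>\<psi> (fst z) (snd z)\<bar>" C "\<bar>k z\<bar>"] C(2) by (simp add: abs_mult mult.commute)
  have bi: "integrable (slab T) (\<lambda>z. k z * \<psi> (fst z) (snd z))" if k: "integrable (slab T) k" for k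
  proof (rule Bochner_Integration.integrable_bound[OF integrable_mult_right[OF integrable_abs[OF k], of C]])
    show "(\<lambda>z. k z * \<psi> (fst z) (snd z)) \<in> borel_measurable (slab T)" by (rule borel_measurable_times[OF borel_measurable_integrable[OF k] \<psi>m])
    show "AE z in slab T. norm (k z * \<psi> (fst z) (snd z)) \<le> norm (C * \<bar>k z\<bar>)"
      unfolding AE_slab using b[of _ k] C(1) by (auto simp: abs_mult intro!: AE_I2)
  qed
  show "integrable (slab T) (\<lambda>z. h z * \<psi> (fst z) (snd z))" by (rule bi[OF L(2)])
  have "norm (stint T (\<lambda>t x. f n t x * \<psi> t x) - (LINT z|slab T. h z * \<psi> (fst z) (snd z))) \<le>
     C * (LINT z|slab T. \<bar>f n (fst z) (snd z) - h z\<bar>)" for n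
  proof -
    have d: "integrable (slab T) (\<lambda>z. f n (fst z) (snd z) - h z)" by (intro Bochner_Integration.integrable_diff fi L(2))
    have "stint T (\<lambda>t x. f n t x * \<psi> t x) = (LINT z|slab T. f n (fst z) (snd z) * \<psi> (fst z) (snd z))"
      by (rule slab_jcont(2)[symmetric]) (intro jcont_intros f \<psi>)
    then have "stint T (\<lambda>t x. f n t x * \<psi> t x) - (LINT z|slab T. h z * \<psi> (fst z) (snd z)) =
       (LINT z|slab T. (f n (fst z) (snd z) - h z) * \<psi> (fst z) (snd z))"
      using Bochner_Integration.integral_diff[OF bi[OF fi] bi[OF L(2)]] by (simp add: left_diff_distrib)
    also have "norm \<dots> \<le> (LINT z|slab T. norm ((f n (fst z) (snd z) - h z) * \<psi> (fst z) (snd z)))" by (rule integral_norm_bound)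
    also have "\<dots> \<le> (LINT z|slab T. C * \<bar>f n (fst z) (snd z) - h z\<bar>)"
    proof (rule integral_mono_AE)
      show "integrable (slab T) (\<lambda>z. norm ((f n (fst z) (snd z) - h z) * \<psi> (fst z) (snd z)))" by (rule integrable_norm[OF bi[OF d]])
      show "integrable (slab T) (\<lambda>z. C * \<bar>f n (fst z) (snd z) - h z\<bar>)" by (rule integrable_mult_right[OF integrable_abs[OF d]])
      show "AE z in slab T. norm ((f n (fst z) (snd z) - h z) * \<psi> (fst z) (snd z)) \<le> C * \<bar>f n (fst z) (snd z) - h z\<bar>"
        unfolding AE_slab real_norm_def by (intro AE_I2 impI b)
    qed
    finally show ?thesis by simp
  qed
  then have "(\<lambda>n. stint T (\<lambda>t x. f n t x * \<psi> t x) - (LINT z|slab T. h z * \<psi> (fst z) (snd z))) \<longlonglongrightarrow> 0"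
    by (intro Lim_null_comparison[OF _ tendsto_mult_right_zero[OF l1, of C]] always_eventually allI)
  then show "(\<lambda>n. stint T (\<lambda>t x. f n t x * \<psi> t x)) \<longlonglongrightarrow> (LINT z|slab T. h z * \<psi> (fst z) (snd z))" by (rule LIM_zero_cancel)
qed

lemma slab_iterated:
  fixes H :: "real \<Rightarrow> real^'n \<Rightarrow> real"
  assumes m: "(\<lambda>z. H (fst z) (snd z)) \<in> borel_measurable borel" and i: "integrable (slab T) (\<lambda>z. H (fst z) (snd z))"
  shows "(LINT t:{0..T}|lebesgue. LINT x:cube|lebesgue. H t x) = (LINT z|slab T. H (fst z) (snd z))"
proof -
  define J where "J t x = indicator {0..T} t * (indicator cube x * H t x)" for t x
  have ind: "indicator (cbox (0, 0) (T, 1)) z *\<^sub>R H (fst z) (snd z) = J (fst z) (snd z)" for z :: "real \<times> (real^'n)"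
    unfolding J_def cube_def by (cases z) (auto simp: indicator_def cbox_Pair_eq)
  have Ji: "integrable (lborel \<Otimes>\<^sub>M lborel) (\<lambda>(t, x). J t x)"
    using i unfolding slab_integral set_integrable_def ind lborel_prod split_beta .
  have sec: "H t \<in> borel_measurable borel" for t
    using measurable_compose[OF _ m, of "\<lambda>x. (t, x)" borel] by (simp add: borel_measurable_continuous_onI continuous_on_Pair)
  have inner: "(LINT x:cube|lebesgue. H t x) = (LINT x|lborel. indicator cube x * H t x)" for t
    unfolding set_integral_lebesgue_lborel(1)[OF sec cube_sets(1)] by (simp add: set_lebesgue_integral_def)
  have ic: "(\<lambda>z. indicator cube (snd z) :: real) \<in> borel_measurable (borel :: (real \<times> (real^'n)) measure)"
    by (rule measurable_compose[OF borel_measurable_continuous_onI[OF continuous_on_snd[OF continuous_on_id]]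
      borel_measurable_indicator[OF cube_sets(1)]])
  have "(\<lambda>(t, x). indicator cube x * H t x) \<in> borel_measurable (borel \<Otimes>\<^sub>M lborel)"
    using borel_measurable_times[OF ic m] by (simp add: borel_prod[symmetric] split_beta cong: measurable_cong_sets)
  then have im: "(\<lambda>t. LINT x|lborel. indicator cube x * H t x) \<in> borel_measurable borel"
    by (rule lborel.borel_measurable_lebesgue_integral)
  have "(LINT t:{0..T}|lebesgue. LINT x:cube|lebesgue. H t x) = (LINT t:{0..T}|lborel. LINT x|lborel. indicator cube x * H t x)"
    unfolding inner by (rule set_integral_lebesgue_lborel(1)[OF im]) simp
  also have "\<dots> = (LINT t|lborel. LINT x|lborel. J t x)"
    unfolding set_lebesgue_integral_def J_def by simp
  also have "\<dots> = (\<integral>z. (case z of (t, x) \<Rightarrow> J t x) \<partial>(lborel \<Otimes>\<^sub>M lborel))"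
    using lborel_pair.integral_fst[OF Ji] .
  also have "\<dots> = (LINT z|slab T. H (fst z) (snd z))"
    unfolding slab_integral set_lebesgue_integral_def ind lborel_prod split_beta ..
  finally show ?thesis .
qed

lemma spacetime_L1I:
  fixes f :: "real \<Rightarrow> real^'n \<Rightarrow> 'b::euclidean_space"
  assumes m: "(\<lambda>z. f (fst z) (snd z)) \<in> borel_measurable borel" and i: "integrable (slab T) (\<lambda>z. f (fst z) (snd z))"
    and p: "\<And>t. periodic (f t)"
  shows "spacetime_L1 T f"
  unfolding spacetime_L1_def spacetime_function_def spacetime_cbox split_beta
  using p borel_lebesgue_on[OF m] i set_integral_lebesgue_lborel(2)[OF m, of "cbox (0, 0) (T, 1)"] by (simp add: slab_integral)

lemma spacetime_L1_zero: "spacetime_L1 T (\<lambda>t x. 0)"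
  by (rule spacetime_L1I) (simp_all add: periodic_def)

text \<open>Fubini for null sets: a Borel set of times of full measure gives a set of full measure
  in the slab. It transfers statements about good times to almost every point of space-time.\<close>

lemma AE_time_slab:
  assumes S: "S \<in> sets borel" and AE: "AE t in lborel. t \<in> {0..T} \<longrightarrow> t \<in> S"
  shows "AE z in (slab T :: (real \<times> (real^'n)) measure). fst z \<in> S"
proof -
  have "{z \<in> space (lborel \<Otimes>\<^sub>M lborel). fst z \<in> {0..T} \<longrightarrow> fst z \<in> S} = (fst -` (- {0..T} \<union> S) \<inter> space (lborel \<Otimes>\<^sub>M (lborel :: (real^'n) measure)))"
    by auto
  also have "\<dots> \<in> sets (lborel \<Otimes>\<^sub>M lborel)" by (rule measurable_sets[OF measurable_fst]) (use S in auto)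
  finally have "AE z in (lborel \<Otimes>\<^sub>M (lborel :: (real^'n) measure)). fst z \<in> {0..T} \<longrightarrow> fst z \<in> S"
    by (rule lborel_pair.AE_pair_measure) (use AE in eventually_elim, auto intro!: AE_I2)
  then show ?thesis unfolding AE_slab lborel_prod by eventually_elim (auto simp: cbox_Pair_eq)
qed

lemma zero_bochner: "(\<lambda>t (x::real^'n). 0::real) \<in> bochner_Lp T p (torus_Ck k) (Ck_norm k)" for p :: real
proof (rule bochner_Lp_stepI[where R = "\<lambda>n t x. 0" and K = "\<lambda>n. 1"])
  have "(\<lambda>(t::real) (x::real^'n). 0) \<in> alg" by (rule alg_const)
  from alg_Ck[OF this, of k] show z: "(\<lambda>x::real^'n. 0::real) \<in> torus_Ck k" by (simp add: torus_Ck_def periodic_def)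
  then show "AE t in lborel. t \<in> {0..T} \<longrightarrow> (\<lambda>x::real^'n. 0::real) \<in> torus_Ck k \<and> (\<lambda>n. Ck_norm k (\<lambda>x::real^'n. 0 - 0 :: real)) \<longlonglongrightarrow> 0"
    by (simp add: Ck_norm_zero)
  show "set_integrable lborel {0..T} (\<lambda>t. Ck_norm k (\<lambda>x::real^'n. 0::real) powr p)"
    by (simp add: Ck_norm_zero set_integrable_def)
qed simp

lemma weak_solution_zero: "weak_solution T u (\<lambda>x::real^'n. 0) (\<lambda>t x. 0)"
proof -
  have "(\<lambda>x::real^'n. 0::real) \<in> torus_Lp 1" by (rule torus_Lp_sup_bound(1)[where c = 0]) (simp_all add: periodic_def)
  then show ?thesis unfolding weak_solution_def by (simp add: set_lebesgue_integral_def spacetime_L1_zero)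
qed

section \<open>The limit pair and its nontriviality\<close>

theorem theorem1p2:
  fixes T :: real
  assumes "CARD('n::finite) \<ge> 2" and "T > 0"
  shows "\<exists>u :: real \<Rightarrow> real ^ 'n \<Rightarrow> real ^ 'n.
    divergence_free T u \<and>
    (\<forall>p\<ge>1. u \<in> bochner_Lp T 1 (torus_W1p p) (W1p_norm p)) \<and>
    (\<exists>\<rho>0 \<rho>1 \<rho>2.
      weak_solution T u \<rho>0 \<rho>1 \<and> weak_solution T u \<rho>0 \<rho>2 \<and>
      (\<forall>p\<ge>1. \<forall>k. \<rho>1 \<in> bochner_Lp T p (torus_Ck k) (Ck_norm k)) \<and>
      (\<forall>p\<ge>1. \<forall>k. \<rho>2 \<in> bochner_Lp T p (torus_Ck k) (Ck_norm k)) \<and>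
      \<not> (AE (t, x) in lebesgue_on (spacetime T). \<rho>1 t x = \<rho>2 t x))"
proof -
  have T: "T > 0" by fact
  \<comment> \<open>The dimension hypothesis supplies the two distinct coordinates in which the
    shear flows act.\<close>
  have "\<not> (\<exists>i::'n. UNIV = {i})"
  proof
    assume "\<exists>i::'n. UNIV = {i}"
    then obtain i :: 'n where "UNIV = {i}" ..
    from arg_cong[OF this, of card] assms(1) show False by simp
  qed
  then obtain i j :: 'n where ij: "i \<noteq> j" by blast
  obtain r U V A B :: "nat \<Rightarrow> real \<Rightarrow> real ^ 'n \<Rightarrow> real" and D where
    sys: "\<And>n. Sys i j (r n) (U n) (V n) (A n) (B n)" and
    AB: "\<And>n. stint T (\<lambda>t x. \<bar>A n t x\<bar>) \<le> D * (1/4) ^ n" "\<And>n. stint T (\<lambda>t x. \<bar>B n t x\<bar>) \<le> D * (1/4) ^ n" and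
    step: "\<And>n. close_step T (Suc n) ((1/4) ^ Suc n) (2 * D * (1/4) ^ n) (r n) (U n) (V n) (r (Suc n)) (U (Suc n)) (V (Suc n))" and
    r0: "stint T (\<lambda>t x. \<bar>r 0 t x\<bar>) \<ge> 4"
    using approximate_solutions[OF ij T] by blast
  have alg: "r n \<in> alg" "U n \<in> alg" "V n \<in> alg" "A n \<in> alg" "B n \<in> alg" for n using sys[of n] unfolding Sys_def by auto
  have "\<forall>n. \<exists>a. continuous_on UNIV a \<and> (\<forall>t. 0 \<le> a t) \<and>
     (\<forall>bs. set bs \<subseteq> Basis \<and> length bs \<le> Suc n \<longrightarrow> (\<forall>t\<in>{0..T}. \<forall>x. \<bar>foldr partial bs ((\<lambda>t x. r (Suc n) t x - r n t x) t) x\<bar> \<le> a t)) \<and>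
     (\<forall>p. 1 \<le> p \<and> p \<le> real (Suc n) \<longrightarrow> integral {0..T} (\<lambda>t. (2 ^ Suc n * a t) powr p) \<le> (1/4) ^ Suc n)"
    using step unfolding close_step_def small_density_def by blast
  from choice[OF this] obtain a where a: "\<And>n. continuous_on UNIV (a n)" "\<And>n t. 0 \<le> a n t"
     "\<And>n bs t x. set bs \<subseteq> Basis \<Longrightarrow> length bs \<le> Suc n \<Longrightarrow> t \<in> {0..T} \<Longrightarrow> \<bar>foldr partial bs (\<lambda>x. r (Suc n) t x - r n t x) x\<bar> \<le> a n t"
     "\<And>n p. 1 \<le> p \<Longrightarrow> p \<le> real (Suc n) \<Longrightarrow> integral {0..T} (\<lambda>t. (2 ^ Suc n * a n t) powr p) \<le> (1/4) ^ Suc n"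
    by blast
  interpret R: density_scheme T r a by unfold_locales (fact T alg a)+
  have "\<forall>n. \<exists>G. continuous_on UNIV G \<and> (\<forall>t. 0 \<le> G t) \<and> integral {0..T} G \<le> (1/4) ^ Suc n \<and>
     (\<forall>t p. 1 \<le> p \<and> p \<le> real (Suc n) \<longrightarrow>
        integral cube (\<lambda>x. \<bar>(\<lambda>t x. W (Suc n) t x - W n t x) t x\<bar> powr p) \<le> G t powr p \<and>
        (\<forall>k. integral cube (\<lambda>x. \<bar>Dx k (\<lambda>t x. W (Suc n) t x - W n t x) t x\<bar> powr p) \<le> G t powr p))" if "W = U \<or> W = V" for W
    using step that unfolding close_step_def small_field_def by blast
  note field_choice = choice[OF this]
  obtain GU where GU: "\<And>n. continuous_on UNIV (GU n)" "\<And>n t. 0 \<le> GU n t" "\<And>n. integral {0..T} (GU n) \<le> (1/4) ^ Suc n"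
     "\<And>n p t. 1 \<le> p \<Longrightarrow> p \<le> real (Suc n) \<Longrightarrow> integral cube (\<lambda>x. \<bar>U (Suc n) t x - U n t x\<bar> powr p) \<le> GU n t powr p"
     "\<And>n p t k. 1 \<le> p \<Longrightarrow> p \<le> real (Suc n) \<Longrightarrow> integral cube (\<lambda>x. \<bar>Dx k (\<lambda>t x. U (Suc n) t x - U n t x) t x\<bar> powr p) \<le> GU n t powr p"
    using field_choice[of U] by blast
  obtain GV where GV: "\<And>n. continuous_on UNIV (GV n)" "\<And>n t. 0 \<le> GV n t" "\<And>n. integral {0..T} (GV n) \<le> (1/4) ^ Suc n"
     "\<And>n p t. 1 \<le> p \<Longrightarrow> p \<le> real (Suc n) \<Longrightarrow> integral cube (\<lambda>x. \<bar>V (Suc n) t x - V n t x\<bar> powr p) \<le> GV n t powr p"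
     "\<And>n p t k. 1 \<le> p \<Longrightarrow> p \<le> real (Suc n) \<Longrightarrow> integral cube (\<lambda>x. \<bar>Dx k (\<lambda>t x. V (Suc n) t x - V n t x) t x\<bar> powr p) \<le> GV n t powr p"
    using field_choice[of V] by blast
  \<comment> \<open>One bound for both components: the two integrals of at most
    \<open>(1/4) ^ Suc n\<close> add up to at most \<open>(1/4) ^ n\<close>, the rate that
    \<open>field_scheme\<close> asks for.\<close>
  define G where "G n t = GU n t + GV n t" for n t
  define w where "w k n = (if k = i then U n else if k = j then V n else (\<lambda>t x. 0))" for k n
  have GG: "GU n t powr p \<le> G n t powr p" "GV n t powr p \<le> G n t powr p" if "1 \<le> p" for n t p
    unfolding G_def using GU(2)[of n t] GV(2)[of n t] that by (auto intro!: powr_mono2)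
  interpret W: field_scheme T w G
  proof
    show "T > 0" by fact
    show "w k n \<in> alg" for k n unfolding w_def using alg alg.alg_const[of 0] by auto
    show "continuous_on UNIV (G n)" for n unfolding G_def by (intro continuous_on_add GU GV)
    show "0 \<le> G n t" for n t unfolding G_def by (intro add_nonneg_nonneg GU GV)
    show "integral {0..T} (G n) \<le> (1/4) ^ n" for n
    proof -
      have "integral {0..T} (G n) = integral {0..T} (GU n) + integral {0..T} (GV n)" unfolding G_def
        by (rule integral_add; rule integrable_continuous_real; rule continuous_on_subset[OF GU(1)] continuous_on_subset[OF GV(1)]; simp)
      also have "\<dots> \<le> (1/4) ^ Suc n + (1/4) ^ Suc n" by (intro add_mono GU GV)
      also have "\<dots> \<le> (1/4) ^ n" by simp
      finally show ?thesis .
    qed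
    fix n p k t assume p: "(1::real) \<le> p" "p \<le> real (Suc n)"
    show "integral cube (\<lambda>x. \<bar>w k (Suc n) t x - w k n t x\<bar> powr p) \<le> G n t powr p"
      unfolding w_def using order_trans[OF GU(4)[OF p] GG(1)[OF p(1)]] order_trans[OF GV(4)[OF p] GG(2)[OF p(1)]] by simp
    fix l
    show "integral cube (\<lambda>x. \<bar>Dx l (w k (Suc n)) t x - Dx l (w k n) t x\<bar> powr p) \<le> G n t powr p"
      using order_trans[OF GU(5)[OF p, of l] GG(1)[OF p(1)], of t] order_trans[OF GV(5)[OF p, of l] GG(2)[OF p(1)], of t]
      by (simp add: w_def Dx_simps(2) alg)
  qed
  define u where "u = W.field w"
  define \<rho> where "\<rho> = R.rho"
  have um: "(\<lambda>z. u (fst z) (snd z)) \<in> borel_measurable borel" unfolding u_def by (rule W.field_joint_borel[OF W.admissible(1)])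
  have \<rho>m: "(\<lambda>z. \<rho> (fst z) (snd z)) \<in> borel_measurable borel" unfolding \<rho>_def by (rule R.rho_borel)
  have up: "periodic (u t)" for t unfolding u_def by (rule W.field_periodic[OF W.admissible(1)])
  have \<rho>p: "periodic (\<rho> t)" for t unfolding \<rho>_def by (rule R.rho_periodic)

  \<comment> \<open>The fluxes \<open>hP\<close> and \<open>hQ\<close> receive limits of their own:
    convergence of two factors in \<open>L^1\<close> does not give convergence of their product in
    \<open>L^1\<close>, which is why \<open>close_step\<close> records the flux increments
    separately.\<close>
  define hr hU hV hP hQ where "hr z = lim (\<lambda>n. r n (fst z) (snd z))" and "hU z = lim (\<lambda>n. U n (fst z) (snd z))"
    and "hV z = lim (\<lambda>n. V n (fst z) (snd z))" and "hP z = lim (\<lambda>n. r n (fst z) (snd z) * U n (fst z) (snd z))"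
    and "hQ z = lim (\<lambda>n. r n (fst z) (snd z) * V n (fst z) (snd z))" for z
  have jc: "jcont (r n)" "jcont (U n)" "jcont (V n)" "jcont (\<lambda>t x. r n t x * U n t x)" "jcont (\<lambda>t x. r n t x * V n t x)"
    "jcont (A n)" "jcont (B n)" for n by (intro jcont_intros jcont_alg alg)+
  have q: "summable (\<lambda>n. (1/4::real) ^ Suc n)" "summable (\<lambda>n. 2 * D * (1/4) ^ n)" by (simp, intro summable_mult summable_geometric, simp)
  have sr: "stint T (\<lambda>t x. \<bar>r (Suc n) t x - r n t x\<bar>) \<le> (1/4) ^ Suc n" for n
    using stint_time_bound[OF jcont_intros(2)[OF jc(1)[of "Suc n"] jc(1)[of n]] a(1)[of n], of T] a(3)[of "[]" n]
      R.a_integral[of n] by simp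
  have sUV: "stint T (\<lambda>t x. \<bar>W (Suc n) t x - W n t x\<bar>) \<le> (1/4) ^ Suc n"
    if W: "\<And>n. jcont (W n)" and H: "\<And>n. continuous_on UNIV (H n)" "\<And>n t. 0 \<le> H n t" "\<And>n. integral {0..T} (H n) \<le> (1/4) ^ Suc n"
      "\<And>n p t. 1 \<le> p \<Longrightarrow> p \<le> real (Suc n) \<Longrightarrow> integral cube (\<lambda>x. \<bar>W (Suc n) t x - W n t x\<bar> powr p) \<le> H n t powr p"
    for W :: "nat \<Rightarrow> real \<Rightarrow> real^'n \<Rightarrow> real" and H :: "nat \<Rightarrow> real \<Rightarrow> real" and n
  proof -
    have j: "jcont (\<lambda>t x. \<bar>W (Suc n) t x - W n t x\<bar>)" by (intro jcont_intros W)
    have "stint T (\<lambda>t x. \<bar>W (Suc n) t x - W n t x\<bar>) = integral {0..T} (\<lambda>t. integral cube (\<lambda>x. \<bar>W (Suc n) t x - W n t x\<bar>))"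
      by (rule stint_iter[OF j])
    also have "\<dots> \<le> integral {0..T} (H n)"
    proof (rule integral_le)
      show "(\<lambda>t. integral cube (\<lambda>x. \<bar>W (Suc n) t x - W n t x\<bar>)) integrable_on {0..T}"
        by (rule integrable_continuous_real[OF jcont_integral_cube[OF j]])
      show "H n integrable_on {0..T}" by (intro integrable_continuous_real continuous_on_subset[OF H(1)]) simp
      show "integral cube (\<lambda>x. \<bar>W (Suc n) t x - W n t x\<bar>) \<le> H n t" for t
        using H(4)[of 1 n t] H(2)[of n t] by simp
    qed
    also have "\<dots> \<le> (1/4) ^ Suc n" by (rule H(3))
    finally show ?thesis .
  qed
  have sU: "stint T (\<lambda>t x. \<bar>U (Suc n) t x - U n t x\<bar>) \<le> (1/4) ^ Suc n" for n by (rule sUV[OF jc(2) GU(1-4)])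
  have sV: "stint T (\<lambda>t x. \<bar>V (Suc n) t x - V n t x\<bar>) \<le> (1/4) ^ Suc n" for n by (rule sUV[OF jc(3) GV(1-4)])
  have sP: "stint T (\<lambda>t x. \<bar>r (Suc n) t x * U (Suc n) t x - r n t x * U n t x\<bar>) \<le> 2 * D * (1/4) ^ n"
    and sQ: "stint T (\<lambda>t x. \<bar>r (Suc n) t x * V (Suc n) t x - r n t x * V n t x\<bar>) \<le> 2 * D * (1/4) ^ n" for n
    using step[of n] unfolding close_step_def by blast+
  note Lr = stint_limit[where f = r, OF jc(1) sr q(1), folded hr_def]
  note LU = stint_limit[where f = U, OF jc(2) sU q(1), folded hU_def]
  note LV = stint_limit[where f = V, OF jc(3) sV q(1), folded hV_def]
  note LP = stint_limit[where f = "\<lambda>n t x. r n t x * U n t x", OF jc(4) sP q(2), folded hP_def]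
  note LQ = stint_limit[where f = "\<lambda>n t x. r n t x * V n t x", OF jc(5) sQ q(2), folded hQ_def]

  have \<rho>_AE: "AE z in slab T. \<rho> (fst z) (snd z) = hr z"
    using AE_time_slab[OF R.good_sets R.AE_good] by eventually_elim (simp add: \<rho>_def R.rho_def hr_def)
  have u_AE: "AE z in slab T. u (fst z) (snd z) = hU z *\<^sub>R axis i 1 + hV z *\<^sub>R axis j 1"
    using AE_time_slab[OF W.good_sets W.AE_good]
  proof eventually_elim
    fix z :: "real \<times> (real^'n)" assume "fst z \<in> W.good"
    then show "u (fst z) (snd z) = hU z *\<^sub>R axis i 1 + hV z *\<^sub>R axis j 1"
      using ij by (auto simp: u_def W.field_def vlim_def W.stage_def w_def hU_def hV_def vec_eq_iff axis_def)
  qed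
  \<comment> \<open>Convergence almost everywhere of the factors identifies the flux limits as
    products, so that the limit flux is the limit density times the limit field.\<close>
  have PQ_AE: "AE z in slab T. hP z = hr z * hU z \<and> hQ z = hr z * hV z"
    using Lr(1) LU(1) LV(1)
  proof eventually_elim
    fix z assume 1: "(\<lambda>n. r n (fst z) (snd z)) \<longlonglongrightarrow> hr z" and 2: "(\<lambda>n. U n (fst z) (snd z)) \<longlonglongrightarrow> hU z"
      and 3: "(\<lambda>n. V n (fst z) (snd z)) \<longlonglongrightarrow> hV z"
    show "hP z = hr z * hU z \<and> hQ z = hr z * hV z" unfolding hP_def hQ_def
      using limI[OF tendsto_mult[OF 1 2]] limI[OF tendsto_mult[OF 1 3]] by simp
  qed
  have \<rho>u_AE: "AE z in slab T. \<rho> (fst z) (snd z) *\<^sub>R u (fst z) (snd z) = hP z *\<^sub>R axis i 1 + hQ z *\<^sub>R axis j 1"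
    using \<rho>_AE u_AE PQ_AE by eventually_elim (simp add: scaleR_add_right)
  have \<rho>um: "(\<lambda>z. \<rho> (fst z) (snd z) *\<^sub>R u (fst z) (snd z)) \<in> borel_measurable borel" by (intro borel_measurable_scaleR \<rho>m um)
  have cong_int: "integrable (slab T) f" if "f \<in> borel_measurable borel" "AE z in slab T. f z = g z" "integrable (slab T) g"
    for f g :: "real \<times> (real^'n) \<Rightarrow> 'c::euclidean_space"
    using integrable_cong_AE[OF borel_slab[OF that(1)] borel_measurable_integrable[OF that(3)] that(2)] that(3) by simp
  have \<rho>_L1: "spacetime_L1 T \<rho>" by (rule spacetime_L1I[OF \<rho>m cong_int[OF \<rho>m \<rho>_AE Lr(2)] \<rho>p])
  have "integrable (slab T) (\<lambda>z. hU z *\<^sub>R axis i 1 + hV z *\<^sub>R (axis j 1 :: real^'n))" "integrable (slab T) (\<lambda>z. hP z *\<^sub>R axis i 1 + hQ z *\<^sub>R (axis j 1 :: real^'n))"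
    by (intro Bochner_Integration.integrable_add integrable_scaleR_left LU(2) LV(2) LP(2) LQ(2))+
  note ui = cong_int[OF um u_AE this(1)] and \<rho>ui = cong_int[OF \<rho>um \<rho>u_AE this(2)]
  have u_L1: "spacetime_L1 T u" by (rule spacetime_L1I[OF um ui up])
  have \<rho>u_L1: "spacetime_L1 T (\<lambda>t x. \<rho> t x *\<^sub>R u t x)"
    by (rule spacetime_L1I[OF \<rho>um \<rho>ui]) (use up \<rho>p in \<open>simp add: periodic_def\<close>)

  have grad_inner: "(h *\<^sub>R axis i 1 + h' *\<^sub>R axis j 1) \<bullet> (\<chi> k. p k) = h * p i + h' * p j" for h h' :: real and p :: "'n \<Rightarrow> real"
    by (simp add: inner_add_left inner_axis')
  have test_m: "(\<lambda>z. \<psi> (fst z) (snd z)) \<in> borel_measurable borel" if "jcont \<psi>" for \<psi> :: "real \<Rightarrow> real^'n \<Rightarrow> real"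
    using that unfolding jcont_def split_beta by (rule borel_measurable_continuous_onI)
  have grad_m: "(\<lambda>z. u (fst z) (snd z) \<bullet> (\<chi> k. \<psi> k (fst z) (snd z))) \<in> borel_measurable borel"
    if "\<And>k. jcont (\<psi> k)" for \<psi> :: "'n \<Rightarrow> real \<Rightarrow> real^'n \<Rightarrow> real"
    by (intro borel_measurable_inner um) (simp add: borel_measurable_vec_iff test_m that)

  have div: "divergence_free T u" unfolding divergence_free_def
  proof (intro conjI u_L1 allI impI)
    fix \<phi> :: "real \<times> (real^'n) \<Rightarrow> real"
    assume "smooth \<phi> \<and> (\<forall>t. periodic (\<lambda>x. \<phi> (t, x))) \<and> (\<exists>a b. 0 < a \<and> b < T \<and> (\<forall>t x. t < a \<or> b < t \<longrightarrow> \<phi> (t, x) = 0))"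
    then have \<phi>: "smooth \<phi>" "\<And>t. periodic (\<lambda>x. \<phi> (t, x))" by auto
    define p where "p k t x = partial (0, axis k 1) \<phi> (t, x)" for k t x
    have pj: "jcont (p k)" for k unfolding p_def by (rule test_jcont(3)[OF \<phi>])
    have "stint T (\<lambda>t x. U n t x * p i t x) + stint T (\<lambda>t x. V n t x * p j t x) = 0" for n
      using Sys_divergence_free[OF \<phi> sys[of n], of T] unfolding p_def[symmetric]
      by (simp add: stint_add jcont_intros jc pj)
    with tendsto_add[OF LU(4)[OF pj[of i]] LV(4)[OF pj[of j]]]
    have "(\<lambda>n. 0) \<longlonglongrightarrow> (LINT z|slab T. hU z * p i (fst z) (snd z)) + (LINT z|slab T. hV z * p j (fst z) (snd z))" by simp
    then have 0: "(LINT z|slab T. hU z * p i (fst z) (snd z)) + (LINT z|slab T. hV z * p j (fst z) (snd z)) = 0"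
      by (rule LIMSEQ_unique) (rule tendsto_const)
    define H where "H t x = u t x \<bullet> (\<chi> k. p k t x)" for t x
    have Hm: "(\<lambda>z. H (fst z) (snd z)) \<in> borel_measurable borel" unfolding H_def by (rule grad_m[OF pj])
    have HAE: "AE z in slab T. H (fst z) (snd z) = hU z * p i (fst z) (snd z) + hV z * p j (fst z) (snd z)"
      using u_AE by eventually_elim (simp add: H_def grad_inner)
    have Hi: "integrable (slab T) (\<lambda>z. hU z * p i (fst z) (snd z) + hV z * p j (fst z) (snd z))"
      by (intro Bochner_Integration.integrable_add LU(3) LV(3) pj)
    have "(LINT t:{0..T}|lebesgue. LINT x:cube|lebesgue. H t x) = (LINT z|slab T. H (fst z) (snd z))"
      by (rule slab_iterated[OF Hm cong_int[OF Hm HAE Hi]])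
    also have "\<dots> = (LINT z|slab T. hU z * p i (fst z) (snd z) + hV z * p j (fst z) (snd z))"
      by (rule integral_cong_AE[OF borel_slab[OF Hm] borel_measurable_integrable[OF Hi] HAE])
    also have "\<dots> = 0" using Bochner_Integration.integral_add[OF LU(3)[OF pj] LV(3)[OF pj]] 0 by simp
    finally show "(LINT t:{0..T}|lebesgue. LINT x:cube|lebesgue. u t x \<bullet> grad (\<lambda>y. \<phi> (t, y)) x) = 0"
      unfolding H_def p_def test_partial_eqs(2)[OF \<phi>] .
  qed

  have weak: "weak_solution T u (\<lambda>x. 0) \<rho>" unfolding weak_solution_def
  proof (intro conjI \<rho>_L1 \<rho>u_L1 allI impI)
    show "(\<lambda>x::real^'n. 0::real) \<in> torus_Lp 1" by (rule torus_Lp_sup_bound(1)[where c = 0]) (simp_all add: periodic_def)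
    fix \<phi> :: "real \<times> (real^'n) \<Rightarrow> real" assume tf: "test_function T \<phi>"
    then have \<phi>: "smooth \<phi>" "\<And>t. periodic (\<lambda>x. \<phi> (t, x))" and \<phi>T: "\<phi> (T, x) = 0" for x unfolding test_function_def by auto
    define p where "p k t x = partial (0, axis k 1) \<phi> (t, x)" for k t x
    define q where "q t x = partial (1, 0) \<phi> (t, x)" for t x
    have pj: "jcont (p k)" for k unfolding p_def by (rule test_jcont(3)[OF \<phi>])
    have qj: "jcont q" unfolding q_def by (rule test_jcont(2)[OF \<phi>])
    \<comment> \<open>The left side converges to the weak formulation of the limit pair, term by
      term; the right side tends to 0 because the errors decay in \<open>L^1\<close> and are tested
      with bounded functions.\<close>
    have w1: "stint T (\<lambda>t x. r n t x * q t x) + stint T (\<lambda>t x. r n t x * U n t x * p i t x) + stint T (\<lambda>t x. r n t x * V n t x * p j t x) =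
       stint T (\<lambda>t x. A n t x * p i t x) + stint T (\<lambda>t x. B n t x * p j t x)" for n
      using Sys_weak[OF \<phi> sys[of n] \<phi>T T] unfolding p_def[symmetric] q_def[symmetric]
      by (simp add: stint_add jcont_intros jc pj qj)
    obtain Ci where Ci: "\<forall>z\<in>cbox (0, 0) (T, 1). \<bar>p i (fst z) (snd z)\<bar> \<le> Ci" "Ci \<ge> 0" using jcont_bounded[OF pj] by blast
    obtain Cj where Cj: "\<forall>z\<in>cbox (0, 0) (T, 1). \<bar>p j (fst z) (snd z)\<bar> \<le> Cj" "Cj \<ge> 0" using jcont_bounded[OF pj] by blast
    have z: "(\<lambda>n. C * (D * (1/4) ^ n)) \<longlonglongrightarrow> 0" for C :: real
      by (intro tendsto_mult_right_zero LIMSEQ_realpow_zero) simp_all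
    have eA: "\<bar>stint T (\<lambda>t x. A n t x * p i t x)\<bar> \<le> Ci * (D * (1/4) ^ n)" for n
      by (rule order_trans[OF stint_test_bound[OF jc(6) pj Ci(1)] mult_left_mono[OF AB(1) Ci(2)]])
    have eB: "\<bar>stint T (\<lambda>t x. B n t x * p j t x)\<bar> \<le> Cj * (D * (1/4) ^ n)" for n
      by (rule order_trans[OF stint_test_bound[OF jc(7) pj Cj(1)] mult_left_mono[OF AB(2) Cj(2)]])
    have zA: "(\<lambda>n. stint T (\<lambda>t x. A n t x * p i t x)) \<longlonglongrightarrow> 0"
      by (rule Lim_null_comparison[OF _ z[of Ci]]) (simp add: eA)
    have zB: "(\<lambda>n. stint T (\<lambda>t x. B n t x * p j t x)) \<longlonglongrightarrow> 0"
      by (rule Lim_null_comparison[OF _ z[of Cj]]) (simp add: eB)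
    have "(\<lambda>n. stint T (\<lambda>t x. A n t x * p i t x) + stint T (\<lambda>t x. B n t x * p j t x)) \<longlonglongrightarrow>
       (LINT z|slab T. hr z * q (fst z) (snd z)) + (LINT z|slab T. hP z * p i (fst z) (snd z)) + (LINT z|slab T. hQ z * p j (fst z) (snd z))"
      using tendsto_add[OF tendsto_add[OF Lr(4)[OF qj] LP(4)[OF pj[of i]]] LQ(4)[OF pj[of j]]] unfolding w1 .
    from LIMSEQ_unique[OF this tendsto_add[OF zA zB]]
    have 0: "(LINT z|slab T. hr z * q (fst z) (snd z)) + (LINT z|slab T. hP z * p i (fst z) (snd z)) + (LINT z|slab T. hQ z * p j (fst z) (snd z)) = 0" by simp
    define H where "H t x = \<rho> t x * (q t x + u t x \<bullet> (\<chi> k. p k t x))" for t x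
    define L where "L z = hr z * q (fst z) (snd z) + hP z * p i (fst z) (snd z) + hQ z * p j (fst z) (snd z)" for z
    have Hm: "(\<lambda>z. H (fst z) (snd z)) \<in> borel_measurable borel"
      unfolding H_def by (intro borel_measurable_times borel_measurable_add grad_m[OF pj] test_m[OF qj] \<rho>m)
    have HAE: "AE z in slab T. H (fst z) (snd z) = L z"
      using \<rho>_AE u_AE PQ_AE by eventually_elim (simp add: H_def L_def grad_inner, simp add: algebra_simps)
    have Li: "integrable (slab T) L" unfolding L_def
      by (intro Bochner_Integration.integrable_add Lr(3) LP(3) LQ(3) pj qj)
    have "(LINT t:{0..T}|lebesgue. LINT x:cube|lebesgue. H t x) = (LINT z|slab T. H (fst z) (snd z))"
      by (rule slab_iterated[OF Hm cong_int[OF Hm HAE Li]])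
    also have "\<dots> = (LINT z|slab T. L z)"
      by (rule integral_cong_AE[OF borel_slab[OF Hm] borel_measurable_integrable[OF Li] HAE])
    also have "\<dots> = 0" unfolding L_def
      using Bochner_Integration.integral_add[OF Bochner_Integration.integrable_add[OF Lr(3)[OF qj] LP(3)[OF pj]] LQ(3)[OF pj]]
        Bochner_Integration.integral_add[OF Lr(3)[OF qj] LP(3)[OF pj]] 0 by simp
    finally have "(LINT t:{0..T}|lebesgue. LINT x:cube|lebesgue. H t x) = 0" .
    then show "- (LINT x:cube|lebesgue. 0 * \<phi> (0, x)) = (LINT t:{0..T}|lebesgue. LINT x:cube|lebesgue.
           \<rho> t x * (deriv (\<lambda>s. \<phi> (s, x)) t + u t x \<bullet> grad (\<lambda>y. \<phi> (t, y)) x))"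
      unfolding H_def p_def q_def test_partial_eqs[OF \<phi>] by (simp add: set_lebesgue_integral_def)
  qed

  have nontrivial: "\<not> (AE (t, x) in lebesgue_on (spacetime T). \<rho> t x = 0)"
  proof
    assume "AE (t, x) in lebesgue_on (spacetime T). \<rho> t x = 0"
    then have "AE z in lebesgue. z \<in> cbox (0, 0) (T, 1 :: real^'n) \<longrightarrow> \<rho> (fst z) (snd z) = 0"
      unfolding spacetime_cbox by (simp add: AE_restrict_space_iff split_beta)
    then have "AE z in slab T. \<rho> (fst z) (snd z) = 0" unfolding AE_slab AE_completion_iff .
    with \<rho>_AE have hr0: "AE z in slab T. hr z = 0" by eventually_elim simp
    \<comment> \<open>If the limit vanished almost everywhere, the \<open>L^1\<close> distance of a
      stage to it would be the \<open>L^1\<close> norm of the stage, which would then tend to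
      0.\<close>
    have "(LINT z|slab T. \<bar>r n (fst z) (snd z) - hr z\<bar>) = stint T (\<lambda>t x. \<bar>r n t x\<bar>)" for n
    proof -
      have "(LINT z|slab T. \<bar>r n (fst z) (snd z) - hr z\<bar>) = (LINT z|slab T. \<bar>r n (fst z) (snd z)\<bar>)"
        using slab_jcont(1)[OF jc(1), of T n] Lr(2) hr0 by (intro integral_cong_AE) (auto elim!: eventually_mono)
      also have "\<dots> = stint T (\<lambda>t x. \<bar>r n t x\<bar>)" by (intro slab_jcont jcont_intros jc)
      finally show ?thesis .
    qed
    with Lr(5) have lim: "(\<lambda>n. stint T (\<lambda>t x. \<bar>r n t x\<bar>)) \<longlonglongrightarrow> 0" by simp
    \<comment> \<open>The increments add up to at most \<open>1/3\<close>, so a start at 4 leaves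
      the norm above 3. The summand \<open>(1/4) ^ n\<close> strengthens the claim enough for the
      induction: an increment \<open>(1/4) ^ Suc n\<close> takes away a quarter of it, and a quarter
      is all that has to remain.\<close>
    have low: "3 + (1/4) ^ n \<le> stint T (\<lambda>t x. \<bar>r n t x\<bar>)" for n
    proof (induction n)
      case 0 show ?case using r0 by simp
    next
      case (Suc n)
      have "stint T (\<lambda>t x. \<bar>r n t x\<bar>) = stint T (\<lambda>t x. \<bar>r (Suc n) t x - (r (Suc n) t x - r n t x)\<bar>)" by simp
      also have "\<dots> \<le> stint T (\<lambda>t x. \<bar>r (Suc n) t x\<bar>) + stint T (\<lambda>t x. \<bar>r (Suc n) t x - r n t x\<bar>)"
        by (intro stint_abs_diff jcont_intros jc)
      finally have 1: "stint T (\<lambda>t x. \<bar>r n t x\<bar>) \<le> stint T (\<lambda>t x. \<bar>r (Suc n) t x\<bar>) + (1/4) ^ Suc n" using sr[of n] by linarith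
      have "(0::real) \<le> (1/4) ^ n" by simp
      with 1 Suc show ?case unfolding power_Suc by linarith
    qed
    have "3 \<le> stint T (\<lambda>t x. \<bar>r n t x\<bar>)" for n
    proof -
      have "(0::real) \<le> (1/4) ^ n" by simp
      with low[of n] show ?thesis by linarith
    qed
    then have "(3::real) \<le> 0" by (intro tendsto_lowerbound[OF lim]) auto
    then show False by simp
  qed

  have bochner: "\<forall>p\<ge>1. \<forall>k. \<rho> \<in> bochner_Lp T p (torus_Ck k) (Ck_norm k)"
    "\<forall>p\<ge>1. \<forall>k. (\<lambda>t (x::real^'n). 0::real) \<in> bochner_Lp T p (torus_Ck k) (Ck_norm k)"
    unfolding \<rho>_def by (intro allI impI R.rho_bochner, assumption) (intro allI impI zero_bochner)
  show ?thesis
  proof (rule exI[of _ u], intro conjI)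
    show "\<forall>p\<ge>1. u \<in> bochner_Lp T 1 (torus_W1p p) (W1p_norm p)"
      unfolding u_def by (intro allI impI W.field_bochner)
    show "\<exists>\<rho>0 \<rho>1 \<rho>2.
      weak_solution T u \<rho>0 \<rho>1 \<and> weak_solution T u \<rho>0 \<rho>2 \<and>
      (\<forall>p\<ge>1. \<forall>k. \<rho>1 \<in> bochner_Lp T p (torus_Ck k) (Ck_norm k)) \<and>
      (\<forall>p\<ge>1. \<forall>k. \<rho>2 \<in> bochner_Lp T p (torus_Ck k) (Ck_norm k)) \<and>
      \<not> (AE (t, x) in lebesgue_on (spacetime T). \<rho>1 t x = \<rho>2 t x)"
      by (rule exI[of _ "\<lambda>x. 0"], rule exI[of _ \<rho>], rule exI[of _ "\<lambda>t x. 0"],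
        intro conjI weak weak_solution_zero bochner nontrivial)
  qed (rule div)
qed

end
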